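(* Assume $\xi$ is positive definite with some lower bound $c_0>0$. Let $\mathcal D\subset\mathbb C^+$ be a bounded domain and $\omega>0$ with $\Im\operatorname{tr}m(z)\ge\omega$ for all $z\in\mathcal D$, where $m(z)$ is the solution in $\mathcal T_+$ of $m=(-z-\Psi(m))^{-1}$. For $z\in\mathcal D$ let $M=M(N,z)$ be the solution in $\mathcal M_N^+$ of $M=F(M)$, and let $M'\in\mathcal M_N^+$, $R\in\mathbb C^{N\times N}$ satisfy $M'=F(M')+R$. Then there are constants $\epsilon_{\mathcal D}>0$, $c_{\mathcal D}$ and $N_{\mathcal D}$ (independent of $z\in\mathcal D$ and $N$) such that if $N\ge N_{\mathcal D}$ and $\|M'-M\|_\infty\vee\|R\|_\infty\le\epsilon_{\mathcal D}$, then $$\|M'-M\|_\infty\le c_{\mathcal D}\big(\|R\|_\infty+N^{-1}\big).$$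
   Context: Standing model. Fix an integer $K\ge1$. For each $N$, $(x_{ij})_{1\le i\le j\le N}$ are real centered random variables with $\operatorname{Var}(x_{ij})\le1$ that are $K$-dependent: each $x_{ij}$ is independent of $(x_{kl})_{|i-k|\vee|j-l|>K}$. The tensor $\xi=\xi^{(N)}$ is: $\xi_{ijkl}=\mathbb E[x_{ij}x_{kl}]$ if $i\le j,k\le l$; $\xi_{ijkl}=\xi_{jilk}$ if $i>j$ and $k>l$; $\xi_{ijkl}=0$ otherwise. There are a function $\psi:[0,1)^2\times\mathbb Z^2\to\mathbb R$ and a partition of $[0,1)$ into finitely many disjoint intervals $I_\alpha$ such that each $\psi(\cdot,\cdot,k,l)$ is Lipschitz on every $I_\alpha\times I_{\alpha'}$, $\psi(\theta,\phi,k,l)=\psi(\theta,\phi,-k,-l)=\psi(\phi,\theta,l,k)$, and for $i\le j$, $k\le l$: $\xi_{ijkl}=\psi(i/N,j/N,k-i,l-j)+O(N^{-1})$ unless $(i/N,j/N)$ is within distance $K/N$ of a discontinuity point of $\psi(\cdot,\cdot,k-i,l-j)$. Positive definiteness: $\xi$ is positive definite with lower bound $c_0>0$ if for every $N$ the covariance matrix of the family $(x_{ij})_{1\le i\le j\le N}$ is $\ge c_0 I$. Matrix equation: $(\Xi(M))_{ik}:=\frac1N\sum_{j,l}\xi_{ijkl}M_{jl}$, $F(M):=(-z-\Xi(M))^{-1}$; $\mathcal M_N^+=\{M\in\mathbb C^{N\times N}:\frac1{2i}(M-M^* )>0\}$; $\|A\|_\infty=\max_{i,j}|A_{ij}|$.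 Limiting equation. $\mathcal K$ is the space of bi-infinite sequences acting as bounded convolution operators on $\ell^2(\mathbb Z)$; inverses in $\mathcal K$ are convolution inverses. $\mathcal T=L^\infty([0,1),\mathcal K)$; for $f\in\mathcal T$ write $f(\theta,k)$, $\check f(\theta,s)=\sum_k f(\theta,k)e^{i2\pi ks}$; $f^{-1}(\theta):=(f(\theta))^{-1}$ in $\mathcal K$; $z$ is identified with $f(\theta,k)=z\delta_{k0}$; $\operatorname{tr}f=\int_0^1f(\theta,0)d\theta$; $\Psi(f)(\theta,k):=\int_0^1\sum_{l}\psi(\theta,\phi,k,l)f(\phi,l)\,d\phi$. $\mathcal T_+=\{f\in\mathcal T:\inf_{\theta,s}\Im\check f(\theta,s)>0\}$. *)

theory Defs
  imports "HOL-Probability.Probability"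
begin

definition far_set :: "nat \<Rightarrow> nat \<Rightarrow> nat \<Rightarrow> nat \<Rightarrow> (nat \<times> nat) set" where
  "far_set K N i j = {(k, l). 1 \<le> k \<and> k \<le> l \<and> l \<le> N \<and>
       max \<bar>int i - int k\<bar> \<bar>int j - int l\<bar> > int K}"

definition K_dependent_model ::
  "nat \<Rightarrow> (nat \<Rightarrow> 'a measure) \<Rightarrow> (nat \<Rightarrow> nat \<Rightarrow> nat \<Rightarrow> 'a \<Rightarrow> real) \<Rightarrow> bool" where
  "K_dependent_model K P x \<longleftrightarrow>
    (\<forall>N. prob_space (P N) \<and>
      (\<forall>i j. 1 \<le> i \<and> i \<le> j \<and> j \<le> N \<longrightarrow>
         x N i j \<in> borel_measurable (P N) \<and>
         integrable (P N) (\<lambda>\<omega>. (x N i j \<omega>)\<^sup>2) \<and>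
         prob_space.expectation (P N) (x N i j) = 0 \<and>
         prob_space.variance (P N) (x N i j) \<le> 1 \<and>
         prob_space.indep_set (P N)
           (sigma_sets (space (P N)) {x N i j -` A \<inter> space (P N) | A. A \<in> sets borel})
           (sigma_sets (space (P N))
              {x N k l -` A \<inter> space (P N) | A k l. (k, l) \<in> far_set K N i j \<and> A \<in> sets borel})))"

definition xi ::
  "(nat \<Rightarrow> 'a measure) \<Rightarrow> (nat \<Rightarrow> nat \<Rightarrow> nat \<Rightarrow> 'a \<Rightarrow> real) \<Rightarrow> nat \<Rightarrow>
   nat \<Rightarrow> nat \<Rightarrow> nat \<Rightarrow> nat \<Rightarrow> real" where
  "xi P x N i j k l =
    (if i \<le> j \<and> k \<le> l then prob_space.expectation (P N) (\<lambda>\<omega>. x N i j \<omega> * x N k l \<omega>)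
     else if j < i \<and> l < k then prob_space.expectation (P N) (\<lambda>\<omega>. x N j i \<omega> * x N l k \<omega>)
     else 0)"

definition cov :: "'a measure \<Rightarrow> ('a \<Rightarrow> real) \<Rightarrow> ('a \<Rightarrow> real) \<Rightarrow> real" where
  "cov M X Y = prob_space.expectation M
     (\<lambda>\<omega>. (X \<omega> - prob_space.expectation M X) * (Y \<omega> - prob_space.expectation M Y))"

definition upper_idx :: "nat \<Rightarrow> (nat \<times> nat) set" where
  "upper_idx N = {(i, j). 1 \<le> i \<and> i \<le> j \<and> j \<le> N}"

definition xi_pos_def ::
  "(nat \<Rightarrow> 'a measure) \<Rightarrow> (nat \<Rightarrow> nat \<Rightarrow> nat \<Rightarrow> 'a \<Rightarrow> real) \<Rightarrow> real \<Rightarrow> bool" where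
  "xi_pos_def P x c0 \<longleftrightarrow>
    (\<forall>N. \<forall>v :: nat \<Rightarrow> nat \<Rightarrow> real.
       (\<Sum>(i, j)\<in>upper_idx N. \<Sum>(k, l)\<in>upper_idx N.
          v i j * v k l * cov (P N) (x N i j) (x N k l))
       \<ge> c0 * (\<Sum>(i, j)\<in>upper_idx N. (v i j)\<^sup>2))"

definition sq01 :: "(real \<times> real) set" where
  "sq01 = {0..<1} \<times> {0..<1}"

definition disc_points :: "(real \<Rightarrow> real \<Rightarrow> int \<Rightarrow> int \<Rightarrow> real) \<Rightarrow> int \<Rightarrow> int \<Rightarrow> (real \<times> real) set" where
  "disc_points \<psi> k l =
     {p \<in> sq01. \<not> continuous (at p within sq01) (\<lambda>(\<theta>, \<phi>). \<psi> \<theta> \<phi> k l)}"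

definition near_disc :: "nat \<Rightarrow> (real \<Rightarrow> real \<Rightarrow> int \<Rightarrow> int \<Rightarrow> real) \<Rightarrow> nat \<Rightarrow> nat \<Rightarrow> nat \<Rightarrow> int \<Rightarrow> int \<Rightarrow> bool" where
  "near_disc K \<psi> N i j k l \<longleftrightarrow>
     (\<exists>p\<in>disc_points \<psi> k l. dist (real i / real N, real j / real N) p \<le> real K / real N)"

definition psi_profile ::
  "nat \<Rightarrow> (nat \<Rightarrow> 'a measure) \<Rightarrow> (nat \<Rightarrow> nat \<Rightarrow> nat \<Rightarrow> 'a \<Rightarrow> real) \<Rightarrow>
   (real \<Rightarrow> real \<Rightarrow> int \<Rightarrow> int \<Rightarrow> real) \<Rightarrow> bool" where
  "psi_profile K P x \<psi> \<longleftrightarrow>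
    (\<exists>\<I> :: real set set. finite \<I> \<and> disjoint \<I> \<and> \<Union>\<I> = {0..<1} \<and> (\<forall>I\<in>\<I>. is_interval I) \<and>
       (\<forall>k l. \<forall>I\<in>\<I>. \<forall>J\<in>\<I>. \<exists>L. L-lipschitz_on (I \<times> J) (\<lambda>(\<theta>, \<phi>). \<psi> \<theta> \<phi> k l))) \<and>
    (\<forall>\<theta> \<phi> k l. \<theta> \<in> {0..<1} \<and> \<phi> \<in> {0..<1} \<longrightarrow>
       \<psi> \<theta> \<phi> k l = \<psi> \<theta> \<phi> (-k) (-l) \<and> \<psi> \<theta> \<phi> k l = \<psi> \<phi> \<theta> l k) \<and>
    (\<exists>C. \<forall>N \<ge> 1. \<forall>i j k l.
       1 \<le> i \<and> i \<le> j \<and> j \<le> N \<and> 1 \<le> k \<and> k \<le> l \<and> l \<le> N \<and>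
       \<not> near_disc K \<psi> N i j (int k - int i) (int l - int j) \<longrightarrow>
       \<bar>xi P x N i j k l - \<psi> (real i / real N) (real j / real N) (int k - int i) (int l - int j)\<bar>
         \<le> C / real N)"

definition l2seq :: "(int \<Rightarrow> complex) \<Rightarrow> bool" where
  "l2seq g \<longleftrightarrow> (\<lambda>n. (cmod (g n))\<^sup>2) summable_on UNIV"

definition l2norm :: "(int \<Rightarrow> complex) \<Rightarrow> real" where
  "l2norm g = sqrt (\<Sum>\<^sub>\<infinity>n. (cmod (g n))\<^sup>2)"

definition conv :: "(int \<Rightarrow> complex) \<Rightarrow> (int \<Rightarrow> complex) \<Rightarrow> int \<Rightarrow> complex" where
  "conv f g n = (\<Sum>\<^sub>\<infinity>k. f k * g (n - k))"

definition conv_bounded :: "(int \<Rightarrow> complex) \<Rightarrow> real \<Rightarrow> bool" where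
  "conv_bounded f C \<longleftrightarrow>
     (\<forall>g. l2seq g \<longrightarrow> l2seq (conv f g) \<and> l2norm (conv f g) \<le> C * l2norm g)"

definition Kspace :: "(int \<Rightarrow> complex) set" where
  "Kspace = {f. \<exists>C. conv_bounded f C}"

definition delta0 :: "int \<Rightarrow> complex" where
  "delta0 k = (if k = 0 then 1 else 0)"

definition K_inverse :: "(int \<Rightarrow> complex) \<Rightarrow> (int \<Rightarrow> complex) \<Rightarrow> bool" where
  "K_inverse a b \<longleftrightarrow> a \<in> Kspace \<and> b \<in> Kspace \<and> conv a b = delta0"

definition Tspace :: "(real \<Rightarrow> int \<Rightarrow> complex) set" where
  "Tspace = {f. (\<forall>k. (\<lambda>\<theta>. f \<theta> k) \<in> borel_measurable (restrict_space lborel {0..<1})) \<and>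
      (\<exists>C. AE \<theta> in lborel. \<theta> \<in> {0..<1} \<longrightarrow> conv_bounded (f \<theta>) C)}"

definition check :: "(real \<Rightarrow> int \<Rightarrow> complex) \<Rightarrow> real \<Rightarrow> real \<Rightarrow> complex" where
  "check f \<theta> s = lim (\<lambda>n::nat. \<Sum>k\<in>{- int n..int n}. f \<theta> k * exp (2 * pi * \<i> * of_int k * of_real s))"

definition Tplus :: "(real \<Rightarrow> int \<Rightarrow> complex) set" where
  "Tplus = {f \<in> Tspace. \<exists>\<delta>>0. AE p in lborel. p \<in> sq01 \<longrightarrow> Im (check f (fst p) (snd p)) \<ge> \<delta>}"

definition Psi :: "(real \<Rightarrow> real \<Rightarrow> int \<Rightarrow> int \<Rightarrow> real) \<Rightarrow> (real \<Rightarrow> int \<Rightarrow> complex) \<Rightarrow> real \<Rightarrow> int \<Rightarrow> complex" where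
  "Psi \<psi> f \<theta> k = (LINT \<phi>:{0..<1}|lborel. (\<Sum>\<^sub>\<infinity>l. of_real (\<psi> \<theta> \<phi> k l) * f \<phi> l))"

definition trT :: "(real \<Rightarrow> int \<Rightarrow> complex) \<Rightarrow> complex" where
  "trT f = (LINT \<theta>:{0..<1}|lborel. f \<theta> 0)"

definition solves_limit_eq :: "(real \<Rightarrow> real \<Rightarrow> int \<Rightarrow> int \<Rightarrow> real) \<Rightarrow> complex \<Rightarrow> (real \<Rightarrow> int \<Rightarrow> complex) \<Rightarrow> bool" where
  "solves_limit_eq \<psi> z m \<longleftrightarrow>
     (AE \<theta> in lborel. \<theta> \<in> {0..<1} \<longrightarrow>
        K_inverse (\<lambda>k. - z * delta0 k - Psi \<psi> m \<theta> k) (m \<theta>))"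

definition Xi ::
  "(nat \<Rightarrow> 'a measure) \<Rightarrow> (nat \<Rightarrow> nat \<Rightarrow> nat \<Rightarrow> 'a \<Rightarrow> real) \<Rightarrow> nat \<Rightarrow>
   (nat \<Rightarrow> nat \<Rightarrow> complex) \<Rightarrow> nat \<Rightarrow> nat \<Rightarrow> complex" where
  "Xi P x N M i k = (1 / of_nat N) *
     (\<Sum>j\<in>{1..N}. \<Sum>l\<in>{1..N}. of_real (xi P x N i j k l) * M j l)"

definition is_mat_inverse :: "nat \<Rightarrow> (nat \<Rightarrow> nat \<Rightarrow> complex) \<Rightarrow> (nat \<Rightarrow> nat \<Rightarrow> complex) \<Rightarrow> bool" where
  "is_mat_inverse N A B \<longleftrightarrow>
     (\<forall>i\<in>{1..N}. \<forall>k\<in>{1..N}. (\<Sum>j\<in>{1..N}. A i j * B j k) = (if i = k then 1 else 0))"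

definition F_is ::
  "(nat \<Rightarrow> 'a measure) \<Rightarrow> (nat \<Rightarrow> nat \<Rightarrow> nat \<Rightarrow> 'a \<Rightarrow> real) \<Rightarrow> nat \<Rightarrow> complex \<Rightarrow>
   (nat \<Rightarrow> nat \<Rightarrow> complex) \<Rightarrow> (nat \<Rightarrow> nat \<Rightarrow> complex) \<Rightarrow> bool" where
  "F_is P x N z M B \<longleftrightarrow>
     is_mat_inverse N (\<lambda>i k. - (if i = k then z else 0) - Xi P x N M i k) B"

definition Mplus :: "nat \<Rightarrow> (nat \<Rightarrow> nat \<Rightarrow> complex) \<Rightarrow> bool" where
  "Mplus N M \<longleftrightarrow>
     (\<forall>v :: nat \<Rightarrow> complex. (\<exists>i\<in>{1..N}. v i \<noteq> 0) \<longrightarrow>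
        Re (\<Sum>i\<in>{1..N}. \<Sum>j\<in>{1..N}. cnj (v i) * ((M i j - cnj (M j i)) / (2 * \<i>)) * v j) > 0)"

definition maxnorm :: "nat \<Rightarrow> (nat \<Rightarrow> nat \<Rightarrow> complex) \<Rightarrow> real" where
  "maxnorm N A = Max (insert 0 {cmod (A i j) | i j. i \<in> {1..N} \<and> j \<in> {1..N}})"

end

theory Submission
  imports Defs
begin

text \<open>
  By positive definiteness, \<open>\<Xi>(X) = c\<^sub>0 tr(X) + \<Phi>(X)\<close> with a completely positive \<open>\<Phi>\<close> given by Kraus
  operators. If \<open>M\<close> solves the matrix equation and \<open>Mh = F(Mt)\<close>, then \<open>\<Delta> = M - Mh\<close> satisfies
  \<open>\<Delta> = M \<Phi>(\<Delta>) Mh + c\<^sub>0 tr(\<Delta>) M Mh - M \<Xi>(Mt - Mh) Mh\<close>. All terms of the resulting Neumann series are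
  dominated by the imaginary parts of \<open>M\<close> and \<open>Mh\<close>, which themselves solve the fixed-point
  equations of the majorants. This leaves a scalar equation for \<open>tr(\<Delta>)\<close>, whose coefficient stays
  away from zero as long as \<open>Im tr(Mh)\<close> does. Hence \<open>\<Delta>\<close> is bounded by \<open>Mt - Mh\<close>, once \<open>Im tr\<close> is known to
  be bounded below.

  For the lower bound, the limiting equation is solved in Fourier space as a quadratic vector
  equation on the unit square, whose kernel is nonnegative as a limit of covariance forms.
  Averaging its solution over blocks of a large fixed length \<open>n\<close> gives block diagonal matrices
  with Toeplitz blocks that solve the matrix equation up to an error that is small in the normalised
  Hilbert-Schmidt norm, and the comparison above transfers \<open>Im tr m \<ge> \<omega>\<close> to \<open>M\<close>.
\<close>

section \<open>Sesquilinear forms and domination\<close>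

text \<open>The closure of the domain may meet the real axis, so no constant in the conclusion may
  depend on \<open>Im z\<close>; this shapes every estimate. Kept whole, \<Xi> would give majorants
  of size \<open>fM / Im z\<close>. Splitting off the trace replaces \<open>Im z\<close> by
  \<open>c0 * Im tr M + Im z\<close>, at the price of the scalar equation. Its coefficient stays
  away from zero because the adjoint of \<open>M\<close> and \<open>Mh\<close> have imaginary parts
  of opposite sign, which makes Cauchy-Schwarz between them strict by an amount of order
  \<open>(Im tr Mh)\<^sup>2\<close>. Bounds that depend on \<open>Im z\<close> or on the dimension
  only serve qualitative purposes: vanishing remainders, integrability, existence of the limiting
  solution and its membership in \<open>Tplus\<close>. The pair \<open>Mt\<close>, \<open>Mh\<close>
  separates two roles: \<open>Mt\<close> carries positivity, \<open>Mh\<close> an exact inverse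
  relation. For the stability claim the pair is \<open>M'\<close>, \<open>M' - R\<close>; for the
  trace bound it is the block matrix and its image under \<open>F\<close>. The bound on
  \<open>Im tr m\<close> is assumed for every solution in \<open>Tplus\<close>, hence it applies to
  the one constructed here.\<close>

definition ip :: "'i set \<Rightarrow> ('i \<Rightarrow> complex) \<Rightarrow> ('i \<Rightarrow> complex) \<Rightarrow> complex" where
  "ip S v w = (\<Sum>i\<in>S. cnj (v i) * w i)"

definition mv :: "'i set \<Rightarrow> ('i \<Rightarrow> 'i \<Rightarrow> complex) \<Rightarrow> ('i \<Rightarrow> complex) \<Rightarrow> 'i \<Rightarrow> complex" where
  "mv S A v = (\<lambda>i. \<Sum>j\<in>S. A i j * v j)"

definition mm :: "'i set \<Rightarrow> ('i \<Rightarrow> 'i \<Rightarrow> complex) \<Rightarrow> ('i \<Rightarrow> 'i \<Rightarrow> complex) \<Rightarrow> 'i \<Rightarrow> 'i \<Rightarrow> complex" where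
  "mm S A B = (\<lambda>i k. \<Sum>j\<in>S. A i j * B j k)"

definition adj :: "('i \<Rightarrow> 'i \<Rightarrow> complex) \<Rightarrow> 'i \<Rightarrow> 'i \<Rightarrow> complex" where
  "adj A = (\<lambda>i j. cnj (A j i))"

definition qf :: "'i set \<Rightarrow> ('i \<Rightarrow> complex) \<Rightarrow> ('i \<Rightarrow> 'i \<Rightarrow> complex) \<Rightarrow> ('i \<Rightarrow> complex) \<Rightarrow> complex" where
  "qf S v A w = ip S v (mv S A w)"

definition sqn :: "'i set \<Rightarrow> ('i \<Rightarrow> complex) \<Rightarrow> real" where
  "sqn S v = (\<Sum>i\<in>S. (cmod (v i))\<^sup>2)"

definition ntr :: "'i set \<Rightarrow> ('i \<Rightarrow> 'i \<Rightarrow> complex) \<Rightarrow> complex" where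
  "ntr S A = (\<Sum>i\<in>S. A i i) / of_nat (card S)"

definition unitv :: "'i \<Rightarrow> 'i \<Rightarrow> complex" where
  "unitv i = (\<lambda>j. if j = i then 1 else 0)"

lemma adj_adj [simp]: "adj (adj A) = A"
  by (simp add: adj_def)

lemma sqn_nonneg [simp]: "0 \<le> sqn S v"
  by (simp add: sqn_def sum_nonneg)

lemma ip_cong: "(\<And>i. i \<in> S \<Longrightarrow> v i = v' i) \<Longrightarrow> (\<And>i. i \<in> S \<Longrightarrow> w i = w' i) \<Longrightarrow> ip S v w = ip S v' w'"
  unfolding ip_def by (intro sum.cong) auto

lemma mv_cong: "(\<And>i. i \<in> S \<Longrightarrow> v i = v' i) \<Longrightarrow> mv S A v = mv S A v'"
  unfolding mv_def by (intro ext sum.cong) auto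

lemma ip_scale_right: "ip S v (\<lambda>i. c * w i) = c * ip S v w"
  by (simp add: ip_def sum_distrib_left algebra_simps)

lemma ip_minus_right: "ip S v (\<lambda>i. - w i) = - ip S v w"
  using ip_scale_right[of S v "-1" w] by simp

lemma cnj_ip: "cnj (ip S v w) = ip S w v"
  by (simp add: ip_def mult.commute)

lemma ip_self: "ip S v v = of_real (sqn S v)"
  unfolding ip_def sqn_def of_real_sum
  by (intro sum.cong) (simp_all add: complex_norm_square[symmetric] mult.commute)

lemma ip_mv_adj: "ip S v (mv S A w) = ip S (mv S (adj A) v) w"
proof -
  have "ip S v (mv S A w) = (\<Sum>i\<in>S. \<Sum>j\<in>S. cnj (v i) * A i j * w j)"
    by (simp add: ip_def mv_def sum_distrib_left mult.assoc)
  also have "\<dots> = (\<Sum>j\<in>S. \<Sum>i\<in>S. cnj (v i) * A i j * w j)"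
    by (rule sum.swap)
  also have "\<dots> = ip S (mv S (adj A) v) w"
    by (simp add: ip_def mv_def adj_def sum_distrib_left sum_distrib_right mult_ac)
  finally show ?thesis .
qed

lemma mv_mv: "mv S A (mv S B v) = mv S (mm S A B) v"
proof
  fix i
  have "mv S A (mv S B v) i = (\<Sum>j\<in>S. \<Sum>k\<in>S. A i j * B j k * v k)"
    by (simp add: mv_def sum_distrib_left mult.assoc)
  also have "\<dots> = (\<Sum>k\<in>S. \<Sum>j\<in>S. A i j * B j k * v k)"
    by (rule sum.swap)
  also have "\<dots> = mv S (mm S A B) v i"
    by (simp add: mv_def mm_def sum_distrib_right)
  finally show "mv S A (mv S B v) i = mv S (mm S A B) v i" .
qed

lemma mm_eq_scalar_mv:
  assumes "finite S" "\<And>i j. i \<in> S \<Longrightarrow> j \<in> S \<Longrightarrow> mm S A B i j = (if i = j then c else 0)" "i \<in> S"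
  shows "mv S A (mv S B v) i = c * v i"
proof -
  have "mv S A (mv S B v) i = (\<Sum>j\<in>S. (if i = j then c else 0) * v j)"
    unfolding mv_mv using assms by (simp add: mv_def)
  also have "\<dots> = c * v i"
    using assms(1,3) by (simp add: if_distrib[of "\<lambda>x. x * _"] cong: if_cong)
  finally show ?thesis .
qed

lemma qf_mm: "qf S v (mm S A B) w = ip S (mv S (adj A) v) (mv S B w)"
  by (simp add: qf_def mv_mv[symmetric] ip_mv_adj)

lemma qf_mm3: "qf S v (mm S A (mm S B C)) w = qf S (mv S (adj A) v) B (mv S C w)"
  by (simp add: qf_def mv_mv[symmetric] ip_mv_adj)

lemma qf_expand: "qf S v A w = (\<Sum>i\<in>S. \<Sum>j\<in>S. cnj (v i) * A i j * w j)"
  by (simp add: qf_def ip_def mv_def sum_distrib_left mult.assoc)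

lemma qf_add: "qf S v (\<lambda>i j. A i j + B i j) w = qf S v A w + qf S v B w"
  by (simp add: qf_expand sum.distrib algebra_simps)

lemma qf_diff: "qf S v (\<lambda>i j. A i j - B i j) w = qf S v A w - qf S v B w"
  by (simp add: qf_expand sum_subtractf algebra_simps)

lemma qf_scale: "qf S v (\<lambda>i j. c * A i j) w = c * qf S v A w"
  by (simp add: qf_expand sum_distrib_left algebra_simps)

lemma qf_diag: "finite S \<Longrightarrow> qf S v (\<lambda>i j. if i = j then c else 0) w = c * ip S v w"
  by (simp add: qf_expand ip_def sum_distrib_left mult.assoc if_distrib[of "\<lambda>x. x * _"]
      if_distrib[of "\<lambda>x. _ * x"] cong: if_cong) (simp add: algebra_simps)

lemma qf_unitv: "finite S \<Longrightarrow> i \<in> S \<Longrightarrow> j \<in> S \<Longrightarrow> qf S (unitv i) A (unitv j) = A i j"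
  by (simp add: qf_expand unitv_def if_distrib[of "\<lambda>x. x * _"] if_distrib[of "\<lambda>x. _ * x"] if_distrib[of cnj]
      cong: if_cong)

lemma sqn_unitv: "finite S \<Longrightarrow> i \<in> S \<Longrightarrow> sqn S (unitv i) = 1"
  by (simp add: sqn_def unitv_def if_distrib[of "\<lambda>x. (cmod x)\<^sup>2"] cong: if_cong)

lemma two_ip_le: "2 * cmod (ip S v w) \<le> sqn S v + sqn S w"
proof -
  have "cmod (ip S v w) \<le> (\<Sum>i\<in>S. cmod (v i) * cmod (w i))"
    unfolding ip_def by (rule order_trans[OF norm_sum]) (simp add: norm_mult)
  also have "2 * \<dots> \<le> (\<Sum>i\<in>S. (cmod (v i))\<^sup>2 + (cmod (w i))\<^sup>2)"
    unfolding sum_distrib_left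
    using sum_squares_bound by (intro sum_mono) (auto simp: mult.assoc)
  finally show ?thesis by (simp add: sqn_def sum.distrib)
qed

text \<open>The constant is crude and grows with the dimension: one plus the sum of all entry
  moduli. It is used to show that remainders of the Neumann series vanish, so its size never reaches
  a final bound.\<close>

lemma qf_bound_ex:
  assumes "finite S"
  shows "\<exists>B>0. \<forall>v w. 2 * cmod (qf S v A w) \<le> B * (sqn S v + sqn S w)"
proof -
  define B where "B = 1 + (\<Sum>i\<in>S. \<Sum>j\<in>S. cmod (A i j))"
  have B0: "(\<Sum>i\<in>S. \<Sum>j\<in>S. cmod (A i j)) \<ge> 0" by (intro sum_nonneg) auto
  have "2 * cmod (qf S v A w) \<le> B * (sqn S v + sqn S w)" for v w
  proof -
    have "cmod (qf S v A w) \<le> (\<Sum>i\<in>S. \<Sum>j\<in>S. cmod (A i j) * (cmod (v i) * cmod (w j)))"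
      unfolding qf_expand
      by (intro order_trans[OF norm_sum] sum_mono) (simp add: norm_mult algebra_simps)
    also have "2 * \<dots> \<le> (\<Sum>i\<in>S. \<Sum>j\<in>S. cmod (A i j) * (sqn S v + sqn S w))"
      unfolding sum_distrib_left
    proof (intro sum_mono)
      fix i j assume ij: "i \<in> S" "j \<in> S"
      have 1: "(cmod (v i))\<^sup>2 \<le> sqn S v" "(cmod (w j))\<^sup>2 \<le> sqn S w"
        unfolding sqn_def using ij assms by (auto intro: member_le_sum)
      have "2 * cmod (v i) * cmod (w j) \<le> (cmod (v i))\<^sup>2 + (cmod (w j))\<^sup>2"
        by (rule sum_squares_bound)
      also have "\<dots> \<le> sqn S v + sqn S w" using 1 by simp
      finally have "cmod (A i j) * (2 * cmod (v i) * cmod (w j)) \<le> cmod (A i j) * (sqn S v + sqn S w)"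
        by (rule mult_left_mono) simp
      then show "2 * (cmod (A i j) * (cmod (v i) * cmod (w j))) \<le> cmod (A i j) * (sqn S v + sqn S w)"
        by (simp add: algebra_simps)
    qed
    also have "\<dots> \<le> B * (sqn S v + sqn S w)"
      unfolding B_def sum_distrib_right[symmetric] by (intro mult_right_mono) auto
    finally show ?thesis by simp
  qed
  then show ?thesis using B0 by (intro exI[of _ B]) (auto simp: B_def)
qed

lemma sqn_mv_bound_ex:
  assumes "finite S"
  shows "\<exists>B>0. \<forall>v. sqn S (mv S A v) \<le> B * sqn S v"
proof -
  obtain B where B: "B > 0" "\<And>v w. 2 * cmod (qf S v (mm S (adj A) A) w) \<le> B * (sqn S v + sqn S w)"
    using qf_bound_ex[OF assms] by blast
  have "sqn S (mv S A v) \<le> B * sqn S v" for v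
    using B(2)[of v v] by (simp add: qf_mm ip_self)
  then show ?thesis using B(1) by blast
qed

text \<open>For nonnegative functionals of degree two, rescaling \<open>v\<close> and
  \<open>w\<close> shows that this amounts to a bound by the geometric mean of \<open>f v\<close>
  and \<open>g w\<close>. The additive form passes through sums over Kraus operators without
  Cauchy-Schwarz, and it allows different majorants for the left and the right vector.\<close>

definition dom :: "'i set \<Rightarrow> ('i \<Rightarrow> 'i \<Rightarrow> complex) \<Rightarrow> (('i \<Rightarrow> complex) \<Rightarrow> real) \<Rightarrow>
    (('i \<Rightarrow> complex) \<Rightarrow> real) \<Rightarrow> bool" where
  "dom S Z f g \<longleftrightarrow> (\<forall>v w. 2 * cmod (qf S v Z w) \<le> f v + g w)"

lemma domD: "dom S Z f g \<Longrightarrow> 2 * cmod (qf S v Z w) \<le> f v + g w"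
  by (simp add: dom_def)

definition ntf :: "'i set \<Rightarrow> (('i \<Rightarrow> complex) \<Rightarrow> real) \<Rightarrow> real" where
  "ntf S f = (\<Sum>i\<in>S. f (unitv i)) / card S"

lemma ntf_mono: "(\<And>v. f v \<le> g v) \<Longrightarrow> ntf S f \<le> ntf S g"
  by (simp add: ntf_def divide_right_mono sum_mono)

lemma ntf_Im_qf: "finite S \<Longrightarrow> ntf S (\<lambda>v. Im (qf S v A v)) = Im (ntr S A)"
  by (simp add: ntf_def ntr_def qf_unitv)

lemma dom_ntr:
  assumes "finite S" "dom S Z f g"
  shows "2 * cmod (ntr S Z) \<le> ntf S f + ntf S g"
proof -
  have "2 * cmod (\<Sum>i\<in>S. Z i i) \<le> (\<Sum>i\<in>S. 2 * cmod (Z i i))"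
    by (simp add: norm_sum sum_distrib_left[symmetric])
  also have "\<dots> \<le> (\<Sum>i\<in>S. f (unitv i) + g (unitv i))"
    using domD[OF assms(2)] qf_unitv[OF assms(1)] by (intro sum_mono) metis
  finally have "2 * cmod (\<Sum>i\<in>S. Z i i) / card S \<le> (\<Sum>i\<in>S. f (unitv i) + g (unitv i)) / card S"
    by (rule divide_right_mono) simp
  then show ?thesis
    by (simp add: ntr_def ntf_def norm_divide sum.distrib add_divide_distrib)
qed

section \<open>Completely positive maps in Kraus form\<close>

locale kraus_map =
  fixes S :: "'i set" and Q :: "'q set" and kr :: "'q \<Rightarrow> 'i \<Rightarrow> 'i \<Rightarrow> real" and c0 :: real
  assumes finS: "finite S" and neS: "S \<noteq> {}" and c0pos: "c0 > 0"
begin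

definition Phi :: "('i \<Rightarrow> 'i \<Rightarrow> complex) \<Rightarrow> 'i \<Rightarrow> 'i \<Rightarrow> complex" where
  "Phi X i k = (\<Sum>a\<in>Q. \<Sum>j\<in>S. \<Sum>l\<in>S. of_real (kr a i j) * of_real (kr a k l) * X j l) / of_nat (card S)"

definition Sig :: "('i \<Rightarrow> 'i \<Rightarrow> complex) \<Rightarrow> 'i \<Rightarrow> 'i \<Rightarrow> complex" where
  "Sig X i k = (if i = k then c0 * ntr S X else 0) + Phi X i k"

text \<open>Transpose of a Kraus matrix. Its entries are real, so it is also the adjoint, and the
  same map acts on both vectors of a sesquilinear form in \<open>qf_Phi\<close>.\<close>

definition kv :: "'q \<Rightarrow> ('i \<Rightarrow> complex) \<Rightarrow> 'i \<Rightarrow> complex" where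
  "kv a v j = (\<Sum>i\<in>S. of_real (kr a i j) * v i)"

text \<open>Dual action of \<open>Phi\<close> on quadratic functionals. It is monotone, which is
  what allows majorants to be iterated.\<close>

definition kf :: "(('i \<Rightarrow> complex) \<Rightarrow> real) \<Rightarrow> ('i \<Rightarrow> complex) \<Rightarrow> real" where
  "kf f v = (\<Sum>a\<in>Q. f (kv a v)) / card S"

lemma cardS: "card S > 0"
  using finS neS by (simp add: card_gt_0_iff)

lemma qf_Phi: "qf S v (Phi X) w = (\<Sum>a\<in>Q. qf S (kv a v) X (kv a w)) / of_nat (card S)"
proof -
  let ?t = "\<lambda>a j l i k. cnj (v i) * of_real (kr a i j) * of_real (kr a k l) * X j l * w k"
  have "qf S v (Phi X) w = (\<Sum>i\<in>S. \<Sum>k\<in>S. \<Sum>a\<in>Q. \<Sum>j\<in>S. \<Sum>l\<in>S. ?t a j l i k) / of_nat (card S)"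
    unfolding qf_expand Phi_def sum_divide_distrib
    by (intro sum.cong refl) (simp add: sum_distrib_left sum_distrib_right sum_divide_distrib algebra_simps)
  note step1 = this
  have "(\<Sum>i\<in>S. \<Sum>k\<in>S. \<Sum>a\<in>Q. \<Sum>j\<in>S. \<Sum>l\<in>S. ?t a j l i k) = (\<Sum>i\<in>S. \<Sum>a\<in>Q. \<Sum>k\<in>S. \<Sum>j\<in>S. \<Sum>l\<in>S. ?t a j l i k)"
    by (intro sum.cong refl sum.swap)
  also have "\<dots> = (\<Sum>a\<in>Q. \<Sum>i\<in>S. \<Sum>k\<in>S. \<Sum>j\<in>S. \<Sum>l\<in>S. ?t a j l i k)"
    by (rule sum.swap)
  also have "\<dots> = (\<Sum>a\<in>Q. \<Sum>i\<in>S. \<Sum>j\<in>S. \<Sum>k\<in>S. \<Sum>l\<in>S. ?t a j l i k)"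
    by (intro sum.cong refl sum.swap)
  also have "\<dots> = (\<Sum>a\<in>Q. \<Sum>j\<in>S. \<Sum>i\<in>S. \<Sum>k\<in>S. \<Sum>l\<in>S. ?t a j l i k)"
    by (intro sum.cong refl sum.swap)
  also have "\<dots> = (\<Sum>a\<in>Q. \<Sum>j\<in>S. \<Sum>i\<in>S. \<Sum>l\<in>S. \<Sum>k\<in>S. ?t a j l i k)"
    by (intro sum.cong refl sum.swap)
  also have "\<dots> = (\<Sum>a\<in>Q. \<Sum>j\<in>S. \<Sum>l\<in>S. \<Sum>i\<in>S. \<Sum>k\<in>S. ?t a j l i k)"
    by (intro sum.cong refl sum.swap)
  also have "\<dots> = (\<Sum>a\<in>Q. qf S (kv a v) X (kv a w))"
    unfolding qf_expand kv_def cnj_sum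
    by (intro sum.cong refl) (simp add: sum_distrib_left sum_distrib_right algebra_simps)
  finally show ?thesis using step1 by simp
qed

lemma Im_qf_Phi: "Im (qf S v (Phi X) v) = kf (\<lambda>v. Im (qf S v X v)) v"
  by (simp add: qf_Phi kf_def)

lemma dom_Phi:
  assumes "dom S Z f g"
  shows "dom S (Phi Z) (kf f) (kf g)"
  unfolding dom_def
proof (intro allI)
  fix v w
  have "2 * cmod (\<Sum>a\<in>Q. qf S (kv a v) Z (kv a w)) \<le> (\<Sum>a\<in>Q. 2 * cmod (qf S (kv a v) Z (kv a w)))"
    by (simp add: norm_sum sum_distrib_left[symmetric])
  also have "\<dots> \<le> (\<Sum>a\<in>Q. f (kv a v) + g (kv a w))"
    using domD[OF assms] by (intro sum_mono)
  finally have "2 * cmod (\<Sum>a\<in>Q. qf S (kv a v) Z (kv a w)) / card S \<le> (\<Sum>a\<in>Q. f (kv a v) + g (kv a w)) / card S"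
    by (rule divide_right_mono) simp
  then show "2 * cmod (qf S v (Phi Z) w) \<le> kf f v + kf g w"
    by (simp add: qf_Phi kf_def norm_divide sum.distrib add_divide_distrib)
qed

lemma kf_mono: "(\<And>v. f v \<le> g v) \<Longrightarrow> kf f v \<le> kf g v"
  by (simp add: kf_def divide_right_mono sum_mono)

lemma kf_scale: "kf (\<lambda>v. c * f v) v = c * kf f v"
  by (simp add: kf_def sum_distrib_left)

lemma qf_Sig: "qf S v (Sig X) w = c0 * ntr S X * ip S v w + qf S v (Phi X) w"
proof -
  have "Sig X = (\<lambda>i k. (if i = k then c0 * ntr S X else 0) + Phi X i k)"
    by (intro ext) (simp add: Sig_def)
  then show ?thesis by (simp add: qf_add qf_diag[OF finS])
qed

lemma ntr_diff: "ntr S (\<lambda>i j. A i j - B i j) = ntr S A - ntr S B"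
  by (simp add: ntr_def sum_subtractf diff_divide_distrib)

lemma ntr_add: "ntr S (\<lambda>i j. A i j + B i j) = ntr S A + ntr S B"
  by (simp add: ntr_def sum.distrib add_divide_distrib)

lemma ntr_scale: "ntr S (\<lambda>i j. c * A i j) = c * ntr S A"
  by (simp add: ntr_def sum_distrib_left)

lemma qf_Phi_diff: "qf S v (Phi (\<lambda>i j. A i j - B i j)) w = qf S v (Phi A) w - qf S v (Phi B) w"
  by (simp add: qf_Phi qf_diff sum_subtractf diff_divide_distrib)

lemma qf_Sig_diff: "qf S v (Sig (\<lambda>i j. A i j - B i j)) w = qf S v (Sig A) w - qf S v (Sig B) w"
  by (simp add: qf_Sig qf_Phi_diff ntr_diff algebra_simps)

lemma Im_qf_Sig: "Im (qf S v (Sig X) v) = c0 * Im (ntr S X) * sqn S v + kf (\<lambda>v. Im (qf S v X v)) v"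
  by (simp add: qf_Sig Im_qf_Phi ip_self)

lemma Im_ntr_nonneg: "(\<And>v. 0 \<le> Im (qf S v X v)) \<Longrightarrow> 0 \<le> Im (ntr S X)"
  unfolding ntf_Im_qf[OF finS, symmetric] ntf_def by (intro divide_nonneg_nonneg sum_nonneg) auto

text \<open>The completely positive part is nonnegative and is discarded; the trace term alone
  provides a quantitative ellipticity.\<close>

lemma Im_qf_Sig_ge:
  assumes "\<And>v. 0 \<le> Im (qf S v X v)"
  shows "c0 * Im (ntr S X) * sqn S v \<le> Im (qf S v (Sig X) v)"
proof -
  have "0 \<le> kf (\<lambda>v. Im (qf S v X v)) v"
    using kf_mono[of "\<lambda>_. 0" "\<lambda>v. Im (qf S v X v)" v] assms by (simp add: kf_def)
  then show ?thesis by (simp add: Im_qf_Sig)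
qed

text \<open>The negative of the matrix inverted by \<open>F\<close>: the equation for
  \<open>M\<close> says that \<open>Qm z M\<close> times \<open>M\<close> is minus the identity.
  With this sign, \<open>Qm z X\<close> has positive imaginary part whenever \<open>X\<close> has
  nonnegative imaginary part and \<open>Im z > 0\<close>.\<close>

definition Qm :: "complex \<Rightarrow> ('i \<Rightarrow> 'i \<Rightarrow> complex) \<Rightarrow> 'i \<Rightarrow> 'i \<Rightarrow> complex" where
  "Qm z X i k = (if i = k then z else 0) + Sig X i k"

lemma qf_Qm: "qf S v (Qm z X) w = z * ip S v w + qf S v (Sig X) w"
proof -
  have "Qm z X = (\<lambda>i k. (if i = k then z else 0) + Sig X i k)"
    by (intro ext) (simp add: Qm_def)
  then show ?thesis by (simp add: qf_add qf_diag[OF finS])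
qed

lemma Im_qf_Qm: "Im (qf S v (Qm z X) v) = Im z * sqn S v + Im (qf S v (Sig X) v)"
  by (simp add: qf_Qm ip_self)

end

section \<open>Comparison of approximate solutions\<close>

text \<open>\<open>M\<close> enters through a left inverse relation and \<open>Mh\<close> through a
  right one, because the difference of the two inverted matrices will be sandwiched between
  \<open>M\<close> and \<open>Mh\<close>. The trace is bounded below for \<open>Mh\<close>, while
  for \<open>M\<close> only nonnegativity is asked. The bounds on \<open>\<epsilon>\<close> mark
  where the error competes: \<open>eps1\<close> keeps \<open>bH\<close> at least half of
  \<open>c0 * Im tr Mh\<close>, and \<open>eps2\<close> lets the error consume at most half of the
  margin in \<open>gap\<close>.\<close>

locale comparison = kraus_map S Q kr c0
  for S :: "'i set" and Q :: "'q set" and kr :: "'q \<Rightarrow> 'i \<Rightarrow> 'i \<Rightarrow> real" and c0 :: real +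
  fixes z :: complex and M Mt Mh :: "'i \<Rightarrow> 'i \<Rightarrow> complex" and \<epsilon> \<omega> :: real
  assumes eta: "Im z > 0"
    and MQ: "\<And>i j. i \<in> S \<Longrightarrow> j \<in> S \<Longrightarrow> mm S M (Qm z M) i j = (if i = j then -1 else 0)"
    and QM: "\<And>i j. i \<in> S \<Longrightarrow> j \<in> S \<Longrightarrow> mm S (Qm z Mt) Mh i j = (if i = j then -1 else 0)"
    and Mpos: "\<And>v. 0 \<le> Im (qf S v M v)"
    and Mtpos: "\<And>v. 0 \<le> Im (qf S v Mt v)"
    and Rdom: "dom S (Sig (\<lambda>i j. Mt i j - Mh i j)) (\<lambda>v. \<epsilon> * sqn S v) (\<lambda>v. \<epsilon> * sqn S v)"
    and eps: "\<epsilon> \<ge> 0" and omega: "\<omega> > 0" and omega_le: "\<omega> \<le> Im (ntr S Mh)"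
    and eps1: "\<epsilon> \<le> c0 * \<omega> / 2" and eps2: "\<epsilon> \<le> c0\<^sup>2 * \<omega>^3 / 4"
begin

definition "uM v = mv S (adj M) v"
definition "uH v = mv S Mh v"
definition "fM v = Im (qf S v M v)"
definition "fH v = Im (qf S v Mh v)"
text \<open>Coefficients of the squared norm in \<open>fM_eq\<close> and \<open>fH_ge\<close>. The
  loss \<open>\<epsilon>\<close> in \<open>bH\<close> pays for \<open>Mh\<close> being inverse to a
  matrix built from \<open>Mt\<close> instead of from \<open>Mh\<close>.\<close>

definition "bM = c0 * Im (ntr S M) + Im z"
definition "bH = c0 * Im (ntr S Mh) + Im z - \<epsilon>"

lemma fM_Q: "fM v = Im (qf S (uM v) (Qm z M) (uM v))"
proof -
  have "qf S (uM v) (Qm z M) (uM v) = ip S v (mv S M (mv S (Qm z M) (uM v)))"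
    by (simp add: qf_def uM_def ip_mv_adj)
  also have "\<dots> = ip S v (\<lambda>i. - uM v i)"
    using mm_eq_scalar_mv[OF finS, of M "Qm z M" "-1"] MQ by (intro ip_cong) auto
  also have "\<dots> = - cnj (qf S v M v)"
    unfolding ip_minus_right uM_def qf_def cnj_ip ip_mv_adj ..
  finally show ?thesis by (simp add: fM_def)
qed

lemma fH_Q: "fH v = Im (qf S (uH v) (Qm z Mt) (uH v))"
proof -
  have "qf S (uH v) (Qm z Mt) (uH v) = ip S (uH v) (\<lambda>i. - v i)"
    unfolding qf_def uH_def
    using mm_eq_scalar_mv[OF finS, of "Qm z Mt" Mh "-1"] QM by (intro ip_cong) auto
  also have "\<dots> = - cnj (qf S v Mh v)"
    unfolding ip_minus_right uH_def qf_def cnj_ip ..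
  finally show ?thesis by (simp add: fH_def)
qed

text \<open>Ward identity: conjugating the imaginary part of \<open>Qm z M\<close> by its inverse
  gives the imaginary part of \<open>M\<close>. Splitting off the trace in \<open>Sig\<close> turns
  this into a recursion for \<open>fM\<close> along \<open>uM\<close>, of which
  \<open>fM / bM\<close> is the normalised fixed point.\<close>

lemma fM_eq: "fM v = bM * sqn S (uM v) + kf fM (uM v)"
proof -
  have "fM v = Im z * sqn S (uM v) + (c0 * Im (ntr S M) * sqn S (uM v) + kf (\<lambda>v. Im (qf S v M v)) (uM v))"
    unfolding fM_Q[of v] Im_qf_Qm Im_qf_Sig ..
  moreover have "(\<lambda>v. Im (qf S v M v)) = fM" by (simp add: fM_def[abs_def])
  ultimately show ?thesis by (simp add: bM_def algebra_simps)
qed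

lemma fH_ge: "bH * sqn S (uH v) + kf fH (uH v) \<le> fH v"
proof -
  have "\<bar>Im (qf S (uH v) (Sig (\<lambda>i j. Mt i j - Mh i j)) (uH v))\<bar> \<le> \<epsilon> * sqn S (uH v)"
    using domD[OF Rdom, of "uH v" "uH v"] abs_Im_le_cmod[of "qf S (uH v) (Sig (\<lambda>i j. Mt i j - Mh i j)) (uH v)"]
    by simp
  moreover have "fH v = Im z * sqn S (uH v) + Im (qf S (uH v) (Sig Mt) (uH v))"
    unfolding fH_Q[of v] Im_qf_Qm ..
  moreover have "(\<lambda>v. Im (qf S v Mh v)) = fH" by (simp add: fH_def[abs_def])
  then have "Im (qf S (uH v) (Sig Mh) (uH v)) = c0 * Im (ntr S Mh) * sqn S (uH v) + kf fH (uH v)"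
    by (simp add: Im_qf_Sig)
  ultimately show ?thesis
    unfolding qf_Sig_diff by (simp add: bH_def algebra_simps)
qed

lemma bH_ge: "bH \<ge> c0 * Im (ntr S Mh) / 2" "bH \<ge> c0 * \<omega> / 2" "bH > 0"
proof -
  have 1: "c0 * \<omega> \<le> c0 * Im (ntr S Mh)" using omega_le c0pos by simp
  then show "bH \<ge> c0 * Im (ntr S Mh) / 2" using eps1 eta by (simp add: bH_def)
  then show "bH \<ge> c0 * \<omega> / 2" using 1 by simp
  moreover have "c0 * \<omega> > 0" using c0pos omega by simp
  ultimately show "bH > 0" by linarith
qed

lemma aM_nonneg: "0 \<le> Im (ntr S M)"
  using Im_ntr_nonneg Mpos by blast

lemma bM_pos: "bM > 0"
  using aM_nonneg eta c0pos unfolding bM_def by (simp add: add_nonneg_pos)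

text \<open>Second resolvent identity in weak form: \<open>Qm z M\<close> and \<open>Qm z Mt\<close>
  are both evaluated between \<open>uM v\<close> and \<open>uH w\<close>, and the spectral parameter
  cancels in the difference.\<close>

lemma delta_eq: "qf S v (\<lambda>i j. M i j - Mh i j) w = qf S (uM v) (Sig (\<lambda>i j. M i j - Mt i j)) (uH w)"
proof -
  have "qf S (uM v) (Qm z M) (uH w) = ip S v (\<lambda>i. - uH w i)"
    unfolding qf_def uM_def ip_mv_adj[symmetric]
    using mm_eq_scalar_mv[OF finS, of M "Qm z M" "-1"] MQ by (intro ip_cong) auto
  then have 1: "qf S (uM v) (Qm z M) (uH w) = - qf S v Mh w"
    by (simp add: ip_minus_right qf_def uH_def)
  have "qf S (uM v) (Qm z Mt) (uH w) = ip S (uM v) (\<lambda>i. - w i)"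
    unfolding qf_def uH_def
    using mm_eq_scalar_mv[OF finS, of "Qm z Mt" Mh "-1"] QM by (intro ip_cong) auto
  then have 2: "qf S (uM v) (Qm z Mt) (uH w) = - qf S v M w"
    by (simp add: ip_minus_right qf_def uM_def ip_mv_adj)
  show ?thesis
  proof -
    have "qf S (uM v) (Sig M) (uH w) - qf S (uM v) (Sig Mt) (uH w)
        = qf S (uM v) (Qm z M) (uH w) - qf S (uM v) (Qm z Mt) (uH w)"
      by (simp add: qf_Qm)
    then show ?thesis unfolding qf_Sig_diff qf_diff using 1 2 by simp
  qed
qed

section \<open>The Neumann series and its majorants\<close>

definition "Dl = (\<lambda>i j. M i j - Mh i j)"
definition "\<tau> = ntr S Dl"
definition "Er = Sig (\<lambda>i j. Mt i j - Mh i j)"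

text \<open>\<open>M - Mt\<close> is written as \<open>(M - Mh) - (Mt - Mh)\<close>. The first
  difference is the unknown and is split into its trace and its completely positive part; the second
  is data.\<close>

lemma delta_eq2:
  "qf S v Dl w = qf S (uM v) (Phi Dl) (uH w) + c0 * \<tau> * ip S (uM v) (uH w) - qf S (uM v) Er (uH w)"
  using delta_eq[of v w] unfolding Er_def qf_Sig_diff Dl_def \<tau>_def
  by (simp add: qf_Sig ntr_diff qf_Phi_diff algebra_simps)

definition "L0 X = mm S M (mm S (Phi X) Mh)"

lemma qf_L0: "qf S v (L0 X) w = qf S (uM v) (Phi X) (uH w)"
  by (simp add: L0_def qf_mm3 uM_def uH_def)

text \<open>Partial sums with \<open>n\<close> terms of the Neumann series of \<open>L0\<close>
  started from \<open>M Mh\<close>; \<open>Ys\<close> is the same series started from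
  \<open>M Er Mh\<close>.\<close>

primrec Xs :: "nat \<Rightarrow> 'i \<Rightarrow> 'i \<Rightarrow> complex" where
  "Xs 0 = (\<lambda>_ _. 0)"
| "Xs (Suc n) = (\<lambda>i j. mm S M Mh i j + L0 (Xs n) i j)"

primrec Ys :: "nat \<Rightarrow> 'i \<Rightarrow> 'i \<Rightarrow> complex" where
  "Ys 0 = (\<lambda>_ _. 0)"
| "Ys (Suc n) = (\<lambda>i j. mm S M (mm S Er Mh) i j + L0 (Ys n) i j)"

text \<open>
  The majorants stay below \<open>fM / bM\<close> and \<open>fH / bH\<close> uniformly in \<open>n\<close>, because \<open>fM\<close> and \<open>fH\<close> are
  supersolutions of the same recursions; no bound on the inverse of \<open>1 - L0\<close> is required.
\<close>

primrec Pf :: "nat \<Rightarrow> ('i \<Rightarrow> complex) \<Rightarrow> real" where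
  "Pf 0 = (\<lambda>_. 0)"
| "Pf (Suc n) = (\<lambda>v. sqn S (uM v) + kf (Pf n) (uM v))"

primrec Pg :: "nat \<Rightarrow> ('i \<Rightarrow> complex) \<Rightarrow> real" where
  "Pg 0 = (\<lambda>_. 0)"
| "Pg (Suc n) = (\<lambda>v. sqn S (uH v) + kf (Pg n) (uH v))"

text \<open>In closed form, at the level of forms on \<open>S\<close>, this is \<open>L0\<close>
  applied \<open>n\<close> times to \<open>Dl\<close>. Writing it as the defect of the truncated
  series makes the error after \<open>n\<close> terms explicit.\<close>

definition "Rm n = (\<lambda>i j. Dl i j - c0 * \<tau> * Xs n i j + Ys n i j)"

lemma qf_Rm: "qf S v (Rm n) w = qf S v Dl w - c0 * \<tau> * qf S v (Xs n) w + qf S v (Ys n) w"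
  unfolding Rm_def by (simp only: qf_add qf_diff qf_scale)

lemma qf_Phi_add: "qf S v (Phi (\<lambda>i j. A i j + B i j)) w = qf S v (Phi A) w + qf S v (Phi B) w"
  by (simp add: qf_Phi qf_add sum.distrib add_divide_distrib)

lemma qf_Phi_scale: "qf S v (Phi (\<lambda>i j. c * A i j)) w = c * qf S v (Phi A) w"
  by (simp add: qf_Phi qf_scale sum_distrib_left)

lemma qf_Rm_Suc: "qf S v (Rm (Suc n)) w = qf S (uM v) (Phi (Rm n)) (uH w)"
proof -
  have "qf S (uM v) (Phi (Rm n)) (uH w) = qf S (uM v) (Phi Dl) (uH w)
      - c0 * \<tau> * qf S (uM v) (Phi (Xs n)) (uH w) + qf S (uM v) (Phi (Ys n)) (uH w)"
    unfolding Rm_def by (simp only: qf_Phi_add qf_Phi_diff qf_Phi_scale)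
  moreover have "qf S v (Xs (Suc n)) w = ip S (uM v) (uH w) + qf S (uM v) (Phi (Xs n)) (uH w)"
    by (simp add: qf_add qf_L0 qf_mm uM_def uH_def)
  moreover have "qf S v (Ys (Suc n)) w = qf S (uM v) Er (uH w) + qf S (uM v) (Phi (Ys n)) (uH w)"
    by (simp add: qf_add qf_L0 qf_mm3 uM_def uH_def)
  ultimately show ?thesis
    unfolding qf_Rm delta_eq2 by (simp add: algebra_simps)
qed

lemma dom_L0: "dom S Z f g \<Longrightarrow> dom S (L0 Z) (\<lambda>v. kf f (uM v)) (\<lambda>w. kf g (uH w))"
  using dom_Phi[of Z f g] unfolding dom_def qf_L0 by blast

lemma dom_Xs: "dom S (Xs n) (Pf n) (Pg n)"
proof (induction n)
  case 0
  show ?case by (simp add: dom_def qf_expand)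
next
  case (Suc n)
  show ?case unfolding dom_def
  proof (intro allI)
    fix v w
    have "cmod (qf S v (Xs (Suc n)) w) \<le> cmod (ip S (uM v) (uH w)) + cmod (qf S v (L0 (Xs n)) w)"
      by (simp add: qf_add qf_mm uM_def uH_def norm_triangle_ineq)
    then show "2 * cmod (qf S v (Xs (Suc n)) w) \<le> Pf (Suc n) v + Pg (Suc n) w"
      using domD[OF dom_L0[OF Suc.IH], of v w] two_ip_le[of S "uM v" "uH w"] by simp
  qed
qed

lemma dom_Ys: "dom S (Ys n) (\<lambda>v. \<epsilon> * Pf n v) (\<lambda>v. \<epsilon> * Pg n v)"
proof (induction n)
  case 0
  show ?case by (simp add: dom_def qf_expand)
next
  case (Suc n)
  show ?case unfolding dom_def
  proof (intro allI)
    fix v w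
    have "cmod (qf S v (Ys (Suc n)) w) \<le> cmod (qf S (uM v) Er (uH w)) + cmod (qf S v (L0 (Ys n)) w)"
      by (simp add: qf_add qf_mm3 uM_def uH_def norm_triangle_ineq)
    then show "2 * cmod (qf S v (Ys (Suc n)) w) \<le> \<epsilon> * Pf (Suc n) v + \<epsilon> * Pg (Suc n) w"
      using domD[OF dom_L0[OF Suc.IH], of v w] domD[OF Rdom, of "uM v" "uH w"]
      by (simp add: kf_scale Er_def[symmetric] algebra_simps)
  qed
qed

lemma Pf_le: "bM * Pf n v \<le> fM v"
proof (induction n arbitrary: v)
  case 0
  show ?case using Mpos by (simp add: fM_def)
next
  case (Suc n)
  have "kf (\<lambda>v. bM * Pf n v) (uM v) \<le> kf fM (uM v)"
    by (rule kf_mono) (rule Suc.IH)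
  then show ?case unfolding fM_eq[of v] by (simp add: kf_scale algebra_simps)
qed

lemma fH_nonneg: "0 \<le> fH v"
  unfolding fH_Q Im_qf_Qm
  using Im_qf_Sig_ge[OF Mtpos, of "uH v"] Im_ntr_nonneg[OF Mtpos] eta c0pos
  by (smt (verit, best) mult_nonneg_nonneg sqn_nonneg)

lemma Pg_le: "bH * Pg n v \<le> fH v"
proof (induction n arbitrary: v)
  case 0
  show ?case using fH_nonneg by simp
next
  case (Suc n)
  have "kf (\<lambda>v. bH * Pg n v) (uH v) \<le> kf fH (uH v)"
    by (rule kf_mono) (rule Suc.IH)
  then show ?case using fH_ge[of v] by (simp add: kf_scale algebra_simps)
qed

text \<open>The pair \<open>fM\<close>, \<open>fH\<close> is itself contracted: \<open>kf fM\<close>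
  at \<open>uM v\<close> is \<open>fM v\<close> minus \<open>bM\<close> times a squared norm, and in
  finite dimension that squared norm is at least a fixed fraction of \<open>fM v\<close>. The rate
  \<open>q\<close> and the prefactor \<open>t\<close> depend on the dimension and on
  \<open>Im z\<close>, which is harmless because only the limit in \<open>n\<close> is used.\<close>

lemma Rm_bound: "\<exists>t\<ge>0. \<exists>q. 0 \<le> q \<and> q < 1 \<and> (\<forall>n. dom S (Rm n) (\<lambda>v. t * q^n * fM v) (\<lambda>v. t * q^n * fH v))"
proof -
  obtain B1 where B1: "B1 > 0" "\<And>v w. 2 * cmod (qf S v (Qm z M) w) \<le> B1 * (sqn S v + sqn S w)"
    using qf_bound_ex[OF finS] by blast
  obtain B2 where B2: "B2 > 0" "\<And>v w. 2 * cmod (qf S v (Qm z Mt) w) \<le> B2 * (sqn S v + sqn S w)"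
    using qf_bound_ex[OF finS] by blast
  obtain B3 where B3: "B3 > 0" "\<And>v w. 2 * cmod (qf S v Dl w) \<le> B3 * (sqn S v + sqn S w)"
    using qf_bound_ex[OF finS] by blast
  obtain C1 where C1: "C1 > 0" "\<And>v. sqn S (mv S (adj (Qm z M)) v) \<le> C1 * sqn S v"
    using sqn_mv_bound_ex[OF finS] by blast
  obtain C2 where C2: "C2 > 0" "\<And>v. sqn S (mv S (Qm z Mt) v) \<le> C2 * sqn S v"
    using sqn_mv_bound_ex[OF finS] by blast
  \<comment> \<open>\<open>b\<close> bounds \<open>fM\<close> and \<open>fH\<close> by the squared
    norms of \<open>uM\<close> and \<open>uH\<close>; including \<open>bM\<close> and
    \<open>bH\<close> in the sum keeps \<open>q\<close> in the range from 0 to 1.\<close>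
  define b where "b = B1 + B2 + bM + bH"
  define q where "q = 1 - min bM bH / b"
  have bpos: "b > 0" using B1 B2 bM_pos bH_ge by (simp add: b_def)
  have q: "0 \<le> q" "q < 1"
    using bpos B1 B2 bM_pos bH_ge(3) by (auto simp: q_def b_def field_simps min_def)
  have fMb: "fM v \<le> b * sqn S (uM v)" for v
  proof -
    have "fM v \<le> B1 * sqn S (uM v)"
      using B1(2)[of "uM v" "uM v"] Im_qf_Qm abs_Im_le_cmod[of "qf S (uM v) (Qm z M) (uM v)"] by (simp add: fM_Q)
    also have "\<dots> \<le> b * sqn S (uM v)"
      using B2 bM_pos bH_ge by (intro mult_right_mono) (auto simp: b_def)
    finally show ?thesis .
  qed
  have fHb: "fH v \<le> b * sqn S (uH v)" for v
  proof -
    have "fH v \<le> B2 * sqn S (uH v)"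
      using B2(2)[of "uH v" "uH v"] abs_Im_le_cmod[of "qf S (uH v) (Qm z Mt) (uH v)"] by (simp add: fH_Q)
    also have "\<dots> \<le> b * sqn S (uH v)"
      using B1 bM_pos bH_ge by (intro mult_right_mono) (auto simp: b_def)
    finally show ?thesis .
  qed
  have kM: "kf fM (uM v) \<le> q * fM v" for v
  proof -
    have "min bM bH / b * fM v \<le> min bM bH / b * (b * sqn S (uM v))"
      using fMb bpos bM_pos bH_ge(3) by (intro mult_left_mono) auto
    also have "\<dots> = min bM bH * sqn S (uM v)" using bpos by simp
    also have "\<dots> \<le> bM * sqn S (uM v)" by (intro mult_right_mono) auto
    finally have "min bM bH / b * fM v \<le> fM v - kf fM (uM v)" using fM_eq[of v] by linarith
    then show ?thesis by (simp add: q_def left_diff_distrib)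
  qed
  have kH: "kf fH (uH v) \<le> q * fH v" for v
  proof -
    have "min bM bH / b * fH v \<le> min bM bH / b * (b * sqn S (uH v))"
      using fHb bpos bM_pos bH_ge(3) by (intro mult_left_mono) auto
    also have "\<dots> = min bM bH * sqn S (uH v)" using bpos by simp
    also have "\<dots> \<le> bH * sqn S (uH v)" by (intro mult_right_mono) auto
    finally have "min bM bH / b * fH v \<le> fH v - kf fH (uH v)" using fH_ge[of v] by linarith
    then show ?thesis by (simp add: q_def left_diff_distrib)
  qed
  \<comment> \<open>Start of the induction: \<open>Dl\<close> must be dominated by multiples of
    \<open>fM\<close> and \<open>fH\<close>, and for that both have to be bounded below by a
    multiple of the squared norm. Positivity of \<open>Im z\<close> and invertibility supply
    this.\<close>
  have lowM: "Im z * sqn S v \<le> C1 * fM v" for v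
  proof -
    have "mv S (adj (Qm z M)) (uM v) i = - v i" if "i \<in> S" for i
    proof -
      have "mm S (adj (Qm z M)) (adj M) i j = (if i = j then -1 else 0)" if "i \<in> S" "j \<in> S" for i j
      proof -
        have "mm S (adj (Qm z M)) (adj M) i j = cnj (mm S M (Qm z M) j i)"
          by (simp add: mm_def adj_def mult.commute)
        then show ?thesis using MQ[OF that(2,1)] by auto
      qed
      from mm_eq_scalar_mv[OF finS this that] show ?thesis unfolding uM_def by simp
    qed
    then have "sqn S v = sqn S (mv S (adj (Qm z M)) (uM v))" by (simp add: sqn_def)
    also have "\<dots> \<le> C1 * sqn S (uM v)" by (rule C1)
    finally have "Im z * sqn S v \<le> C1 * (Im z * sqn S (uM v))"
      using eta by (simp add: mult_left_mono algebra_simps)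
    also have "\<dots> \<le> C1 * fM v"
    proof (intro mult_left_mono)
      show "Im z * sqn S (uM v) \<le> fM v"
        unfolding fM_Q Im_qf_Qm using Im_qf_Sig_ge[OF Mpos, of "uM v"] aM_nonneg c0pos
        by (smt (verit, best) mult_nonneg_nonneg sqn_nonneg)
    qed (use C1 in auto)
    finally show ?thesis .
  qed
  have lowH: "Im z * sqn S v \<le> C2 * fH v" for v
  proof -
    have "mv S (Qm z Mt) (uH v) i = - v i" if "i \<in> S" for i
      using mm_eq_scalar_mv[OF finS QM that] unfolding uH_def by simp
    then have "sqn S v = sqn S (mv S (Qm z Mt) (uH v))" by (simp add: sqn_def)
    also have "\<dots> \<le> C2 * sqn S (uH v)" by (rule C2)
    finally have "Im z * sqn S v \<le> C2 * (Im z * sqn S (uH v))"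
      using eta by (simp add: mult_left_mono algebra_simps)
    also have "\<dots> \<le> C2 * fH v"
    proof (intro mult_left_mono)
      show "Im z * sqn S (uH v) \<le> fH v"
        unfolding fH_Q Im_qf_Qm using Im_qf_Sig_ge[OF Mtpos, of "uH v"] Im_ntr_nonneg[OF Mtpos] c0pos
        by (smt (verit, best) mult_nonneg_nonneg sqn_nonneg)
    qed (use C2 in auto)
    finally show ?thesis .
  qed
  define t where "t = B3 * (C1 + C2) / Im z"
  have t0: "t \<ge> 0" using B3 C1 C2 eta by (simp add: t_def)
  have fM0: "fM v \<ge> 0" for v using Mpos by (simp add: fM_def)
  have "dom S (Rm n) (\<lambda>v. t * q^n * fM v) (\<lambda>v. t * q^n * fH v)" for n
  proof (induction n)
    case 0
    have R0: "Rm 0 = Dl" by (intro ext) (simp add: Rm_def)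
    have lM: "B3 * sqn S v \<le> t * fM v" for v
    proof -
      have "B3 * (Im z * sqn S v) \<le> B3 * (C1 * fM v)" using lowM B3 by (simp add: mult_left_mono)
      also have "\<dots> \<le> B3 * ((C1 + C2) * fM v)" using C2 B3 fM0[of v] by (intro mult_left_mono mult_right_mono) auto
      finally show ?thesis using eta by (simp add: t_def field_simps)
    qed
    have lH: "B3 * sqn S v \<le> t * fH v" for v
    proof -
      have "B3 * (Im z * sqn S v) \<le> B3 * (C2 * fH v)" using lowH B3 by (simp add: mult_left_mono)
      also have "\<dots> \<le> B3 * ((C1 + C2) * fH v)" using C1 B3 fH_nonneg[of v] by (intro mult_left_mono mult_right_mono) auto
      finally show ?thesis using eta by (simp add: t_def field_simps)
    qed
    show ?case unfolding dom_def
    proof (intro allI)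
      fix v w
      show "2 * cmod (qf S v (Rm 0) w) \<le> t * q ^ 0 * fM v + t * q ^ 0 * fH w"
        using B3(2)[of v w] lM[of v] lH[of w] by (simp add: R0 distrib_left)
    qed
  next
    case (Suc n)
    show ?case unfolding dom_def
    proof (intro allI)
      fix v w
      have "2 * cmod (qf S v (Rm (Suc n)) w) \<le> kf (\<lambda>v. t * q^n * fM v) (uM v) + kf (\<lambda>v. t * q^n * fH v) (uH w)"
        unfolding qf_Rm_Suc by (rule domD[OF dom_Phi[OF Suc.IH]])
      also have "\<dots> = (t * q^n) * kf fM (uM v) + (t * q^n) * kf fH (uH w)"
        by (simp only: kf_scale)
      also have "\<dots> \<le> (t * q^n) * (q * fM v) + (t * q^n) * (q * fH w)"
        using kM kH t0 q by (intro add_mono mult_left_mono) auto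
      finally show "2 * cmod (qf S v (Rm (Suc n)) w) \<le> t * q ^ Suc n * fM v + t * q ^ Suc n * fH w"
        by (simp add: algebra_simps)
    qed
  qed
  then show ?thesis using t0 q by blast
qed

section \<open>The scalar equation for the trace\<close>

lemma ntf_scale: "ntf S (\<lambda>v. c * f v) = c * ntf S f"
  by (simp add: ntf_def sum_distrib_left)

lemma ntf_fM: "ntf S fM = Im (ntr S M)" and ntf_fH: "ntf S fH = Im (ntr S Mh)"
  using ntf_Im_qf[OF finS] by (simp_all add: fM_def[abs_def] fH_def[abs_def])

definition "aM = Im (ntr S M)"
definition "aH = Im (ntr S Mh)"

lemma ntf_Pf: "ntf S (Pf n) \<le> aM / bM"
proof -
  have "ntf S (Pf n) \<le> ntf S (\<lambda>v. 1 / bM * fM v)"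
    using Pf_le bM_pos by (intro ntf_mono) (simp add: field_simps)
  also have "\<dots> = aM / bM"
    unfolding ntf_scale by (simp add: ntf_fM aM_def)
  finally show ?thesis .
qed

lemma ntf_Pg: "ntf S (Pg n) \<le> aH / bH"
proof -
  have "ntf S (Pg n) \<le> ntf S (\<lambda>v. 1 / bH * fH v)"
    using Pg_le bH_ge by (intro ntf_mono) (simp add: field_simps)
  also have "\<dots> = aH / bH"
    unfolding ntf_scale by (simp add: ntf_fH aH_def)
  finally show ?thesis .
qed

text \<open>The left side is the normalised squared Hilbert-Schmidt norm of the adjoint of
  \<open>M\<close> minus \<open>Mh\<close>. Conjugation flips the sign of the imaginary part for
  \<open>M\<close> only, so the diagonal entries of this difference have imaginary part
  \<open>- (Im (M i i) + Im (Mh i i))\<close>. Keeping only these and applying Cauchy-Schwarz over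
  \<open>i\<close> gives the square on the right.\<close>

lemma HS_gap:
  "ntf S (\<lambda>v. sqn S (uM v)) + ntf S (\<lambda>v. sqn S (uH v)) - 2 * Re (ntr S (mm S M Mh)) \<ge> (aM + aH)\<^sup>2"
proof -
  have u1: "sqn S (uM (unitv i)) = (\<Sum>j\<in>S. (cmod (M i j))\<^sup>2)" if "i \<in> S" for i
    using that finS
    by (simp add: uM_def sqn_def mv_def adj_def unitv_def if_distrib[of "\<lambda>x. _ * x"] cong: if_cong)
  have u2: "sqn S (uH (unitv i)) = (\<Sum>j\<in>S. (cmod (Mh j i))\<^sup>2)" if "i \<in> S" for i
    using that finS
    by (simp add: uH_def sqn_def mv_def unitv_def if_distrib[of "\<lambda>x. _ * x"] cong: if_cong)
  have sq: "(cmod (cnj a - b))\<^sup>2 = (cmod a)\<^sup>2 + (cmod b)\<^sup>2 - 2 * Re (a * b)" for a b :: complex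
    unfolding cmod_power2 by (simp add: power2_eq_square algebra_simps)
  have "(\<Sum>i\<in>S. (Im (M i i) + Im (Mh i i))\<^sup>2) \<le> (\<Sum>i\<in>S. \<Sum>j\<in>S. (cmod (cnj (M i j) - Mh j i))\<^sup>2)"
  proof (intro sum_mono)
    fix i assume i: "i \<in> S"
    have I: "Im (cnj (M i i) - Mh i i) = - (Im (M i i) + Im (Mh i i))" by simp
    have "(Im (M i i) + Im (Mh i i))\<^sup>2 \<le> (cmod (cnj (M i i) - Mh i i))\<^sup>2"
    proof -
      have "(Im (M i i) + Im (Mh i i))\<^sup>2 = (Im (cnj (M i i) - Mh i i))\<^sup>2"
        unfolding I by (rule power2_minus[symmetric])
      then show ?thesis unfolding cmod_power2 by (simp only: le_add_same_cancel2 zero_le_power2)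
    qed
    also have "\<dots> \<le> (\<Sum>j\<in>S. (cmod (cnj (M i j) - Mh j i))\<^sup>2)"
      using i finS by (intro member_le_sum[of i S "\<lambda>j. (cmod (cnj (M i j) - Mh j i))\<^sup>2"]) auto
    finally show "(Im (M i i) + Im (Mh i i))\<^sup>2 \<le> (\<Sum>j\<in>S. (cmod (cnj (M i j) - Mh j i))\<^sup>2)" .
  qed
  also have "\<dots> = (\<Sum>i\<in>S. sqn S (uM (unitv i))) + (\<Sum>i\<in>S. sqn S (uH (unitv i))) - 2 * (\<Sum>i\<in>S. Re (mm S M Mh i i))"
    unfolding sq by (simp add: u1 u2 mm_def sum.distrib sum_subtractf sum_distrib_left)
  finally have 1: "(\<Sum>i\<in>S. (Im (M i i) + Im (Mh i i))\<^sup>2) \<le> \<dots>" .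
  have "(\<Sum>i\<in>S. Im (M i i) + Im (Mh i i))\<^sup>2 \<le> card S * (\<Sum>i\<in>S. (Im (M i i) + Im (Mh i i))\<^sup>2)"
    using sum_squared_le_sum_of_squares[of "\<lambda>i. Im (M i i) + Im (Mh i i)" S] by (simp only: mult.commute)
  also have "\<dots> \<le> card S * ((\<Sum>i\<in>S. sqn S (uM (unitv i))) + (\<Sum>i\<in>S. sqn S (uH (unitv i))) - 2 * (\<Sum>i\<in>S. Re (mm S M Mh i i)))"
    using 1 by (intro mult_left_mono) auto
  finally have "((\<Sum>i\<in>S. Im (M i i) + Im (Mh i i)) / card S)\<^sup>2 \<le>
     ((\<Sum>i\<in>S. sqn S (uM (unitv i))) + (\<Sum>i\<in>S. sqn S (uH (unitv i))) - 2 * (\<Sum>i\<in>S. Re (mm S M Mh i i))) / card S"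
    using cardS by (simp add: power_divide field_simps power2_eq_square)
  then show ?thesis
    by (simp add: aM_def aH_def ntf_def ntr_def sum.distrib add_divide_distrib diff_divide_distrib)
qed

text \<open>Domination by the majorants, whose traces are at most about \<open>1 / c0\<close>, only
  shows that \<open>c0 * Re (ntr S X)\<close> is at most about 1 for the partial sums
  \<open>X\<close>. Domination is therefore used for all terms but the first, and
  \<open>HS_gap\<close> for the first term \<open>M Mh\<close>; this gains
  \<open>c0 * \<omega>\<^sup>2 / 2\<close>. The index is \<open>Suc m\<close> because
  \<open>Xs 0\<close> does not contain the first term.\<close>

lemma gap: "c0 * \<omega>\<^sup>2 / 4 \<le> cmod (1 - c0 * ntr S (Xs (Suc m)))"
proof -
  define n where "n = Suc m"
  note Suc = n_def
  have aM0: "aM \<ge> 0" and aH0: "aH \<ge> \<omega>" using aM_nonneg omega_le by (auto simp: aM_def aH_def)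
  have "2 * cmod (ntr S (L0 (Xs m))) \<le> ntf S (\<lambda>v. kf (Pf m) (uM v)) + ntf S (\<lambda>v. kf (Pg m) (uH v))"
    by (rule dom_ntr[OF finS dom_L0[OF dom_Xs]])
  moreover have "ntf S (Pf n) = ntf S (\<lambda>v. sqn S (uM v)) + ntf S (\<lambda>v. kf (Pf m) (uM v))"
    "ntf S (Pg n) = ntf S (\<lambda>v. sqn S (uH v)) + ntf S (\<lambda>v. kf (Pg m) (uH v))"
    by (simp_all add: Suc ntf_def sum.distrib add_divide_distrib)
  ultimately have 1: "2 * cmod (ntr S (L0 (Xs m))) \<le> aM / bM + aH / bH
      - ntf S (\<lambda>v. sqn S (uM v)) - ntf S (\<lambda>v. sqn S (uH v))"
    using ntf_Pf[of n] ntf_Pg[of n] by linarith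
  have "2 * Re (ntr S (Xs n)) \<le> 2 * Re (ntr S (mm S M Mh)) + 2 * cmod (ntr S (L0 (Xs m)))"
    using complex_Re_le_cmod[of "ntr S (L0 (Xs m))"] by (simp add: Suc ntr_add)
  also have "\<dots> \<le> aM / bM + aH / bH - (aM + aH)\<^sup>2"
    using 1 HS_gap by linarith
  finally have "c0 * (2 * Re (ntr S (Xs n))) \<le> c0 * (aM / bM + aH / bH - (aM + aH)\<^sup>2)"
    using c0pos by (simp add: mult_left_mono)
  also have "\<dots> \<le> 1 + (1 + 2 * \<epsilon> / (c0 * \<omega>)) - c0 * \<omega>\<^sup>2"
  proof -
    have "c0 * (aM / bM) \<le> 1"
      using bM_pos eta by (simp add: bM_def aM_def field_simps)
    moreover have "c0 * (aH / bH) \<le> 1 + 2 * \<epsilon> / (c0 * \<omega>)"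
    proof -
      have "c0 * aH \<le> bH + \<epsilon>" using eta by (simp add: bH_def aH_def)
      moreover have "\<epsilon> \<le> bH * (2 * \<epsilon> / (c0 * \<omega>))"
      proof -
        have "\<epsilon> = (c0 * \<omega> / 2) * (2 * \<epsilon> / (c0 * \<omega>))" using c0pos omega by simp
        also have "\<dots> \<le> bH * (2 * \<epsilon> / (c0 * \<omega>))"
          using bH_ge(2) eps c0pos omega by (intro mult_right_mono) auto
        finally show ?thesis .
      qed
      ultimately have "c0 * aH \<le> bH * (1 + 2 * \<epsilon> / (c0 * \<omega>))" by (simp add: distrib_left)
      then show ?thesis using bH_ge(3) by (simp add: pos_divide_le_eq mult.commute)
    qed
    moreover have "c0 * \<omega>\<^sup>2 \<le> c0 * (aM + aH)\<^sup>2"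
      using aM0 aH0 omega c0pos by (intro mult_left_mono power_mono) auto
    ultimately show ?thesis by (simp add: algebra_simps)
  qed
  finally have 2: "c0 * Re (ntr S (Xs n)) \<le> 1 + \<epsilon> / (c0 * \<omega>) - c0 * \<omega>\<^sup>2 / 2" by simp
  have "\<epsilon> / (c0 * \<omega>) \<le> c0 * \<omega>\<^sup>2 / 4"
    using eps2 c0pos omega by (simp add: field_simps power2_eq_square power3_eq_cube)
  then have "c0 * \<omega>\<^sup>2 / 4 \<le> Re (1 - c0 * ntr S (Xs n))" 
  proof -
    have "Re (1 - c0 * ntr S (Xs n)) = 1 - c0 * Re (ntr S (Xs n))" by simp
    then show ?thesis using 2 \<open>\<epsilon> / (c0 * \<omega>) \<le> c0 * \<omega>\<^sup>2 / 4\<close> by linarith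
  qed
  also have "\<dots> \<le> cmod (1 - c0 * ntr S (Xs n))" by (rule complex_Re_le_cmod)
  finally show ?thesis unfolding Suc .
qed

text \<open>The trace of the defect formula reads
  \<open>\<tau> * (1 - c0 * tr X) = tr R - tr Y\<close>, and the remainder \<open>R\<close>
  disappears as \<open>n\<close> grows. The constant 6 is \<open>4 * 3 / 2\<close>: 4 from
  \<open>gap\<close>, 3 from the bounds \<open>1 / c0\<close> and \<open>2 / c0\<close> on the two
  majorant traces. Since \<open>aM / bM\<close> is at most \<open>1 / c0\<close> whatever the trace
  of \<open>M\<close>, the estimate can carry a trace bound from \<open>Mh\<close> over to an
  unknown \<open>M\<close>.\<close>

lemma tau_bound: "cmod \<tau> \<le> 6 * \<epsilon> / (c0\<^sup>2 * \<omega>\<^sup>2)"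
proof -
  obtain t q where t: "t \<ge> 0" "0 \<le> q" "q < 1" "\<And>n. dom S (Rm n) (\<lambda>v. t * q^n * fM v) (\<lambda>v. t * q^n * fH v)"
    using Rm_bound by blast
  have *: "cmod \<tau> * (c0 * \<omega>\<^sup>2 / 4) \<le> 3 * \<epsilon> / (2 * c0) + t * q ^ Suc n * (aM + aH) / 2" for n
  proof -
    have "ntr S (Rm (Suc n)) = \<tau> - c0 * \<tau> * ntr S (Xs (Suc n)) + ntr S (Ys (Suc n))"
      unfolding Rm_def by (simp only: ntr_add ntr_diff ntr_scale \<tau>_def)
    then have "\<tau> * (1 - c0 * ntr S (Xs (Suc n))) = ntr S (Rm (Suc n)) - ntr S (Ys (Suc n))"
      by (simp add: algebra_simps)
    then have "cmod \<tau> * cmod (1 - c0 * ntr S (Xs (Suc n))) = cmod (ntr S (Rm (Suc n)) - ntr S (Ys (Suc n)))"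
      by (metis norm_mult)
    also have "\<dots> \<le> cmod (ntr S (Rm (Suc n))) + cmod (ntr S (Ys (Suc n)))"
      by (rule norm_triangle_ineq4)
    finally have 1: "cmod \<tau> * cmod (1 - c0 * ntr S (Xs (Suc n))) \<le> \<dots>" .
    have 2: "2 * cmod (ntr S (Rm (Suc n))) \<le> t * q ^ Suc n * (aM + aH)"
      using dom_ntr[OF finS t(4)[of "Suc n"]]
      unfolding ntf_scale ntf_fM ntf_fH aM_def aH_def by (simp add: algebra_simps)
    have "2 * cmod (ntr S (Ys (Suc n))) \<le> \<epsilon> * ntf S (Pf (Suc n)) + \<epsilon> * ntf S (Pg (Suc n))"
      using dom_ntr[OF finS dom_Ys[of "Suc n"]] unfolding ntf_scale .
    also have "\<dots> \<le> \<epsilon> * (1 / c0) + \<epsilon> * (2 / c0)"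
    proof (intro add_mono mult_left_mono eps)
      show "ntf S (Pf (Suc n)) \<le> 1 / c0"
      proof (rule order_trans[OF ntf_Pf])
        show "aM / bM \<le> 1 / c0"
          using bM_pos eta c0pos by (simp add: divide_simps) (simp add: bM_def aM_def)
      qed
      show "ntf S (Pg (Suc n)) \<le> 2 / c0"
      proof (rule order_trans[OF ntf_Pg])
        show "aH / bH \<le> 2 / c0"
          using bH_ge c0pos by (simp add: divide_simps) (simp add: aH_def mult.commute)
      qed
    qed
    finally have 3: "2 * cmod (ntr S (Ys (Suc n))) \<le> 3 * \<epsilon> / c0" by (simp add: field_simps)
    have "cmod \<tau> * (c0 * \<omega>\<^sup>2 / 4) \<le> cmod \<tau> * cmod (1 - c0 * ntr S (Xs (Suc n)))"
      by (intro mult_left_mono gap) auto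
    moreover have "3 * \<epsilon> / (2 * c0) = (3 * \<epsilon> / c0) / 2" by simp
    ultimately show ?thesis using 1 2 3 by linarith
  qed
  have "(\<lambda>n. 3 * \<epsilon> / (2 * c0) + t * q ^ Suc n * (aM + aH) / 2) \<longlonglongrightarrow> 3 * \<epsilon> / (2 * c0) + t * 0 * (aM + aH) / 2"
    using t by (intro tendsto_intros LIMSEQ_Suc[OF LIMSEQ_power_zero]) auto
  then have "cmod \<tau> * (c0 * \<omega>\<^sup>2 / 4) \<le> 3 * \<epsilon> / (2 * c0)"
    using * by (intro LIMSEQ_le_const) auto
  then show ?thesis using c0pos omega by (simp add: field_simps power2_eq_square)
qed

text \<open>Domination is evaluated at two unit vectors. One factor \<open>1 / bM\<close> comes from
  the majorant \<open>fM / bM\<close>, the other from the bound \<open>1 / bM\<close> on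
  \<open>fM\<close> at a unit vector; likewise for \<open>bH\<close>.\<close>

lemma entry_bound:
  assumes "i \<in> S" "j \<in> S"
  shows "2 * cmod (M i j - Mh i j) \<le> (c0 * cmod \<tau> + \<epsilon>) * (1 / bM\<^sup>2 + 1 / bH\<^sup>2)"
proof -
  obtain t q where t: "t \<ge> 0" "0 \<le> q" "q < 1" "\<And>n. dom S (Rm n) (\<lambda>v. t * q^n * fM v) (\<lambda>v. t * q^n * fH v)"
    using Rm_bound by blast
  let ?v = "unitv i :: 'i \<Rightarrow> complex" and ?w = "unitv j :: 'i \<Rightarrow> complex"
  define g where "g = fM ?v / bM + fH ?w / bH"
  have *: "2 * cmod (qf S ?v Dl ?w) \<le> (c0 * cmod \<tau> + \<epsilon>) * g + t * q ^ n * (fM ?v + fH ?w)" for n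
  proof -
    have "qf S ?v Dl ?w = c0 * \<tau> * qf S ?v (Xs n) ?w - qf S ?v (Ys n) ?w + qf S ?v (Rm n) ?w"
      by (simp add: qf_Rm)
    then have "2 * cmod (qf S ?v Dl ?w) \<le> 2 * cmod (c0 * \<tau> * qf S ?v (Xs n) ?w)
        + 2 * cmod (qf S ?v (Ys n) ?w) + 2 * cmod (qf S ?v (Rm n) ?w)"
      using norm_triangle_ineq[of "c0 * \<tau> * qf S ?v (Xs n) ?w - qf S ?v (Ys n) ?w" "qf S ?v (Rm n) ?w"]
        norm_triangle_ineq4[of "c0 * \<tau> * qf S ?v (Xs n) ?w" "qf S ?v (Ys n) ?w"] by simp
    moreover have "Pf n ?v + Pg n ?w \<le> g"
      using Pf_le[of n ?v] Pg_le[of n ?w] bM_pos bH_ge(3) unfolding g_def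
      by (intro add_mono) (simp_all add: field_simps)
    moreover have "2 * cmod (c0 * \<tau> * qf S ?v (Xs n) ?w) \<le> c0 * cmod \<tau> * (Pf n ?v + Pg n ?w)"
      using mult_left_mono[OF domD[OF dom_Xs[of n], of ?v ?w], of "c0 * cmod \<tau>"] c0pos
      by (simp add: norm_mult algebra_simps)
    moreover have "2 * cmod (qf S ?v (Ys n) ?w) \<le> \<epsilon> * (Pf n ?v + Pg n ?w)"
      using domD[OF dom_Ys[of n], of ?v ?w] by (simp add: algebra_simps)
    moreover have "2 * cmod (qf S ?v (Rm n) ?w) \<le> t * q ^ n * (fM ?v + fH ?w)"
      using domD[OF t(4)[of n], of ?v ?w] by (simp add: algebra_simps)
    moreover have "(c0 * cmod \<tau> + \<epsilon>) * (Pf n ?v + Pg n ?w) \<le> (c0 * cmod \<tau> + \<epsilon>) * g"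
      using calculation(2) c0pos eps by (intro mult_left_mono) auto
    ultimately show ?thesis by (simp add: algebra_simps)
  qed
  have "(\<lambda>n. (c0 * cmod \<tau> + \<epsilon>) * g + t * q ^ n * (fM ?v + fH ?w)) \<longlonglongrightarrow> (c0 * cmod \<tau> + \<epsilon>) * g + t * 0 * (fM ?v + fH ?w)"
    using t by (intro tendsto_intros LIMSEQ_power_zero) auto
  then have 1: "2 * cmod (qf S ?v Dl ?w) \<le> (c0 * cmod \<tau> + \<epsilon>) * g"
    using * by (intro LIMSEQ_le_const) auto
  \<comment> \<open>By the Ward identity \<open>bM\<close> times the squared norm of
    \<open>uM\<close> is at most \<open>fM\<close>, while \<open>fM\<close> is at most the modulus
    of an inner product with a unit vector. A weighted Young inequality lets \<open>fM\<close>
    absorb the norm term.\<close>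
  have fMu: "fM ?v \<le> 1 / bM"
  proof -
    have k: "0 \<le> kf fM (uM ?v)"
      using kf_mono[of "\<lambda>_. 0" fM "uM ?v"] Mpos by (simp add: kf_def fM_def)
    have "fM ?v \<le> cmod (ip S (uM ?v) ?v)"
      using abs_Im_le_cmod[of "ip S (uM ?v) ?v"] by (simp add: fM_def qf_def ip_mv_adj uM_def)
    moreover have "bM * (2 * cmod (ip S (uM ?v) ?v)) \<le> bM * (bM * sqn S (uM ?v) + 1 / bM)"
    proof -
      have "2 * cmod (ip S (\<lambda>i. of_real bM * uM ?v i) ?v) \<le> sqn S (\<lambda>i. of_real bM * uM ?v i) + 1"
        using two_ip_le[of S "\<lambda>i. of_real bM * uM ?v i" ?v] sqn_unitv[OF finS assms(1)] by simp
      moreover have "ip S (\<lambda>i. of_real bM * uM ?v i) ?v = of_real bM * ip S (uM ?v) ?v"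
        by (simp add: ip_def sum_distrib_left algebra_simps)
      moreover have "sqn S (\<lambda>i. of_real bM * uM ?v i) = bM\<^sup>2 * sqn S (uM ?v)"
        by (simp add: sqn_def norm_mult power_mult_distrib sum_distrib_left)
      ultimately show ?thesis using bM_pos by (simp add: norm_mult power2_eq_square algebra_simps)
    qed
    then have "2 * cmod (ip S (uM ?v) ?v) \<le> bM * sqn S (uM ?v) + 1 / bM"
      using bM_pos by simp
    ultimately show ?thesis using fM_eq[of ?v] k by linarith
  qed
  have fHu: "fH ?w \<le> 1 / bH"
  proof -
    have k: "0 \<le> kf fH (uH ?w)"
      using kf_mono[of "\<lambda>_. 0" fH "uH ?w"] fH_nonneg by (simp add: kf_def)
    have "fH ?w \<le> cmod (ip S ?w (uH ?w))"
      using abs_Im_le_cmod[of "ip S ?w (uH ?w)"] by (simp add: fH_def qf_def uH_def)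
    moreover have "bH * (2 * cmod (ip S ?w (uH ?w))) \<le> bH * (bH * sqn S (uH ?w) + 1 / bH)"
    proof -
      have sq: "sqn S (\<lambda>i. of_real bH * uH ?w i) = bH\<^sup>2 * sqn S (uH ?w)"
        by (simp add: sqn_def norm_mult power_mult_distrib sum_distrib_left)
      have "2 * cmod (of_real bH * ip S ?w (uH ?w)) \<le> 1 + bH\<^sup>2 * sqn S (uH ?w)"
        using two_ip_le[of S ?w "\<lambda>i. of_real bH * uH ?w i"]
        unfolding ip_scale_right sq sqn_unitv[OF finS assms(2)] .
      then have "2 * (bH * cmod (ip S ?w (uH ?w))) \<le> 1 + bH\<^sup>2 * sqn S (uH ?w)"
        using bH_ge(3) by (simp add: norm_mult)
      moreover have "bH * (bH * sqn S (uH ?w) + 1 / bH) = bH\<^sup>2 * sqn S (uH ?w) + 1"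
        using bH_ge(3) by (simp add: power2_eq_square distrib_left)
      ultimately show ?thesis by linarith
    qed
    then have "2 * cmod (ip S ?w (uH ?w)) \<le> bH * sqn S (uH ?w) + 1 / bH"
      using bH_ge(3) by simp
    ultimately show ?thesis using fH_ge[of ?w] k by linarith
  qed
  have "g \<le> 1 / bM\<^sup>2 + 1 / bH\<^sup>2"
    using divide_right_mono[OF fMu, of bM] divide_right_mono[OF fHu, of bH] bM_pos bH_ge(3)
    by (simp add: g_def power2_eq_square)
  then have "(c0 * cmod \<tau> + \<epsilon>) * g \<le> (c0 * cmod \<tau> + \<epsilon>) * (1 / bM\<^sup>2 + 1 / bH\<^sup>2)"
    using c0pos eps by (intro mult_left_mono) auto
  then show ?thesis using 1 assms by (simp add: qf_unitv finS Dl_def)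
qed

end

section \<open>Kraus representation of the covariance\<close>

text \<open>Cholesky factorisation by induction on the index set: the row of the pivot
  \<open>s\<close> gives one rank-one term, and the Schur complement stays positive semidefinite. A
  vanishing pivot forces its whole row to vanish.\<close>

lemma psd_factorization:
  fixes q :: "'b \<Rightarrow> 'b \<Rightarrow> real"
  assumes "finite I" "\<And>i j. i \<in> I \<Longrightarrow> j \<in> I \<Longrightarrow> q i j = q j i"
    and "\<And>v. 0 \<le> (\<Sum>i\<in>I. \<Sum>j\<in>I. v i * v j * q i j)"
  shows "\<exists>(n::nat) k. \<forall>i\<in>I. \<forall>j\<in>I. q i j = (\<Sum>a<n. k a i * k a j)"
  using assms
proof (induction I arbitrary: q rule: finite_induct)
  case empty
  then show ?case by simp
next
  case (insert s I)
  have expand: "(\<Sum>i\<in>insert s I. \<Sum>j\<in>insert s I. v i * v j * q i j)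
     = v s * v s * q s s + 2 * v s * (\<Sum>j\<in>I. v j * q s j) + (\<Sum>i\<in>I. \<Sum>j\<in>I. v i * v j * q i j)" for v :: "'b \<Rightarrow> real"
  proof -
    have "(\<Sum>i\<in>I. v i * v s * q i s) = v s * (\<Sum>j\<in>I. v j * q s j)"
      unfolding sum_distrib_left using insert.prems(1) by (intro sum.cong refl) auto
    moreover have "(\<Sum>i\<in>I. v s * v i * q s i) = v s * (\<Sum>j\<in>I. v j * q s j)"
      unfolding sum_distrib_left by (intro sum.cong refl) auto
    ultimately show ?thesis using insert.hyps by (simp add: sum.distrib algebra_simps)
  qed
  define d where "d = q s s"
  have d0: "d \<ge> 0"
  proof -
    define v where "v i = (if i = s then 1 else (0::real))" for i
    have "v i = 0" if "i \<in> I" for i using that insert.hyps by (auto simp: v_def)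
    then have "(\<Sum>j\<in>I. v j * q s j) = 0" "(\<Sum>i\<in>I. \<Sum>j\<in>I. v i * v j * q i j) = 0" by simp_all
    then show ?thesis using insert.prems(2)[of v] unfolding expand by (simp add: v_def d_def)
  qed
  \<comment> \<open>For \<open>d = 0\<close> division by zero yields \<open>r = 0\<close>, so a zero
    pivot contributes an empty rank-one term.\<close>
  define r where "r i = q i s / sqrt d" for i
  have qs: "q s j = r s * r j" if j: "j \<in> insert s I" for j
  proof (cases "d = 0")
    case False
    then show ?thesis using d0 insert.prems(1)[of s j] j by (simp add: r_def d_def)
  next
    case True
    have "q s j = 0"
    proof (rule ccontr)
      assume n: "q s j \<noteq> 0"
      then have js: "j \<noteq> s" "j \<in> I" using True j by (auto simp: d_def)
      \<comment> \<open>Chosen so that the form at the test vector below equals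
        \<open>2 * c + q j j = -1\<close>.\<close>
      define c where "c = - (1 + q j j) / 2"
      define t where "t = c / q s j"
      define v where "v i = (if i = s then t else if i = j then 1 else (0::real))" for i
      have "(\<Sum>i\<in>I. v i * q s i) = (\<Sum>i\<in>I. if i = j then q s j else 0)"
        using insert.hyps by (intro sum.cong refl) (auto simp: v_def)
      then have "(\<Sum>i\<in>I. v i * q s i) = q s j" using js insert.hyps by simp
      moreover have "(\<Sum>i\<in>I. \<Sum>k\<in>I. v i * v k * q i k) = (\<Sum>i\<in>I. \<Sum>k\<in>I. if k = j then (if i = j then q j j else 0) else 0)"
        using insert.hyps by (intro sum.cong refl) (auto simp: v_def)
      then have "(\<Sum>i\<in>I. \<Sum>k\<in>I. v i * v k * q i k) = q j j"
        using js insert.hyps by simp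
      ultimately have "0 \<le> 2 * t * q s j + q j j"
        using insert.prems(2)[of v] True unfolding expand by (simp add: v_def d_def)
      moreover have "t * q s j = c" using n by (simp only: t_def nonzero_divide_eq_eq nonzero_eq_divide_eq times_divide_eq_left nonzero_mult_div_cancel_right not_False_eq_True)
      ultimately show False by (simp add: c_def)
    qed
    then show ?thesis using True by (simp add: r_def)
  qed
  define q' where "q' i j = q i j - r i * r j" for i j
  have "\<exists>(n::nat) k. \<forall>i\<in>I. \<forall>j\<in>I. q' i j = (\<Sum>a<n. k a i * k a j)"
  proof (rule insert.IH)
    show "q' i j = q' j i" if "i \<in> I" "j \<in> I" for i j
      using insert.prems(1)[of i j] that by (simp add: q'_def)
    show "0 \<le> (\<Sum>i\<in>I. \<Sum>j\<in>I. v i * v j * q' i j)" for v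
    proof -
      define m where "m = (\<Sum>j\<in>I. v j * r j)"
      \<comment> \<open>The value at \<open>s\<close> minimises the form over the pivot coordinate,
        so the form at \<open>w\<close> is the Schur complement at \<open>v\<close>.\<close>
      define w where "w = v(s := - m / sqrt d)"
      have wI: "w i = v i" if "i \<in> I" for i using that insert.hyps by (auto simp: w_def)
      have "(\<Sum>j\<in>I. w j * q s j) = sqrt d * m"
        unfolding m_def sum_distrib_left
      proof (intro sum.cong refl)
        fix j assume j: "j \<in> I"
        have "q s j = sqrt d * r j"
        proof (cases "d = 0")
          case True
          then show ?thesis using qs[of j] j by (simp add: r_def)
        next
          case False
          then show ?thesis using d0 insert.prems(1)[of s j] j by (simp add: r_def)
        qed
        then show "w j * q s j = sqrt d * (v j * r j)" using wI[OF j] by simp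
      qed
      note sum_w = this
      have m0: "m = 0" if "d = 0" using that by (simp add: m_def r_def)
      have q'_sum: "(\<Sum>i\<in>I. \<Sum>j\<in>I. v i * v j * q' i j) = (\<Sum>i\<in>I. \<Sum>j\<in>I. w i * w j * q i j) - m * m"
        unfolding m_def sum_product sum_subtractf[symmetric]
        by (intro sum.cong refl) (simp add: q'_def wI right_diff_distrib)
      have ge: "0 \<le> w s * w s * d + 2 * w s * (sqrt d * m) + (\<Sum>i\<in>I. \<Sum>j\<in>I. w i * w j * q i j)"
        using insert.prems(2)[of w] unfolding expand d_def[symmetric] sum_w .
      have "w s * w s * d + 2 * w s * (sqrt d * m) = - (m * m)"
      proof (cases "d = 0")
        case True
        then show ?thesis using m0 by simp
      next
        case False
        define t where "t = sqrt d"
        have t: "t \<noteq> 0" "d = t * t" using False d0 by (simp_all add: t_def)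
        have "w s * t = - m" using t(1) by (simp add: w_def t_def[symmetric])
        moreover have "w s * w s * d + 2 * w s * (t * m) = (w s * t) * (w s * t) + 2 * (w s * t) * m"
          unfolding t(2) by (simp only: mult_ac)
        ultimately show ?thesis by (simp add: t_def[symmetric])
      qed
      then show ?thesis using ge q'_sum by linarith
    qed
  qed
  then obtain n :: nat and k where k: "\<And>i j. i \<in> I \<Longrightarrow> j \<in> I \<Longrightarrow> q' i j = (\<Sum>a<n. k a i * k a j)"
    by blast
  define k' where "k' a i = (if a = n then r i else if i = s then 0 else k a i)" for a i
  have "q i j = (\<Sum>a<Suc n. k' a i * k' a j)" if ij: "i \<in> insert s I" "j \<in> insert s I" for i j
  proof -
    have *: "(\<Sum>a<Suc n. k' a i * k' a j) = (\<Sum>a<n. if i = s \<or> j = s then 0 else k a i * k a j) + r i * r j"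
      unfolding sum.lessThan_Suc by (intro arg_cong2[where f = "(+)"] sum.cong refl) (auto simp: k'_def)
    show ?thesis
    proof (cases "i = s \<or> j = s")
      case True
      have "q i j = r i * r j"
      proof (cases "i = s")
        case True
        then show ?thesis using qs[OF ij(2)] by simp
      next
        case False
        then have "j = s" using \<open>i = s \<or> j = s\<close> by simp
        then show ?thesis using qs[OF ij(1)] insert.prems(1)[OF ij] by (simp only: mult.commute)
      qed
      then show ?thesis unfolding * using True by simp
    next
      case False
      then show ?thesis using k[of i j] ij unfolding * by (auto simp: q'_def)
    qed
  qed
  then show ?case by blast
qed

text \<open>Gaussian elimination. The pivot is nonzero because its imaginary part is that of the
  form at a unit vector. The Schur complement inherits positivity because its form at
  \<open>v\<close> equals the full form at the extension of \<open>v\<close> that row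
  \<open>s\<close> annihilates.\<close>

lemma Im_pos_solve:
  assumes "finite S" "\<And>v. \<exists>i\<in>S. v i \<noteq> 0 \<Longrightarrow> 0 < Im (qf S v A v)"
  shows "\<exists>x. \<forall>i\<in>S. mv S A x i = y i"
  using assms
proof (induction S arbitrary: A y rule: finite_induct)
  case empty
  then show ?case by simp
next
  case (insert s S)
  define d where "d = A s s"
  have "qf (insert s S) (unitv s) A (unitv s) = d"
    using insert.hyps by (subst qf_unitv) (auto simp: d_def)
  then have d: "d \<noteq> 0"
    using insert.prems[of "unitv s"] by (auto simp: unitv_def)
  define A' where "A' i j = A i j - A i s * A s j / d" for i j
  have mv_ins: "mv (insert s S) A x i = A i s * x s + (\<Sum>j\<in>S. A i j * x j)" for x i
    using insert.hyps by (simp add: mv_def)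
  have A'_mv: "mv S A' x i = (\<Sum>j\<in>S. A i j * x j) - A i s * (\<Sum>j\<in>S. A s j * x j) / d" for x i
    by (simp add: mv_def A'_def sum_subtractf left_diff_distrib sum_distrib_left sum_divide_distrib algebra_simps)
  have "\<exists>x. \<forall>i\<in>S. mv S A' x i = y i - A i s * y s / d"
  proof (rule insert.IH)
    fix v :: "'a \<Rightarrow> complex" assume v: "\<exists>i\<in>S. v i \<noteq> 0"
    define w where "w = v(s := - (\<Sum>j\<in>S. A s j * v j) / d)"
    have wS: "w i = v i" if "i \<in> S" for i using that insert.hyps by (auto simp: w_def)
    have ws: "w s = - (\<Sum>j\<in>S. A s j * v j) / d" by (simp add: w_def)
    have sums: "(\<Sum>j\<in>S. A i j * w j) = (\<Sum>j\<in>S. A i j * v j)" for i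
      by (intro sum.cong refl) (simp add: wS)
    have "mv (insert s S) A w s = 0" unfolding mv_ins sums ws using d by (simp add: d_def)
    moreover have "mv (insert s S) A w i = mv S A' v i" for i
      unfolding mv_ins sums ws A'_mv using d by (simp add: field_simps)
    ultimately have "qf (insert s S) w A w = qf S v A' v"
      using insert.hyps by (simp add: qf_def ip_def wS)
    moreover have "\<exists>i\<in>insert s S. w i \<noteq> 0" using v wS by auto
    ultimately show "0 < Im (qf S v A' v)" using insert.prems[of w] by simp
  qed
  then obtain x where x: "\<And>i. i \<in> S \<Longrightarrow> mv S A' x i = y i - A i s * y s / d" by blast
  define x' where "x' = x(s := (y s - (\<Sum>j\<in>S. A s j * x j)) / d)"
  have sums: "(\<Sum>j\<in>S. A i j * x' j) = (\<Sum>j\<in>S. A i j * x j)" for i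
    using insert.hyps by (intro sum.cong refl) (auto simp: x'_def)
  have "mv (insert s S) A x' i = y i" if "i \<in> insert s S" for i
  proof (cases "i = s")
    case True
    then show ?thesis unfolding mv_ins sums using d by (simp add: x'_def d_def)
  next
    case False
    then have "i \<in> S" using that by simp
    from x[OF this] show ?thesis
      unfolding mv_ins sums A'_mv using d by (simp add: x'_def field_simps)
  qed
  then show ?case by blast
qed

lemma Im_pos_inverse_ex:
  assumes "finite S" "\<And>v. \<exists>i\<in>S. v i \<noteq> 0 \<Longrightarrow> 0 < Im (qf S v A v)"
  shows "\<exists>B. \<forall>i\<in>S. \<forall>j\<in>S. mm S A B i j = (if i = j then c else 0)"
proof -
  have "\<exists>x. \<forall>i\<in>S. mv S A x i = (if i = j then c else 0)" for j
    by (rule Im_pos_solve[OF assms])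
  then obtain X where X: "\<And>j i. i \<in> S \<Longrightarrow> mv S A (X j) i = (if i = j then c else 0)" by metis
  show ?thesis using X by (intro exI[of _ "\<lambda>i j. X j i"]) (auto simp: mm_def mv_def)
qed

context kraus_map
begin

lemma Sig_eq:
  assumes "\<And>i j k l. i \<in> S \<Longrightarrow> j \<in> S \<Longrightarrow> k \<in> S \<Longrightarrow> l \<in> S \<Longrightarrow>
      \<xi> i j k l = (if i = k \<and> j = l then c0 else 0) + (\<Sum>a\<in>Q. kr a i j * kr a k l)"
    and "i \<in> S" "k \<in> S"
  shows "Sig X i k = (\<Sum>j\<in>S. \<Sum>l\<in>S. of_real (\<xi> i j k l) * X j l) / of_nat (card S)"
proof -
  have "(\<Sum>j\<in>S. \<Sum>l\<in>S. of_real (\<xi> i j k l) * X j l) =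
     (\<Sum>j\<in>S. \<Sum>l\<in>S. (if j = l then (if i = k then of_real c0 * X j l else 0) else 0)) +
     (\<Sum>j\<in>S. \<Sum>l\<in>S. \<Sum>a\<in>Q. of_real (kr a i j) * of_real (kr a k l) * X j l)"
    unfolding sum.distrib[symmetric]
    using assms by (intro sum.cong refl) (auto simp: sum_distrib_right distrib_right)
  also have "(\<Sum>j\<in>S. \<Sum>l\<in>S. (if j = l then (if i = k then of_real c0 * X j l else 0) else 0))
     = (\<Sum>j\<in>S. if i = k then of_real c0 * X j j else 0)"
    using finS by simp
  also have "(\<Sum>j\<in>S. \<Sum>l\<in>S. \<Sum>a\<in>Q. of_real (kr a i j) * of_real (kr a k l) * X j l)
     = (\<Sum>j\<in>S. \<Sum>a\<in>Q. \<Sum>l\<in>S. of_real (kr a i j) * of_real (kr a k l) * X j l)"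
    by (intro sum.cong refl sum.swap)
  also have "\<dots> = (\<Sum>a\<in>Q. \<Sum>j\<in>S. \<Sum>l\<in>S. of_real (kr a i j) * of_real (kr a k l) * X j l)"
    by (rule sum.swap)
  finally show ?thesis
    by (simp add: Sig_def Phi_def ntr_def add_divide_distrib sum_distrib_left[symmetric])
qed

lemma Qm_Im_pos:
  assumes "Im z > 0" "\<And>v. 0 \<le> Im (qf S v X v)"
  shows "Im z * sqn S v \<le> Im (qf S v (Qm z X) v)"
  unfolding Im_qf_Qm
  using Im_qf_Sig_ge[OF assms(2), of v] Im_ntr_nonneg[OF assms(2)] c0pos
  by (smt (verit, best) mult_nonneg_nonneg sqn_nonneg)

lemma sqn_pos: "\<exists>i\<in>S. v i \<noteq> 0 \<Longrightarrow> sqn S v > 0"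
  unfolding sqn_def using finS by (auto intro!: sum_pos2)

text \<open>A column \<open>v\<close> of \<open>B Q + 1\<close>, where \<open>Q\<close> is
  \<open>Qm z X\<close>, satisfies \<open>Q v = 0\<close> because \<open>Q B = -1\<close>. The
  imaginary part of the form of \<open>Q\<close> is definite, so \<open>v\<close> vanishes on
  \<open>S\<close>.\<close>

lemma left_inverse:
  assumes "Im z > 0" "\<And>v. 0 \<le> Im (qf S v X v)"
    and QM: "\<And>i j. i \<in> S \<Longrightarrow> j \<in> S \<Longrightarrow> mm S (Qm z X) B i j = (if i = j then -1 else 0)"
    and ij: "i \<in> S" "j \<in> S"
  shows "mm S B (Qm z X) i j = (if i = j then -1 else 0)"
proof -
  define v where "v = (\<lambda>k. mm S B (Qm z X) k j + (if k = j then 1 else 0))"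
  have "mv S (Qm z X) v k = 0" if k: "k \<in> S" for k
  proof -
    have "mv S (Qm z X) v k = mv S (Qm z X) (mv S B (\<lambda>i. Qm z X i j)) k + (\<Sum>l\<in>S. Qm z X k l * (if l = j then 1 else 0))"
      by (simp add: v_def mv_def mm_def sum.distrib distrib_left)
    also have "mv S (Qm z X) (mv S B (\<lambda>i. Qm z X i j)) k = - Qm z X k j"
      using mm_eq_scalar_mv[OF finS QM k] by simp
    also have "(\<Sum>l\<in>S. Qm z X k l * (if l = j then 1 else 0)) = Qm z X k j"
      using finS ij by (simp add: if_distrib[of "\<lambda>x. _ * x"] cong: if_cong)
    finally show ?thesis by simp
  qed
  then have "qf S v (Qm z X) v = 0" by (simp add: qf_def ip_def)
  then have "Im z * sqn S v \<le> 0" using Qm_Im_pos[OF assms(1,2), of v] by simp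
  then have "\<not> sqn S v > 0" using assms(1) by (simp add: mult_le_0_iff)
  then have "v i = 0" using sqn_pos ij by blast
  then show ?thesis by (auto simp: v_def add_eq_0_iff2)
qed

lemma right_inverse_ex:
  assumes "Im z > 0" "\<And>v. 0 \<le> Im (qf S v X v)"
  shows "\<exists>B. \<forall>i\<in>S. \<forall>j\<in>S. mm S (Qm z X) B i j = (if i = j then -1 else 0)"
proof (rule Im_pos_inverse_ex[OF finS])
  fix v :: "'i \<Rightarrow> complex" assume "\<exists>i\<in>S. v i \<noteq> 0"
  then have "0 < Im z * sqn S v" using sqn_pos assms(1) by simp
  then show "0 < Im (qf S v (Qm z X) v)" using Qm_Im_pos[OF assms, of v] by linarith
qed

end

section \<open>The covariance tensor and its Kraus operators\<close>

locale model =
  fixes K :: nat and P :: "nat \<Rightarrow> 'a measure" and x :: "nat \<Rightarrow> nat \<Rightarrow> nat \<Rightarrow> 'a \<Rightarrow> real" and c0 :: real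
  assumes Kdep: "K_dependent_model K P x" and c0pos: "c0 > 0" and posdef: "xi_pos_def P x c0"
begin

text \<open>With integer indices the offsets \<open>k - i\<close>, \<open>l - j\<close> and the
  block shifts are exact, whereas subtraction of natural numbers truncates.\<close>

definition xz :: "nat \<Rightarrow> int \<Rightarrow> int \<Rightarrow> int \<Rightarrow> int \<Rightarrow> real" where
  "xz N i j k l = xi P x N (nat i) (nat j) (nat k) (nat l)"

lemma prob_P: "prob_space (P N)"
  by (rule Kdep[unfolded K_dependent_model_def, rule_format, THEN conjunct1])

lemma Kdep_at:
  assumes "1 \<le> i" "i \<le> j" "j \<le> N"
  shows "x N i j \<in> borel_measurable (P N) \<and>
         integrable (P N) (\<lambda>\<omega>. (x N i j \<omega>)\<^sup>2) \<and>
         prob_space.expectation (P N) (x N i j) = 0 \<and>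
         prob_space.variance (P N) (x N i j) \<le> 1 \<and>
         prob_space.indep_set (P N)
           (sigma_sets (space (P N)) {x N i j -` A \<inter> space (P N) | A. A \<in> sets borel})
           (sigma_sets (space (P N))
              {x N k l -` A \<inter> space (P N) | A k l. (k, l) \<in> far_set K N i j \<and> A \<in> sets borel})"
  by (rule Kdep[unfolded K_dependent_model_def, rule_format, THEN conjunct2, rule_format]) (use assms in simp)

lemma entry:
  assumes "1 \<le> i" "i \<le> j" "j \<le> N"
  shows "x N i j \<in> borel_measurable (P N)" "integrable (P N) (\<lambda>\<omega>. (x N i j \<omega>)\<^sup>2)"
    "integral\<^sup>L (P N) (x N i j) = 0" "integral\<^sup>L (P N) (\<lambda>\<omega>. (x N i j \<omega>)\<^sup>2) \<le> 1"
    "integrable (P N) (x N i j)"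
proof -
  interpret prob_space "P N" by (rule prob_P)
  show m: "x N i j \<in> borel_measurable (P N)" and s: "integrable (P N) (\<lambda>\<omega>. (x N i j \<omega>)\<^sup>2)"
    and e: "integral\<^sup>L (P N) (x N i j) = 0"
    using Kdep_at[OF assms] by blast+
  have "variance (x N i j) \<le> 1" using Kdep_at[OF assms] by blast
  then show "integral\<^sup>L (P N) (\<lambda>\<omega>. (x N i j \<omega>)\<^sup>2) \<le> 1" unfolding e by simp
  show "integrable (P N) (x N i j)" using square_integrable_imp_integrable[OF m s] .
qed

lemma entry_prod:
  assumes "1 \<le> i" "i \<le> j" "j \<le> N" "1 \<le> k" "k \<le> l" "l \<le> N"
  shows "integrable (P N) (\<lambda>\<omega>. x N i j \<omega> * x N k l \<omega>)"
    "\<bar>integral\<^sup>L (P N) (\<lambda>\<omega>. x N i j \<omega> * x N k l \<omega>)\<bar> \<le> 1"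
    "cov (P N) (x N i j) (x N k l) = integral\<^sup>L (P N) (\<lambda>\<omega>. x N i j \<omega> * x N k l \<omega>)"
    "(k, l) \<in> far_set K N i j \<Longrightarrow> integral\<^sup>L (P N) (\<lambda>\<omega>. x N i j \<omega> * x N k l \<omega>) = 0"
proof -
  interpret prob_space "P N" by (rule prob_P)
  note X = entry[OF assms(1-3)] and Y = entry[OF assms(4-6)]
  let ?X = "x N i j" and ?Y = "x N k l"
  have b: "2 * \<bar>?X w * ?Y w\<bar> \<le> (?X w)\<^sup>2 + (?Y w)\<^sup>2" for w
    using sum_squares_bound[of "\<bar>?X w\<bar>" "\<bar>?Y w\<bar>"] by (simp add: abs_mult)
  have i2: "integrable (P N) (\<lambda>w. (?X w)\<^sup>2 + (?Y w)\<^sup>2)" by (intro Bochner_Integration.integrable_add X(2) Y(2))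
  show int: "integrable (P N) (\<lambda>\<omega>. ?X \<omega> * ?Y \<omega>)"
  proof (rule Bochner_Integration.integrable_bound[OF i2])
    show "(\<lambda>\<omega>. ?X \<omega> * ?Y \<omega>) \<in> borel_measurable (P N)" using X(1) Y(1) by simp
    show "AE w in P N. norm (?X w * ?Y w) \<le> norm ((?X w)\<^sup>2 + (?Y w)\<^sup>2)"
    proof (rule AE_I2)
      fix w
      have "0 \<le> \<bar>?X w * ?Y w\<bar>" by simp
      then have "\<bar>?X w * ?Y w\<bar> \<le> (?X w)\<^sup>2 + (?Y w)\<^sup>2" using b[of w] by linarith
      then show "norm (?X w * ?Y w) \<le> norm ((?X w)\<^sup>2 + (?Y w)\<^sup>2)" by simp
    qed
  qed
  have "2 * \<bar>integral\<^sup>L (P N) (\<lambda>\<omega>. ?X \<omega> * ?Y \<omega>)\<bar> \<le> 2 * integral\<^sup>L (P N) (\<lambda>\<omega>. \<bar>?X \<omega> * ?Y \<omega>\<bar>)"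
    using integral_norm_bound[of "P N" "\<lambda>\<omega>. ?X \<omega> * ?Y \<omega>"] by simp
  also have "\<dots> = integral\<^sup>L (P N) (\<lambda>\<omega>. 2 * \<bar>?X \<omega> * ?Y \<omega>\<bar>)" by simp
  also have "\<dots> \<le> integral\<^sup>L (P N) (\<lambda>w. (?X w)\<^sup>2 + (?Y w)\<^sup>2)"
    using b by (intro integral_mono integrable_mult_right integrable_abs int i2)
  also have "\<dots> = integral\<^sup>L (P N) (\<lambda>w. (?X w)\<^sup>2) + integral\<^sup>L (P N) (\<lambda>w. (?Y w)\<^sup>2)"
    using X(2) Y(2) by (rule Bochner_Integration.integral_add)
  finally show "\<bar>integral\<^sup>L (P N) (\<lambda>\<omega>. ?X \<omega> * ?Y \<omega>)\<bar> \<le> 1" using X(4) Y(4) by linarith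
  show "cov (P N) ?X ?Y = integral\<^sup>L (P N) (\<lambda>\<omega>. ?X \<omega> * ?Y \<omega>)"
    using X(3) Y(3) by (simp add: cov_def)
  show "integral\<^sup>L (P N) (\<lambda>\<omega>. ?X \<omega> * ?Y \<omega>) = 0" if far: "(k, l) \<in> far_set K N i j"
  proof -
    have ind: "indep_set (sigma_sets (space (P N)) {?X -` A \<inter> space (P N) | A. A \<in> sets borel})
       (sigma_sets (space (P N)) {x N k l -` A \<inter> space (P N) | A k l. (k, l) \<in> far_set K N i j \<and> A \<in> sets borel})"
      using Kdep_at[OF assms(1-3)] by blast
    have "indep_set (sigma_sets (space (P N)) {?X -` A \<inter> space (P N) | A. A \<in> sets borel})
       (sigma_sets (space (P N)) {?Y -` A \<inter> space (P N) | A. A \<in> sets borel})"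
      unfolding indep_set_def
    proof (rule indep_sets_mono_sets[OF ind[unfolded indep_set_def]])
      have "sigma_sets (space (P N)) {?Y -` A \<inter> space (P N) | A. A \<in> sets borel} \<subseteq>
        sigma_sets (space (P N)) {x N k l -` A \<inter> space (P N) | A k l. (k, l) \<in> far_set K N i j \<and> A \<in> sets borel}"
        by (rule sigma_sets_mono') (use far in blast)
      then show "case_bool (sigma_sets (space (P N)) {?X -` A \<inter> space (P N) | A. A \<in> sets borel})
           (sigma_sets (space (P N)) {?Y -` A \<inter> space (P N) | A. A \<in> sets borel}) b
        \<subseteq> case_bool (sigma_sets (space (P N)) {?X -` A \<inter> space (P N) | A. A \<in> sets borel})
           (sigma_sets (space (P N)) {x N k l -` A \<inter> space (P N) | A k l. (k, l) \<in> far_set K N i j \<and> A \<in> sets borel}) b" for b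
        by (cases b) auto
    qed
    then have "indep_var borel ?X borel ?Y" unfolding indep_var_eq using X(1) Y(1) by simp
    from indep_var_lebesgue_integral[OF this X(5) Y(5)] show ?thesis using X(3) by simp
  qed
qed

lemma xz_upper: "i \<le> j \<Longrightarrow> k \<le> l \<Longrightarrow> xz N i j k l = integral\<^sup>L (P N) (\<lambda>\<omega>. x N (nat i) (nat j) \<omega> * x N (nat k) (nat l) \<omega>)"
  by (simp add: xz_def xi_def nat_mono)

lemma xz_lower: "1 \<le> j \<Longrightarrow> 1 \<le> l \<Longrightarrow> j < i \<Longrightarrow> l < k \<Longrightarrow> xz N i j k l = xz N j i l k"
  by (auto simp: xz_def xi_def)

lemma xz_mixed: "1 \<le> i \<Longrightarrow> 1 \<le> j \<Longrightarrow> 1 \<le> k \<Longrightarrow> 1 \<le> l \<Longrightarrow> i \<le> j \<longleftrightarrow> l < k \<Longrightarrow> xz N i j k l = 0"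
  by (auto simp: xz_def xi_def)

lemma xz_bound:
  assumes "i \<in> {1..int N}" "j \<in> {1..int N}" "k \<in> {1..int N}" "l \<in> {1..int N}"
  shows "\<bar>xz N i j k l\<bar> \<le> 1"
proof -
  have up: "\<bar>xz N i j k l\<bar> \<le> 1" if "i \<in> {1..int N}" "j \<in> {1..int N}" "k \<in> {1..int N}" "l \<in> {1..int N}" "i \<le> j" "k \<le> l" for i j k l
    unfolding xz_upper[OF that(5,6)] using that by (intro entry_prod(2)) auto
  show ?thesis
  proof (cases "i \<le> j \<longleftrightarrow> k \<le> l")
    case True
    then show ?thesis
      using up[of i j k l] up[of j i l k] assms xz_lower[of j l i k N] by (cases "i \<le> j") auto
  next
    case False
    then show ?thesis using xz_mixed[of i j k l N] assms by auto
  qed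
qed

lemma xz_band:
  assumes "i \<in> {1..int N}" "j \<in> {1..int N}" "k \<in> {1..int N}" "l \<in> {1..int N}"
    and "int K < \<bar>k - i\<bar> \<or> int K < \<bar>l - j\<bar>"
  shows "xz N i j k l = 0"
proof -
  have up: "xz N i j k l = 0" if "i \<in> {1..int N}" "j \<in> {1..int N}" "k \<in> {1..int N}" "l \<in> {1..int N}" "i \<le> j" "k \<le> l"
    "int K < \<bar>k - i\<bar> \<or> int K < \<bar>l - j\<bar>" for i j k l
    unfolding xz_upper[OF that(5,6)] using that by (intro entry_prod(4)) (auto simp: far_set_def)
  show ?thesis
  proof (cases "i \<le> j \<longleftrightarrow> k \<le> l")
    case True
    then show ?thesis
      using up[of i j k l] up[of j i l k] assms xz_lower[of j l i k N] by (cases "i \<le> j") auto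
  next
    case False
    then show ?thesis using xz_mixed[of i j k l N] assms by auto
  qed
qed

text \<open>On the upper triangle the covariance minus \<open>c0\<close> times the identity is
  positive semidefinite, and its factors are the Kraus matrices. Each factor is used twice, once on
  \<open>i \<le> j\<close> and once transposed on \<open>j < i\<close>, and the boolean tag
  separates the two copies. Products of an upper and a lower pair then vanish, exactly as
  \<open>xi\<close> does.\<close>

lemma kraus_ex:
  "\<exists>(Q :: (bool \<times> nat) set) kr. \<forall>i\<in>{1..int N}. \<forall>j\<in>{1..int N}. \<forall>k\<in>{1..int N}. \<forall>l\<in>{1..int N}.
     xz N i j k l = (if i = k \<and> j = l then c0 else 0) + (\<Sum>a\<in>Q. kr a i j * kr a k l)"
proof -
  define I where "I = upper_idx N"
  define q where "q p p' = cov (P N) (x N (fst p) (snd p)) (x N (fst p') (snd p')) - (if p = p' then c0 else 0)"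
    for p p' :: "nat \<times> nat"
  have finI: "finite I" unfolding I_def upper_idx_def
    by (rule finite_subset[of _ "{1..N} \<times> {1..N}"]) auto
  have "\<exists>(n::nat) k. \<forall>i\<in>I. \<forall>j\<in>I. q i j = (\<Sum>a<n. k a i * k a j)"
  proof (rule psd_factorization[OF finI])
    show "q p p' = q p' p" for p p'
      by (auto simp: q_def cov_def mult.commute)
    fix v :: "nat \<times> nat \<Rightarrow> real"
    have "c0 * (\<Sum>p\<in>I. (v p)\<^sup>2) \<le> (\<Sum>p\<in>I. \<Sum>p'\<in>I. v p * v p' * cov (P N) (x N (fst p) (snd p)) (x N (fst p') (snd p')))"
      using posdef[unfolded xi_pos_def_def, rule_format, where v = "\<lambda>i j. v (i, j)" and N = N]
      by (simp add: I_def case_prod_beta)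
    also have "\<dots> = (\<Sum>p\<in>I. \<Sum>p'\<in>I. v p * v p' * q p p' + (if p = p' then c0 * (v p)\<^sup>2 else 0))"
      by (intro sum.cong refl) (auto simp: q_def algebra_simps power2_eq_square)
    also have "\<dots> = (\<Sum>p\<in>I. \<Sum>p'\<in>I. v p * v p' * q p p') + c0 * (\<Sum>p\<in>I. (v p)\<^sup>2)"
      using finI by (simp add: sum.distrib sum_distrib_left)
    finally show "0 \<le> (\<Sum>p\<in>I. \<Sum>p'\<in>I. v p * v p' * q p p')" by simp
  qed
  then obtain n :: nat and h where h: "\<And>p p'. p \<in> I \<Longrightarrow> p' \<in> I \<Longrightarrow> q p p' = (\<Sum>a<n. h a p * h a p')" by blast
  define kr where "kr a i j = (if fst a then (if i \<le> j then h (snd a) (nat i, nat j) else 0)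
     else (if j < i then h (snd a) (nat j, nat i) else 0))" for a :: "bool \<times> nat" and i j :: int
  have up: "xz N i j k l = (if i = k \<and> j = l then c0 else 0) + (\<Sum>a<n. h a (nat i, nat j) * h a (nat k, nat l))"
    if "i \<in> {1..int N}" "j \<in> {1..int N}" "k \<in> {1..int N}" "l \<in> {1..int N}" "i \<le> j" "k \<le> l" for i j k l
  proof -
    have I: "(nat i, nat j) \<in> I" "(nat k, nat l) \<in> I" using that by (auto simp: I_def upper_idx_def)
    have "xz N i j k l = cov (P N) (x N (nat i) (nat j)) (x N (nat k) (nat l))"
      unfolding xz_upper[OF that(5,6)] by (subst entry_prod(3)) (use that in auto)
    also have "\<dots> = q (nat i, nat j) (nat k, nat l) + (if i = k \<and> j = l then c0 else 0)"
      using that by (auto simp: q_def)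
    finally show ?thesis using h[OF I] by simp
  qed
  have "xz N i j k l = (if i = k \<and> j = l then c0 else 0) + (\<Sum>a\<in>UNIV \<times> {..<n}. kr a i j * kr a k l)"
    if r: "i \<in> {1..int N}" "j \<in> {1..int N}" "k \<in> {1..int N}" "l \<in> {1..int N}" for i j k l
  proof -
    have "(\<Sum>a\<in>UNIV \<times> {..<n}. kr a i j * kr a k l) = (\<Sum>a<n. kr (True, a) i j * kr (True, a) k l)
        + (\<Sum>a<n. kr (False, a) i j * kr (False, a) k l)"
    proof -
      have "(\<Sum>a\<in>UNIV \<times> {..<n}. kr a i j * kr a k l) = (\<Sum>b\<in>UNIV. \<Sum>a<n. kr (b, a) i j * kr (b, a) k l)"
        by (simp add: sum.cartesian_product case_prod_beta)
      then show ?thesis by (simp add: UNIV_bool)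
    qed
    also have "\<dots> = (if i \<le> j \<and> k \<le> l then \<Sum>a<n. h a (nat i, nat j) * h a (nat k, nat l)
       else if j < i \<and> l < k then \<Sum>a<n. h a (nat j, nat i) * h a (nat l, nat k) else 0)"
      by (auto simp: kr_def)
    finally have s: "(\<Sum>a\<in>UNIV \<times> {..<n}. kr a i j * kr a k l) = \<dots>" .
    consider "i \<le> j" "k \<le> l" | "j < i" "l < k" | "i \<le> j \<longleftrightarrow> l < k" by linarith
    then show ?thesis
    proof cases
      case 1
      then show ?thesis using s up[OF r] by simp
    next
      case 2
      then show ?thesis using s up[of j i l k] r xz_lower[of j l i k N] by auto
    next
      case 3
      then show ?thesis using s xz_mixed[of i j k l N] r by auto
    qed
  qed
  then show ?thesis by blast
qed

end

section \<open>Quadratic vector equations\<close>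

lemma sqrt_mult_le_weighted:
  fixes a b l :: real
  assumes "a \<ge> 0" "b \<ge> 0" "l > 0"
  shows "sqrt (a * b) \<le> (l * a + b / l) / 2"
proof -
  have "sqrt (a * b) = sqrt ((l * a) * (b / l))" using assms by simp
  also have "\<dots> \<le> (l * a + b / l) / 2"
    using assms by (intro arith_geo_mean_sqrt) auto
  finally show ?thesis .
qed

locale qve = prob_space \<mu> for \<mu> :: "'b measure" +
  fixes p :: "'b \<Rightarrow> 'b \<Rightarrow> real" and C :: real and z :: complex
  assumes p_meas: "(\<lambda>(x, y). p x y) \<in> borel_measurable (\<mu> \<Otimes>\<^sub>M \<mu>)"
    and p_nonneg: "\<And>x y. 0 \<le> p x y" and p_le: "\<And>x y. p x y \<le> C" and eta: "Im z > 0"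
begin

definition T :: "('b \<Rightarrow> complex) \<Rightarrow> 'b \<Rightarrow> complex" where
  "T g x = (\<integral>y. of_real (p x y) * g y \<partial>\<mu>)"

definition adm :: "('b \<Rightarrow> complex) \<Rightarrow> bool" where
  "adm g \<longleftrightarrow> g \<in> borel_measurable \<mu> \<and> (\<forall>x\<in>space \<mu>. cmod (g x) \<le> 1 / Im z \<and> 0 \<le> Im (g x))"

lemma C_nonneg: "C \<ge> 0"
  using p_nonneg p_le order_trans by blast

lemma p_meas1 [measurable]: "x \<in> space \<mu> \<Longrightarrow> p x \<in> borel_measurable \<mu>"
  using measurable_Pair2[OF p_meas, of x] by simp

lemma integrable_pf:
  fixes f :: "'b \<Rightarrow> 'c::{banach, second_countable_topology, real_normed_algebra_1}"
  assumes "x \<in> space \<mu>" "f \<in> borel_measurable \<mu>" "\<And>y. y \<in> space \<mu> \<Longrightarrow> norm (f y) \<le> B"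
  shows "integrable \<mu> (\<lambda>y. of_real (p x y) * f y)"
proof (rule integrable_const_bound[where B = "C * B"])
  have [measurable]: "p x \<in> borel_measurable \<mu>" "f \<in> borel_measurable \<mu>" using assms by auto
  show "(\<lambda>y. of_real (p x y) * f y) \<in> borel_measurable \<mu>" by measurable
  show "AE y in \<mu>. norm (of_real (p x y) * f y) \<le> C * B"
  proof (rule AE_I2)
    fix y assume "y \<in> space \<mu>"
    have "norm (of_real (p x y) * f y) \<le> norm (of_real (p x y) :: 'c) * norm (f y)" by (rule norm_mult_ineq)
    also have "\<dots> \<le> C * B" using p_nonneg[of x y] p_le[of x y] assms(3)[OF \<open>y \<in> space \<mu>\<close>] C_nonneg
      by (intro mult_mono) auto
    finally show "norm (of_real (p x y) * f y) \<le> C * B" .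
  qed
qed

lemma T_props:
  assumes "adm g" "x \<in> space \<mu>"
  shows "integrable \<mu> (\<lambda>y. of_real (p x y) * g y)" "integrable \<mu> (\<lambda>y. p x y * Im (g y))"
    "Im (T g x) = (\<integral>y. p x y * Im (g y) \<partial>\<mu>)" "0 \<le> Im (T g x)" "Im (T g x) \<le> C / Im z"
    "cmod (T g x) \<le> C / Im z"
proof -
  have g: "g \<in> borel_measurable \<mu>" "\<And>y. y \<in> space \<mu> \<Longrightarrow> cmod (g y) \<le> 1 / Im z" "\<And>y. y \<in> space \<mu> \<Longrightarrow> 0 \<le> Im (g y)"
    using assms(1) by (auto simp: adm_def)
  show i: "integrable \<mu> (\<lambda>y. of_real (p x y) * g y)"
    by (rule integrable_pf[OF assms(2) g(1,2)])
  have "integrable \<mu> (\<lambda>y. of_real (p x y) * Im (g y))"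
  proof (rule integrable_pf[OF assms(2)])
    show "(\<lambda>y. Im (g y)) \<in> borel_measurable \<mu>" using g(1) by simp
    show "norm (Im (g y)) \<le> 1 / Im z" if "y \<in> space \<mu>" for y
      using g(2)[OF that] abs_Im_le_cmod[of "g y"] by simp
  qed
  then show "integrable \<mu> (\<lambda>y. p x y * Im (g y))" by simp
  have "Im (T g x) = (\<integral>y. Im (of_real (p x y) * g y) \<partial>\<mu>)"
    unfolding T_def by (rule integral_Im[OF i, symmetric])
  then show I: "Im (T g x) = (\<integral>y. p x y * Im (g y) \<partial>\<mu>)" by simp
  show "0 \<le> Im (T g x)" unfolding I
    using g(3) p_nonneg by (intro integral_nonneg_AE AE_I2) auto
  show c: "cmod (T g x) \<le> C / Im z"
  proof -
    have "cmod (T g x) \<le> (\<integral>y. cmod (of_real (p x y) * g y) \<partial>\<mu>)"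
      unfolding T_def by (rule integral_norm_bound)
    also have "\<dots> \<le> (\<integral>y. C * (1 / Im z) \<partial>\<mu>)"
    proof (rule integral_mono_AE)
      show "integrable \<mu> (\<lambda>y. cmod (of_real (p x y) * g y))" using i by simp
      show "AE y in \<mu>. cmod (of_real (p x y) * g y) \<le> C * (1 / Im z)"
      proof (rule AE_I2)
        fix y assume "y \<in> space \<mu>"
        then show "cmod (of_real (p x y) * g y) \<le> C * (1 / Im z)"
          unfolding norm_mult using p_nonneg[of x y] p_le[of x y] g(2) C_nonneg by (intro mult_mono) auto
      qed
    qed simp
    also have "\<dots> = C / Im z" by (simp add: prob_space)
    finally show ?thesis .
  qed
  show "Im (T g x) \<le> C / Im z"
    using c abs_Im_le_cmod[of "T g x"] by linarith
qed

definition G :: "('b \<Rightarrow> complex) \<Rightarrow> 'b \<Rightarrow> complex" where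
  "G g x = - 1 / (z + T g x)"

text \<open>Lower bound for \<open>Im (G g)\<close> at admissible \<open>g\<close>: the imaginary
  part of \<open>z + T g\<close> is at least \<open>Im z\<close>, and its modulus is at most
  \<open>cmod z + C / Im z\<close>.\<close>

definition "dl = Im z / (cmod z + C / Im z)\<^sup>2"

lemma dl_pos: "dl > 0"
proof -
  have "cmod z > 0" using eta by auto
  moreover have "C / Im z \<ge> 0" using C_nonneg eta by simp
  ultimately have "cmod z + C / Im z > 0" by linarith
  then show ?thesis using eta unfolding dl_def by (intro divide_pos_pos zero_less_power)
qed

lemma Im_G: "Im (G g x) = Im (z + T g x) / (cmod (z + T g x))\<^sup>2"
proof -
  have "Im (G g x) = - Im (1 / (z + T g x))" by (simp add: G_def)
  also have "\<dots> = Im (z + T g x) / (cmod (z + T g x))\<^sup>2"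
    unfolding Im_divide cmod_power2 by (simp only: minus_divide_left) simp
  finally show ?thesis .
qed

lemma G_adm:
  assumes "adm g"
  shows "adm (G g)" "x \<in> space \<mu> \<Longrightarrow> dl \<le> Im (G g x)"
proof -
  have gm[measurable]: "g \<in> borel_measurable \<mu>" using assms by (simp add: adm_def)
  note [measurable] = p_meas
  have [measurable]: "(\<lambda>w. p (fst w) (snd w)) \<in> borel_measurable (\<mu> \<Otimes>\<^sub>M \<mu>)"
    using p_meas by (simp add: case_prod_beta)
  have "(\<lambda>x. T g x) \<in> borel_measurable \<mu>" unfolding T_def
  proof (rule borel_measurable_lebesgue_integral)
    show "(\<lambda>(x, y). of_real (p x y) * g y) \<in> borel_measurable (\<mu> \<Otimes>\<^sub>M \<mu>)"
      unfolding case_prod_beta by measurable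
  qed
  then have [measurable]: "G g \<in> borel_measurable \<mu>" unfolding G_def[abs_def] by measurable
  have W: "Im z \<le> cmod (z + T g x)" "cmod (z + T g x) \<le> cmod z + C / Im z" "Im z \<le> Im (z + T g x)" if "x \<in> space \<mu>" for x
    using T_props(4,6)[OF assms that] abs_Im_le_cmod[of "z + T g x"] norm_triangle_ineq[of z "T g x"] by auto
  show d: "dl \<le> Im (G g x)" if "x \<in> space \<mu>" for x
    unfolding Im_G dl_def using W[OF that] eta by (intro frac_le power_mono) auto
  have "cmod (G g x) \<le> 1 / Im z" if "x \<in> space \<mu>" for x
    unfolding G_def using W(1)[OF that] eta by (simp add: norm_divide frac_le)
  then show "adm (G g)" using d dl_pos unfolding adm_def by (auto intro: order_trans[OF less_imp_le])
qed

primrec gs :: "nat \<Rightarrow> 'b \<Rightarrow> complex" where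
  "gs 0 = G (\<lambda>_. 0)"
| "gs (Suc n) = G (gs n)"

lemma gs_adm: "adm (gs n)" "x \<in> space \<mu> \<Longrightarrow> dl \<le> Im (gs n x)"
proof -
  have 0: "adm (\<lambda>_. 0)" using eta by (simp add: adm_def)
  show a: "adm (gs n)" for n by (induction n) (use G_adm 0 in auto)
  show "x \<in> space \<mu> \<Longrightarrow> dl \<le> Im (gs n x)"
    by (cases n) (use G_adm 0 a in auto)
qed

text \<open>\<open>a \<le> q * (a + Im z)\<close> holds for \<open>0 \<le> a \<le> C / Im z\<close>,
  the range of \<open>Im (T g)\<close>. The constant \<open>s0\<close> makes \<open>s0 * dl\<close>
  equal to \<open>2 / Im z\<close>, the trivial bound on the first increment.\<close>

definition "q = (C / Im z) / (C / Im z + Im z)"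
definition "s0 = 2 / (Im z * dl)"

lemma q_props: "0 \<le> q" "q < 1"
proof -
  have "C / Im z \<ge> 0" using C_nonneg eta by simp
  then show "0 \<le> q" unfolding q_def using eta C_nonneg by (intro divide_nonneg_nonneg) auto
  show "q < 1" unfolding q_def using eta \<open>C / Im z \<ge> 0\<close>
    by (subst divide_less_eq_1_pos) (auto intro: add_nonneg_pos)
qed

text \<open>The quotient of \<open>cmod (g - h)\<close> by \<open>sqrt (Im g * Im h)\<close> is a
  monotone function of the hyperbolic distance in the upper half-plane. The inversion
  \<open>-1 / w\<close> preserves it, integration against a nonnegative kernel does not increase it,
  and adding \<open>z\<close> contracts it by the factor \<open>q\<close>. The iteration therefore
  converges however large the kernel is.\<close>

lemma gs_contract:
  "x \<in> space \<mu> \<Longrightarrow> cmod (gs (Suc n) x - gs n x) \<le> s0 * q^n * sqrt (Im (gs (Suc n) x) * Im (gs n x))"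
proof (induction n arbitrary: x)
  case 0
  have "cmod (gs (Suc 0) x - gs 0 x) \<le> cmod (gs (Suc 0) x) + cmod (gs 0 x)" by (rule norm_triangle_ineq4)
  also have "\<dots> \<le> 1 / Im z + 1 / Im z"
    using gs_adm(1)[of "Suc 0"] gs_adm(1)[of 0] 0 unfolding adm_def by (intro add_mono) auto
  also have "\<dots> = s0 * dl" using dl_pos by (simp add: s0_def)
  also have "\<dots> \<le> s0 * sqrt (Im (gs (Suc 0) x) * Im (gs 0 x))"
  proof (intro mult_left_mono)
    have "dl * dl \<le> Im (gs (Suc 0) x) * Im (gs 0 x)"
      using gs_adm(2)[OF 0, of "Suc 0"] gs_adm(2)[OF 0, of 0] dl_pos by (intro mult_mono) auto
    then show "dl \<le> sqrt (Im (gs (Suc 0) x) * Im (gs 0 x))"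
      using dl_pos by (intro real_le_rsqrt) (simp add: power2_eq_square)
    show "0 \<le> s0" using eta dl_pos by (simp add: s0_def)
  qed
  finally show ?case by simp
next
  case (Suc n)
  let ?g1 = "gs n" and ?g2 = "gs (Suc n)"
  have s0: "0 \<le> s0 * q ^ n" using eta dl_pos q_props by (simp add: s0_def)
  note a1 = gs_adm(1)[of n] and a2 = gs_adm(1)[of "Suc n"]
  note t1 = T_props[OF a1 Suc.prems] and t2 = T_props[OF a2 Suc.prems]
  define a where "a = Im (T ?g2 x)"
  define b where "b = Im (T ?g1 x)"
  define c where "c = C / Im z"
  have ab: "0 \<le> a" "0 \<le> b" "a \<le> c" "b \<le> c" using t1 t2 by (auto simp: a_def b_def c_def)
  define e where "e = Im z"
  have e: "e > 0" using eta by (simp add: e_def)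
  \<comment> \<open>The weight does not depend on the integration variable, so the linearised
    geometric mean can be integrated. This choice balances the two summands: with \<open>e\<close>
    added to \<open>a\<close> and \<open>b\<close>, both equal \<open>r\<close>.\<close>
  define l where "l = sqrt ((b + e) / (a + e))"
  have l: "l > 0" using ab e by (simp add: l_def)
  define r where "r = sqrt ((a + e) * (b + e))"
  have r1: "l * (a + e) = r" "(b + e) / l = r"
  proof -
    have "l * (a + e) = sqrt ((b + e) / (a + e) * (a + e)\<^sup>2)"
      using ab e unfolding l_def real_sqrt_mult by simp
    also have "(b + e) / (a + e) * (a + e)\<^sup>2 = (a + e) * (b + e)"
      using ab e by (simp add: power2_eq_square)
    finally show "l * (a + e) = r" by (simp add: r_def)
    have "(b + e) / l = sqrt ((b + e)\<^sup>2 / ((b + e) / (a + e)))"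
      using ab e unfolding l_def real_sqrt_divide by simp
    also have "(b + e)\<^sup>2 / ((b + e) / (a + e)) = (a + e) * (b + e)"
      using ab e by (simp add: power2_eq_square)
    finally show "(b + e) / l = r" by (simp add: r_def)
  qed
  have "T ?g2 x - T ?g1 x = (\<integral>y. of_real (p x y) * ?g2 y - of_real (p x y) * ?g1 y \<partial>\<mu>)"
    unfolding T_def using t1(1) t2(1) by simp
  then have "cmod (T ?g2 x - T ?g1 x) \<le> (\<integral>y. cmod (of_real (p x y) * ?g2 y - of_real (p x y) * ?g1 y) \<partial>\<mu>)"
    by (simp only: integral_norm_bound)
  also have "\<dots> \<le> (\<integral>y. s0 * q^n * ((l * (p x y * Im (?g2 y)) + (p x y * Im (?g1 y)) / l) / 2) \<partial>\<mu>)"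
  proof (rule integral_mono_AE)
    show "integrable \<mu> (\<lambda>y. cmod (of_real (p x y) * ?g2 y - of_real (p x y) * ?g1 y))"
      using t1(1) t2(1) by (intro integrable_norm Bochner_Integration.integrable_diff)
    show "integrable \<mu> (\<lambda>y. s0 * q^n * ((l * (p x y * Im (?g2 y)) + (p x y * Im (?g1 y)) / l) / 2))"
      using t1(2) t2(2) by (intro integrable_mult_right integrable_divide_zero Bochner_Integration.integrable_add) auto
    show "AE y in \<mu>. cmod (of_real (p x y) * ?g2 y - of_real (p x y) * ?g1 y)
        \<le> s0 * q^n * ((l * (p x y * Im (?g2 y)) + (p x y * Im (?g1 y)) / l) / 2)"
    proof (rule AE_I2)
      fix y assume y: "y \<in> space \<mu>"
      have "cmod (of_real (p x y) * ?g2 y - of_real (p x y) * ?g1 y) = p x y * cmod (?g2 y - ?g1 y)"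
        using p_nonneg[of x y] by (simp add: right_diff_distrib[symmetric] norm_mult)
      also have "\<dots> \<le> p x y * (s0 * q^n * sqrt (Im (?g2 y) * Im (?g1 y)))"
        using Suc.IH[OF y] p_nonneg[of x y] by (intro mult_left_mono) auto
      also have "\<dots> \<le> p x y * (s0 * q^n * ((l * Im (?g2 y) + Im (?g1 y) / l) / 2))"
        using a1 a2 y s0 p_nonneg[of x y] l unfolding adm_def
        by (intro mult_left_mono sqrt_mult_le_weighted) auto
      finally show "cmod (of_real (p x y) * ?g2 y - of_real (p x y) * ?g1 y)
        \<le> s0 * q^n * ((l * (p x y * Im (?g2 y)) + (p x y * Im (?g1 y)) / l) / 2)"
        by (simp add: algebra_simps add_divide_distrib)
    qed
  qed
  also have "\<dots> = s0 * q^n * ((l * a + b / l) / 2)"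
    using t1(2,3) t2(2,3) by (simp add: a_def b_def)
  also have "\<dots> \<le> s0 * q^n * (q * r)"
  proof (intro mult_left_mono s0)
    have q: "q = c / (c + e)" by (simp add: q_def c_def e_def)
    have "a \<le> q * (a + e)" "b \<le> q * (b + e)"
      using ab e unfolding q by (simp_all add: field_simps)
    then have "l * a \<le> l * (q * (a + e))" "b / l \<le> q * (b + e) / l"
      using l by (auto intro: mult_left_mono divide_right_mono)
    then have "l * a + b / l \<le> q * (l * (a + e)) + q * ((b + e) / l)" by (simp add: mult.left_commute)
    then show "(l * a + b / l) / 2 \<le> q * r" unfolding r1 by (simp add: mult.commute)
  qed
  finally have T: "cmod (T ?g2 x - T ?g1 x) \<le> s0 * q ^ Suc n * r" by (simp add: algebra_simps)
  let ?W1 = "z + T ?g1 x" and ?W2 = "z + T ?g2 x"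
  have imW: "Im ?W1 = b + e" "Im ?W2 = a + e" by (simp_all add: a_def b_def e_def)
  have nz: "?W1 \<noteq> 0" "?W2 \<noteq> 0" using imW ab e by (metis add_nonneg_pos less_irrefl zero_complex.sel(2))+
  have "gs (Suc (Suc n)) x - gs (Suc n) x = (T ?g2 x - T ?g1 x) / (?W1 * ?W2)"
    using nz by (simp add: G_def field_simps)
  then have "cmod (gs (Suc (Suc n)) x - gs (Suc n) x) = cmod (T ?g2 x - T ?g1 x) / (cmod ?W1 * cmod ?W2)"
    by (simp only: norm_divide norm_mult)
  also have "\<dots> \<le> s0 * q ^ Suc n * r / (cmod ?W1 * cmod ?W2)"
    by (intro divide_right_mono T) auto
  also have "r / (cmod ?W1 * cmod ?W2) = sqrt (Im (gs (Suc (Suc n)) x) * Im (gs (Suc n) x))"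
  proof -
    have "sqrt (Im (gs (Suc (Suc n)) x) * Im (gs (Suc n) x)) = sqrt ((a + e) / (cmod ?W2)\<^sup>2 * ((b + e) / (cmod ?W1)\<^sup>2))"
      by (simp only: gs.simps Im_G imW[simplified gs.simps])
    also have "\<dots> = r / (cmod ?W1 * cmod ?W2)"
      by (simp only: r_def real_sqrt_divide real_sqrt_mult real_sqrt_abs abs_norm_cancel times_divide_times_eq mult.commute)
    finally show ?thesis by simp
  qed
  then have "s0 * q ^ Suc n * r / (cmod ?W1 * cmod ?W2) = s0 * q ^ Suc n * sqrt (Im (gs (Suc (Suc n)) x) * Im (gs (Suc n) x))"
    by (metis times_divide_eq_right)
  finally show ?case .
qed

text \<open>The solution is the pointwise limit of the iterates, whose increments are summable by
  \<open>gs_contract\<close>; dominated convergence passes the equation to the limit.\<close>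

theorem qve_exists:
  "\<exists>g. g \<in> borel_measurable \<mu> \<and> (\<exists>\<delta>>0. \<forall>x\<in>space \<mu>. \<delta> \<le> Im (g x)) \<and>
     (\<forall>x\<in>space \<mu>. cmod (g x) \<le> 1 / Im z \<and> g x * (- z - (\<integral>y. of_real (p x y) * g y \<partial>\<mu>)) = 1)"
proof -
  have conv: "convergent (\<lambda>n. gs n x)" if x: "x \<in> space \<mu>" for x
  proof -
    have bnd: "cmod (gs (Suc n) x - gs n x) \<le> (s0 / Im z) * q ^ n" for n
    proof -
      have i: "0 \<le> Im (gs k x)" "Im (gs k x) \<le> 1 / Im z" for k
        using gs_adm(1)[of k] x abs_Im_le_cmod[of "gs k x"] unfolding adm_def by force+
      have "sqrt (Im (gs (Suc n) x) * Im (gs n x)) \<le> sqrt ((1 / Im z) * (1 / Im z))"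
        using i[of n] i[of "Suc n"] eta by (intro real_sqrt_le_mono mult_mono) auto
      also have "\<dots> = 1 / Im z" using eta unfolding real_sqrt_abs2 by simp
      finally have "s0 * q^n * sqrt (Im (gs (Suc n) x) * Im (gs n x)) \<le> s0 * q^n * (1 / Im z)"
        using eta dl_pos q_props by (intro mult_left_mono) (auto simp: s0_def)
      then show ?thesis using gs_contract[OF x, of n] by simp
    qed
    have sm: "summable (\<lambda>n. (s0 / Im z) * q ^ n)"
      using q_props by (intro summable_mult summable_geometric) auto
    have "summable (\<lambda>n. gs (Suc n) x - gs n x)"
      by (rule summable_comparison_test'[OF sm, of 0]) (rule bnd)
    then have "convergent (\<lambda>n. \<Sum>k<n. gs (Suc k) x - gs k x)" by (simp add: summable_iff_convergent)
    then have "convergent (\<lambda>n. gs n x - gs 0 x)" by (simp only: sum_lessThan_telescope[of "\<lambda>n. gs n x"])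
    then have "convergent (\<lambda>n. (gs n x - gs 0 x) + gs 0 x)" by (intro convergent_add convergent_const)
    then show ?thesis by simp
  qed
  define g where "g x = lim (\<lambda>n. gs n x)" for x
  have lim: "(\<lambda>n. gs n x) \<longlonglongrightarrow> g x" if "x \<in> space \<mu>" for x
    using conv[OF that] by (simp add: g_def convergent_LIMSEQ_iff)
  have gsm [measurable]: "gs n \<in> borel_measurable \<mu>" for n using gs_adm(1)[of n] by (simp add: adm_def)
  have gm [measurable]: "g \<in> borel_measurable \<mu>"
    by (rule borel_measurable_LIMSEQ_metric[of gs]) (use lim in auto)
  have b: "dl \<le> Im (g x)" "cmod (g x) \<le> 1 / Im z" if x: "x \<in> space \<mu>" for x
  proof -
    show "dl \<le> Im (g x)"
      using tendsto_Im[OF lim[OF x]] gs_adm(2)[OF x] by (intro LIMSEQ_le_const) auto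
    show "cmod (g x) \<le> 1 / Im z"
      using tendsto_norm[OF lim[OF x]] gs_adm(1) x unfolding adm_def by (intro LIMSEQ_le_const2) auto
  qed
  have eq: "g x * (- z - (\<integral>y. of_real (p x y) * g y \<partial>\<mu>)) = 1" if x: "x \<in> space \<mu>" for x
  proof -
    have [measurable]: "p x \<in> borel_measurable \<mu>" using x by (rule p_meas1)
    have "(\<lambda>n. \<integral>y. of_real (p x y) * gs n y \<partial>\<mu>) \<longlonglongrightarrow> (\<integral>y. of_real (p x y) * g y \<partial>\<mu>)"
    proof (rule integral_dominated_convergence[where w = "\<lambda>_. C * (1 / Im z)"])
      show "AE y in \<mu>. (\<lambda>n. of_real (p x y) * gs n y) \<longlonglongrightarrow> of_real (p x y) * g y"
        using lim by (intro AE_I2 tendsto_intros) auto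
      show "AE y in \<mu>. norm (of_real (p x y) * gs n y) \<le> C * (1 / Im z)" for n
      proof (rule AE_I2)
        fix y assume "y \<in> space \<mu>"
        then show "norm (of_real (p x y) * gs n y) \<le> C * (1 / Im z)"
          unfolding norm_mult using p_nonneg[of x y] p_le[of x y] gs_adm(1)[of n] C_nonneg unfolding adm_def
          by (intro mult_mono) auto
      qed
    qed auto
    then have "(\<lambda>n. gs (Suc n) x * (- z - (\<integral>y. of_real (p x y) * gs n y \<partial>\<mu>)))
        \<longlonglongrightarrow> g x * (- z - (\<integral>y. of_real (p x y) * g y \<partial>\<mu>))"
      using LIMSEQ_Suc[OF lim[OF x]] by (intro tendsto_intros)
    moreover have "gs (Suc n) x * (- z - (\<integral>y. of_real (p x y) * gs n y \<partial>\<mu>)) = 1" for n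
    proof -
      have "Im (z + T (gs n) x) > 0" using T_props(4)[OF gs_adm(1) x] eta by (simp add: add_pos_nonneg)
      then have "z + T (gs n) x \<noteq> 0" by force
      moreover have e: "(- z - (\<integral>y. of_real (p x y) * gs n y \<partial>\<mu>)) = - (z + T (gs n) x)" by (simp add: T_def)
      moreover have "- 1 / W * - W = 1" if "W \<noteq> 0" for W :: complex using that by simp
      ultimately show ?thesis unfolding e gs.simps G_def by blast
    qed
    ultimately show ?thesis by (simp only: LIMSEQ_const_iff)
  qed
  show ?thesis using gm b eq dl_pos by (intro exI[of _ g]) auto
qed

end

section \<open>The covariance profile\<close>

lemma interval_minus_interior:
  fixes I :: "real set"
  assumes "is_interval I" "bounded I"
  shows "finite (I - interior I)"
proof -
  have "I - interior I \<subseteq> {Inf I, Sup I}"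
  proof
    fix t assume t: "t \<in> I - interior I"
    have b: "bdd_below I" "bdd_above I" using assms(2) by (auto intro: bounded_imp_bdd_below bounded_imp_bdd_above)
    have le: "Inf I \<le> t" "t \<le> Sup I" using t b by (auto intro: cInf_lower cSup_upper)
    show "t \<in> {Inf I, Sup I}"
    proof (rule ccontr)
      assume "t \<notin> {Inf I, Sup I}"
      then have lt: "Inf I < t" "t < Sup I" using le by auto
      have "{Inf I<..<Sup I} \<subseteq> I"
      proof
        fix u assume u: "u \<in> {Inf I<..<Sup I}"
        have ne: "I \<noteq> {}" using t by auto
        obtain c where c: "c \<in> I" "c < u" using u ne cInf_lessD[of I u] by auto
        obtain d where d: "d \<in> I" "u < d" using u ne less_cSupD[of I u] by auto
        show "u \<in> I" using mem_is_interval_1_I[OF assms(1) c(1) d(1)] c d by simp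
      qed
      then have "{Inf I<..<Sup I} \<subseteq> interior I" by (intro interior_maximal) auto
      then show False using lt t by auto
    qed
  qed
  then show ?thesis by (rule finite_subset) simp
qed

text \<open>Grouping by the difference \<open>k\<close> produces Fejer weights, the number of
  positions \<open>a\<close> for which \<open>a\<close> and \<open>a + k\<close> both lie in
  \<open>A\<close>.\<close>

lemma sum_diff_band:
  fixes h :: "int \<Rightarrow> real"
  assumes "finite A" "finite B" "\<And>k. k \<notin> B \<Longrightarrow> h k = 0"
  shows "(\<Sum>a\<in>A. \<Sum>a'\<in>A. h (a' - a)) = (\<Sum>k\<in>B. real (card {a\<in>A. a + k \<in> A}) * h k)"
proof -
  have "(\<Sum>a'\<in>A. h (a' - a)) = (\<Sum>k\<in>B. if a + k \<in> A then h k else 0)" for a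
  proof -
    have "(\<Sum>a'\<in>A. h (a' - a)) = (\<Sum>a'\<in>{a'\<in>A. a' - a \<in> B}. h (a' - a))"
      using assms by (intro sum.mono_neutral_right) auto
    also have "\<dots> = (\<Sum>k\<in>{k\<in>B. a + k \<in> A}. h k)"
      by (intro sum.reindex_bij_witness[of _ "\<lambda>k. a + k" "\<lambda>a'. a' - a"]) auto
    also have "\<dots> = (\<Sum>k\<in>B. if a + k \<in> A then h k else 0)"
      using assms(2) by (simp add: sum.inter_filter)
    finally show ?thesis .
  qed
  then have "(\<Sum>a\<in>A. \<Sum>a'\<in>A. h (a' - a)) = (\<Sum>a\<in>A. \<Sum>k\<in>B. if a + k \<in> A then h k else 0)" by simp
  also have "\<dots> = (\<Sum>k\<in>B. \<Sum>a\<in>A. if a + k \<in> A then h k else 0)" by (rule sum.swap)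
  also have "\<dots> = (\<Sum>k\<in>B. real (card {a\<in>A. a + k \<in> A}) * h k)"
    using assms(1) by (intro sum.cong refl) (simp add: sum.inter_filter[symmetric])
  finally show ?thesis .
qed

lemma card_shift_bounds:
  assumes "\<bar>k\<bar> \<le> int K"
  shows "real n - real K \<le> real (card {a\<in>{1..int n}. a + k \<in> {1..int n}})"
    "real (card {a\<in>{1..int n}. a + k \<in> {1..int n}}) \<le> real n"
proof -
  have "card {a\<in>{1..int n}. a + k \<in> {1..int n}} \<le> card {1..int n}"
    by (intro card_mono) auto
  then show "real (card {a\<in>{1..int n}. a + k \<in> {1..int n}}) \<le> real n" by simp
  have "{max 1 (1 - k)..min (int n) (int n - k)} \<subseteq> {a\<in>{1..int n}. a + k \<in> {1..int n}}" by auto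
  then have "card {max 1 (1 - k)..min (int n) (int n - k)} \<le> card {a\<in>{1..int n}. a + k \<in> {1..int n}}"
    by (intro card_mono finite_Collect_conjI) auto
  then show "real n - real K \<le> real (card {a\<in>{1..int n}. a + k \<in> {1..int n}})"
    using assms by (auto simp: max_def min_def split: if_splits)
qed

locale profile = model K P x c0
  for K :: nat and P :: "nat \<Rightarrow> 'a measure" and x :: "nat \<Rightarrow> nat \<Rightarrow> nat \<Rightarrow> 'a \<Rightarrow> real" and c0 :: real +
  fixes \<psi> :: "real \<Rightarrow> real \<Rightarrow> int \<Rightarrow> int \<Rightarrow> real"
  assumes prof: "psi_profile K P x \<psi>"
begin

definition Parts :: "real set set" where
  "Parts = (SOME \<I>. finite \<I> \<and> disjoint \<I> \<and> \<Union>\<I> = {0..<1} \<and> (\<forall>I\<in>\<I>. is_interval I) \<and>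
       (\<forall>k l. \<forall>I\<in>\<I>. \<forall>J\<in>\<I>. \<exists>L. L-lipschitz_on (I \<times> J) (\<lambda>(\<theta>, \<phi>). \<psi> \<theta> \<phi> k l)))"

lemma Parts: "finite Parts" "\<Union>Parts = {0..<1}" "\<And>I. I \<in> Parts \<Longrightarrow> is_interval I"
  "\<And>k l I J. I \<in> Parts \<Longrightarrow> J \<in> Parts \<Longrightarrow> \<exists>L. L-lipschitz_on (I \<times> J) (\<lambda>(\<theta>, \<phi>). \<psi> \<theta> \<phi> k l)"
proof -
  have "finite Parts \<and> disjoint Parts \<and> \<Union>Parts = {0..<1} \<and> (\<forall>I\<in>Parts. is_interval I) \<and>
       (\<forall>k l. \<forall>I\<in>Parts. \<forall>J\<in>Parts. \<exists>L. L-lipschitz_on (I \<times> J) (\<lambda>(\<theta>, \<phi>). \<psi> \<theta> \<phi> k l))"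
    unfolding Parts_def by (rule someI_ex) (use prof in \<open>simp add: psi_profile_def\<close>)
  then show "finite Parts" "\<Union>Parts = {0..<1}" "\<And>I. I \<in> Parts \<Longrightarrow> is_interval I"
    "\<And>k l I J. I \<in> Parts \<Longrightarrow> J \<in> Parts \<Longrightarrow> \<exists>L. L-lipschitz_on (I \<times> J) (\<lambda>(\<theta>, \<phi>). \<psi> \<theta> \<phi> k l)"
    by blast+
qed

text \<open>On \<open>Gd \<times> Gd\<close> the profile is continuous for all pairs of offsets at
  once, and only finitely many points of the unit interval are lost.\<close>

definition Gd :: "real set" where "Gd = (\<Union>I\<in>Parts. interior I)"

lemma open_Gd: "open Gd" by (auto simp: Gd_def)

lemma Gd_subset: "Gd \<subseteq> {0<..<1}"
proof -
  have "interior I \<subseteq> {0<..<1}" if "I \<in> Parts" for I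
  proof -
    have "I \<subseteq> {0..<1}" using Parts(2) that by auto
    then have "interior I \<subseteq> interior {0..<1::real}" by (rule interior_mono)
    then show ?thesis by simp
  qed
  then show ?thesis by (auto simp: Gd_def)
qed

lemma finite_bad: "finite ({0..<1} - Gd)"
proof -
  have "{0..<1} - Gd \<subseteq> (\<Union>I\<in>Parts. I - interior I)"
    using Parts(2) by (auto simp: Gd_def)
  moreover have "finite (\<Union>I\<in>Parts. I - interior I)"
  proof (intro finite_UN_I Parts(1) interval_minus_interior Parts(3))
    fix I assume "I \<in> Parts"
    then have "I \<subseteq> {0..<1}" using Parts(2) by auto
    then show "bounded I" by (rule bounded_subset[rotated]) simp
  qed
  ultimately show ?thesis by (rule finite_subset)
qed

lemma psi_cont:
  assumes "\<theta> \<in> Gd" "\<phi> \<in> Gd"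
  shows "continuous (at (\<theta>, \<phi>)) (\<lambda>(\<theta>, \<phi>). \<psi> \<theta> \<phi> k l)"
proof -
  obtain I J where IJ: "I \<in> Parts" "J \<in> Parts" "\<theta> \<in> interior I" "\<phi> \<in> interior J"
    using assms by (auto simp: Gd_def)
  obtain L where "L-lipschitz_on (I \<times> J) (\<lambda>(\<theta>, \<phi>). \<psi> \<theta> \<phi> k l)" using Parts(4)[OF IJ(1,2)] by blast
  then have "continuous_on (I \<times> J) (\<lambda>(\<theta>, \<phi>). \<psi> \<theta> \<phi> k l)" by (rule lipschitz_on_continuous_on)
  then show ?thesis
    using IJ(3,4) by (intro continuous_on_interior[of "I \<times> J"]) (auto simp: interior_Times)
qed

lemma psi_sym:
  assumes "\<theta> \<in> {0..<1}" "\<phi> \<in> {0..<1}"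
  shows "\<psi> \<theta> \<phi> k l = \<psi> \<theta> \<phi> (- k) (- l)" "\<psi> \<theta> \<phi> k l = \<psi> \<phi> \<theta> l k"
  using prof assms unfolding psi_profile_def by blast+

lemma in_range_eventually:
  assumes "(\<lambda>N. real_of_int (i N) / real N) \<longlonglongrightarrow> \<theta>" "0 < \<theta>" "\<theta> < 1"
  shows "\<forall>\<^sub>F N in sequentially. i N \<in> {1..int N}"
proof -
  have "\<forall>\<^sub>F N in sequentially. 0 < real_of_int (i N) / real N" "\<forall>\<^sub>F N in sequentially. real_of_int (i N) / real N < 1"
    using assms order_tendstoD by blast+
  then show ?thesis using eventually_gt_at_top[of 0]
  proof eventually_elim
    case (elim N)
    then have "0 < i N" "real_of_int (i N) < real N" by (auto simp: zero_less_divide_iff)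
    then show ?case by auto
  qed
qed

lemma lt_eventually:
  assumes "(\<lambda>N. real_of_int (i N) / real N) \<longlonglongrightarrow> \<theta>" "(\<lambda>N. real_of_int (j N) / real N) \<longlonglongrightarrow> \<phi>" "\<theta> < \<phi>"
  shows "\<forall>\<^sub>F N in sequentially. i N < j N"
proof -
  obtain c where c: "\<theta> < c" "c < \<phi>" using assms(3) dense by blast
  have "\<forall>\<^sub>F N in sequentially. real_of_int (i N) / real N < c" "\<forall>\<^sub>F N in sequentially. c < real_of_int (j N) / real N"
    using assms(1,2) c order_tendstoD by blast+
  then show ?thesis using eventually_gt_at_top[of 0]
  proof eventually_elim
    case (elim N)
    then have "real_of_int (i N) / real N < real_of_int (j N) / real N" by linarith
    then show ?case using elim(3) by (simp add: divide_less_cancel)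
  qed
qed

text \<open>For large \<open>N\<close> the sampling point and everything within \<open>K / N\<close>
  of it lie in a ball inside \<open>Gd \<times> Gd\<close>, hence away from all discontinuities. The
  strict order puts the pairs \<open>(i, j)\<close> and \<open>(i + k, j + l)\<close> in the upper
  triangle, where the profile estimate is stated.\<close>

lemma xz_limit_lt:
  assumes \<theta>: "\<theta> \<in> Gd" and \<phi>: "\<phi> \<in> Gd" and lt: "\<theta> < \<phi>"
    and i: "(\<lambda>N. real_of_int (i N) / real N) \<longlonglongrightarrow> \<theta>" and j: "(\<lambda>N. real_of_int (j N) / real N) \<longlonglongrightarrow> \<phi>"
  shows "(\<lambda>N. xz N (i N) (j N) (i N + k) (j N + l)) \<longlonglongrightarrow> \<psi> \<theta> \<phi> k l"
proof -
  have rng: "0 < \<theta>" "\<theta> < 1" "0 < \<phi>" "\<phi> < 1" using \<theta> \<phi> Gd_subset by auto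
  have shift: "(\<lambda>N. real_of_int (f N + m) / real N) \<longlonglongrightarrow> t" if "(\<lambda>N. real_of_int (f N) / real N) \<longlonglongrightarrow> t" for f m t
  proof -
    have "(\<lambda>N. real_of_int (f N) / real N + real_of_int m / real N) \<longlonglongrightarrow> t + 0"
      by (intro tendsto_add that lim_const_over_n)
    then show ?thesis by (simp add: add_divide_distrib)
  qed
  obtain C where C: "\<And>N i j k l. N \<ge> 1 \<Longrightarrow> 1 \<le> i \<Longrightarrow> i \<le> j \<Longrightarrow> j \<le> N \<Longrightarrow> 1 \<le> k \<Longrightarrow> k \<le> l \<Longrightarrow> l \<le> N \<Longrightarrow>
       \<not> near_disc K \<psi> N i j (int k - int i) (int l - int j) \<Longrightarrow>
       \<bar>xi P x N i j k l - \<psi> (real i / real N) (real j / real N) (int k - int i) (int l - int j)\<bar> \<le> C / real N"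
  proof -
    obtain C where C0: "\<forall>N \<ge> 1. \<forall>i j k l.
       1 \<le> i \<and> i \<le> j \<and> j \<le> N \<and> 1 \<le> k \<and> k \<le> l \<and> l \<le> N \<and>
       \<not> near_disc K \<psi> N i j (int k - int i) (int l - int j) \<longrightarrow>
       \<bar>xi P x N i j k l - \<psi> (real i / real N) (real j / real N) (int k - int i) (int l - int j)\<bar>
         \<le> C / real N"
      using prof unfolding psi_profile_def by (elim conjE exE) (rule that)
    show ?thesis by (rule that[of C]) (rule C0[rule_format], simp_all)
  qed
  have "open (Gd \<times> Gd)" using open_Gd by (intro open_Times)
  then obtain r where r: "r > 0" "ball (\<theta>, \<phi>) r \<subseteq> Gd \<times> Gd" using \<theta> \<phi> openE[of "Gd \<times> Gd" "(\<theta>, \<phi>)"] by blast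
  have tp: "(\<lambda>N. (real_of_int (i N) / real N, real_of_int (j N) / real N)) \<longlonglongrightarrow> (\<theta>, \<phi>)"
    by (intro tendsto_Pair i j)
  have ev1: "\<forall>\<^sub>F N in sequentially. dist (real_of_int (i N) / real N, real_of_int (j N) / real N) (\<theta>, \<phi>) < r / 2"
    using tp r(1) by (intro tendstoD) auto
  have ev2: "\<forall>\<^sub>F N in sequentially. real K / real N < r / 2"
    using lim_const_over_n[of "real K"] r(1) by (intro order_tendstoD) auto
  have "\<forall>\<^sub>F N in sequentially. \<bar>xz N (i N) (j N) (i N + k) (j N + l)
      - \<psi> (real_of_int (i N) / real N) (real_of_int (j N) / real N) k l\<bar> \<le> C / real N"
    using ev1 ev2 eventually_ge_at_top[of 1] in_range_eventually[OF i rng(1,2)] in_range_eventually[OF j rng(3,4)]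
      in_range_eventually[OF shift[OF i, of k] rng(1,2)] in_range_eventually[OF shift[OF j, of l] rng(3,4)]
      lt_eventually[OF i j lt] lt_eventually[OF shift[OF i, of k] shift[OF j, of l] lt]
  proof eventually_elim
    case (elim N)
    have nn: "int (nat (i N)) = i N" "int (nat (j N)) = j N" "int (nat (i N + k)) = i N + k" "int (nat (j N + l)) = j N + l"
      using elim by auto
    have rr: "real (nat (i N)) = real_of_int (i N)" "real (nat (j N)) = real_of_int (j N)"
      using elim by auto
    have "\<not> near_disc K \<psi> N (nat (i N)) (nat (j N)) k l"
    proof
      assume "near_disc K \<psi> N (nat (i N)) (nat (j N)) k l"
      then obtain p where p: "p \<in> disc_points \<psi> k l"
        "dist (real_of_int (i N) / real N, real_of_int (j N) / real N) p \<le> real K / real N"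
        unfolding near_disc_def rr by blast
      have "dist (\<theta>, \<phi>) p \<le> dist (real_of_int (i N) / real N, real_of_int (j N) / real N) (\<theta>, \<phi>)
          + dist (real_of_int (i N) / real N, real_of_int (j N) / real N) p"
        by (rule dist_triangle3)
      then have "p \<in> ball (\<theta>, \<phi>) r" unfolding mem_ball using p(2) elim(1,2) by linarith
      then have "fst p \<in> Gd" "snd p \<in> Gd" using r(2) by auto
      from psi_cont[OF this, of k l] have "continuous (at p within sq01) (\<lambda>(\<theta>, \<phi>). \<psi> \<theta> \<phi> k l)"
        by (simp add: continuous_at_imp_continuous_at_within)
      then show False using p(1) by (simp add: disc_points_def)
    qed
    then show ?case
      using C[of N "nat (i N)" "nat (j N)" "nat (i N + k)" "nat (j N + l)"] elim
      unfolding xz_def nn rr by auto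
  qed
  then have "(\<lambda>N. xz N (i N) (j N) (i N + k) (j N + l) - \<psi> (real_of_int (i N) / real N) (real_of_int (j N) / real N) k l) \<longlonglongrightarrow> 0"
    by (intro Lim_null_comparison[OF _ lim_const_over_n[of C]]) simp
  moreover have "(\<lambda>N. \<psi> (real_of_int (i N) / real N) (real_of_int (j N) / real N) k l) \<longlonglongrightarrow> \<psi> \<theta> \<phi> k l"
    using isCont_tendsto_compose[OF psi_cont[OF \<theta> \<phi>, of k l] tp] by simp
  ultimately have "(\<lambda>N. (xz N (i N) (j N) (i N + k) (j N + l) - \<psi> (real_of_int (i N) / real N) (real_of_int (j N) / real N) k l)
     + \<psi> (real_of_int (i N) / real N) (real_of_int (j N) / real N) k l) \<longlonglongrightarrow> 0 + \<psi> \<theta> \<phi> k l"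
    by (rule tendsto_add)
  then show ?thesis by simp
qed

lemma shift_over_n:
  assumes "(\<lambda>N. real_of_int (f N) / real N) \<longlonglongrightarrow> t"
  shows "(\<lambda>N. real_of_int (f N + m) / real N) \<longlonglongrightarrow> t"
proof -
  have "(\<lambda>N. real_of_int (f N) / real N + real_of_int m / real N) \<longlonglongrightarrow> t + 0"
    by (intro tendsto_add assms lim_const_over_n)
  then show ?thesis by (simp add: add_divide_distrib)
qed

lemma xz_limit:
  assumes \<theta>: "\<theta> \<in> Gd" and \<phi>: "\<phi> \<in> Gd" and ne: "\<theta> \<noteq> \<phi>"
    and i: "(\<lambda>N. real_of_int (i N) / real N) \<longlonglongrightarrow> \<theta>" and j: "(\<lambda>N. real_of_int (j N) / real N) \<longlonglongrightarrow> \<phi>"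
  shows "(\<lambda>N. xz N (i N) (j N) (i N + k) (j N + l)) \<longlonglongrightarrow> \<psi> \<theta> \<phi> k l"
proof (cases "\<theta> < \<phi>")
  case True
  then show ?thesis using xz_limit_lt assms by blast
next
  case False
  then have lt: "\<phi> < \<theta>" using ne by simp
  have rng: "0 < \<theta>" "\<theta> < 1" "0 < \<phi>" "\<phi> < 1" using \<theta> \<phi> Gd_subset by auto
  have "(\<lambda>N. xz N (j N) (i N) (j N + l) (i N + k)) \<longlonglongrightarrow> \<psi> \<phi> \<theta> l k"
    by (rule xz_limit_lt[OF \<phi> \<theta> lt j i])
  moreover have "\<psi> \<phi> \<theta> l k = \<psi> \<theta> \<phi> k l" using psi_sym(2)[of \<phi> \<theta> l k] rng by simp
  moreover have "\<forall>\<^sub>F N in sequentially. xz N (j N) (i N) (j N + l) (i N + k) = xz N (i N) (j N) (i N + k) (j N + l)"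
    using in_range_eventually[OF j rng(3,4)] in_range_eventually[OF shift_over_n[OF j, of l] rng(3,4)]
      lt_eventually[OF j i lt] lt_eventually[OF shift_over_n[OF j, of l] shift_over_n[OF i, of k] lt]
  proof eventually_elim
    case (elim N)
    then show ?case using xz_lower[of "j N" "j N + l" "i N" "i N + k" N] by simp
  qed
  ultimately show ?thesis by (auto intro: Lim_transform_eventually)
qed

lemma floor_over_n: "(\<lambda>N. real_of_int \<lfloor>\<theta> * real N\<rfloor> / real N) \<longlonglongrightarrow> \<theta>"
proof (rule tendsto_sandwich[of "\<lambda>N. \<theta> - 1 / real N" _ _ "\<lambda>N. \<theta>"])
  show "\<forall>\<^sub>F N in sequentially. \<theta> - 1 / real N \<le> real_of_int \<lfloor>\<theta> * real N\<rfloor> / real N"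
    using eventually_gt_at_top[of 0]
  proof eventually_elim
    case (elim N)
    have "(\<theta> * real N - 1) / real N \<le> real_of_int \<lfloor>\<theta> * real N\<rfloor> / real N"
      by (intro divide_right_mono) (linarith, simp)
    then show ?case using elim by (simp add: diff_divide_distrib)
  qed
  show "\<forall>\<^sub>F N in sequentially. real_of_int \<lfloor>\<theta> * real N\<rfloor> / real N \<le> \<theta>"
    using eventually_gt_at_top[of 0]
  proof eventually_elim
    case (elim N)
    then show ?case by (simp add: divide_le_eq)
  qed
  have "(\<lambda>N. \<theta> - 1 / real N) \<longlonglongrightarrow> \<theta> - 0" by (intro tendsto_diff tendsto_const lim_const_over_n)
  then show "(\<lambda>N. \<theta> - 1 / real N) \<longlonglongrightarrow> \<theta>" by simp
qed simp

text \<open>Off the diagonal \<open>\<psi>\<close> is a limit of covariances along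
  \<open>\<lfloor>\<theta> * N\<rfloor>\<close>, \<open>\<lfloor>\<phi> * N\<rfloor>\<close>, so
  both properties are inherited from \<open>xz_bound\<close> and \<open>xz_band\<close>.\<close>

lemma psi_facts:
  assumes \<theta>: "\<theta> \<in> Gd" and \<phi>: "\<phi> \<in> Gd" and ne: "\<theta> \<noteq> \<phi>"
  shows "\<bar>\<psi> \<theta> \<phi> k l\<bar> \<le> 1" "int K < \<bar>k\<bar> \<or> int K < \<bar>l\<bar> \<Longrightarrow> \<psi> \<theta> \<phi> k l = 0"
proof -
  let ?i = "\<lambda>N. \<lfloor>\<theta> * real N\<rfloor>" and ?j = "\<lambda>N. \<lfloor>\<phi> * real N\<rfloor>"
  have rng: "0 < \<theta>" "\<theta> < 1" "0 < \<phi>" "\<phi> < 1" using \<theta> \<phi> Gd_subset by auto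
  have lim: "(\<lambda>N. xz N (?i N) (?j N) (?i N + k) (?j N + l)) \<longlonglongrightarrow> \<psi> \<theta> \<phi> k l"
    by (rule xz_limit[OF assms floor_over_n floor_over_n])
  have ev: "\<forall>\<^sub>F N in sequentially. ?i N \<in> {1..int N} \<and> ?j N \<in> {1..int N} \<and> ?i N + k \<in> {1..int N} \<and> ?j N + l \<in> {1..int N}"
    by (intro eventually_conj in_range_eventually[OF _ rng(1,2)] in_range_eventually[OF _ rng(3,4)]
        floor_over_n shift_over_n)
  show "\<bar>\<psi> \<theta> \<phi> k l\<bar> \<le> 1"
  proof (rule tendsto_upperbound[OF tendsto_rabs[OF lim]])
    show "\<forall>\<^sub>F N in sequentially. \<bar>xz N (?i N) (?j N) (?i N + k) (?j N + l)\<bar> \<le> 1"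
      using ev by eventually_elim (intro xz_bound, auto)
  qed simp
  show "\<psi> \<theta> \<phi> k l = 0" if "int K < \<bar>k\<bar> \<or> int K < \<bar>l\<bar>"
  proof (rule LIMSEQ_unique[OF lim])
    have "\<forall>\<^sub>F N in sequentially. 0 = xz N (?i N) (?j N) (?i N + k) (?j N + l)"
      using ev
    proof eventually_elim
      case (elim N)
      then show ?case using xz_band[of "?i N" N "?j N" "?i N + k" "?j N + l"] that by simp
    qed
    then show "(\<lambda>N. xz N (?i N) (?j N) (?i N + k) (?j N + l)) \<longlonglongrightarrow> 0"
      by (rule Lim_transform_eventually[OF tendsto_const])
  qed
qed

text \<open>After inserting the Kraus form, the part without \<open>c0\<close> is a sum of squares
  over \<open>Q\<close>.\<close>

lemma xz_form_ge:
  assumes "\<And>a. a \<in> A \<Longrightarrow> i + a \<in> {1..int N}" "\<And>b. b \<in> A \<Longrightarrow> j + b \<in> {1..int N}" "finite A"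
  shows "c0 * (\<Sum>a\<in>A. \<Sum>b\<in>A. (v a b)\<^sup>2) \<le>
    (\<Sum>a\<in>A. \<Sum>b\<in>A. \<Sum>a'\<in>A. \<Sum>b'\<in>A. v a b * v a' b' * xz N (i + a) (j + b) (i + a') (j + b'))"
proof -
  obtain Q :: "(bool \<times> nat) set" and kr where kr: "\<And>i j k l. i \<in> {1..int N} \<Longrightarrow> j \<in> {1..int N} \<Longrightarrow> k \<in> {1..int N} \<Longrightarrow> l \<in> {1..int N} \<Longrightarrow>
     xz N i j k l = (if i = k \<and> j = l then c0 else 0) + (\<Sum>q\<in>Q. kr q i j * kr q k l)"
    using kraus_ex[of N] by blast
  let ?f = "\<lambda>q a b. v a b * kr q (i + a) (j + b)"
  have "(\<Sum>a\<in>A. \<Sum>b\<in>A. \<Sum>a'\<in>A. \<Sum>b'\<in>A. v a b * v a' b' * xz N (i + a) (j + b) (i + a') (j + b'))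
    = (\<Sum>a\<in>A. \<Sum>b\<in>A. \<Sum>a'\<in>A. \<Sum>b'\<in>A. (if b = b' then (if a = a' then c0 * (v a b)\<^sup>2 else 0) else 0) + (\<Sum>q\<in>Q. ?f q a b * ?f q a' b'))"
    using assms by (intro sum.cong refl) (auto simp: kr sum_distrib_left algebra_simps power2_eq_square)
  also have "\<dots> = (\<Sum>a\<in>A. \<Sum>b\<in>A. \<Sum>a'\<in>A. \<Sum>b'\<in>A. (if b = b' then (if a = a' then c0 * (v a b)\<^sup>2 else 0) else 0))
     + (\<Sum>a\<in>A. \<Sum>b\<in>A. \<Sum>a'\<in>A. \<Sum>b'\<in>A. \<Sum>q\<in>Q. ?f q a b * ?f q a' b')"
    by (simp only: sum.distrib)
  also have "(\<Sum>a\<in>A. \<Sum>b\<in>A. \<Sum>a'\<in>A. \<Sum>b'\<in>A. (if b = b' then (if a = a' then c0 * (v a b)\<^sup>2 else 0) else 0))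
     = c0 * (\<Sum>a\<in>A. \<Sum>b\<in>A. (v a b)\<^sup>2)"
    using assms(3) by (simp add: sum_distrib_left)
  also have "(\<Sum>a\<in>A. \<Sum>b\<in>A. \<Sum>a'\<in>A. \<Sum>b'\<in>A. \<Sum>q\<in>Q. ?f q a b * ?f q a' b')
     = (\<Sum>p\<in>A\<times>A. \<Sum>p'\<in>A\<times>A. \<Sum>q\<in>Q. ?f q (fst p) (snd p) * ?f q (fst p') (snd p'))"
  proof -
    have pair: "(\<Sum>a\<in>A. \<Sum>b\<in>A. g a b) = (\<Sum>p\<in>A\<times>A. g (fst p) (snd p))" for g :: "int \<Rightarrow> int \<Rightarrow> real"
      by (simp add: sum.cartesian_product case_prod_beta)
    show ?thesis by (simp only: pair)
  qed
  also have "\<dots> = (\<Sum>p\<in>A\<times>A. \<Sum>q\<in>Q. \<Sum>p'\<in>A\<times>A. ?f q (fst p) (snd p) * ?f q (fst p') (snd p'))"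
    by (intro sum.cong refl sum.swap)
  also have "\<dots> = (\<Sum>q\<in>Q. \<Sum>p\<in>A\<times>A. \<Sum>p'\<in>A\<times>A. ?f q (fst p) (snd p) * ?f q (fst p') (snd p'))"
    by (rule sum.swap)
  also have "\<dots> = (\<Sum>q\<in>Q. (\<Sum>p\<in>A\<times>A. ?f q (fst p) (snd p)) * (\<Sum>p\<in>A\<times>A. ?f q (fst p) (snd p)))"
    by (simp only: sum_product)
  finally show ?thesis by (simp add: sum_nonneg)
qed

lemma psi_form_ge:
  assumes \<theta>: "\<theta> \<in> Gd" and \<phi>: "\<phi> \<in> Gd" and ne: "\<theta> \<noteq> \<phi>" and A: "finite A"
  shows "c0 * (\<Sum>a\<in>A. \<Sum>b\<in>A. (v a b)\<^sup>2) \<le>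
    (\<Sum>a\<in>A. \<Sum>b\<in>A. \<Sum>a'\<in>A. \<Sum>b'\<in>A. v a b * v a' b' * \<psi> \<theta> \<phi> (a' - a) (b' - b))"
proof -
  let ?i = "\<lambda>N. \<lfloor>\<theta> * real N\<rfloor>" and ?j = "\<lambda>N. \<lfloor>\<phi> * real N\<rfloor>"
  have rng: "0 < \<theta>" "\<theta> < 1" "0 < \<phi>" "\<phi> < 1" using \<theta> \<phi> Gd_subset by auto
  have "(\<lambda>N. xz N (?i N + a) (?j N + b) (?i N + a') (?j N + b')) \<longlonglongrightarrow> \<psi> \<theta> \<phi> (a' - a) (b' - b)" for a b a' b'
    using xz_limit[OF \<theta> \<phi> ne shift_over_n[OF floor_over_n[of \<theta>], of a] shift_over_n[OF floor_over_n[of \<phi>], of b], of "a' - a" "b' - b"]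
    by simp
  then have lim: "(\<lambda>N. \<Sum>a\<in>A. \<Sum>b\<in>A. \<Sum>a'\<in>A. \<Sum>b'\<in>A. v a b * v a' b' * xz N (?i N + a) (?j N + b) (?i N + a') (?j N + b'))
     \<longlonglongrightarrow> (\<Sum>a\<in>A. \<Sum>b\<in>A. \<Sum>a'\<in>A. \<Sum>b'\<in>A. v a b * v a' b' * \<psi> \<theta> \<phi> (a' - a) (b' - b))"
    by (intro tendsto_sum tendsto_mult tendsto_const)
  have "\<forall>\<^sub>F N in sequentially. \<forall>a\<in>A. ?i N + a \<in> {1..int N}" "\<forall>\<^sub>F N in sequentially. \<forall>a\<in>A. ?j N + a \<in> {1..int N}"
    using A by (auto intro!: eventually_ball_finite in_range_eventually[OF shift_over_n[OF floor_over_n]] simp: rng simp del: atLeastAtMost_iff)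
  then have "\<forall>\<^sub>F N in sequentially. c0 * (\<Sum>a\<in>A. \<Sum>b\<in>A. (v a b)\<^sup>2) \<le>
     (\<Sum>a\<in>A. \<Sum>b\<in>A. \<Sum>a'\<in>A. \<Sum>b'\<in>A. v a b * v a' b' * xz N (?i N + a) (?j N + b) (?i N + a') (?j N + b'))"
    by eventually_elim (intro xz_form_ge A, auto)
  then show ?thesis by (intro tendsto_lowerbound[OF lim]) auto
qed

text \<open>
  At interval endpoints and on the diagonal, \<open>\<psi>\<close> is not controlled by the covariances; it is
  replaced by \<open>0\<close> on this null set.
\<close>

definition \<psi>t :: "real \<Rightarrow> real \<Rightarrow> int \<Rightarrow> int \<Rightarrow> real" where
  "\<psi>t \<theta> \<phi> k l = (if \<theta> \<in> Gd \<and> \<phi> \<in> Gd \<and> \<theta> \<noteq> \<phi> then \<psi> \<theta> \<phi> k l else 0)"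

definition Kb :: "int set" where "Kb = {- int K..int K}"

text \<open>The symbol of the profile in both offsets. The minus sign at \<open>l\<close> matches
  the convention that Fourier coefficients in \<open>t\<close> are taken against
  \<open>ee (- l)\<close>. Only the cosine appears because the sine part is odd under
  \<open>(k, l) \<mapsto> (-k, -l)\<close> and cancels, see \<open>pk_complex\<close>.\<close>

definition pk :: "real \<Rightarrow> real \<Rightarrow> real \<Rightarrow> real \<Rightarrow> real" where
  "pk \<theta> s \<phi> t = (\<Sum>k\<in>Kb. \<Sum>l\<in>Kb. \<psi>t \<theta> \<phi> k l * cos (2 * pi * (of_int k * s - of_int l * t)))"

lemma \<psi>t_bound: "\<bar>\<psi>t \<theta> \<phi> k l\<bar> \<le> 1"
  by (simp add: \<psi>t_def psi_facts)

lemma \<psi>t_neg: "\<psi>t \<theta> \<phi> (- k) (- l) = \<psi>t \<theta> \<phi> k l"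
proof (cases "\<theta> \<in> Gd \<and> \<phi> \<in> Gd \<and> \<theta> \<noteq> \<phi>")
  case True
  then have "\<theta> \<in> {0..<1}" "\<phi> \<in> {0..<1}" using Gd_subset by auto
  from psi_sym(1)[OF this, of k l] show ?thesis using True by (simp only: \<psi>t_def)
next
  case False
  then show ?thesis by (simp only: \<psi>t_def if_False)
qed

lemma card_Kb: "card Kb = 2 * K + 1" "finite Kb"
  by (simp_all add: Kb_def)

lemma pk_le: "\<bar>pk \<theta> s \<phi> t\<bar> \<le> (2 * real K + 1)\<^sup>2"
proof -
  have "\<bar>pk \<theta> s \<phi> t\<bar> \<le> (\<Sum>k\<in>Kb. \<Sum>l\<in>Kb. 1)"
    unfolding pk_def
  proof (intro order_trans[OF sum_abs] sum_mono)
    fix k l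
    show "\<bar>\<psi>t \<theta> \<phi> k l * cos (2 * pi * (of_int k * s - of_int l * t))\<bar> \<le> 1"
      unfolding abs_mult using \<psi>t_bound by (intro mult_le_one) auto
  qed
  also have "\<dots> = (2 * real K + 1)\<^sup>2" by (simp add: card_Kb power2_eq_square algebra_simps)
  finally show ?thesis .
qed

text \<open>The form of \<open>\<psi>\<close> is tested on the real and the imaginary part of a
  plane wave over an \<open>n\<close> by \<open>n\<close> box. Together they give
  \<open>c0 * n\<^sup>2\<close> on the left and a sum of the terms of \<open>pk\<close> with Fejer
  weights on the right. After division by \<open>n\<^sup>2\<close> the weights tend to 1 on the
  finite band.\<close>

lemma pk_ge:
  assumes \<theta>: "\<theta> \<in> Gd" and \<phi>: "\<phi> \<in> Gd" and ne: "\<theta> \<noteq> \<phi>"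
  shows "c0 \<le> pk \<theta> s \<phi> t"
proof -
  define f where "f k l = \<psi> \<theta> \<phi> k l * cos (2 * pi * (of_int k * s - of_int l * t))" for k l
  have f0: "f k l = 0" if "k \<notin> Kb \<or> l \<notin> Kb" for k l
    using psi_facts(2)[OF assms, of k l] that by (auto simp: f_def Kb_def)
  have f1: "\<bar>f k l\<bar> \<le> 1" for k l
    unfolding f_def abs_mult using psi_facts(1)[OF assms] by (intro mult_le_one) auto
  have pk: "pk \<theta> s \<phi> t = (\<Sum>k\<in>Kb. \<Sum>l\<in>Kb. f k l)"
    using assms by (simp add: pk_def f_def \<psi>t_def)
  define c where "c n k = real (card {a\<in>{1..int n}. a + k \<in> {1..int n}})" for n k
  have main: "c0 * (real n)\<^sup>2 \<le> (\<Sum>k\<in>Kb. \<Sum>l\<in>Kb. c n k * c n l * f k l)" for n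
  proof -
    let ?A = "{1..int n}"
    let ?u = "\<lambda>a b. 2 * pi * (of_int a * s - of_int b * t)"
    have "c0 * (\<Sum>a\<in>?A. \<Sum>b\<in>?A. (cos (?u a b))\<^sup>2) + c0 * (\<Sum>a\<in>?A. \<Sum>b\<in>?A. (sin (?u a b))\<^sup>2) \<le>
      (\<Sum>a\<in>?A. \<Sum>b\<in>?A. \<Sum>a'\<in>?A. \<Sum>b'\<in>?A. cos (?u a b) * cos (?u a' b') * \<psi> \<theta> \<phi> (a' - a) (b' - b)) +
      (\<Sum>a\<in>?A. \<Sum>b\<in>?A. \<Sum>a'\<in>?A. \<Sum>b'\<in>?A. sin (?u a b) * sin (?u a' b') * \<psi> \<theta> \<phi> (a' - a) (b' - b))"
      using psi_form_ge[OF assms, of ?A] by (intro add_mono) auto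
    also have "\<dots> = (\<Sum>a\<in>?A. \<Sum>b\<in>?A. \<Sum>a'\<in>?A. \<Sum>b'\<in>?A. f (a' - a) (b' - b))"
      unfolding sum.distrib[symmetric]
    proof (intro sum.cong refl)
      fix a b a' b'
      have "cos (?u a b) * cos (?u a' b') + sin (?u a b) * sin (?u a' b') = cos (?u a' b' - ?u a b)"
        unfolding cos_diff by (simp only: mult.commute)
      also have "?u a' b' - ?u a b = 2 * pi * (of_int (a' - a) * s - of_int (b' - b) * t)"
        by (simp add: algebra_simps)
      finally have e: "cos (?u a b) * cos (?u a' b') + sin (?u a b) * sin (?u a' b') = cos (2 * pi * (of_int (a' - a) * s - of_int (b' - b) * t))" .
      show "cos (?u a b) * cos (?u a' b') * \<psi> \<theta> \<phi> (a' - a) (b' - b) + sin (?u a b) * sin (?u a' b') * \<psi> \<theta> \<phi> (a' - a) (b' - b)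
        = f (a' - a) (b' - b)"
        unfolding f_def distrib_right[symmetric] e by (rule mult.commute)
    qed
    also have "\<dots> = (\<Sum>a\<in>?A. \<Sum>a'\<in>?A. \<Sum>b\<in>?A. \<Sum>b'\<in>?A. f (a' - a) (b' - b))"
      by (intro sum.cong refl sum.swap)
    also have "\<dots> = (\<Sum>a\<in>?A. \<Sum>a'\<in>?A. \<Sum>l\<in>Kb. c n l * f (a' - a) l)"
      unfolding c_def using f0 card_Kb(2) by (intro sum.cong refl sum_diff_band) auto
    also have "\<dots> = (\<Sum>k\<in>Kb. c n k * (\<Sum>l\<in>Kb. c n l * f k l))"
      unfolding c_def using f0 card_Kb(2)
      by (intro sum_diff_band[where h = "\<lambda>k. \<Sum>l\<in>Kb. real (card {a\<in>?A. a + l \<in> ?A}) * f k l"]) auto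
    also have "\<dots> = (\<Sum>k\<in>Kb. \<Sum>l\<in>Kb. c n k * c n l * f k l)"
      by (simp add: sum_distrib_left mult.assoc)
    also have "c0 * (\<Sum>a\<in>?A. \<Sum>b\<in>?A. (cos (?u a b))\<^sup>2) + c0 * (\<Sum>a\<in>?A. \<Sum>b\<in>?A. (sin (?u a b))\<^sup>2) = c0 * (real n)\<^sup>2"
      unfolding distrib_left[symmetric] sum.distrib[symmetric] sin_cos_squared_add2
      by (simp add: power2_eq_square)
    finally show ?thesis .
  qed
  have lim: "(\<lambda>n. c n k / real n) \<longlonglongrightarrow> 1" if "k \<in> Kb" for k
  proof (rule tendsto_sandwich[of "\<lambda>n. 1 - real K / real n" _ _ "\<lambda>_. 1"])
    have "\<bar>k\<bar> \<le> int K" using that by (auto simp: Kb_def)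
    note b = card_shift_bounds[OF this, folded c_def]
    show "\<forall>\<^sub>F n in sequentially. 1 - real K / real n \<le> c n k / real n"
      using eventually_gt_at_top[of 0]
    proof eventually_elim
      case (elim n)
      have "(real n - real K) / real n \<le> c n k / real n" using b(1)[of n] by (intro divide_right_mono) auto
      then show ?case using elim by (simp add: diff_divide_distrib)
    qed
    show "\<forall>\<^sub>F n in sequentially. c n k / real n \<le> 1"
      using eventually_gt_at_top[of 0]
    proof eventually_elim
      case (elim n)
      then show ?case using b(2)[of n] by simp
    qed
    have "(\<lambda>n. 1 - real K / real n) \<longlonglongrightarrow> 1 - 0" by (intro tendsto_diff tendsto_const lim_const_over_n)
    then show "(\<lambda>n. 1 - real K / real n) \<longlonglongrightarrow> 1" by simp
  qed simp
  have "(\<lambda>n. \<Sum>k\<in>Kb. \<Sum>l\<in>Kb. (c n k / real n) * (c n l / real n) * f k l) \<longlonglongrightarrow> (\<Sum>k\<in>Kb. \<Sum>l\<in>Kb. 1 * 1 * f k l)"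
    by (intro tendsto_sum tendsto_mult tendsto_const lim)
  moreover have "\<forall>\<^sub>F n in sequentially. c0 \<le> (\<Sum>k\<in>Kb. \<Sum>l\<in>Kb. (c n k / real n) * (c n l / real n) * f k l)"
    using eventually_gt_at_top[of 0]
  proof eventually_elim
    case (elim n)
    have "(\<Sum>k\<in>Kb. \<Sum>l\<in>Kb. (c n k / real n) * (c n l / real n) * f k l) = (\<Sum>k\<in>Kb. \<Sum>l\<in>Kb. c n k * c n l * f k l) / (real n)\<^sup>2"
      by (simp add: sum_divide_distrib power2_eq_square)
    then show ?case using main[of n] elim by (simp add: le_divide_eq)
  qed
  ultimately show ?thesis unfolding pk by (intro tendsto_lowerbound) auto
qed

lemma pk_nonneg: "0 \<le> pk \<theta> s \<phi> t"
proof (cases "\<theta> \<in> Gd \<and> \<phi> \<in> Gd \<and> \<theta> \<noteq> \<phi>")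
  case True
  then show ?thesis using pk_ge[of \<theta> \<phi> s t] c0pos by simp
next
  case False
  then show ?thesis by (auto simp: pk_def \<psi>t_def)
qed

end

section \<open>Fourier coefficients on the unit interval\<close>

definition U :: "real measure" where "U = restrict_space lborel {0..<1}"

lemma space_U [simp]: "space U = {0..<1}"
  by (simp add: U_def space_restrict_space)

lemma prob_U: "prob_space U"
  unfolding U_def by (intro prob_space_restrict_space) auto

interpretation U: prob_space U by (rule prob_U)

lemma measure_U [simp]: "measure U {0..<1} = 1"
  using U.prob_space by simp

lemma measurable_U: "f \<in> borel_measurable borel \<Longrightarrow> f \<in> borel_measurable U"
  unfolding U_def by (intro measurable_restrict_space1) auto

lemma integral_U: "integral\<^sup>L U f = (LINT x:{0..<1}|lborel. f x)"
  for f :: "real \<Rightarrow> 'b::{banach, second_countable_topology}"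
  unfolding U_def set_lebesgue_integral_def by (rule integral_restrict_space) auto

lemma AE_U_iff: "(AE x in U. Q x) \<longleftrightarrow> (AE x in lborel. x \<in> {0..<1} \<longrightarrow> Q x)"
  unfolding U_def by (subst AE_restrict_space_iff) auto

lemma AE_U_finite: "finite B \<Longrightarrow> AE x in U. x \<notin> B"
  unfolding AE_U_iff using AE_not_in[OF finite_imp_null_set_lborel[of B]] by auto

lemma integrable_U:
  fixes f :: "real \<Rightarrow> 'b::{banach, second_countable_topology}"
  assumes "f \<in> borel_measurable U" "\<And>x. x \<in> {0..<1} \<Longrightarrow> norm (f x) \<le> B"
  shows "integrable U f"
  using assms by (intro U.integrable_const_bound[where B = B] AE_I2) auto

definition ee :: "int \<Rightarrow> real \<Rightarrow> complex" where
  "ee k s = cis (2 * pi * (of_int k * s))"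

lemma norm_ee [simp]: "cmod (ee k s) = 1"
  by (simp add: ee_def)

lemma ee_mult: "ee k s * ee l s = ee (k + l) s"
  by (simp add: ee_def cis_mult algebra_simps)

lemma ee_0 [simp]: "ee 0 s = 1"
  by (simp add: ee_def)

lemma cnj_ee: "cnj (ee k s) = ee (- k) s"
  by (simp add: ee_def cis_cnj)

lemma ee_frac: "ee k (frac s) = ee k s"
proof -
  have "2 * pi * (of_int k * s) = 2 * pi * (of_int k * frac s) + 2 * pi * of_int (k * \<lfloor>s\<rfloor>)"
    by (simp add: frac_def algebra_simps)
  then have "ee k s = ee k (frac s) * cis (2 * pi * of_int (k * \<lfloor>s\<rfloor>))"
    unfolding ee_def by (simp only: cis_mult)
  then show ?thesis by (simp only: cis_multiple_2pi[OF Ints_of_int] mult_1_right)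
qed

lemma ee_exp: "exp (2 * pi * \<i> * of_int k * of_real s) = ee k s"
  by (simp add: ee_def cis_conv_exp algebra_simps)

lemma continuous_ee [continuous_intros]: "continuous_on A (ee k)"
  unfolding ee_def by (intro continuous_intros)

lemma ee_deriv: "(ee k has_vector_derivative (2 * pi * \<i> * of_int k) * ee k s) (at s within A)"
proof -
  have "((\<lambda>s. exp ((2 * pi * \<i> * of_int k) * of_real s)) has_vector_derivative
      (2 * pi * \<i> * of_int k) * exp ((2 * pi * \<i> * of_int k) * of_real s)) (at s within A)"
    by (auto intro!: derivative_eq_intros has_vector_derivative_real_field simp: field_simps)
  then show ?thesis unfolding ee_exp .
qed

definition cf :: "(real \<Rightarrow> complex) \<Rightarrow> int \<Rightarrow> complex" where
  "cf f k = (\<integral>t. f t * ee (- k) t \<partial>U)"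

lemma cf_bound:
  assumes "f \<in> borel_measurable U" "\<And>t. t \<in> {0..<1} \<Longrightarrow> cmod (f t) \<le> B"
  shows "cmod (cf f k) \<le> B"
proof -
  have [measurable]: "f \<in> borel_measurable U" by fact
  have [measurable]: "ee (-k) \<in> borel_measurable U"
    by (intro measurable_U borel_measurable_continuous_onI continuous_ee)
  have "cmod (cf f k) \<le> (\<integral>t. cmod (f t * ee (- k) t) \<partial>U)"
    unfolding cf_def by (rule integral_norm_bound)
  also have "\<dots> \<le> (\<integral>t. B \<partial>U)"
  proof (intro integral_mono)
    show "integrable U (\<lambda>t. cmod (f t * ee (- k) t))"
      using assms by (intro integrable_U[where B = B]) (auto simp: norm_mult)
    show "cmod (f t * ee (- k) t) \<le> B" if "t \<in> space U" for t
      using assms(2)[of t] that by (simp add: norm_mult)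
  qed simp
  also have "\<dots> = B" by simp
  finally show ?thesis .
qed

lemma integral_U_FTC:
  fixes F f :: "real \<Rightarrow> complex"
  assumes "\<And>s. (F has_vector_derivative f s) (at s)" "continuous_on UNIV f"
  shows "integral\<^sup>L U f = F 1 - F 0"
proof -
  have [measurable]: "f \<in> borel_measurable borel" using assms(2) by (rule borel_measurable_continuous_onI)
  have "integral\<^sup>L U f = (\<integral>x. indicator {0..<1} x *\<^sub>R f x \<partial>lborel)"
    unfolding integral_U set_lebesgue_integral_def ..
  also have "\<dots> = (\<integral>x. indicator {0..1} x *\<^sub>R f x \<partial>lborel)"
  proof (rule integral_cong_AE)
    show "AE x in lborel. indicator {0..<1} x *\<^sub>R f x = indicator {0..1} x *\<^sub>R f x"
      using AE_lborel_singleton[of "1::real"] by eventually_elim (auto simp: indicator_def)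
  qed auto
  also have "\<dots> = F 1 - F 0"
    by (rule integral_FTC_Icc)
      (use assms in \<open>auto intro: has_vector_derivative_at_within continuous_on_subset\<close>)
  finally show ?thesis .
qed

text \<open>Integration by parts; the boundary terms cancel because both \<open>f\<close> and
  \<open>ee (- k)\<close> take equal values at 0 and 1.\<close>

lemma cf_deriv:
  assumes d: "\<And>s. (f has_vector_derivative f' s) (at s)" and c: "continuous_on UNIV f'" and per: "f 1 = f 0"
  shows "cf f' k = 2 * pi * \<i> * of_int k * cf f k"
proof -
  have cf: "continuous_on UNIV f"
    by (intro continuous_at_imp_continuous_on ballI has_vector_derivative_continuous[OF d])
  let ?F = "\<lambda>s. f s * ee (- k) s"
  let ?f = "\<lambda>s. f s * ((2 * pi * \<i> * of_int (- k)) * ee (- k) s) + f' s * ee (- k) s"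
  have "(?F has_vector_derivative ?f s) (at s)" for s
    by (rule has_vector_derivative_mult[OF d ee_deriv])
  moreover have "continuous_on UNIV ?f" by (intro continuous_intros c cf)
  ultimately have "integral\<^sup>L U ?f = ?F 1 - ?F 0" by (rule integral_U_FTC)
  moreover have "ee (- k) 1 = ee (- k) 0" using ee_frac[of "- k" 1] by (simp add: frac_def)
  ultimately have 0: "integral\<^sup>L U ?f = 0" unfolding per by simp
  have i: "integrable U (\<lambda>s. h s * ee (- k) s)" if h: "continuous_on UNIV h" for h :: "real \<Rightarrow> complex"
  proof -
    have "compact ((\<lambda>s. h s * ee (- k) s) ` {0..1})"
      using h by (intro compact_continuous_image continuous_intros) (auto intro: continuous_on_subset)
    then obtain B where B: "\<forall>w\<in>(\<lambda>s. h s * ee (- k) s) ` {0..1}. norm w \<le> B"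
      using compact_imp_bounded bounded_iff by blast
    show ?thesis
    proof (rule integrable_U[where B = B])
      show "(\<lambda>s. h s * ee (- k) s) \<in> borel_measurable U"
        by (intro measurable_U borel_measurable_continuous_onI continuous_intros h)
      show "norm (h s * ee (- k) s) \<le> B" if "s \<in> {0..<1}" for s
        using that by (intro B[rule_format] imageI) simp
    qed
  qed
  have "integral\<^sup>L U ?f = (\<integral>s. (2 * pi * \<i> * of_int (- k)) * (f s * ee (- k) s) + f' s * ee (- k) s \<partial>U)"
    by (rule Bochner_Integration.integral_cong[OF refl]) (simp only: mult.left_commute)
  also have "\<dots> = (2 * pi * \<i> * of_int (- k)) * cf f k + cf f' k"
    unfolding cf_def Bochner_Integration.integral_add[OF integrable_mult_right[OF i[OF cf]] i[OF c]]
      integral_mult_right_zero ..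
  finally have "(2 * pi * \<i> * of_int (- k)) * cf f k + cf f' k = 0" unfolding 0 by (rule sym)
  then show ?thesis by (simp add: add_eq_0_iff)
qed

lemma integral_ee: "(\<integral>t. ee k t \<partial>U) = (if k = 0 then 1 else 0)"
proof (cases "k = 0")
  case True
  then show ?thesis by simp
next
  case False
  have "cf (\<lambda>_. 0) (- k) = 2 * pi * \<i> * of_int (- k) * cf (\<lambda>_. 1) (- k)"
    by (rule cf_deriv) (auto intro: derivative_eq_intros)
  then have "cf (\<lambda>_. 1) (- k) = 0" using False by (simp add: cf_def)
  then show ?thesis using False by (simp add: cf_def)
qed

text \<open>Bessel's inequality, from the mean square of \<open>f\<close> minus its projection
  \<open>h\<close> onto the frequencies in \<open>F\<close>. Its constant is the supremum of the
  symbol alone, so that it can be made independent of \<open>Im z\<close>, in contrast to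
  summability obtained from smoothness.\<close>

lemma cf_bessel:
  assumes m: "f \<in> borel_measurable U" and b: "\<And>t. t \<in> {0..<1} \<Longrightarrow> cmod (f t) \<le> B" and F: "finite F"
  shows "(\<Sum>k\<in>F. (cmod (cf f k))\<^sup>2) \<le> B\<^sup>2"
proof -
  note [measurable] = m
  have em [measurable]: "ee k \<in> borel_measurable U" for k
    by (intro measurable_U borel_measurable_continuous_onI continuous_ee)
  define h where "h t = (\<Sum>k\<in>F. cf f k * ee k t)" for t
  have hm [measurable]: "h \<in> borel_measurable U" unfolding h_def by measurable
  have hc [measurable]: "(\<lambda>t. cnj (h t)) \<in> borel_measurable U"
    by (rule measurable_compose[OF hm borel_measurable_continuous_onI]) (intro continuous_intros)
  define H where "H = (\<Sum>k\<in>F. cmod (cf f k))"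
  have hb: "cmod (h t) \<le> H" for t
    unfolding h_def H_def by (intro order_trans[OF norm_sum]) (simp add: norm_mult)
  have B0: "B \<ge> 0" using b[of 0] norm_ge_zero[of "f 0"] by (simp del: norm_ge_zero)
  have if1: "integrable U (\<lambda>t. f t * ee k t)" for k
    by (rule integrable_U[where B = B]) (use b in \<open>auto simp: norm_mult\<close>)
  have fh: "(\<integral>t. f t * cnj (h t) \<partial>U) = of_real (\<Sum>k\<in>F. (cmod (cf f k))\<^sup>2)"
  proof -
    have "(\<integral>t. f t * cnj (h t) \<partial>U) = (\<integral>t. (\<Sum>k\<in>F. cnj (cf f k) * (f t * ee (- k) t)) \<partial>U)"
      by (simp add: h_def sum_distrib_left cnj_ee algebra_simps)
    also have "\<dots> = (\<Sum>k\<in>F. cnj (cf f k) * cf f k)"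
      using if1 by (subst Bochner_Integration.integral_sum) (auto simp: cf_def)
    also have "\<dots> = of_real (\<Sum>k\<in>F. (cmod (cf f k))\<^sup>2)"
      unfolding of_real_sum by (intro sum.cong refl) (metis complex_norm_square mult.commute)
    finally show ?thesis .
  qed
  have hh: "(\<integral>t. h t * cnj (h t) \<partial>U) = of_real (\<Sum>k\<in>F. (cmod (cf f k))\<^sup>2)"
  proof -
    have "(\<integral>t. h t * cnj (h t) \<partial>U) = (\<integral>t. (\<Sum>k\<in>F. \<Sum>l\<in>F. cf f k * cnj (cf f l) * ee (k - l) t) \<partial>U)"
    proof (intro arg_cong2[where f = "integral\<^sup>L"] refl ext)
      fix t
      have "h t * cnj (h t) = (\<Sum>k\<in>F. \<Sum>l\<in>F. (cf f k * ee k t) * (cnj (cf f l) * ee (- l) t))"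
        by (simp add: h_def sum_product cnj_ee)
      also have "\<dots> = (\<Sum>k\<in>F. \<Sum>l\<in>F. cf f k * cnj (cf f l) * ee (k - l) t)"
        using ee_mult[of _ t "- _"] by (intro sum.cong refl) (simp add: algebra_simps)
      finally show "h t * cnj (h t) = (\<Sum>k\<in>F. \<Sum>l\<in>F. cf f k * cnj (cf f l) * ee (k - l) t)" .
    qed
    also have "\<dots> = (\<Sum>k\<in>F. \<Sum>l\<in>F. cf f k * cnj (cf f l) * (if k = l then 1 else 0))"
    proof -
      have ie: "integrable U (\<lambda>t. c * ee k t)" for c k
        by (rule integrable_U[where B = "cmod c"]) (auto simp: norm_mult)
      have "(\<integral>t. (\<Sum>k\<in>F. \<Sum>l\<in>F. cf f k * cnj (cf f l) * ee (k - l) t) \<partial>U)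
          = (\<Sum>k\<in>F. \<integral>t. (\<Sum>l\<in>F. cf f k * cnj (cf f l) * ee (k - l) t) \<partial>U)"
        by (intro Bochner_Integration.integral_sum Bochner_Integration.integrable_sum ie)
      also have "\<dots> = (\<Sum>k\<in>F. \<Sum>l\<in>F. \<integral>t. cf f k * cnj (cf f l) * ee (k - l) t \<partial>U)"
        by (intro sum.cong refl Bochner_Integration.integral_sum ie)
      finally show ?thesis by (simp add: integral_ee)
    qed
    also have "\<dots> = (\<Sum>k\<in>F. cf f k * cnj (cf f k))"
      using F by (simp add: if_distrib[of "\<lambda>x. _ * x"] cong: if_cong)
    also have "\<dots> = of_real (\<Sum>k\<in>F. (cmod (cf f k))\<^sup>2)"
      unfolding of_real_sum by (intro sum.cong refl) (metis complex_norm_square)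
    finally show ?thesis .
  qed
  define s where "s = (\<Sum>k\<in>F. (cmod (cf f k))\<^sup>2)"
  have i1: "integrable U (\<lambda>t. f t * cnj (h t))"
    by (rule integrable_U[where B = "B * H"]) (simp_all add: norm_mult mult_mono[OF b hb] B0)
  have i2: "integrable U (\<lambda>t. h t * cnj (h t))"
    by (rule integrable_U[where B = "H * H"]) (simp_all add: norm_mult mult_mono[OF hb hb] order_trans[OF norm_ge_zero hb])
  have i3: "integrable U (\<lambda>t. (cmod (f t))\<^sup>2)"
    by (rule integrable_U[where B = "B\<^sup>2"]) (use b in \<open>auto intro!: power_mono\<close>)
  have "0 \<le> (\<integral>t. (cmod (f t - h t))\<^sup>2 \<partial>U)" by simp
  also have "\<dots> = (\<integral>t. (cmod (f t))\<^sup>2 - 2 * Re (f t * cnj (h t)) + Re (h t * cnj (h t)) \<partial>U)"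
  proof (intro arg_cong2[where f = "integral\<^sup>L"] refl ext)
    fix t
    show "(cmod (f t - h t))\<^sup>2 = (cmod (f t))\<^sup>2 - 2 * Re (f t * cnj (h t)) + Re (h t * cnj (h t))"
      unfolding cmod_power2 by (simp add: power2_eq_square algebra_simps)
  qed
  also have "\<dots> = (\<integral>t. (cmod (f t))\<^sup>2 \<partial>U) - 2 * (\<integral>t. Re (f t * cnj (h t)) \<partial>U) + (\<integral>t. Re (h t * cnj (h t)) \<partial>U)"
  proof -
    have "integral\<^sup>L U (\<lambda>t. a t - 2 * b t + c t) = integral\<^sup>L U a - 2 * integral\<^sup>L U b + integral\<^sup>L U c"
      if "integrable U a" "integrable U b" "integrable U c" for a b c :: "real \<Rightarrow> real"
      using that by simp
    from this[OF i3 integrable_Re[OF i1] integrable_Re[OF i2]] show ?thesis .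
  qed
  also have "(\<integral>t. Re (f t * cnj (h t)) \<partial>U) = s" using integral_Re[OF i1] fh by (simp add: s_def)
  also have "(\<integral>t. Re (h t * cnj (h t)) \<partial>U) = s" using integral_Re[OF i2] hh by (simp add: s_def)
  finally have "s \<le> (\<integral>t. (cmod (f t))\<^sup>2 \<partial>U)" by simp
  also have "\<dots> \<le> (\<integral>t. B\<^sup>2 \<partial>U)"
    using b i3 by (intro integral_mono) (auto intro!: power_mono)
  also have "\<dots> = B\<^sup>2" by simp
  finally show ?thesis by (simp add: s_def)
qed

text \<open>Young's inequality for a summable and a square summable sequence: Cauchy-Schwarz with
  weights \<open>cmod (f k)\<close> for finite partial sums, followed by the limit along finite
  subsets.\<close>

lemma conv_bounded_l1:
  fixes f :: "int \<Rightarrow> complex"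
  assumes f: "\<And>A. finite A \<Longrightarrow> (\<Sum>k\<in>A. cmod (f k)) \<le> C"
  shows "conv_bounded f C"
  unfolding conv_bounded_def
proof (intro allI impI)
  fix g assume g: "l2seq g"
  have C0: "C \<ge> 0" using f[of "{}"] by simp
  define G where "G = (\<Sum>\<^sub>\<infinity>n. (cmod (g n))\<^sup>2)"
  have gs: "(\<lambda>n. (cmod (g n))\<^sup>2) summable_on UNIV" using g by (simp add: l2seq_def)
  have G0: "G \<ge> 0" unfolding G_def by (rule infsum_nonneg) simp
  have gF: "(\<Sum>n\<in>F. (cmod (g n))\<^sup>2) \<le> G" if "finite F" for F
    unfolding G_def using gs that by (intro finite_sum_le_infsum) auto
  have gb: "cmod (g n) \<le> sqrt G" for n
    using gF[of "{n}"] by (intro real_le_rsqrt) simp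
  have conv: "((\<lambda>k. f k * g (n - k)) has_sum conv f g n) UNIV" for n
  proof -
    have "(\<lambda>k. norm (f k * g (n - k))) summable_on UNIV"
    proof (rule nonneg_bdd_above_summable_on)
      show "bdd_above (sum (\<lambda>k. norm (f k * g (n - k))) ` {F. F \<subseteq> UNIV \<and> finite F})"
      proof (rule bdd_aboveI2)
        fix F assume "F \<in> {F::int set. F \<subseteq> UNIV \<and> finite F}"
        then have "finite F" by simp
        have "(\<Sum>k\<in>F. norm (f k * g (n - k))) \<le> (\<Sum>k\<in>F. cmod (f k) * sqrt G)"
          using gb by (intro sum_mono) (simp add: norm_mult mult_left_mono)
        also have "\<dots> \<le> C * sqrt G"
          unfolding sum_distrib_right[symmetric] using f[OF \<open>finite F\<close>] G0 by (intro mult_right_mono) auto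
        finally show "(\<Sum>k\<in>F. norm (f k * g (n - k))) \<le> C * sqrt G" .
      qed
    qed simp
    then have "(\<lambda>k. f k * g (n - k)) summable_on UNIV" by (rule abs_summable_summable)
    then show ?thesis unfolding conv_def by (rule has_sum_infsum)
  qed
  have fin: "(\<Sum>n\<in>F. (cmod (conv f g n))\<^sup>2) \<le> C\<^sup>2 * G" if F: "finite F" for F
  proof -
    have *: "(\<Sum>n\<in>F. (cmod (\<Sum>k\<in>A. f k * g (n - k)))\<^sup>2) \<le> C\<^sup>2 * G" if A: "finite A" for A
    proof -
      have 1: "(cmod (\<Sum>k\<in>A. f k * g (n - k)))\<^sup>2 \<le> C * (\<Sum>k\<in>A. cmod (f k) * (cmod (g (n - k)))\<^sup>2)" for n
      proof -
        have "cmod (\<Sum>k\<in>A. f k * g (n - k)) \<le> (\<Sum>k\<in>A. sqrt (cmod (f k)) * (sqrt (cmod (f k)) * cmod (g (n - k))))"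
          by (intro order_trans[OF norm_sum]) (simp add: norm_mult mult.assoc[symmetric])
        then have "(cmod (\<Sum>k\<in>A. f k * g (n - k)))\<^sup>2 \<le> (\<Sum>k\<in>A. sqrt (cmod (f k)) * (sqrt (cmod (f k)) * cmod (g (n - k))))\<^sup>2"
          by (intro power_mono) auto
        also have "\<dots> \<le> (\<Sum>k\<in>A. (sqrt (cmod (f k)))\<^sup>2) * (\<Sum>k\<in>A. (sqrt (cmod (f k)) * cmod (g (n - k)))\<^sup>2)"
          by (rule Cauchy_Schwarz_ineq_sum)
        also have "\<dots> = (\<Sum>k\<in>A. cmod (f k)) * (\<Sum>k\<in>A. cmod (f k) * (cmod (g (n - k)))\<^sup>2)"
          by (simp add: power_mult_distrib)
        also have "\<dots> \<le> C * (\<Sum>k\<in>A. cmod (f k) * (cmod (g (n - k)))\<^sup>2)"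
          using f[OF A] by (intro mult_right_mono sum_nonneg) auto
        finally show ?thesis .
      qed
      have "(\<Sum>n\<in>F. (cmod (\<Sum>k\<in>A. f k * g (n - k)))\<^sup>2) \<le> (\<Sum>n\<in>F. C * (\<Sum>k\<in>A. cmod (f k) * (cmod (g (n - k)))\<^sup>2))"
        by (intro sum_mono 1)
      also have "\<dots> = C * (\<Sum>k\<in>A. cmod (f k) * (\<Sum>n\<in>F. (cmod (g (n - k)))\<^sup>2))"
        unfolding sum_distrib_left[symmetric] by (subst sum.swap) (simp add: sum_distrib_left)
      also have "\<dots> \<le> C * (\<Sum>k\<in>A. cmod (f k) * G)"
      proof (intro mult_left_mono sum_mono C0)
        fix k
        have "(\<Sum>n\<in>F. (cmod (g (n - k)))\<^sup>2) = (\<Sum>n\<in>(\<lambda>n. n - k) ` F. (cmod (g n))\<^sup>2)"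
          by (subst sum.reindex) (auto simp: inj_on_def)
        also have "\<dots> \<le> G" using F by (intro gF) auto
        finally show "(\<Sum>n\<in>F. (cmod (g (n - k)))\<^sup>2) \<le> G" .
      qed auto
      also have "\<dots> \<le> C * (C * G)"
        unfolding sum_distrib_right[symmetric] using f[OF A] C0 G0 by (intro mult_left_mono mult_right_mono) auto
      finally show ?thesis by (simp add: power2_eq_square)
    qed
    have "((\<lambda>A. \<Sum>n\<in>F. (cmod (\<Sum>k\<in>A. f k * g (n - k)))\<^sup>2) \<longlongrightarrow> (\<Sum>n\<in>F. (cmod (conv f g n))\<^sup>2)) (finite_subsets_at_top UNIV)"
      using conv unfolding has_sum_def by (intro tendsto_sum tendsto_power tendsto_norm)
    then show ?thesis
      by (rule tendsto_upperbound) (auto intro!: eventually_finite_subsets_at_top_weakI *)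
  qed
  have s: "(\<lambda>n. (cmod (conv f g n))\<^sup>2) summable_on UNIV"
    by (rule nonneg_bdd_above_summable_on) (auto intro!: bdd_aboveI2 fin)
  show "l2seq (conv f g) \<and> l2norm (conv f g) \<le> C * l2norm g"
  proof
    show "l2seq (conv f g)" using s by (simp add: l2seq_def)
    have "(\<Sum>\<^sub>\<infinity>n. (cmod (conv f g n))\<^sup>2) \<le> C\<^sup>2 * G"
      using s by (intro infsum_le_finite_sums fin) auto
    then have "l2norm (conv f g) \<le> sqrt (C\<^sup>2 * G)" unfolding l2norm_def by (rule real_sqrt_le_mono)
    also have "\<dots> = C * l2norm g" using C0 by (simp add: l2norm_def G_def real_sqrt_mult)
    finally show "l2norm (conv f g) \<le> C * l2norm g" .
  qed
qed

lemma sum_inverse_squares_int: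
  assumes "finite (A :: int set)"
  shows "(\<Sum>k\<in>A. 1 / (1 + (real_of_int k)\<^sup>2)) \<le> 6"
proof -
  \<comment> \<open>Telescoping: \<open>1 / (1 + n\<^sup>2)\<close> is at most
    \<open>3 / ((n + 1) * (n + 2))\<close>, because \<open>3 * (1 + n\<^sup>2)\<close> exceeds the
    product by \<open>(2 * n - 1) * (n - 1)\<close>. Two half-lines that both contain 0 then give
    the bound 6.\<close>
  have nat: "(\<Sum>j<n. 1 / (1 + (real j)\<^sup>2)) \<le> 3 * (1 - 1 / (real n + 1))" for n
  proof (induction n)
    case (Suc n)
    have "1 / (1 + (real n)\<^sup>2) \<le> 3 / ((real n + 1) * (real n + 2))"
    proof -
      have "(2 * real n - 1) * (real n - 1) \<ge> 0"
      proof (cases n)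
        case (Suc k)
        then show ?thesis by (intro mult_nonneg_nonneg) auto
      qed simp
      then have "(real n + 1) * (real n + 2) \<le> 3 * (1 + (real n)\<^sup>2)" by (simp add: power2_eq_square algebra_simps)
      then show ?thesis by (simp add: divide_simps add_nonneg_pos add_pos_nonneg)
    qed
    also have "\<dots> = 3 * (1 / (real n + 1) - 1 / (real n + 2))" by (simp add: field_simps)
    finally show ?case using Suc by (simp add: algebra_simps)
  qed simp
  obtain n :: nat where n: "\<And>k. k \<in> A \<Longrightarrow> \<bar>k\<bar> < int n"
  proof -
    define n where "n = (\<Sum>k\<in>A. nat \<bar>k\<bar>) + 1"
    have "\<bar>k\<bar> < int n" if "k \<in> A" for k
    proof -
      have "nat \<bar>k\<bar> \<le> (\<Sum>k\<in>A. nat \<bar>k\<bar>)"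
        using that assms by (intro member_le_sum) auto
      then have "nat \<bar>k\<bar> < n" by (simp add: n_def)
      then show ?thesis by linarith
    qed
    then show ?thesis using that by blast
  qed
  have "A \<subseteq> int ` {..<n} \<union> (\<lambda>j. - int j) ` {..<n}"
  proof
    fix k assume "k \<in> A"
    then have "\<bar>k\<bar> < int n" by (rule n)
    then show "k \<in> int ` {..<n} \<union> (\<lambda>j. - int j) ` {..<n}"
      by (cases "k \<ge> 0") (auto intro!: image_eqI[of _ _ "nat \<bar>k\<bar>"])
  qed
  then have "(\<Sum>k\<in>A. 1 / (1 + (real_of_int k)\<^sup>2)) \<le> (\<Sum>k\<in>int ` {..<n} \<union> (\<lambda>j. - int j) ` {..<n}. 1 / (1 + (real_of_int k)\<^sup>2))"
    by (intro sum_mono2) auto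
  also have "\<dots> \<le> (\<Sum>k\<in>int ` {..<n}. 1 / (1 + (real_of_int k)\<^sup>2)) + (\<Sum>k\<in>(\<lambda>j. - int j) ` {..<n}. 1 / (1 + (real_of_int k)\<^sup>2))"
    by (subst sum.union_inter[symmetric]) (auto intro!: sum_nonneg)
  also have "\<dots> = (\<Sum>j<n. 1 / (1 + (real j)\<^sup>2)) + (\<Sum>j<n. 1 / (1 + (real j)\<^sup>2))"
    by (subst (1 2) sum.reindex) (auto simp: inj_on_def)
  also have "\<dots> \<le> 6"
  proof -
    have "3 * (1 - 1 / (real n + 1)) \<le> 3" by simp
    then show ?thesis using nat[of n] by linarith
  qed
  finally show ?thesis .
qed

section \<open>The kernel on the unit square\<close>

interpretation UU: pair_prob_space U U ..

lemma UU_prob: "prob_space (U \<Otimes>\<^sub>M U)"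
  by (rule UU.P.prob_space_axioms)

lemma space_UU: "space (U \<Otimes>\<^sub>M U) = {0..<1} \<times> {0..<1}"
  by (simp add: space_pair_measure)

lemma integrable_UU:
  fixes f :: "real \<times> real \<Rightarrow> 'b::{banach, second_countable_topology}"
  assumes "f \<in> borel_measurable (U \<Otimes>\<^sub>M U)" "\<And>p. p \<in> space (U \<Otimes>\<^sub>M U) \<Longrightarrow> norm (f p) \<le> B"
  shows "integrable (U \<Otimes>\<^sub>M U) f"
  using assms by (intro UU.P.integrable_const_bound[where B = B] AE_I2)

lemma fst_UU: "(\<lambda>p. fst p) \<in> borel_measurable (U \<Otimes>\<^sub>M U)" and snd_UU: "(\<lambda>p. snd p) \<in> borel_measurable (U \<Otimes>\<^sub>M U)"
  by (rule measurable_compose[OF measurable_fst measurable_U], simp)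
    (rule measurable_compose[OF measurable_snd measurable_U], simp)

context profile
begin

lemma AE_Gd: "AE \<theta> in U. \<theta> \<in> Gd"
proof -
  have "AE \<theta> in U. \<theta> \<notin> {0..<1} - Gd" by (rule AE_U_finite[OF finite_bad])
  then show ?thesis by (rule AE_mp) (auto intro!: AE_I2)
qed

lemma \<psi>t_meas: "(\<lambda>p. \<psi>t (fst p) (snd p) k l) \<in> borel_measurable borel"
proof -
  let ?O = "{p. fst p \<in> Gd \<and> snd p \<in> Gd \<and> fst p \<noteq> snd p}"
  have "?O = (Gd \<times> Gd) \<inter> {p. fst p \<noteq> snd p}" by auto
  moreover have "open ((Gd \<times> Gd) \<inter> {p::real\<times>real. fst p \<noteq> snd p})"
    by (intro open_Int open_Times open_Gd open_Collect_neq continuous_intros)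
  ultimately have O: "open ?O" by simp
  have "isCont (\<lambda>p. \<psi> (fst p) (snd p) k l) p" if "p \<in> ?O" for p
    using psi_cont[of "fst p" "snd p" k l] that unfolding case_prod_beta' by simp
  then have "continuous_on ?O (\<lambda>p. \<psi> (fst p) (snd p) k l)"
    by (intro continuous_at_imp_continuous_on ballI)
  from borel_measurable_continuous_on_indicator[OF borel_open[OF O] this]
  have "(\<lambda>p. indicator ?O p *\<^sub>R \<psi> (fst p) (snd p) k l) \<in> borel_measurable borel" .
  moreover have "(\<lambda>p. indicator ?O p *\<^sub>R \<psi> (fst p) (snd p) k l) = (\<lambda>p. \<psi>t (fst p) (snd p) k l)"
    by (intro ext) (simp add: \<psi>t_def indicator_def)
  ultimately show ?thesis by simp
qed

lemma \<psi>t_meas2: "f \<in> borel_measurable M \<Longrightarrow> g \<in> borel_measurable M \<Longrightarrow> (\<lambda>w. \<psi>t (f w) (g w) k l) \<in> borel_measurable M"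
  using measurable_compose[OF borel_measurable_Pair \<psi>t_meas, of f M g k l] by simp

lemma pk_meas: "(\<lambda>(v, w). pk (fst v) (snd v) (fst w) (snd w)) \<in> borel_measurable ((U \<Otimes>\<^sub>M U) \<Otimes>\<^sub>M (U \<Otimes>\<^sub>M U))"
proof -
  let ?M = "(U \<Otimes>\<^sub>M U) \<Otimes>\<^sub>M (U \<Otimes>\<^sub>M U)"
  have [measurable]: "(\<lambda>w. fst (fst w)) \<in> borel_measurable ?M" "(\<lambda>w. snd (fst w)) \<in> borel_measurable ?M"
    "(\<lambda>w. fst (snd w)) \<in> borel_measurable ?M" "(\<lambda>w. snd (snd w)) \<in> borel_measurable ?M"
    by (rule measurable_compose[OF measurable_fst fst_UU] measurable_compose[OF measurable_fst snd_UU]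
      measurable_compose[OF measurable_snd fst_UU] measurable_compose[OF measurable_snd snd_UU])+
  have [measurable]: "(\<lambda>w. \<psi>t (fst (fst w)) (fst (snd w)) k l) \<in> borel_measurable ?M" for k l
    by (rule \<psi>t_meas2) measurable
  show ?thesis unfolding pk_def case_prod_beta by measurable
qed

lemma pk_complex:
  "complex_of_real (pk \<theta> s \<phi> t) = (\<Sum>k\<in>Kb. \<Sum>l\<in>Kb. of_real (\<psi>t \<theta> \<phi> k l) * (ee k s * ee (- l) t))"
proof -
  define sn where "sn k l = \<psi>t \<theta> \<phi> k l * sin (2 * pi * (of_int k * s - of_int l * t))" for k l
  have e: "ee k s * ee (- l) t = cis (2 * pi * (of_int k * s - of_int l * t))" for k l
    by (simp add: ee_def cis_mult algebra_simps)
  have neg: "sn (- k) (- l) = - sn k l" for k l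
  proof -
    have "2 * pi * (of_int (- k) * s - of_int (- l) * t) = - (2 * pi * (of_int k * s - of_int l * t))"
      by (simp add: algebra_simps)
    then show ?thesis unfolding sn_def \<psi>t_neg by (simp only: sin_minus mult_minus_right)
  qed
  have flip: "(\<Sum>k\<in>Kb. f (- k)) = (\<Sum>k\<in>Kb. f k)" for f :: "int \<Rightarrow> real"
    by (rule sum.reindex_bij_witness[of _ uminus uminus]) (auto simp: Kb_def)
  have "(\<Sum>k\<in>Kb. \<Sum>l\<in>Kb. sn k l) = (\<Sum>k\<in>Kb. \<Sum>l\<in>Kb. sn (- k) l)"
    by (rule flip[of "\<lambda>k. \<Sum>l\<in>Kb. sn k l", symmetric])
  also have "\<dots> = (\<Sum>k\<in>Kb. \<Sum>l\<in>Kb. sn (- k) (- l))"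
    by (intro sum.cong refl flip[symmetric])
  also have "\<dots> = - (\<Sum>k\<in>Kb. \<Sum>l\<in>Kb. sn k l)" unfolding neg by (simp only: sum_negf)
  finally have z: "(\<Sum>k\<in>Kb. \<Sum>l\<in>Kb. sn k l) = 0" by simp
  show ?thesis
    by (rule complex_eqI) (simp_all add: e pk_def z[unfolded sn_def])
qed

end

section \<open>The limiting equation\<close>

locale limit_problem = profile K P x c0 \<psi>
  for K :: nat and P :: "nat \<Rightarrow> 'a measure" and x :: "nat \<Rightarrow> nat \<Rightarrow> nat \<Rightarrow> 'a \<Rightarrow> real" and c0 :: real
    and \<psi> :: "real \<Rightarrow> real \<Rightarrow> int \<Rightarrow> int \<Rightarrow> real" +
  fixes z :: complex
  assumes eta: "Im z > 0"
begin

text \<open>A function of position and frequency. Under the Fourier transform convolution inverses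
  become pointwise reciprocals, which is why the equation for sequences turns into a scalar one at
  each point.\<close>

definition g0 :: "real \<times> real \<Rightarrow> complex" where
  "g0 = (SOME g. g \<in> borel_measurable (U \<Otimes>\<^sub>M U) \<and> (\<exists>\<delta>>0. \<forall>v\<in>space (U \<Otimes>\<^sub>M U). \<delta> \<le> Im (g v)) \<and>
     (\<forall>v\<in>space (U \<Otimes>\<^sub>M U). cmod (g v) \<le> 1 / Im z \<and>
        g v * (- z - (\<integral>w. of_real (pk (fst v) (snd v) (fst w) (snd w)) * g w \<partial>(U \<Otimes>\<^sub>M U))) = 1))"

lemma g0_all: "g0 \<in> borel_measurable (U \<Otimes>\<^sub>M U) \<and> (\<exists>\<delta>>0. \<forall>v\<in>space (U \<Otimes>\<^sub>M U). \<delta> \<le> Im (g0 v)) \<and>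
     (\<forall>v\<in>space (U \<Otimes>\<^sub>M U). cmod (g0 v) \<le> 1 / Im z \<and>
        g0 v * (- z - (\<integral>w. of_real (pk (fst v) (snd v) (fst w) (snd w)) * g0 w \<partial>(U \<Otimes>\<^sub>M U))) = 1)"
proof -
  have "qve (U \<Otimes>\<^sub>M U) (\<lambda>v w. pk (fst v) (snd v) (fst w) (snd w)) ((2 * real K + 1)\<^sup>2) z"
    using pk_le by (intro qve.intro qve_axioms.intro UU_prob pk_meas pk_nonneg eta) (auto intro: abs_le_D1)
  from qve.qve_exists[OF this] show ?thesis unfolding g0_def by (rule someI_ex)
qed

lemma g0_meas [measurable]: "g0 \<in> borel_measurable (U \<Otimes>\<^sub>M U)"
  using g0_all by blast

lemma g0_bound: "\<theta> \<in> {0..<1} \<Longrightarrow> t \<in> {0..<1} \<Longrightarrow> cmod (g0 (\<theta>, t)) \<le> 1 / Im z"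
  using g0_all by (auto simp: space_UU)

lemma g0_Im: "\<exists>\<delta>>0. \<forall>\<theta>\<in>{0..<1}. \<forall>t\<in>{0..<1}. \<delta> \<le> Im (g0 (\<theta>, t))"
  using g0_all by (auto simp: space_UU)

lemma g0_sec [measurable]: "\<theta> \<in> {0..<1} \<Longrightarrow> (\<lambda>t. g0 (\<theta>, t)) \<in> borel_measurable U"
  using measurable_Pair2[OF g0_meas, of \<theta>] by simp

definition m :: "real \<Rightarrow> int \<Rightarrow> complex" where
  "m \<theta> k = cf (\<lambda>t. g0 (\<theta>, t)) k"

lemma ee_meas [measurable]: "ee k \<in> borel_measurable U"
  by (intro measurable_U borel_measurable_continuous_onI continuous_ee)

lemma ee_snd_meas [measurable]: "(\<lambda>w. ee k (snd w)) \<in> borel_measurable (U \<Otimes>\<^sub>M U)"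
  by (rule measurable_compose[OF measurable_snd ee_meas])

lemma m_meas [measurable]: "(\<lambda>\<theta>. m \<theta> k) \<in> borel_measurable U"
proof -
  have "(\<lambda>\<theta>. \<integral>t. g0 (\<theta>, t) * ee (- k) t \<partial>U) \<in> borel_measurable U"
  proof (rule U.borel_measurable_lebesgue_integral)
    have "(\<lambda>w. g0 w * ee (- k) (snd w)) \<in> borel_measurable (U \<Otimes>\<^sub>M U)" by measurable
    then show "(\<lambda>(\<theta>, t). g0 (\<theta>, t) * ee (- k) t) \<in> borel_measurable (U \<Otimes>\<^sub>M U)"
      by (simp add: case_prod_beta)
  qed
  then show ?thesis by (simp add: m_def cf_def)
qed

lemma m_bound: "\<theta> \<in> {0..<1} \<Longrightarrow> cmod (m \<theta> k) \<le> 1 / Im z"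
  unfolding m_def using g0_bound by (intro cf_bound g0_sec)

text \<open>\<Psi>(m) with \<open>\<psi>t\<close> in place of \<open>\<psi>\<close> and the sum
  restricted to the band; by \<open>Psi_eq\<close> it agrees with \<open>Psi \<psi> m\<close> at all
  points of \<open>Gd\<close>.\<close>

definition u :: "real \<Rightarrow> int \<Rightarrow> complex" where
  "u \<theta> k = (\<Sum>l\<in>Kb. \<integral>\<phi>. of_real (\<psi>t \<theta> \<phi> k l) * m \<phi> l \<partial>U)"

text \<open>Symbol of \<open>- z - \<Psi>(m)\<close>. It is a trigonometric polynomial of degree at
  most \<open>K\<close>, so its reciprocal \<open>g0\<close> is smooth in the frequency.\<close>

definition aa :: "real \<Rightarrow> real \<Rightarrow> complex" where
  "aa \<theta> s = - z - (\<Sum>k\<in>Kb. u \<theta> k * ee k s)"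

lemma id_U [measurable]: "(\<lambda>x. x) \<in> borel_measurable U"
  by (rule measurable_U) simp

lemma \<psi>t_sec [measurable]: "(\<lambda>\<phi>. \<psi>t \<theta> \<phi> k l) \<in> borel_measurable U"
  by (rule \<psi>t_meas2) simp_all

lemma \<psi>m_integrable: "integrable U (\<lambda>\<phi>. of_real (\<psi>t \<theta> \<phi> k l) * m \<phi> l)"
proof (rule integrable_U[where B = "1 * (1 / Im z)"])
  show "(\<lambda>\<phi>. of_real (\<psi>t \<theta> \<phi> k l) * m \<phi> l) \<in> borel_measurable U" by measurable
  show "norm (complex_of_real (\<psi>t \<theta> \<phi> k l) * m \<phi> l) \<le> 1 * (1 / Im z)" if "\<phi> \<in> {0..<1}" for \<phi>
    unfolding norm_mult norm_of_real using \<psi>t_bound m_bound[OF that] by (intro mult_mono) auto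
qed

lemma u_bound: "cmod (u \<theta> k) \<le> (2 * real K + 1) / Im z"
proof -
  have "cmod (u \<theta> k) \<le> (\<Sum>l\<in>Kb. 1 / Im z)"
    unfolding u_def
  proof (intro order_trans[OF norm_sum] sum_mono)
    fix l
    have "cmod (\<integral>\<phi>. of_real (\<psi>t \<theta> \<phi> k l) * m \<phi> l \<partial>U) \<le> (\<integral>\<phi>. cmod (of_real (\<psi>t \<theta> \<phi> k l) * m \<phi> l) \<partial>U)"
      by (rule integral_norm_bound)
    also have "\<dots> \<le> (\<integral>\<phi>. 1 * (1 / Im z) \<partial>U)"
    proof (rule integral_mono)
      show "integrable U (\<lambda>\<phi>. cmod (of_real (\<psi>t \<theta> \<phi> k l) * m \<phi> l))" by (rule integrable_norm[OF \<psi>m_integrable])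
      show "cmod (complex_of_real (\<psi>t \<theta> \<phi> k l) * m \<phi> l) \<le> 1 * (1 / Im z)" if "\<phi> \<in> space U" for \<phi>
        unfolding norm_mult norm_of_real using \<psi>t_bound m_bound[of \<phi>] that by (intro mult_mono) auto
    qed simp
    finally show "cmod (\<integral>\<phi>. of_real (\<psi>t \<theta> \<phi> k l) * m \<phi> l \<partial>U) \<le> 1 / Im z" by simp
  qed
  also have "\<dots> = (2 * real K + 1) / Im z" by (simp add: card_Kb add_divide_distrib)
  finally show ?thesis .
qed

lemma u_zero: "k \<notin> Kb \<Longrightarrow> u \<theta> k = 0"
proof -
  assume "k \<notin> Kb"
  then have "\<psi>t \<theta> \<phi> k l = 0" for \<phi> l
    using psi_facts(2)[of \<theta> \<phi> k l] by (auto simp: \<psi>t_def Kb_def)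
  then show ?thesis by (simp add: u_def)
qed

lemma T_eq:
  "(\<integral>w. of_real (pk \<theta> s (fst w) (snd w)) * g0 w \<partial>(U \<Otimes>\<^sub>M U)) = (\<Sum>k\<in>Kb. u \<theta> k * ee k s)"
proof -
  let ?h = "\<lambda>k l w. complex_of_real (\<psi>t \<theta> (fst w) k l) * (g0 w * ee (- l) (snd w))"
  have pm [measurable]: "(\<lambda>w. \<psi>t \<theta> (fst w) k l) \<in> borel_measurable (U \<Otimes>\<^sub>M U)" for k l
    by (rule \<psi>t_meas2[OF _ fst_UU]) simp
  have hi: "integrable (U \<Otimes>\<^sub>M U) (?h k l)" for k l
  proof (rule integrable_UU[where B = "1 * (1 / Im z)"])
    show "?h k l \<in> borel_measurable (U \<Otimes>\<^sub>M U)" by measurable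
    fix p assume "p \<in> space (U \<Otimes>\<^sub>M U)"
    then have "cmod (g0 p) \<le> 1 / Im z" using g0_all by blast
    then show "norm (?h k l p) \<le> 1 * (1 / Im z)"
      unfolding norm_mult norm_of_real norm_ee using \<psi>t_bound by (intro mult_mono) auto
  qed
  have hI: "integral\<^sup>L (U \<Otimes>\<^sub>M U) (?h k l) = (\<integral>\<phi>. of_real (\<psi>t \<theta> \<phi> k l) * m \<phi> l \<partial>U)" for k l
  proof -
    have "integral\<^sup>L (U \<Otimes>\<^sub>M U) (?h k l) = (\<integral>\<phi>. (\<integral>t. ?h k l (\<phi>, t) \<partial>U) \<partial>U)"
      by (rule UU.integral_fst'[OF hi, symmetric])
    also have "\<dots> = (\<integral>\<phi>. of_real (\<psi>t \<theta> \<phi> k l) * m \<phi> l \<partial>U)"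
      unfolding m_def cf_def fst_conv snd_conv integral_mult_right_zero ..
    finally show ?thesis .
  qed
  have "(\<integral>w. of_real (pk \<theta> s (fst w) (snd w)) * g0 w \<partial>(U \<Otimes>\<^sub>M U)) =
      (\<integral>w. (\<Sum>k\<in>Kb. \<Sum>l\<in>Kb. ee k s * ?h k l w) \<partial>(U \<Otimes>\<^sub>M U))"
    unfolding pk_complex sum_distrib_right
    by (intro Bochner_Integration.integral_cong refl sum.cong) (simp only: mult_ac)
  also have "\<dots> = (\<Sum>k\<in>Kb. \<integral>w. (\<Sum>l\<in>Kb. ee k s * ?h k l w) \<partial>(U \<Otimes>\<^sub>M U))"
    by (intro Bochner_Integration.integral_sum Bochner_Integration.integrable_sum integrable_mult_right hi)
  also have "\<dots> = (\<Sum>k\<in>Kb. \<Sum>l\<in>Kb. \<integral>w. ee k s * ?h k l w \<partial>(U \<Otimes>\<^sub>M U))"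
    by (intro sum.cong refl Bochner_Integration.integral_sum integrable_mult_right hi)
  also have "\<dots> = (\<Sum>k\<in>Kb. \<Sum>l\<in>Kb. ee k s * (\<integral>\<phi>. of_real (\<psi>t \<theta> \<phi> k l) * m \<phi> l \<partial>U))"
    unfolding integral_mult_right_zero hI ..
  also have "\<dots> = (\<Sum>k\<in>Kb. u \<theta> k * ee k s)"
    unfolding u_def sum_distrib_left[symmetric] by (intro sum.cong refl) (rule mult.commute)
  finally show ?thesis .
qed

lemma g0_aa: "\<theta> \<in> {0..<1} \<Longrightarrow> t \<in> {0..<1} \<Longrightarrow> g0 (\<theta>, t) * aa \<theta> t = 1"
proof -
  assume "\<theta> \<in> {0..<1}" "t \<in> {0..<1}"
  then have "(\<theta>, t) \<in> space (U \<Otimes>\<^sub>M U)" by (simp add: space_UU)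
  with g0_all have "g0 (\<theta>, t) * (- z - (\<integral>w. of_real (pk (fst (\<theta>, t)) (snd (\<theta>, t)) (fst w) (snd w)) * g0 w \<partial>(U \<Otimes>\<^sub>M U))) = 1"
    by blast
  then show ?thesis unfolding fst_conv snd_conv T_eq aa_def .
qed

lemma aa_frac: "aa \<theta> (frac s) = aa \<theta> s"
  by (simp add: aa_def ee_frac)

lemma aa_nz: "\<theta> \<in> {0..<1} \<Longrightarrow> aa \<theta> s \<noteq> 0"
  using g0_aa[of \<theta> "frac s"] by (auto simp: aa_frac frac_lt_1)

lemma inv_aa: "\<theta> \<in> {0..<1} \<Longrightarrow> t \<in> {0..<1} \<Longrightarrow> 1 / aa \<theta> t = g0 (\<theta>, t)"
  using g0_aa[of \<theta> t] aa_nz[of \<theta> t] by (simp add: field_simps)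

lemma inv_aa_bound: "\<theta> \<in> {0..<1} \<Longrightarrow> cmod (1 / aa \<theta> s) \<le> 1 / Im z"
  using inv_aa[of \<theta> "frac s"] g0_bound[of \<theta> "frac s"] by (simp add: aa_frac frac_lt_1)

lemma m_cf: "\<theta> \<in> {0..<1} \<Longrightarrow> m \<theta> k = cf (\<lambda>t. 1 / aa \<theta> t) k"
  unfolding m_def cf_def by (intro Bochner_Integration.integral_cong refl) (simp add: inv_aa)

text \<open>\<open>B1\<close> and \<open>B2\<close> bound the first and second derivative of
  \<open>aa\<close> in the frequency. \<open>Bd\<close> adds the supremum of \<open>1 / aa\<close>
  to a bound for its second derivative. These constants depend on \<open>Im z\<close>; they serve to
  place \<open>m\<close> in \<open>Tplus\<close> and to verify its equation.\<close>

definition B1 :: real where "B1 = (2 * real K + 1) * ((2 * real K + 1) / Im z * (2 * pi * real K))"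
definition B2 :: real where "B2 = (2 * real K + 1) * ((2 * real K + 1) / Im z * (2 * pi * real K)\<^sup>2)"
definition Bd :: real where "Bd = 1 / Im z + (B2 * (1 / Im z)\<^sup>2 + 2 * B1\<^sup>2 * (1 / Im z)^3)"

text \<open>Integrating by parts twice turns the coefficients of the second derivative of
  \<open>1 / aa\<close> into \<open>(2 * pi * \<i> * k)\<^sup>2 * m \<theta> k\<close>. Summable
  decay is needed because \<open>check\<close> and \<open>conv\<close> are defined through series of
  coefficients and not through the symbol.\<close>

lemma m_decay:
  assumes \<theta>: "\<theta> \<in> {0..<1}"
  shows "cmod (m \<theta> k) \<le> Bd * (1 / (1 + (real_of_int k)\<^sup>2))"
proof -
  define w where "w k = 2 * pi * \<i> * of_int k" for k :: int
  \<comment> \<open>Extended to complex arguments so that the quotient rule for field derivatives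
    applies; on the real line it is \<open>aa \<theta>\<close>.\<close>
  define A where "A y = - z - (\<Sum>k\<in>Kb. u \<theta> k * exp (w k * y))" for y
  define A1 where "A1 y = - (\<Sum>k\<in>Kb. u \<theta> k * (w k * exp (w k * y)))" for y
  define A2 where "A2 y = - (\<Sum>k\<in>Kb. u \<theta> k * ((w k)\<^sup>2 * exp (w k * y)))" for y
  have ew: "exp (w k * of_real s) = ee k s" for k s unfolding w_def by (rule ee_exp)
  have A: "A (of_real s) = aa \<theta> s" for s by (simp add: A_def aa_def ew)
  have Anz: "A (of_real s) \<noteq> 0" for s unfolding A by (rule aa_nz[OF \<theta>])
  have dA: "(A has_field_derivative A1 y) (at y)" for y
    unfolding A_def A1_def
    by (auto intro!: derivative_eq_intros simp: sum_negf[symmetric] mult_ac)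
  have dA1: "(A1 has_field_derivative A2 y) (at y)" for y
    unfolding A1_def A2_def
    by (auto intro!: derivative_eq_intros simp: power2_eq_square mult_ac)
  let ?f = "\<lambda>y. 1 / A y" and ?f1 = "\<lambda>y. - A1 y / (A y)\<^sup>2"
    and ?f2 = "\<lambda>y. - A2 y / (A y)\<^sup>2 + 2 * (A1 y)\<^sup>2 / (A y)^3"
  have d1: "((\<lambda>s. ?f (of_real s)) has_vector_derivative ?f1 (of_real s)) (at s)" for s :: real
  proof (rule has_vector_derivative_real_field)
    show "(?f has_field_derivative ?f1 (of_real s)) (at (of_real s))"
      using Anz[of s] by (auto intro!: derivative_eq_intros dA simp: power2_eq_square field_simps)
  qed
  have d2: "((\<lambda>s. ?f1 (of_real s)) has_vector_derivative ?f2 (of_real s)) (at s)" for s :: real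
  proof (rule has_vector_derivative_real_field)
    show "(?f1 has_field_derivative ?f2 (of_real s)) (at (of_real s))"
      using Anz[of s] by (auto intro!: derivative_eq_intros dA dA1 simp: power2_eq_square power3_eq_cube field_simps)
  qed
  have cA: "continuous_on UNIV (\<lambda>s::real. A (of_real s))" "continuous_on UNIV (\<lambda>s::real. A1 (of_real s))" "continuous_on UNIV (\<lambda>s::real. A2 (of_real s))"
    unfolding A_def A1_def A2_def by (intro continuous_intros)+
  have c1: "continuous_on UNIV (\<lambda>s::real. ?f1 (of_real s))"
    using Anz by (intro continuous_intros cA) auto
  have c2: "continuous_on UNIV (\<lambda>s::real. ?f2 (of_real s))"
    using Anz by (intro continuous_intros cA) auto
  have per: "ee k 1 = ee k 0" for k using ee_frac[of k 1] by (simp add: frac_def)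
  have e1: "cf (\<lambda>s. ?f1 (of_real s)) k = w k * cf (\<lambda>s. ?f (of_real s)) k"
    unfolding w_def by (rule cf_deriv[OF d1 c1]) (simp only: A aa_def per)
  have "A1 (of_real 1) = A1 (of_real 0)" unfolding A1_def ew per ..
  moreover have "A (of_real 1) = A (of_real 0)" unfolding A aa_def per ..
  ultimately have e2: "cf (\<lambda>s. ?f2 (of_real s)) k = w k * cf (\<lambda>s. ?f1 (of_real s)) k"
    unfolding w_def by (intro cf_deriv[OF d2 c2]) (simp only:)
  have wk: "cmod (w k) \<le> 2 * pi * real K" if "k \<in> Kb" for k
    using that by (auto simp: w_def norm_mult Kb_def)
  have bA1: "cmod (A1 (of_real s)) \<le> B1" for s
  proof -
    have "cmod (A1 (of_real s)) \<le> (\<Sum>k\<in>Kb. (2 * real K + 1) / Im z * (2 * pi * real K))"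
      unfolding A1_def norm_minus_cancel ew
    proof (intro order_trans[OF norm_sum] sum_mono)
      fix k assume "k \<in> Kb"
      then show "norm (u \<theta> k * (w k * ee k s)) \<le> (2 * real K + 1) / Im z * (2 * pi * real K)"
        unfolding norm_mult norm_ee mult_1_right using u_bound wk eta by (intro mult_mono) auto
    qed
    then show ?thesis by (simp add: card_Kb B1_def add.commute)
  qed
  have bA2: "cmod (A2 (of_real s)) \<le> B2" for s
  proof -
    have "cmod (A2 (of_real s)) \<le> (\<Sum>k\<in>Kb. (2 * real K + 1) / Im z * (2 * pi * real K)\<^sup>2)"
      unfolding A2_def norm_minus_cancel ew
    proof (intro order_trans[OF norm_sum] sum_mono)
      fix k assume "k \<in> Kb"
      then show "norm (u \<theta> k * ((w k)\<^sup>2 * ee k s)) \<le> (2 * real K + 1) / Im z * (2 * pi * real K)\<^sup>2"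
        unfolding norm_mult norm_ee mult_1_right norm_power using u_bound wk eta by (intro mult_mono power_mono) auto
    qed
    then show ?thesis by (simp add: card_Kb B2_def add.commute)
  qed
  have bA: "cmod (inverse (A (of_real s))) \<le> 1 / Im z" for s
    using inv_aa_bound[OF \<theta>, of s] by (simp add: A inverse_eq_divide)
  have bf2: "cmod (?f2 (of_real s)) \<le> B2 * (1 / Im z)\<^sup>2 + 2 * B1\<^sup>2 * (1 / Im z)^3" for s
  proof -
    have "?f2 (of_real s) = - A2 (of_real s) * (inverse (A (of_real s)))\<^sup>2 + 2 * (A1 (of_real s))\<^sup>2 * (inverse (A (of_real s)))^3"
      by (simp add: divide_inverse power_inverse)
    also have "cmod \<dots> \<le> cmod (A2 (of_real s)) * (cmod (inverse (A (of_real s))))\<^sup>2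
        + 2 * (cmod (A1 (of_real s)))\<^sup>2 * (cmod (inverse (A (of_real s))))^3"
      by (rule order_trans[OF norm_triangle_ineq]) (simp add: norm_mult norm_power)
    also have "\<dots> \<le> B2 * (1 / Im z)\<^sup>2 + 2 * B1\<^sup>2 * (1 / Im z)^3"
      using bA1[of s] bA2[of s] bA[of s] order_trans[OF norm_ge_zero bA2[of s]]
      by (intro add_mono mult_mono power_mono) auto
    finally show ?thesis .
  qed
  have "(\<lambda>s::real. ?f2 (of_real s)) \<in> borel_measurable U"
    by (intro measurable_U borel_measurable_continuous_onI c2)
  then have b2: "cmod (cf (\<lambda>s. ?f2 (of_real s)) k) \<le> B2 * (1 / Im z)\<^sup>2 + 2 * B1\<^sup>2 * (1 / Im z)^3"
    using bf2 by (rule cf_bound)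
  have mm: "m \<theta> k = cf (\<lambda>s. ?f (of_real s)) k" unfolding m_cf[OF \<theta>] A ..
  have "cf (\<lambda>s. ?f2 (of_real s)) k = (w k)\<^sup>2 * m \<theta> k"
    unfolding e2 e1 mm by (simp add: power2_eq_square)
  then have "(cmod (w k))\<^sup>2 * cmod (m \<theta> k) \<le> B2 * (1 / Im z)\<^sup>2 + 2 * B1\<^sup>2 * (1 / Im z)^3"
    using b2 by (simp add: norm_mult norm_power)
  moreover have "(real_of_int k)\<^sup>2 * cmod (m \<theta> k) \<le> (cmod (w k))\<^sup>2 * cmod (m \<theta> k)"
  proof (intro mult_right_mono)
    have "\<bar>real_of_int k\<bar> * 1 \<le> \<bar>real_of_int k\<bar> * (2 * pi)"
      using pi_gt3 by (intro mult_left_mono) auto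
    then have "\<bar>real_of_int k\<bar> \<le> cmod (w k)" by (simp add: w_def norm_mult mult_ac)
    then show "(real_of_int k)\<^sup>2 \<le> (cmod (w k))\<^sup>2" by (metis abs_ge_zero power_mono power2_abs)
  qed auto
  ultimately have "(1 + (real_of_int k)\<^sup>2) * cmod (m \<theta> k) \<le> Bd"
    using m_bound[OF \<theta>, of k] by (simp add: Bd_def algebra_simps)
  moreover have "1 + (real_of_int k)\<^sup>2 > 0" by (simp add: add_pos_nonneg)
  ultimately show ?thesis by (simp add: le_divide_eq mult.commute)
qed

lemma Bd_nonneg: "Bd \<ge> 0"
  using order_trans[OF norm_ge_zero m_decay[of 0 0]] by simp

lemma m_l1: "\<theta> \<in> {0..<1} \<Longrightarrow> finite A \<Longrightarrow> (\<Sum>k\<in>A. cmod (m \<theta> k)) \<le> Bd * 6"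
proof -
  assume \<theta>: "\<theta> \<in> {0..<1}" and A: "finite A"
  have "(\<Sum>k\<in>A. cmod (m \<theta> k)) \<le> Bd * (\<Sum>k\<in>A. 1 / (1 + (real_of_int k)\<^sup>2))"
    unfolding sum_distrib_left by (intro sum_mono m_decay \<theta>)
  also have "\<dots> \<le> Bd * 6" by (intro mult_left_mono sum_inverse_squares_int A Bd_nonneg)
  finally show ?thesis .
qed

definition av :: "real \<Rightarrow> int \<Rightarrow> complex" where
  "av \<theta> k = - z * delta0 k - u \<theta> k"

lemma zero_Kb: "0 \<in> Kb" by (simp add: Kb_def)

lemma av_sum: "(\<Sum>k\<in>Kb. av \<theta> k * ee k s) = aa \<theta> s"
proof -
  have "(\<Sum>k\<in>Kb. z * delta0 k * ee k s) = (\<Sum>k\<in>Kb. if k = 0 then z else 0)"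
    by (intro sum.cong refl) (simp add: delta0_def)
  also have "\<dots> = z" using zero_Kb card_Kb(2) by simp
  finally have "(\<Sum>k\<in>Kb. z * delta0 k * ee k s) = z" .
  then show ?thesis by (simp add: av_def aa_def left_diff_distrib sum_subtractf sum_negf)
qed

text \<open>Fourier coefficient number \<open>n\<close> of the identity \<open>aa * g0 = 1\<close>.
  The sequence \<open>av\<close> has finite support, so the convolution is a finite sum and commutes
  with the integral.\<close>

lemma conv_finite:
  assumes \<theta>: "\<theta> \<in> {0..<1}"
  shows "(\<Sum>k\<in>Kb. av \<theta> k * m \<theta> (n - k)) = delta0 n"
proof -
  have i: "integrable U (\<lambda>t. g0 (\<theta>, t) * ee k t)" for k
  proof (rule integrable_U[where B = "1 / Im z"])
    show "(\<lambda>t. g0 (\<theta>, t) * ee k t) \<in> borel_measurable U" using g0_sec[OF \<theta>] by measurable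
    show "norm (g0 (\<theta>, t) * ee k t) \<le> 1 / Im z" if "t \<in> {0..<1}" for t
      using g0_bound[OF \<theta> that] by (simp add: norm_mult)
  qed
  have "(\<Sum>k\<in>Kb. av \<theta> k * m \<theta> (n - k)) = (\<Sum>k\<in>Kb. \<integral>t. av \<theta> k * (g0 (\<theta>, t) * ee (- (n - k)) t) \<partial>U)"
    by (simp add: m_def cf_def)
  also have "\<dots> = (\<integral>t. (\<Sum>k\<in>Kb. av \<theta> k * (g0 (\<theta>, t) * ee (- (n - k)) t)) \<partial>U)"
    by (intro Bochner_Integration.integral_sum[symmetric] integrable_mult_right i)
  also have "\<dots> = (\<integral>t. ee (- n) t \<partial>U)"
  proof (intro Bochner_Integration.integral_cong refl)
    fix t assume t: "t \<in> space U"
    have "(\<Sum>k\<in>Kb. av \<theta> k * (g0 (\<theta>, t) * ee (- (n - k)) t)) = (\<Sum>k\<in>Kb. av \<theta> k * ee k t) * (g0 (\<theta>, t) * ee (- n) t)"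
      unfolding sum_distrib_right
    proof (intro sum.cong refl)
      fix k
      have "ee (- (n - k)) t = ee k t * ee (- n) t" by (simp add: ee_mult)
      then show "av \<theta> k * (g0 (\<theta>, t) * ee (- (n - k)) t) = av \<theta> k * ee k t * (g0 (\<theta>, t) * ee (- n) t)"
        by (simp only: mult_ac)
    qed
    also have "\<dots> = ee (- n) t" unfolding av_sum using g0_aa[OF \<theta>, of t] t
      by (simp add: mult.assoc[symmetric] mult.commute[of "aa \<theta> t"])
    finally show "(\<Sum>k\<in>Kb. av \<theta> k * (g0 (\<theta>, t) * ee (- (n - k)) t)) = ee (- n) t" .
  qed
  also have "\<dots> = delta0 n" by (simp add: integral_ee delta0_def)
  finally show ?thesis .
qed

end

lemma int_interval_filterlim:
  "filterlim (\<lambda>n::nat. {- int n..int n}) (finite_subsets_at_top UNIV) sequentially"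
  unfolding filterlim_finite_subsets_at_top
proof (intro allI impI)
  fix X :: "int set" assume X: "finite X \<and> X \<subseteq> UNIV"
  define N where "N = (\<Sum>k\<in>X. nat \<bar>k\<bar>)"
  have "X \<subseteq> {- int n..int n}" if n: "n \<ge> N" for n
  proof
    fix k assume k: "k \<in> X"
    have "nat \<bar>k\<bar> \<le> N" unfolding N_def using k X by (intro member_le_sum) auto
    then have "\<bar>k\<bar> \<le> int n" using n by linarith
    then show "k \<in> {- int n..int n}" unfolding atLeastAtMost_iff by linarith
  qed
  then show "\<forall>\<^sub>F n in sequentially. finite {- int n..int n} \<and> X \<subseteq> {- int n..int n} \<and> {- int n..int n} \<subseteq> UNIV"
    unfolding eventually_sequentially by blast
qed

context limit_problem
begin

lemma m_conv_bounded: "\<theta> \<in> {0..<1} \<Longrightarrow> conv_bounded (m \<theta>) (Bd * 6)"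
  by (rule conv_bounded_l1) (rule m_l1)

text \<open>Fourier inversion by algebra: the series converges absolutely to some \<open>G\<close>,
  multiplication by the trigonometric polynomial \<open>aa\<close> together with
  \<open>conv_finite\<close> gives \<open>aa * G = 1\<close>, and this identifies \<open>G\<close>
  with \<open>g0\<close>.\<close>

lemma check_eq:
  assumes \<theta>: "\<theta> \<in> {0..<1}" and s: "s \<in> {0..<1}"
  shows "check m \<theta> s = g0 (\<theta>, s)"
proof -
  define f where "f k = m \<theta> k * ee k s" for k
  have "(\<lambda>k. norm (f k)) summable_on UNIV"
  proof (rule nonneg_bdd_above_summable_on)
    show "bdd_above (sum (\<lambda>k. norm (f k)) ` {F. F \<subseteq> UNIV \<and> finite F})"
    proof (rule bdd_aboveI2)
      fix F assume "F \<in> {F::int set. F \<subseteq> UNIV \<and> finite F}"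
      then show "(\<Sum>k\<in>F. norm (f k)) \<le> Bd * 6" using m_l1[OF \<theta>, of F] by (simp add: f_def norm_mult)
    qed
  qed simp
  then have "f summable_on UNIV" by (rule abs_summable_summable)
  then obtain G where G: "(f has_sum G) UNIV" by (auto simp: summable_on_def)
  have sh: "((\<lambda>n. f (n - k)) has_sum G) UNIV" for k
  proof -
    have "bij_betw (\<lambda>n::int. n - k) UNIV UNIV"
      by (rule bij_betw_byWitness[of _ "\<lambda>n. n + k"]) auto
    from has_sum_reindex_bij_betw[OF this, of f G] G show ?thesis by simp
  qed
  have tm: "(\<Sum>k\<in>Kb. (av \<theta> k * ee k s) * f (n - k)) = ee n s * delta0 n" for n
  proof -
    have "(\<Sum>k\<in>Kb. (av \<theta> k * ee k s) * f (n - k)) = (\<Sum>k\<in>Kb. ee n s * (av \<theta> k * m \<theta> (n - k)))"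
    proof (intro sum.cong refl)
      fix k
      have "ee n s = ee k s * ee (n - k) s" by (simp add: ee_mult)
      then show "(av \<theta> k * ee k s) * f (n - k) = ee n s * (av \<theta> k * m \<theta> (n - k))"
        unfolding f_def by (simp only: mult_ac)
    qed
    also have "\<dots> = ee n s * delta0 n" unfolding sum_distrib_left[symmetric] conv_finite[OF \<theta>] ..
    finally show ?thesis .
  qed
  have "((\<lambda>A. \<Sum>k\<in>Kb. \<Sum>n\<in>A. (av \<theta> k * ee k s) * f (n - k)) \<longlongrightarrow> (\<Sum>k\<in>Kb. (av \<theta> k * ee k s) * G)) (finite_subsets_at_top UNIV)"
    using has_sum_cmult_right[OF sh] unfolding has_sum_def by (intro tendsto_sum)
  moreover have "(\<Sum>k\<in>Kb. \<Sum>n\<in>A. (av \<theta> k * ee k s) * f (n - k)) = (\<Sum>n\<in>A. ee n s * delta0 n)" for A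
    unfolding tm[symmetric] by (rule sum.swap)
  moreover have "(\<Sum>k\<in>Kb. (av \<theta> k * ee k s) * G) = aa \<theta> s * G"
    unfolding sum_distrib_right[symmetric] av_sum ..
  ultimately have h1: "((\<lambda>n. ee n s * delta0 n) has_sum aa \<theta> s * G) UNIV"
    unfolding has_sum_def by simp
  have "((\<lambda>n. ee n s * delta0 n) has_sum 1) {0}"
    by (rule has_sum_finiteI) (simp_all add: delta0_def)
  then have "((\<lambda>n. ee n s * delta0 n) has_sum 1) UNIV"
    by (subst has_sum_cong_neutral[of "{0}" _ _ "\<lambda>n. ee n s * delta0 n"]) (auto simp: delta0_def)
  then have "aa \<theta> s * G = 1" using has_sum_unique[OF h1] by simp
  then have "aa \<theta> s * G = aa \<theta> s * g0 (\<theta>, s)" using g0_aa[OF \<theta> s] by (simp only: mult.commute)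
  then have Gg: "G = g0 (\<theta>, s)" using aa_nz[OF \<theta>, of s] by simp
  have "(\<lambda>n::nat. \<Sum>k\<in>{- int n..int n}. f k) \<longlonglongrightarrow> G"
    using filterlim_compose[OF G[unfolded has_sum_def] int_interval_filterlim] .
  then have "(\<lambda>n::nat. \<Sum>k\<in>{- int n..int n}. m \<theta> k * exp (2 * pi * \<i> * of_int k * of_real s)) \<longlonglongrightarrow> G"
    unfolding f_def ee_exp .
  then show ?thesis unfolding check_def Gg by (rule limI)
qed

lemma m_Tplus: "m \<in> Tplus"
proof -
  have "m \<in> Tspace"
    unfolding Tspace_def
  proof (intro CollectI conjI allI exI)
    show "(\<lambda>\<theta>. m \<theta> k) \<in> borel_measurable (restrict_space lborel {0..<1})" for k
      using m_meas[of k] by (simp add: U_def)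
    show "AE \<theta> in lborel. \<theta> \<in> {0..<1} \<longrightarrow> conv_bounded (m \<theta>) (Bd * 6)"
      using m_conv_bounded by (intro AE_I2) blast
  qed
  moreover obtain \<delta> where \<delta>: "\<delta> > 0" "\<And>\<theta> t. \<theta> \<in> {0..<1} \<Longrightarrow> t \<in> {0..<1} \<Longrightarrow> \<delta> \<le> Im (g0 (\<theta>, t))"
    using g0_Im by blast
  have "AE p in lborel. p \<in> sq01 \<longrightarrow> Im (check m (fst p) (snd p)) \<ge> \<delta>"
  proof (intro AE_I2 impI)
    fix p assume "p \<in> sq01"
    then have "fst p \<in> {0..<1}" "snd p \<in> {0..<1}" by (auto simp: sq01_def)
    then show "\<delta> \<le> Im (check m (fst p) (snd p))"
      using \<delta>(2)[of "fst p" "snd p"] check_eq[of "fst p" "snd p"] by (simp only:)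
  qed
  ultimately show ?thesis unfolding Tplus_def using \<delta>(1) by blast
qed

text \<open>For fixed \<open>\<theta>\<close> in \<open>Gd\<close> the two integrands can differ
  only where \<open>\<phi>\<close> is outside \<open>Gd\<close> or equals \<open>\<theta>\<close>, a
  finite subset of the unit interval.\<close>

lemma Psi_eq:
  assumes \<theta>: "\<theta> \<in> Gd"
  shows "Psi \<psi> m \<theta> k = u \<theta> k"
proof -
  let ?X = "({0..<1} - Gd) \<union> {\<theta>}"
  have "Psi \<psi> m \<theta> k = (\<integral>\<phi>. indicator {0..<1} \<phi> *\<^sub>R (\<Sum>\<^sub>\<infinity>l. of_real (\<psi> \<theta> \<phi> k l) * m \<phi> l) \<partial>lborel)"
    unfolding Psi_def set_lebesgue_integral_def ..
  also have "\<dots> = (\<integral>\<phi>. indicator {0..<1} \<phi> *\<^sub>R (\<Sum>l\<in>Kb. of_real (\<psi>t \<theta> \<phi> k l) * m \<phi> l) \<partial>lborel)"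
  proof (rule integral_discrete_difference[of ?X])
    show "countable ?X" using finite_bad by (intro countable_finite) simp
    show "emeasure lborel {\<phi>} = 0" for \<phi> :: real by simp
    show "{\<phi>} \<in> sets lborel" for \<phi> :: real by simp
    show "indicator {0..<1} \<phi> *\<^sub>R (\<Sum>\<^sub>\<infinity>l. of_real (\<psi> \<theta> \<phi> k l) * m \<phi> l) =
        indicator {0..<1} \<phi> *\<^sub>R (\<Sum>l\<in>Kb. of_real (\<psi>t \<theta> \<phi> k l) * m \<phi> l)" if "\<phi> \<in> space lborel" "\<phi> \<notin> ?X" for \<phi>
    proof (cases "\<phi> \<in> {0..<1}")
      case True
      then have g: "\<phi> \<in> Gd" "\<theta> \<noteq> \<phi>" using that by auto
      have "(\<Sum>\<^sub>\<infinity>l. of_real (\<psi> \<theta> \<phi> k l) * m \<phi> l) = (\<Sum>\<^sub>\<infinity>l\<in>Kb. complex_of_real (\<psi>t \<theta> \<phi> k l) * m \<phi> l)"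
      proof (rule infsum_cong_neutral)
        fix l assume "l \<in> UNIV - Kb"
        then have "int K < \<bar>l\<bar>" by (auto simp: Kb_def)
        then show "complex_of_real (\<psi> \<theta> \<phi> k l) * m \<phi> l = 0" using psi_facts(2)[OF \<theta> g, of k l] by simp
      qed (use \<theta> g in \<open>simp_all add: \<psi>t_def\<close>)
      then show ?thesis using card_Kb(2) by simp
    qed simp
  qed
  also have "\<dots> = (\<integral>\<phi>. (\<Sum>l\<in>Kb. of_real (\<psi>t \<theta> \<phi> k l) * m \<phi> l) \<partial>U)"
    unfolding integral_U set_lebesgue_integral_def ..
  also have "\<dots> = u \<theta> k"
    unfolding u_def by (intro Bochner_Integration.integral_sum \<psi>m_integrable)
  finally show ?thesis .
qed

lemma solves: "solves_limit_eq \<psi> z m"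
proof -
  have "K_inverse (\<lambda>k. - z * delta0 k - Psi \<psi> m \<theta> k) (m \<theta>)" if \<theta>: "\<theta> \<in> Gd" for \<theta>
  proof -
    have \<theta>1: "\<theta> \<in> {0..<1}" using \<theta> Gd_subset by auto
    have e: "(\<lambda>k. - z * delta0 k - Psi \<psi> m \<theta> k) = av \<theta>"
      by (intro ext) (simp add: Psi_eq[OF \<theta>] av_def)
    have av0: "av \<theta> k = 0" if "k \<notin> Kb" for k
      using u_zero[OF that] that zero_Kb by (auto simp: av_def delta0_def)
    have "conv_bounded (av \<theta>) (\<Sum>k\<in>Kb. cmod (av \<theta> k))"
    proof (rule conv_bounded_l1)
      fix A :: "int set" assume "finite A"
      have "(\<Sum>k\<in>A. cmod (av \<theta> k)) = (\<Sum>k\<in>A \<inter> Kb. cmod (av \<theta> k))"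
        using \<open>finite A\<close> av0 by (intro sum.mono_neutral_right) auto
      also have "\<dots> \<le> (\<Sum>k\<in>Kb. cmod (av \<theta> k))" using card_Kb(2) by (intro sum_mono2) auto
      finally show "(\<Sum>k\<in>A. cmod (av \<theta> k)) \<le> (\<Sum>k\<in>Kb. cmod (av \<theta> k))" .
    qed
    then have k1: "av \<theta> \<in> Kspace" unfolding Kspace_def by blast
    have k2: "m \<theta> \<in> Kspace" using m_conv_bounded[OF \<theta>1] unfolding Kspace_def by blast
    have "conv (av \<theta>) (m \<theta>) = delta0"
    proof
      fix n
      have "conv (av \<theta>) (m \<theta>) n = (\<Sum>\<^sub>\<infinity>k\<in>Kb. av \<theta> k * m \<theta> (n - k))"
        unfolding conv_def by (rule infsum_cong_neutral) (auto simp: av0)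
      also have "\<dots> = delta0 n" using card_Kb(2) conv_finite[OF \<theta>1, of n] by simp
      finally show "conv (av \<theta>) (m \<theta>) n = delta0 n" .
    qed
    then show ?thesis unfolding K_inverse_def e using k1 k2 by blast
  qed
  moreover have "AE \<theta> in lborel. \<theta> \<in> {0..<1} \<longrightarrow> \<theta> \<in> Gd" using AE_Gd unfolding AE_U_iff .
  then show ?thesis unfolding solves_limit_eq_def
  proof eventually_elim
    case (elim \<theta>)
    then show ?case using calculation by blast
  qed
qed

lemma g0_integrable: "integrable (U \<Otimes>\<^sub>M U) g0"
  using g0_all by (intro integrable_UU[where B = "1 / Im z"]) auto

lemma trT_eq: "trT m = integral\<^sup>L (U \<Otimes>\<^sub>M U) g0"
proof -
  have "trT m = (\<integral>\<theta>. m \<theta> 0 \<partial>U)" unfolding trT_def integral_U ..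
  also have "\<dots> = (\<integral>\<theta>. (\<integral>t. g0 (\<theta>, t) \<partial>U) \<partial>U)" by (simp add: m_def cf_def)
  also have "\<dots> = integral\<^sup>L (U \<Otimes>\<^sub>M U) g0" by (rule UU.integral_fst'[OF g0_integrable])
  finally show ?thesis .
qed

text \<open>The modulus of \<open>aa\<close> is at least minus its imaginary part, which is
  \<open>Im z\<close> plus the integral of \<open>Im g0\<close> against \<open>pk\<close>. Since
  \<open>pk\<close> is almost everywhere at least \<open>c0\<close>, that integral is at least
  \<open>c0 * Im (trT m)\<close>. Unlike \<open>1 / Im z\<close>, the resulting bound survives near
  the real axis.\<close>

lemma g0_strong:
  assumes \<omega>: "\<omega> > 0" "\<omega> \<le> Im (trT m)" and \<theta>: "\<theta> \<in> Gd" and s: "s \<in> {0..<1}"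
  shows "cmod (g0 (\<theta>, s)) \<le> 1 / (c0 * \<omega>)"
proof -
  have \<theta>1: "\<theta> \<in> {0..<1}" using \<theta> Gd_subset by auto
  let ?r = "\<lambda>w. pk \<theta> s (fst w) (snd w) * Im (g0 w)"
  have pkm [measurable]: "(\<lambda>w. pk \<theta> s (fst w) (snd w)) \<in> borel_measurable (U \<Otimes>\<^sub>M U)"
    using measurable_Pair2[OF pk_meas, of "(\<theta>, s)"] \<theta>1 s by (simp add: space_UU)
  define C where "C = (2 * real K + 1)\<^sup>2"
  have ii: "integrable (U \<Otimes>\<^sub>M U) (\<lambda>w. of_real (pk \<theta> s (fst w) (snd w)) * g0 w)"
  proof (rule integrable_UU[where B = "C * (1 / Im z)"])
    show "(\<lambda>w. complex_of_real (pk \<theta> s (fst w) (snd w)) * g0 w) \<in> borel_measurable (U \<Otimes>\<^sub>M U)" by measurable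
    fix p assume "p \<in> space (U \<Otimes>\<^sub>M U)"
    then have "cmod (g0 p) \<le> 1 / Im z" using g0_all by blast
    then show "norm (complex_of_real (pk \<theta> s (fst p) (snd p)) * g0 p) \<le> C * (1 / Im z)"
      unfolding norm_mult norm_of_real using pk_le by (intro mult_mono) (auto simp: C_def)
  qed
  have ri: "integrable (U \<Otimes>\<^sub>M U) ?r" using integrable_Im[OF ii] by simp
  have gi: "integrable (U \<Otimes>\<^sub>M U) (\<lambda>w. c0 * Im (g0 w))"
    by (intro integrable_mult_right integrable_Im[OF g0_integrable])
  have "c0 * Im (trT m) = (\<integral>w. c0 * Im (g0 w) \<partial>(U \<Otimes>\<^sub>M U))"
    unfolding trT_eq integral_mult_right_zero integral_Im[OF g0_integrable] ..
  also have "\<dots> = (\<integral>\<phi>. (\<integral>t. c0 * Im (g0 (\<phi>, t)) \<partial>U) \<partial>U)" by (rule UU.integral_fst'[OF gi, symmetric])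
  also have "\<dots> \<le> (\<integral>\<phi>. (\<integral>t. ?r (\<phi>, t) \<partial>U) \<partial>U)"
  proof (rule integral_mono_AE)
    show "integrable U (\<lambda>\<phi>. \<integral>t. c0 * Im (g0 (\<phi>, t)) \<partial>U)" by (rule UU.integrable_fst'[OF gi])
    show "integrable U (\<lambda>\<phi>. \<integral>t. ?r (\<phi>, t) \<partial>U)" by (rule UU.integrable_fst'[OF ri])
    have "AE \<phi> in U. \<phi> \<notin> {\<theta>}" by (rule AE_U_finite) simp
    then show "AE \<phi> in U. (\<integral>t. c0 * Im (g0 (\<phi>, t)) \<partial>U) \<le> (\<integral>t. ?r (\<phi>, t) \<partial>U)"
      using AE_Gd UU.AE_integrable_fst'[OF gi] UU.AE_integrable_fst'[OF ri]
    proof eventually_elim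
      case (elim \<phi>)
      obtain \<delta> where \<delta>: "\<delta> > 0" "\<And>\<theta> t. \<theta> \<in> {0..<1} \<Longrightarrow> t \<in> {0..<1} \<Longrightarrow> \<delta> \<le> Im (g0 (\<theta>, t))"
        using g0_Im by blast
      have \<phi>1: "\<phi> \<in> {0..<1}" using elim(2) Gd_subset by auto
      show ?case
      proof (rule integral_mono[OF elim(3,4)])
        fix t assume "t \<in> space U"
        then have "0 \<le> Im (g0 (\<phi>, t))" using \<delta>(1) \<delta>(2)[OF \<phi>1, of t] by simp
        moreover have "c0 \<le> pk \<theta> s \<phi> t" using pk_ge[OF \<theta> elim(2), of s t] elim(1) by auto
        ultimately show "c0 * Im (g0 (\<phi>, t)) \<le> ?r (\<phi>, t)" by (simp add: mult_right_mono)
      qed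
    qed
  qed
  also have "\<dots> = integral\<^sup>L (U \<Otimes>\<^sub>M U) ?r" by (rule UU.integral_fst'[OF ri])
  also have "\<dots> = Im (\<Sum>k\<in>Kb. u \<theta> k * ee k s)"
    unfolding T_eq[symmetric] integral_Im[OF ii, symmetric] by simp
  finally have "c0 * Im (trT m) \<le> Im (\<Sum>k\<in>Kb. u \<theta> k * ee k s)" .
  moreover have "c0 * \<omega> \<le> c0 * Im (trT m)" using \<omega>(2) c0pos by simp
  moreover have "Im (aa \<theta> s) = - Im z - Im (\<Sum>k\<in>Kb. u \<theta> k * ee k s)" unfolding aa_def by simp
  ultimately have "Im (aa \<theta> s) \<le> - (c0 * \<omega>)" using eta by linarith
  then have ge: "c0 * \<omega> \<le> cmod (aa \<theta> s)" using abs_Im_le_cmod[of "aa \<theta> s"] by linarith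
  have pos: "c0 * \<omega> > 0" using c0pos \<omega> by simp
  have "cmod (1 / aa \<theta> s) \<le> 1 / (c0 * \<omega>)"
    unfolding norm_divide norm_one using ge pos by (intro frac_le) auto
  then show ?thesis unfolding inv_aa[OF \<theta>1 s] .
qed

end

section \<open>Convergence of the blocks of the covariance\<close>

context profile
begin

text \<open>Extension by zero: block shifts may leave the index range without a case distinction,
  and the bound 1 persists.\<close>

definition xc :: "nat \<Rightarrow> int \<Rightarrow> int \<Rightarrow> int \<Rightarrow> int \<Rightarrow> real" where
  "xc N i j k l = (if i \<in> {1..int N} \<and> j \<in> {1..int N} \<and> k \<in> {1..int N} \<and> l \<in> {1..int N} then xz N i j k l else 0)"

text \<open>Number of the block of length \<open>n\<close> to which position \<open>\<phi>\<close>
  belongs, counted from 0.\<close>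

definition fl :: "nat \<Rightarrow> nat \<Rightarrow> real \<Rightarrow> int" where
  "fl n N \<phi> = \<lfloor>\<phi> * real N / real n\<rfloor>"

text \<open>Total deviation from the profile over all entries of the blocks of
  \<open>\<phi>'\<close> and \<open>\<phi>\<close>. It is not normalised in \<open>n\<close>, which
  costs nothing because \<open>n\<close> is fixed while \<open>N\<close> grows.\<close>

definition DN :: "nat \<Rightarrow> nat \<Rightarrow> real \<Rightarrow> real \<Rightarrow> real" where
  "DN n N \<phi>' \<phi> = (\<Sum>a\<in>{1..int n}. \<Sum>b\<in>{1..int n}. \<Sum>k\<in>Kb. \<Sum>l\<in>Kb.
     \<bar>xc N (int n * fl n N \<phi>' + a) (int n * fl n N \<phi> + b) (int n * fl n N \<phi>' + a + k) (int n * fl n N \<phi> + b + l) - \<psi>t \<phi>' \<phi> k l\<bar>)"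

definition dN :: "nat \<Rightarrow> nat \<Rightarrow> real \<Rightarrow> real" where
  "dN n N \<phi>' = (\<integral>\<phi>. DN n N \<phi>' \<phi> \<partial>U)"

lemma xc_bound: "\<bar>xc N i j k l\<bar> \<le> 1"
  by (simp add: xc_def xz_bound)

lemma DN_nonneg: "0 \<le> DN n N \<phi>' \<phi>"
  unfolding DN_def by (intro sum_nonneg) simp

definition Dc :: "nat \<Rightarrow> real" where "Dc n = (\<Sum>a\<in>{1..int n}. \<Sum>b\<in>{1..int n}. \<Sum>k\<in>Kb. \<Sum>l\<in>Kb. 2)"

lemma DN_le: "DN n N \<phi>' \<phi> \<le> Dc n"
  unfolding DN_def Dc_def
proof (intro sum_mono)
  fix a b k l
  show "\<bar>xc N (int n * fl n N \<phi>' + a) (int n * fl n N \<phi> + b) (int n * fl n N \<phi>' + a + k) (int n * fl n N \<phi> + b + l) - \<psi>t \<phi>' \<phi> k l\<bar> \<le> 2"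
    using xc_bound[of N "int n * fl n N \<phi>' + a" "int n * fl n N \<phi> + b" "int n * fl n N \<phi>' + a + k" "int n * fl n N \<phi> + b + l"]
      \<psi>t_bound[of \<phi>' \<phi> k l] by linarith
qed

lemma fl_meas: "fl n N \<in> measurable U (count_space UNIV)"
proof -
  have "(\<lambda>\<phi>. \<phi> * real N / real n) \<in> borel_measurable U" by (rule measurable_U) simp
  from measurable_compose[OF this measurable_real_floor] show ?thesis
    unfolding fl_def[abs_def] .
qed

lemma DN_meas: "(\<lambda>(\<phi>', \<phi>). DN n N \<phi>' \<phi>) \<in> borel_measurable (U \<Otimes>\<^sub>M U)"
proof -
  have f1: "(\<lambda>w. fl n N (fst w)) \<in> measurable (U \<Otimes>\<^sub>M U) (count_space UNIV)"
    by (rule measurable_compose[OF measurable_fst fl_meas])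
  have f2: "(\<lambda>w. fl n N (snd w)) \<in> measurable (U \<Otimes>\<^sub>M U) (count_space UNIV)"
    by (rule measurable_compose[OF measurable_snd fl_meas])
  have comp: "(\<lambda>w. F (fl n N (fst w)) (fl n N (snd w))) \<in> borel_measurable (U \<Otimes>\<^sub>M U)" for F :: "int \<Rightarrow> int \<Rightarrow> real"
  proof (rule measurable_compose_countable[OF _ f1, where f = "\<lambda>p w. F p (fl n N (snd w))"])
    fix p
    show "(\<lambda>w. F p (fl n N (snd w))) \<in> borel_measurable (U \<Otimes>\<^sub>M U)"
      by (rule measurable_compose[OF f2]) simp
  qed
  have [measurable]: "(\<lambda>w. \<psi>t (fst w) (snd w) k l) \<in> borel_measurable (U \<Otimes>\<^sub>M U)" for k l
    by (rule \<psi>t_meas2[OF fst_UU snd_UU])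
  have [measurable]: "(\<lambda>w. xc N (int n * fl n N (fst w) + a) (int n * fl n N (snd w) + b) (int n * fl n N (fst w) + a + k) (int n * fl n N (snd w) + b + l)) \<in> borel_measurable (U \<Otimes>\<^sub>M U)" for a b k l
    by (rule comp[of "\<lambda>p q. xc N (int n * p + a) (int n * q + b) (int n * p + a + k) (int n * q + b + l)"])
  show ?thesis unfolding DN_def case_prod_beta by measurable
qed

lemma DN_sec: "\<phi>' \<in> {0..<1} \<Longrightarrow> DN n N \<phi>' \<in> borel_measurable U"
  using measurable_Pair2[OF DN_meas, of \<phi>'] by simp

lemma DN_integrable: "\<phi>' \<in> {0..<1} \<Longrightarrow> integrable U (DN n N \<phi>')"
  using DN_nonneg DN_le by (intro integrable_U[where B = "Dc n"] DN_sec) auto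

lemma dN_meas: "dN n N \<in> borel_measurable U"
  unfolding dN_def[abs_def] by (rule U.borel_measurable_lebesgue_integral[OF DN_meas])

lemma dN_nonneg: "0 \<le> dN n N \<phi>'"
  unfolding dN_def by (simp add: DN_nonneg)

lemma dN_le: "\<phi>' \<in> {0..<1} \<Longrightarrow> dN n N \<phi>' \<le> Dc n"
proof -
  assume "\<phi>' \<in> {0..<1}"
  then have "dN n N \<phi>' \<le> (\<integral>\<phi>. Dc n \<partial>U)"
    unfolding dN_def by (intro integral_mono DN_integrable DN_le) auto
  then show ?thesis by simp
qed

lemma fl_over_n:
  assumes "n \<ge> 1"
  shows "(\<lambda>N. real_of_int (int n * fl n N \<phi> + a) / real N) \<longlonglongrightarrow> \<phi>"
proof (rule shift_over_n)
  show "(\<lambda>N. real_of_int (int n * fl n N \<phi>) / real N) \<longlonglongrightarrow> \<phi>"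
  proof (rule tendsto_sandwich[of "\<lambda>N. \<phi> - real n / real N" _ _ "\<lambda>N. \<phi>"])
    have b: "real n * real_of_int (fl n N \<phi>) \<le> \<phi> * real N" "\<phi> * real N - real n \<le> real n * real_of_int (fl n N \<phi>)" for N
    proof -
      have "real_of_int (fl n N \<phi>) \<le> \<phi> * real N / real n" "\<phi> * real N / real n - 1 \<le> real_of_int (fl n N \<phi>)"
        unfolding fl_def by linarith+
      then show "real n * real_of_int (fl n N \<phi>) \<le> \<phi> * real N" "\<phi> * real N - real n \<le> real n * real_of_int (fl n N \<phi>)"
        using assms by (simp_all add: field_simps)
    qed
    show "\<forall>\<^sub>F N in sequentially. \<phi> - real n / real N \<le> real_of_int (int n * fl n N \<phi>) / real N"
      using eventually_gt_at_top[of 0]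
    proof eventually_elim
      case (elim N)
      have "(\<phi> * real N - real n) / real N \<le> real n * real_of_int (fl n N \<phi>) / real N"
        by (intro divide_right_mono b) simp
      then show ?case using elim by (simp add: diff_divide_distrib)
    qed
    show "\<forall>\<^sub>F N in sequentially. real_of_int (int n * fl n N \<phi>) / real N \<le> \<phi>"
      using eventually_gt_at_top[of 0]
    proof eventually_elim
      case (elim N)
      have "real n * real_of_int (fl n N \<phi>) / real N \<le> \<phi> * real N / real N"
        by (intro divide_right_mono b) simp
      then show ?case using elim by simp
    qed
    have "(\<lambda>N. \<phi> - real n / real N) \<longlonglongrightarrow> \<phi> - 0" by (intro tendsto_diff tendsto_const lim_const_over_n)
    then show "(\<lambda>N. \<phi> - real n / real N) \<longlonglongrightarrow> \<phi>" by simp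
  qed simp
qed

lemma DN_limit:
  assumes n: "n \<ge> 1" and g: "\<phi>' \<in> Gd" "\<phi> \<in> Gd" "\<phi>' \<noteq> \<phi>"
  shows "(\<lambda>N. DN n N \<phi>' \<phi>) \<longlonglongrightarrow> 0"
proof -
  have rng: "0 < \<phi>'" "\<phi>' < 1" "0 < \<phi>" "\<phi> < 1" using g Gd_subset by auto
  let ?i = "\<lambda>N. int n * fl n N \<phi>'" and ?j = "\<lambda>N. int n * fl n N \<phi>"
  have "(\<lambda>N. xc N (?i N + a) (?j N + b) (?i N + a + k) (?j N + b + l)) \<longlonglongrightarrow> \<psi>t \<phi>' \<phi> k l" for a b k l
  proof -
    have "(\<lambda>N. xz N (?i N + a) (?j N + b) (?i N + a + k) (?j N + b + l)) \<longlonglongrightarrow> \<psi> \<phi>' \<phi> k l"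
      by (rule xz_limit[OF g fl_over_n[OF n] fl_over_n[OF n]])
    moreover have "\<forall>\<^sub>F N in sequentially. ?i N + a \<in> {1..int N} \<and> ?j N + b \<in> {1..int N} \<and> ?i N + a + k \<in> {1..int N} \<and> ?j N + b + l \<in> {1..int N}"
      by (intro eventually_conj in_range_eventually[OF _ rng(1,2)] in_range_eventually[OF _ rng(3,4)]
          fl_over_n[OF n] shift_over_n[OF fl_over_n[OF n]])
    then have "\<forall>\<^sub>F N in sequentially. xz N (?i N + a) (?j N + b) (?i N + a + k) (?j N + b + l) = xc N (?i N + a) (?j N + b) (?i N + a + k) (?j N + b + l)"
      by eventually_elim (simp add: xc_def)
    ultimately have "(\<lambda>N. xc N (?i N + a) (?j N + b) (?i N + a + k) (?j N + b + l)) \<longlonglongrightarrow> \<psi> \<phi>' \<phi> k l"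
      by (rule Lim_transform_eventually)
    then show ?thesis using g by (simp add: \<psi>t_def)
  qed
  then have "(\<lambda>N. DN n N \<phi>' \<phi>) \<longlonglongrightarrow> (\<Sum>a\<in>{1..int n}. \<Sum>b\<in>{1..int n}. \<Sum>k\<in>Kb. \<Sum>l\<in>Kb. \<bar>\<psi>t \<phi>' \<phi> k l - \<psi>t \<phi>' \<phi> k l\<bar>)"
    unfolding DN_def by (intro tendsto_sum tendsto_rabs tendsto_diff tendsto_const)
  then show ?thesis by simp
qed

lemma dN_limit:
  assumes n: "n \<ge> 1" and g: "\<phi>' \<in> Gd"
  shows "(\<lambda>N. dN n N \<phi>') \<longlonglongrightarrow> 0"
proof -
  have \<phi>': "\<phi>' \<in> {0..<1}" using g Gd_subset by auto
  have "(\<lambda>N. \<integral>\<phi>. DN n N \<phi>' \<phi> \<partial>U) \<longlonglongrightarrow> (\<integral>\<phi>. 0 \<partial>U)"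
  proof (rule integral_dominated_convergence[where w = "\<lambda>_. Dc n"])
    show "DN n N \<phi>' \<in> borel_measurable U" for N by (rule DN_sec[OF \<phi>'])
    have "AE \<phi> in U. \<phi> \<notin> {\<phi>'}" by (rule AE_U_finite) simp
    then show "AE \<phi> in U. (\<lambda>N. DN n N \<phi>' \<phi>) \<longlonglongrightarrow> 0"
      using AE_Gd
    proof eventually_elim
      case (elim \<phi>)
      then show ?case using DN_limit[OF n g, of \<phi>] by auto
    qed
    show "AE \<phi> in U. norm (DN n N \<phi>' \<phi>) \<le> Dc n" for N
      using DN_nonneg DN_le by (intro AE_I2) simp
  qed simp_all
  then show ?thesis by (simp add: dN_def)
qed

text \<open>Convergence in mean without a rate: dominated convergence absorbs the blocks near
  discontinuities, near the diagonal and at the ends of the index range.\<close>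

lemma e1_limit:
  assumes n: "n \<ge> 1"
  shows "(\<lambda>N. \<integral>\<phi>'. dN n N \<phi>' \<partial>U) \<longlonglongrightarrow> 0"
proof -
  have "(\<lambda>N. \<integral>\<phi>'. dN n N \<phi>' \<partial>U) \<longlonglongrightarrow> (\<integral>\<phi>'. 0 \<partial>U)"
  proof (rule integral_dominated_convergence[where w = "\<lambda>_. Dc n"])
    show "dN n N \<in> borel_measurable U" for N by (rule dN_meas)
    show "AE \<phi>' in U. (\<lambda>N. dN n N \<phi>') \<longlonglongrightarrow> 0"
      using AE_Gd by eventually_elim (rule dN_limit[OF n])
    show "AE \<phi>' in U. norm (dN n N \<phi>') \<le> Dc n" for N
      using dN_nonneg dN_le by (intro AE_I2) simp
  qed simp_all
  then show ?thesis by simp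
qed

end

text \<open>From the nonnegative weighted integral of \<open>(cmod (h - c))\<^sup>2\<close> with
  \<open>c\<close> the weighted integral of \<open>h\<close>. Total mass at most 1 suffices, which
  covers the last block when the unit interval cuts it off.\<close>

lemma weighted_jensen:
  fixes w :: "real \<Rightarrow> real" and h :: "real \<Rightarrow> complex"
  assumes wm: "w \<in> borel_measurable U" and w0: "\<And>\<phi>. 0 \<le> w \<phi>" and wB: "\<And>\<phi>. w \<phi> \<le> W" and w1: "integral\<^sup>L U w \<le> 1"
    and hm: "h \<in> borel_measurable U" and hB: "\<And>\<phi>. \<phi> \<in> {0..<1} \<Longrightarrow> cmod (h \<phi>) \<le> B"
  shows "(cmod (\<integral>\<phi>. of_real (w \<phi>) * h \<phi> \<partial>U))\<^sup>2 \<le> (\<integral>\<phi>. w \<phi> * (cmod (h \<phi>))\<^sup>2 \<partial>U)"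
proof -
  note [measurable] = wm hm
  define c where "c = (\<integral>\<phi>. of_real (w \<phi>) * h \<phi> \<partial>U)"
  have B0: "B \<ge> 0" using order_trans[OF norm_ge_zero hB[of 0]] by simp
  have W0: "W \<ge> 0" using order_trans[OF w0 wB] .
  have iw: "integrable U w"
    by (rule integrable_U[where B = W]) (simp_all add: w0 wB wm)
  have iwh: "integrable U (\<lambda>\<phi>. of_real (w \<phi>) * h \<phi>)"
  proof (rule integrable_U[where B = "W * B"])
    show "norm (of_real (w \<phi>) * h \<phi>) \<le> W * B" if "\<phi> \<in> {0..<1}" for \<phi>
      unfolding norm_mult norm_of_real using w0[of \<phi>] wB[of \<phi>] hB[OF that] W0 by (intro mult_mono) simp_all
  qed measurable
  have iwh2: "integrable U (\<lambda>\<phi>. w \<phi> * (cmod (h \<phi>))\<^sup>2)"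
  proof (rule integrable_U[where B = "W * B\<^sup>2"])
    show "norm (w \<phi> * (cmod (h \<phi>))\<^sup>2) \<le> W * B\<^sup>2" if "\<phi> \<in> {0..<1}" for \<phi>
      unfolding norm_mult using w0[of \<phi>] wB[of \<phi>] hB[OF that] W0 by (intro mult_mono) (simp_all add: power_mono)
  qed measurable
  have iR: "integrable U (\<lambda>\<phi>. Re (cnj c * (of_real (w \<phi>) * h \<phi>)))"
    by (intro integrable_Re integrable_mult_right iwh)
  have "0 \<le> (\<integral>\<phi>. w \<phi> * (cmod (h \<phi> - c))\<^sup>2 \<partial>U)" by (intro integral_nonneg_AE AE_I2) (simp add: w0)
  also have "\<dots> = (\<integral>\<phi>. w \<phi> * (cmod (h \<phi>))\<^sup>2 - 2 * Re (cnj c * (of_real (w \<phi>) * h \<phi>)) + (cmod c)\<^sup>2 * w \<phi> \<partial>U)"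
  proof (intro Bochner_Integration.integral_cong refl)
    fix \<phi>
    have "(cmod (h \<phi> - c))\<^sup>2 = (cmod (h \<phi>))\<^sup>2 - 2 * Re (cnj c * h \<phi>) + (cmod c)\<^sup>2"
      unfolding cmod_power2 by (simp add: power2_eq_square algebra_simps)
    moreover have "Re (cnj c * (of_real (w \<phi>) * h \<phi>)) = w \<phi> * Re (cnj c * h \<phi>)" by (simp add: algebra_simps)
    moreover have "v * (A - 2 * R + C) = v * A - 2 * (v * R) + C * v" for v A R C :: real by (simp add: algebra_simps)
    ultimately show "w \<phi> * (cmod (h \<phi> - c))\<^sup>2 = w \<phi> * (cmod (h \<phi>))\<^sup>2 - 2 * Re (cnj c * (of_real (w \<phi>) * h \<phi>)) + (cmod c)\<^sup>2 * w \<phi>"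
      by (simp only:)
  qed
  also have "\<dots> = (\<integral>\<phi>. w \<phi> * (cmod (h \<phi>))\<^sup>2 \<partial>U) - 2 * (\<integral>\<phi>. Re (cnj c * (of_real (w \<phi>) * h \<phi>)) \<partial>U) + (cmod c)\<^sup>2 * integral\<^sup>L U w"
  proof -
    have "integral\<^sup>L U (\<lambda>t. f t - 2 * g t + d * k t) = integral\<^sup>L U f - 2 * integral\<^sup>L U g + d * integral\<^sup>L U k"
      if "integrable U f" "integrable U g" "integrable U k" for f g k :: "real \<Rightarrow> real" and d
      using that by simp
    from this[OF iwh2 iR iw] show ?thesis .
  qed
  also have "(\<integral>\<phi>. Re (cnj c * (of_real (w \<phi>) * h \<phi>)) \<partial>U) = (cmod c)\<^sup>2"
  proof -
    have "(\<integral>\<phi>. Re (cnj c * (of_real (w \<phi>) * h \<phi>)) \<partial>U) = Re (cnj c * c)"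
      unfolding integral_Re[OF integrable_mult_right[OF iwh]] integral_mult_right_zero c_def ..
    also have "\<dots> = (cmod c)\<^sup>2" unfolding cmod_power2 by (simp add: power2_eq_square)
    finally show ?thesis .
  qed
  finally have "2 * (cmod c)\<^sup>2 \<le> (\<integral>\<phi>. w \<phi> * (cmod (h \<phi>))\<^sup>2 \<partial>U) + (cmod c)\<^sup>2 * integral\<^sup>L U w" by simp
  moreover have "(cmod c)\<^sup>2 * integral\<^sup>L U w \<le> (cmod c)\<^sup>2 * 1" using w1 by (intro mult_left_mono) simp_all
  ultimately show ?thesis unfolding c_def by simp
qed

text \<open>Matrix indices start at 1 and block numbers at 0, hence the division of
  \<open>j - 1\<close> and the block \<open>n * q + 1\<close> up to
  \<open>n * q + n\<close>.\<close>

lemma div_block: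
  fixes j q :: int and n :: nat
  assumes "n \<ge> 1"
  shows "(j - 1) div int n = q \<longleftrightarrow> j \<in> {int n * q + 1..int n * q + int n}"
proof
  assume e: "(j - 1) div int n = q"
  have "j - 1 = int n * q + (j - 1) mod int n"
    unfolding e[symmetric] by (rule mult_div_mod_eq[symmetric])
  moreover have "0 \<le> (j - 1) mod int n" "(j - 1) mod int n < int n" using assms by simp_all
  ultimately show "j \<in> {int n * q + 1..int n * q + int n}" unfolding atLeastAtMost_iff by (intro conjI; linarith)
next
  assume "j \<in> {int n * q + 1..int n * q + int n}"
  then show "(j - 1) div int n = q" using assms
    by (intro int_div_pos_eq[of _ _ _ "j - 1 - int n * q"]) auto
qed

section \<open>Block Toeplitz discretization\<close>

locale discretization = limit_problem K P x c0 \<psi> z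
  for K :: nat and P :: "nat \<Rightarrow> 'a measure" and x :: "nat \<Rightarrow> nat \<Rightarrow> nat \<Rightarrow> 'a \<Rightarrow> real" and c0 :: real
    and \<psi> :: "real \<Rightarrow> real \<Rightarrow> int \<Rightarrow> int \<Rightarrow> real" and z :: complex +
  fixes n N :: nat and \<omega> :: real
  assumes n1: "n \<ge> 1" and nN: "n \<le> N" and om: "\<omega> > 0" and om_le: "\<omega> \<le> Im (trT m)"
begin

abbreviation S :: "int set" where "S \<equiv> {1..int N}"

definition \<Gamma> :: real where "\<Gamma> = 1 / (c0 * \<omega>)"
definition qb :: "int \<Rightarrow> int" where "qb j = (j - 1) div int n"
text \<open>Density of the uniform distribution on the positions of block \<open>q\<close>; for a
  complete block its mass is 1.\<close>

definition w :: "int \<Rightarrow> real \<Rightarrow> real" where "w q \<phi> = (if fl n N \<phi> = q then real N / real n else 0)"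
text \<open>\<open>m\<close> is averaged over the positions of a block rather than sampled, because
  it is only known to be measurable in the position.\<close>

definition Mt :: "int \<Rightarrow> int \<Rightarrow> complex" where
  "Mt j l = (if qb j = qb l then (\<integral>\<phi>. of_real (w (qb j) \<phi>) * m \<phi> (l - j) \<partial>U) else 0)"

lemma N1: "N \<ge> 1" using n1 nN by simp

lemma \<Gamma>_pos: "\<Gamma> > 0" using c0pos om by (simp add: \<Gamma>_def)

lemma qb_iff: "qb j = q \<longleftrightarrow> j \<in> {int n * q + 1..int n * q + int n}"
  unfolding qb_def by (rule div_block[OF n1])

lemma w_nonneg: "0 \<le> w q \<phi>" by (simp add: w_def)
lemma w_le: "w q \<phi> \<le> real N / real n" by (simp add: w_def)

lemma w_meas [measurable]: "w q \<in> borel_measurable U"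
proof -
  have "(\<lambda>\<phi>. (\<lambda>p. if p = q then real N / real n else 0) (fl n N \<phi>)) \<in> borel_measurable U"
    by (rule measurable_compose[OF fl_meas]) simp
  then show ?thesis by (simp add: w_def[abs_def])
qed

definition J :: "int \<Rightarrow> real set" where
  "J q = {real_of_int q * real n / real N..<(real_of_int q + 1) * real n / real N}"

lemma fl_iff: "fl n N \<phi> = q \<longleftrightarrow> \<phi> \<in> J q"
proof -
  have "fl n N \<phi> = q \<longleftrightarrow> real_of_int q \<le> \<phi> * real N / real n \<and> \<phi> * real N / real n < real_of_int q + 1"
    unfolding fl_def by (rule floor_eq_iff)
  also have "\<dots> \<longleftrightarrow> \<phi> \<in> J q"
    using n1 N1 by (simp add: J_def le_divide_eq divide_le_eq divide_less_eq less_divide_eq)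
  finally show ?thesis .
qed

lemma measure_J: "measure lborel (J q) = real n / real N"
proof -
  have "(real_of_int q + 1) * real n / real N - real_of_int q * real n / real N = real n / real N"
    by (simp add: add_divide_distrib distrib_right)
  moreover have "0 \<le> real n / real N" by simp
  ultimately show ?thesis unfolding J_def by (subst measure_lborel_Ico) linarith+
qed

lemma w_integral: "integral\<^sup>L U (w q) = real N / real n * measure lborel (J q \<inter> {0..<1})"
proof -
  have "w q = (\<lambda>\<phi>. real N / real n * indicator (J q) \<phi>)"
    by (intro ext) (simp add: w_def fl_iff indicator_def)
  then have "integral\<^sup>L U (w q) = real N / real n * measure U (J q \<inter> {0..<1})" by simp
  also have "measure U (J q \<inter> {0..<1}) = measure lborel (J q \<inter> {0..<1})"
    unfolding U_def by (rule measure_restrict_space) simp_all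
  finally show ?thesis .
qed

lemma w_integral_le: "integral\<^sup>L U (w q) \<le> 1"
proof -
  have "measure lborel (J q \<inter> {0..<1}) \<le> measure lborel (J q)"
  proof (rule measure_mono_fmeasurable)
    show "J q \<in> fmeasurable lborel"
    proof (rule fmeasurableI)
      show "emeasure lborel (J q) < \<infinity>" unfolding J_def by (rule emeasure_bounded_finite) simp
    qed (simp add: J_def)
  qed (simp_all add: J_def)
  then have "real N / real n * measure lborel (J q \<inter> {0..<1}) \<le> real N / real n * (real n / real N)"
    unfolding measure_J by (intro mult_left_mono) simp_all
  then show ?thesis using n1 N1 by (simp add: w_integral)
qed

lemma w_integral_full:
  assumes "0 \<le> q" "(q + 1) * int n \<le> int N"
  shows "integral\<^sup>L U (w q) = 1"
proof -
  have "real_of_int ((q + 1) * int n) \<le> real_of_int (int N)" using assms(2) by (simp only: of_int_le_iff)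
  then have "(real_of_int q + 1) * real n \<le> real N" by simp
  then have "(real_of_int q + 1) * real n / real N \<le> 1" by (simp add: divide_le_eq)
  note hi = this
  have lo: "0 \<le> real_of_int q * real n / real N" using assms(1) by simp
  have "J q \<subseteq> {0..<1}"
  proof
    fix \<phi> assume "\<phi> \<in> J q"
    then have "real_of_int q * real n / real N \<le> \<phi>" "\<phi> < (real_of_int q + 1) * real n / real N"
      unfolding J_def atLeastLessThan_iff by blast+
    then have "0 \<le> \<phi>" "\<phi> < 1" using lo hi by linarith+
    then show "\<phi> \<in> {0..<1}" by simp
  qed
  then have "J q \<inter> {0..<1} = J q" by (rule Int_absorb2)
  then show ?thesis using n1 N1 by (simp add: w_integral measure_J)
qed

lemma Gd_01: "\<phi> \<in> Gd \<Longrightarrow> \<phi> \<in> {0..<1}" using Gd_subset by auto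

lemma m_strong: "\<phi> \<in> Gd \<Longrightarrow> cmod (m \<phi> k) \<le> \<Gamma>"
  unfolding m_def \<Gamma>_def using g0_strong[OF om om_le] by (intro cf_bound g0_sec Gd_01)

lemma m_bessel: "\<phi> \<in> Gd \<Longrightarrow> finite F \<Longrightarrow> (\<Sum>k\<in>F. (cmod (m \<phi> k))\<^sup>2) \<le> \<Gamma>\<^sup>2"
  unfolding m_def \<Gamma>_def using g0_strong[OF om om_le] by (intro cf_bessel g0_sec Gd_01)

lemma wm_integrable: "integrable U (\<lambda>\<phi>. of_real (w q \<phi>) * m \<phi> k)"
proof (rule integrable_U[where B = "real N / real n * (1 / Im z)"])
  show "norm (complex_of_real (w q \<phi>) * m \<phi> k) \<le> real N / real n * (1 / Im z)" if "\<phi> \<in> {0..<1}" for \<phi>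
    unfolding norm_mult norm_of_real using w_nonneg[of q \<phi>] w_le[of q \<phi>] m_bound[OF that] by (intro mult_mono) simp_all
qed measurable

lemma w_integrable: "integrable U (w q)"
  by (rule integrable_U[where B = "real N / real n"]) (simp_all add: w_nonneg w_le w_meas)

lemma wm2_integrable: "integrable U (\<lambda>\<phi>. w q \<phi> * (cmod (m \<phi> k))\<^sup>2)"
proof (rule integrable_U[where B = "real N / real n * (1 / Im z)\<^sup>2"])
  show "norm (w q \<phi> * (cmod (m \<phi> k))\<^sup>2) \<le> real N / real n * (1 / Im z)\<^sup>2" if "\<phi> \<in> {0..<1}" for \<phi>
    unfolding norm_mult using w_nonneg[of q \<phi>] w_le[of q \<phi>] m_bound[OF that, of k]
    by (intro mult_mono) (simp_all add: power_mono)
qed measurable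

text \<open>Jensen moves the average over positions outside the square, and Bessel bounds the row
  sum at almost every position. An entrywise bound would lose a factor of the block length.\<close>

lemma Mt_row: "finite F \<Longrightarrow> (\<Sum>l\<in>F. (cmod (Mt j l))\<^sup>2) \<le> \<Gamma>\<^sup>2"
proof -
  assume F: "finite F"
  have "(\<Sum>l\<in>F. (cmod (Mt j l))\<^sup>2) \<le> (\<Sum>l\<in>F. \<integral>\<phi>. w (qb j) \<phi> * (cmod (m \<phi> (l - j)))\<^sup>2 \<partial>U)"
  proof (intro sum_mono)
    fix l
    have "(cmod (\<integral>\<phi>. of_real (w (qb j) \<phi>) * m \<phi> (l - j) \<partial>U))\<^sup>2 \<le> (\<integral>\<phi>. w (qb j) \<phi> * (cmod (m \<phi> (l - j)))\<^sup>2 \<partial>U)"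
      by (rule weighted_jensen[OF w_meas w_nonneg w_le w_integral_le m_meas m_bound])
    moreover have "0 \<le> (\<integral>\<phi>. w (qb j) \<phi> * (cmod (m \<phi> (l - j)))\<^sup>2 \<partial>U)"
      by (intro integral_nonneg_AE AE_I2) (simp add: w_nonneg)
    ultimately show "(cmod (Mt j l))\<^sup>2 \<le> (\<integral>\<phi>. w (qb j) \<phi> * (cmod (m \<phi> (l - j)))\<^sup>2 \<partial>U)"
      unfolding Mt_def by (cases "qb j = qb l") (simp_all only: if_True if_False refl norm_zero power_zero_numeral)
  qed
  also have "\<dots> = (\<integral>\<phi>. (\<Sum>l\<in>F. w (qb j) \<phi> * (cmod (m \<phi> (l - j)))\<^sup>2) \<partial>U)"
    by (intro Bochner_Integration.integral_sum[symmetric] wm2_integrable)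
  also have "\<dots> \<le> (\<integral>\<phi>. w (qb j) \<phi> * \<Gamma>\<^sup>2 \<partial>U)"
  proof (rule integral_mono_AE)
    show "integrable U (\<lambda>\<phi>. \<Sum>l\<in>F. w (qb j) \<phi> * (cmod (m \<phi> (l - j)))\<^sup>2)"
      by (intro Bochner_Integration.integrable_sum wm2_integrable)
    show "integrable U (\<lambda>\<phi>. w (qb j) \<phi> * \<Gamma>\<^sup>2)" by (intro integrable_mult_left w_integrable)
    show "AE \<phi> in U. (\<Sum>l\<in>F. w (qb j) \<phi> * (cmod (m \<phi> (l - j)))\<^sup>2) \<le> w (qb j) \<phi> * \<Gamma>\<^sup>2"
      using AE_Gd
    proof eventually_elim
      case (elim \<phi>)
      have "(\<Sum>l\<in>F. (cmod (m \<phi> (l - j)))\<^sup>2) = (\<Sum>k\<in>(\<lambda>l. l - j) ` F. (cmod (m \<phi> k))\<^sup>2)"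
        by (subst sum.reindex) (simp_all add: inj_on_def)
      also have "\<dots> \<le> \<Gamma>\<^sup>2" using F by (intro m_bessel[OF elim]) simp
      finally show ?case unfolding sum_distrib_left[symmetric] by (intro mult_left_mono w_nonneg)
    qed
  qed
  also have "\<dots> = integral\<^sup>L U (w (qb j)) * \<Gamma>\<^sup>2" by simp
  also have "\<dots> \<le> 1 * \<Gamma>\<^sup>2" using w_integral_le by (intro mult_right_mono) simp_all
  finally show ?thesis by simp
qed

text \<open>An integral over \<open>\<phi>\<close> of Toeplitz forms with symbol
  \<open>g0 (\<phi>, t)\<close>. Each is a positive multiple of the integral of
  \<open>(cmod (V t))\<^sup>2 * g0 (\<phi>, t)\<close> for a trigonometric polynomial
  \<open>V\<close> built from \<open>v\<close>, and \<open>Im g0\<close> is positive.\<close>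

lemma Mt_pos: "0 \<le> Im (qf S v Mt v)"
proof -
  define T where "T \<phi> = (\<Sum>j\<in>S. \<Sum>l\<in>S. cnj (v j) * (if qb j = qb l then of_real (w (qb j) \<phi>) * m \<phi> (l - j) else 0) * v l)" for \<phi>
  have i1: "integrable U (\<lambda>\<phi>. if qb j = qb l then of_real (w (qb j) \<phi>) * m \<phi> (l - j) else 0)" for j l
    using wm_integrable by (cases "qb j = qb l") simp_all
  have Ti: "integrable U T"
    unfolding T_def[abs_def] by (intro Bochner_Integration.integrable_sum integrable_mult_left integrable_mult_right i1)
  have "integral\<^sup>L U T = (\<Sum>j\<in>S. \<Sum>l\<in>S. \<integral>\<phi>. cnj (v j) * (if qb j = qb l then of_real (w (qb j) \<phi>) * m \<phi> (l - j) else 0) * v l \<partial>U)"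
    unfolding T_def[abs_def]
    by (subst Bochner_Integration.integral_sum, intro Bochner_Integration.integrable_sum integrable_mult_left integrable_mult_right i1)
      (intro sum.cong refl Bochner_Integration.integral_sum integrable_mult_left integrable_mult_right i1)
  also have "\<dots> = qf S v Mt v"
    unfolding qf_expand by (intro sum.cong refl) (simp add: Mt_def)
  finally have q: "qf S v Mt v = integral\<^sup>L U T" by simp
  have "0 \<le> Im (T \<phi>)" if \<phi>: "\<phi> \<in> {0..<1}" for \<phi>
  proof -
    define A where "A = {j\<in>S. qb j = fl n N \<phi>}"
    define V where "V t = (\<Sum>l\<in>A. v l * ee (- l) t)" for t
    have finA: "finite A" by (rule finite_subset[of _ S]) (auto simp: A_def)
    have gi: "integrable U (\<lambda>t. g0 (\<phi>, t) * ee k t)" for k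
    proof (rule integrable_U[where B = "1 / Im z"])
      show "(\<lambda>t. g0 (\<phi>, t) * ee k t) \<in> borel_measurable U" using g0_sec[OF \<phi>] by measurable
      show "norm (g0 (\<phi>, t) * ee k t) \<le> 1 / Im z" if "t \<in> {0..<1}" for t
        using g0_bound[OF \<phi> that] by (simp add: norm_mult)
    qed
    have "T \<phi> = (\<Sum>j\<in>S. \<Sum>l\<in>S. if j \<in> A \<and> l \<in> A then of_real (real N / real n) * (cnj (v j) * v l * m \<phi> (l - j)) else 0)"
      unfolding T_def by (intro sum.cong refl) (auto simp: w_def A_def)
    also have "\<dots> = (\<Sum>j\<in>A. \<Sum>l\<in>A. of_real (real N / real n) * (cnj (v j) * v l * m \<phi> (l - j)))"
    proof -
      have "(\<Sum>l\<in>S. if j \<in> A \<and> l \<in> A then f l else 0) = (if j \<in> A then \<Sum>l\<in>A. f l else 0)" for j and f :: "int \<Rightarrow> complex"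
      proof (cases "j \<in> A")
        case True
        have "(\<Sum>l\<in>S. if l \<in> A then f l else 0) = (\<Sum>l\<in>{l\<in>S. l \<in> A}. f l)"
          by (rule sum.inter_filter[symmetric]) simp
        also have "{l\<in>S. l \<in> A} = A" by (auto simp: A_def)
        finally show ?thesis using True by simp
      qed simp
      then have "(\<Sum>j\<in>S. \<Sum>l\<in>S. if j \<in> A \<and> l \<in> A then of_real (real N / real n) * (cnj (v j) * v l * m \<phi> (l - j)) else 0)
         = (\<Sum>j\<in>S. if j \<in> A then \<Sum>l\<in>A. of_real (real N / real n) * (cnj (v j) * v l * m \<phi> (l - j)) else 0)" by simp
      also have "\<dots> = (\<Sum>j\<in>{j\<in>S. j \<in> A}. \<Sum>l\<in>A. of_real (real N / real n) * (cnj (v j) * v l * m \<phi> (l - j)))"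
        by (rule sum.inter_filter[symmetric]) simp
      also have "{j\<in>S. j \<in> A} = A" by (auto simp: A_def)
      finally show ?thesis .
    qed
    also have "\<dots> = of_real (real N / real n) * (\<Sum>j\<in>A. \<Sum>l\<in>A. \<integral>t. cnj (v j) * v l * (g0 (\<phi>, t) * ee (- (l - j)) t) \<partial>U)"
      by (simp only: sum_distrib_left m_def cf_def integral_mult_right_zero)
    also have "(\<Sum>j\<in>A. \<Sum>l\<in>A. \<integral>t. cnj (v j) * v l * (g0 (\<phi>, t) * ee (- (l - j)) t) \<partial>U)
       = (\<integral>t. (\<Sum>j\<in>A. \<Sum>l\<in>A. cnj (v j) * v l * (g0 (\<phi>, t) * ee (- (l - j)) t)) \<partial>U)"
      by (subst Bochner_Integration.integral_sum, intro Bochner_Integration.integrable_sum integrable_mult_right gi)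
        (intro sum.cong refl Bochner_Integration.integral_sum[symmetric] integrable_mult_right gi)
    finally have T: "T \<phi> = of_real (real N / real n) * (\<integral>t. (\<Sum>j\<in>A. \<Sum>l\<in>A. cnj (v j) * v l * (g0 (\<phi>, t) * ee (- (l - j)) t)) \<partial>U)" .
    have int: "integrable U (\<lambda>t. (\<Sum>j\<in>A. \<Sum>l\<in>A. cnj (v j) * v l * (g0 (\<phi>, t) * ee (- (l - j)) t)))"
      by (intro Bochner_Integration.integrable_sum integrable_mult_right gi)
    have pt: "0 \<le> Im (\<Sum>j\<in>A. \<Sum>l\<in>A. cnj (v j) * v l * (g0 (\<phi>, t) * ee (- (l - j)) t))" if t: "t \<in> {0..<1}" for t
    proof -
      have "(\<Sum>j\<in>A. \<Sum>l\<in>A. cnj (v j) * v l * (g0 (\<phi>, t) * ee (- (l - j)) t)) = (cnj (V t) * V t) * g0 (\<phi>, t)"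
      proof -
        have "(cnj (V t) * V t) * g0 (\<phi>, t) = (\<Sum>j\<in>A. \<Sum>l\<in>A. cnj (v j * ee (- j) t) * (v l * ee (- l) t)) * g0 (\<phi>, t)"
          by (simp only: V_def cnj_sum sum_product)
        also have "\<dots> = (\<Sum>j\<in>A. \<Sum>l\<in>A. cnj (v j * ee (- j) t) * (v l * ee (- l) t) * g0 (\<phi>, t))"
          by (simp only: sum_distrib_right)
        also have "\<dots> = (\<Sum>j\<in>A. \<Sum>l\<in>A. cnj (v j) * v l * (g0 (\<phi>, t) * ee (- (l - j)) t))"
        proof (intro sum.cong refl)
        fix j l
        have "ee (- (l - j)) t = ee j t * ee (- l) t" by (simp add: ee_mult)
        moreover have "cnj (v j * ee (- j) t) = cnj (v j) * ee j t" by (simp add: cnj_ee)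
        ultimately show "cnj (v j * ee (- j) t) * (v l * ee (- l) t) * g0 (\<phi>, t) = cnj (v j) * v l * (g0 (\<phi>, t) * ee (- (l - j)) t)"
          by (simp only: mult_ac)
        qed
        finally show ?thesis by (rule sym)
      qed
      also have "cnj (V t) * V t = of_real ((cmod (V t))\<^sup>2)"
        by (metis complex_norm_square mult.commute)
      finally have "Im (\<Sum>j\<in>A. \<Sum>l\<in>A. cnj (v j) * v l * (g0 (\<phi>, t) * ee (- (l - j)) t)) = (cmod (V t))\<^sup>2 * Im (g0 (\<phi>, t))"
        by simp
      moreover obtain \<delta> where "\<delta> > 0" "\<And>\<theta> t. \<theta> \<in> {0..<1} \<Longrightarrow> t \<in> {0..<1} \<Longrightarrow> \<delta> \<le> Im (g0 (\<theta>, t))"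
        using g0_Im by blast
      then have "0 \<le> Im (g0 (\<phi>, t))" using \<phi> t by (meson less_imp_le order_trans)
      ultimately show ?thesis by simp
    qed
    have "Im (\<integral>t. (\<Sum>j\<in>A. \<Sum>l\<in>A. cnj (v j) * v l * (g0 (\<phi>, t) * ee (- (l - j)) t)) \<partial>U) \<ge> 0"
      unfolding integral_Im[OF int, symmetric] using pt by (intro integral_nonneg_AE AE_I2) simp
    moreover have "Im (of_real c * X) = c * Im X" for c X by simp
    ultimately show ?thesis unfolding T by (simp only: mult_nonneg_nonneg divide_nonneg_nonneg of_nat_0_le_iff)
  qed
  then have "0 \<le> (\<integral>\<phi>. Im (T \<phi>) \<partial>U)" by (intro integral_nonneg_AE AE_I2) simp
  then show ?thesis unfolding q integral_Im[OF Ti] .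
qed

end

lemma sum_band:
  fixes f :: "int \<Rightarrow> 'b::comm_monoid_add"
  assumes "finite A" "finite B" "\<And>l. l \<in> A \<Longrightarrow> l - j \<notin> B \<Longrightarrow> f l = 0"
  shows "(\<Sum>l\<in>A. f l) = (\<Sum>k\<in>B. if j + k \<in> A then f (j + k) else 0)"
proof -
  have "(\<Sum>l\<in>A. f l) = (\<Sum>l\<in>{l\<in>A. l - j \<in> B}. f l)"
    using assms by (intro sum.mono_neutral_right) auto
  also have "\<dots> = (\<Sum>k\<in>{k\<in>B. j + k \<in> A}. f (j + k))"
    by (rule sum.reindex_bij_witness[of _ "\<lambda>k. j + k" "\<lambda>l. l - j"]) auto
  also have "\<dots> = (\<Sum>k\<in>B. if j + k \<in> A then f (j + k) else 0)"
    by (rule sum.inter_filter[OF assms(2)])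
  finally show ?thesis .
qed

lemma norm_sum_sq_le:
  fixes f :: "'b \<Rightarrow> complex"
  shows "(cmod (\<Sum>k\<in>B. f k))\<^sup>2 \<le> real (card B) * (\<Sum>k\<in>B. (cmod (f k))\<^sup>2)"
proof -
  have "(cmod (\<Sum>k\<in>B. f k))\<^sup>2 \<le> (\<Sum>k\<in>B. cmod (f k))\<^sup>2" by (intro power_mono norm_sum) simp
  also have "\<dots> \<le> (\<Sum>k\<in>B. (cmod (f k))\<^sup>2) * real (card B)" by (rule sum_squared_le_sum_of_squares)
  finally show ?thesis by (simp only: mult.commute)
qed

section \<open>Trace and self-energy of the block matrix\<close>

context discretization
begin

lemma fl_nonneg: "\<phi> \<in> {0..<1} \<Longrightarrow> 0 \<le> fl n N \<phi>"
  unfolding fl_def by (simp add: zero_le_floor)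

text \<open>Density, in the position variable, of the matrix rows. It equals \<open>N\<close>
  wherever the block of \<open>\<phi>\<close> is complete, so dividing the trace of
  \<open>Mt\<close> by \<open>N\<close> recovers the integral of \<open>m\<close> there.\<close>

definition cs :: "real \<Rightarrow> real" where "cs \<phi> = (\<Sum>j\<in>S. w (qb j) \<phi>)"

lemma cs_eq: "cs \<phi> = real N / real n * real (card {j\<in>S. qb j = fl n N \<phi>})"
proof -
  have "cs \<phi> = (\<Sum>j\<in>S. if qb j = fl n N \<phi> then real N / real n else 0)"
    unfolding cs_def by (intro sum.cong refl) (auto simp: w_def)
  also have "\<dots> = (\<Sum>j\<in>{j\<in>S. qb j = fl n N \<phi>}. real N / real n)"
    by (rule sum.inter_filter[symmetric]) simp
  finally show ?thesis by simp
qed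

lemma block_subset: "{j\<in>S. qb j = q} \<subseteq> {int n * q + 1..int n * q + int n}"
  using qb_iff by blast

lemma cs_nonneg: "0 \<le> cs \<phi>" unfolding cs_eq by simp

lemma cs_le: "cs \<phi> \<le> real N"
proof -
  have "card {j\<in>S. qb j = fl n N \<phi>} \<le> card {int n * fl n N \<phi> + 1..int n * fl n N \<phi> + int n}"
    by (rule card_mono[OF _ block_subset]) simp
  then have "real (card {j\<in>S. qb j = fl n N \<phi>}) \<le> real n" by simp
  then have "real N / real n * real (card {j\<in>S. qb j = fl n N \<phi>}) \<le> real N / real n * real n"
    by (intro mult_left_mono) simp_all
  then show ?thesis unfolding cs_eq using n1 by simp
qed

lemma cs_full:
  assumes "0 \<le> fl n N \<phi>" "(fl n N \<phi> + 1) * int n \<le> int N"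
  shows "cs \<phi> = real N"
proof -
  let ?q = "fl n N \<phi>"
  have nq: "0 \<le> int n * ?q" using assms(1) by simp
  have nq2: "int n * ?q + int n \<le> int N" using assms(2) by (simp add: algebra_simps)
  have "{j\<in>S. qb j = ?q} = {int n * ?q + 1..int n * ?q + int n}"
  proof (intro subset_antisym block_subset subsetI)
    fix j assume j: "j \<in> {int n * ?q + 1..int n * ?q + int n}"
    then have "qb j = ?q" by (simp only: qb_iff)
    moreover have "1 \<le> j" "j \<le> int N" using j nq nq2 unfolding atLeastAtMost_iff by linarith+
    ultimately show "j \<in> {j\<in>S. qb j = ?q}" by simp
  qed
  then show ?thesis unfolding cs_eq using n1 by simp
qed

lemma cs_meas [measurable]: "cs \<in> borel_measurable U"
  unfolding cs_def[abs_def] by measurable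

lemma m0_integrable: "integrable U (\<lambda>\<phi>. m \<phi> 0)"
  by (rule integrable_U[where B = "1 / Im z"]) (simp_all only: m_meas m_bound)

text \<open>\<open>cs / N\<close> can differ from 1 only on the last stretch of length
  \<open>n / N\<close>, where the block may be incomplete; there the integrand is almost everywhere
  at most \<open>\<Gamma>\<close>.\<close>

lemma ntr_Mt: "cmod (ntr S Mt - trT m) \<le> \<Gamma> * (real n / real N)"
proof -
  have "(\<Sum>j\<in>S. Mt j j) = (\<Sum>j\<in>S. \<integral>\<phi>. of_real (w (qb j) \<phi>) * m \<phi> 0 \<partial>U)" by (simp add: Mt_def)
  also have "\<dots> = (\<integral>\<phi>. (\<Sum>j\<in>S. of_real (w (qb j) \<phi>) * m \<phi> 0) \<partial>U)"
    by (intro Bochner_Integration.integral_sum[symmetric] wm_integrable)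
  also have "\<dots> = (\<integral>\<phi>. of_real (cs \<phi>) * m \<phi> 0 \<partial>U)"
    by (simp only: cs_def of_real_sum sum_distrib_right)
  finally have s: "(\<Sum>j\<in>S. Mt j j) = (\<integral>\<phi>. of_real (cs \<phi>) * m \<phi> 0 \<partial>U)" .
  have ci: "integrable U (\<lambda>\<phi>. of_real (cs \<phi>) * m \<phi> 0)"
    unfolding cs_def of_real_sum sum_distrib_right by (intro Bochner_Integration.integrable_sum wm_integrable)
  have t: "trT m = (\<integral>\<phi>. m \<phi> 0 \<partial>U)" unfolding trT_def integral_U ..
  have "ntr S Mt - trT m = (\<integral>\<phi>. of_real (cs \<phi>) * m \<phi> 0 / of_nat N \<partial>U) - (\<integral>\<phi>. m \<phi> 0 \<partial>U)"
    unfolding ntr_def s t by simp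
  also have "\<dots> = (\<integral>\<phi>. of_real (cs \<phi>) * m \<phi> 0 / of_nat N - m \<phi> 0 \<partial>U)"
    using ci m0_integrable by (intro Bochner_Integration.integral_diff[symmetric] integrable_divide_zero) simp_all
  finally have e: "ntr S Mt - trT m = (\<integral>\<phi>. of_real (cs \<phi>) * m \<phi> 0 / of_nat N - m \<phi> 0 \<partial>U)" .
  let ?I = "{1 - real n / real N..<1}"
  have "cmod (ntr S Mt - trT m) \<le> (\<integral>\<phi>. cmod (of_real (cs \<phi>) * m \<phi> 0 / of_nat N - m \<phi> 0) \<partial>U)"
    unfolding e by (rule integral_norm_bound)
  also have "\<dots> \<le> (\<integral>\<phi>. \<Gamma> * indicator ?I \<phi> \<partial>U)"
  proof (rule integral_mono_AE)
    show "integrable U (\<lambda>\<phi>. cmod (of_real (cs \<phi>) * m \<phi> 0 / of_nat N - m \<phi> 0))"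
      using ci m0_integrable by (intro integrable_norm Bochner_Integration.integrable_diff integrable_divide_zero) simp_all
    show "integrable U (\<lambda>\<phi>. \<Gamma> * indicator ?I \<phi>)"
    proof (intro integrable_mult_right integrable_U[where B = 1])
      show "(indicator ?I :: real \<Rightarrow> real) \<in> borel_measurable U" by (rule measurable_U) simp
    qed simp
    show "AE \<phi> in U. cmod (of_real (cs \<phi>) * m \<phi> 0 / of_nat N - m \<phi> 0) \<le> \<Gamma> * indicator ?I \<phi>"
      using AE_Gd
    proof eventually_elim
      case (elim \<phi>)
      have \<phi>1: "\<phi> \<in> {0..<1}" using elim by (rule Gd_01)
      have fac: "of_real (cs \<phi>) * m \<phi> 0 / of_nat N - m \<phi> 0 = of_real (cs \<phi> / real N - 1) * m \<phi> 0"
        by (simp add: left_diff_distrib)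
      show ?case
      proof (cases "\<phi> \<in> ?I")
        case True
        have "0 \<le> cs \<phi> / real N" "cs \<phi> / real N \<le> 1" using cs_nonneg[of \<phi>] cs_le[of \<phi>] N1 by simp_all
        then have "\<bar>cs \<phi> / real N - 1\<bar> \<le> 1" by linarith
        then have "\<bar>cs \<phi> / real N - 1\<bar> * cmod (m \<phi> 0) \<le> 1 * \<Gamma>"
          using m_strong[OF elim, of 0] by (intro mult_mono) simp_all
        then show ?thesis unfolding fac norm_mult norm_of_real using True by simp
      next
        case False
        then have lt: "\<phi> < 1 - real n / real N" using \<phi>1 by simp
        have "real_of_int (fl n N \<phi>) \<le> \<phi> * real N / real n" unfolding fl_def by (rule of_int_floor_le)
        then have "real_of_int (fl n N \<phi>) * real n \<le> \<phi> * real N" using n1 by (simp add: le_divide_eq)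
        also have "\<phi> * real N \<le> (1 - real n / real N) * real N" using lt by (intro mult_right_mono) simp_all
        also have "\<dots> = real N - real n" using N1 by (simp add: left_diff_distrib)
        finally have "real_of_int ((fl n N \<phi> + 1) * int n) \<le> real_of_int (int N)" by (simp add: distrib_right)
        then have "(fl n N \<phi> + 1) * int n \<le> int N" by (simp only: of_int_le_iff)
        then have "cs \<phi> = real N" by (rule cs_full[OF fl_nonneg[OF \<phi>1]])
        then show ?thesis unfolding fac using False N1 by simp
      qed
    qed
  qed
  also have "\<dots> = \<Gamma> * measure U (?I \<inter> {0..<1})" by simp
  also have "measure U (?I \<inter> {0..<1}) = measure lborel (?I \<inter> {0..<1})"
    unfolding U_def by (rule measure_restrict_space) simp_all
  also have "?I \<inter> {0..<1} = ?I"
  proof -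
    have "real n / real N \<le> 1" using nN N1 by simp
    then show ?thesis by (intro Int_absorb2 subsetI) simp
  qed
  also have "measure lborel ?I = real n / real N"
  proof -
    have "0 \<le> real n / real N" by simp
    then show ?thesis by (subst measure_lborel_Ico) linarith+
  qed
  finally show ?thesis .
qed

definition Xm :: "int \<Rightarrow> int \<Rightarrow> complex" where
  "Xm i k = (\<Sum>j\<in>S. \<Sum>l\<in>S. of_real (xz N i j k l) * Mt j l) / of_nat N"

text \<open>Mean of the covariance along offset \<open>l\<close> inside block \<open>q\<close>.
  Pairs that leave the block are dropped because \<open>Mt\<close> vanishes between blocks, while
  the divisor remains \<open>n\<close>.\<close>

definition Av :: "int \<Rightarrow> int \<Rightarrow> int \<Rightarrow> int \<Rightarrow> real" where
  "Av i k l q = (\<Sum>b\<in>{1..int n}. if b + l \<in> {1..int n} then xc N i (int n * q + b) k (int n * q + b + l) else 0) / real n"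

lemma Av_meas [measurable]: "(\<lambda>\<phi>. Av i k l (fl n N \<phi>)) \<in> borel_measurable U"
  by (rule measurable_compose[OF fl_meas]) simp

lemma Av_bound: "\<bar>Av i k l q\<bar> \<le> 1"
proof -
  have "\<bar>\<Sum>b\<in>{1..int n}. if b + l \<in> {1..int n} then xc N i (int n * q + b) k (int n * q + b + l) else 0\<bar> \<le> (\<Sum>b\<in>{1..int n}. 1)"
    by (intro order_trans[OF sum_abs] sum_mono) (simp add: xc_bound)
  then show ?thesis unfolding Av_def using n1 by (simp add: divide_le_eq)
qed

lemma Av_integrable: "integrable U (\<lambda>\<phi>. of_real (Av i k l (fl n N \<phi>)) * m \<phi> l')"
proof (rule integrable_U[where B = "1 * (1 / Im z)"])
  show "norm (complex_of_real (Av i k l (fl n N \<phi>)) * m \<phi> l') \<le> 1 * (1 / Im z)" if "\<phi> \<in> {0..<1}" for \<phi>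
    unfolding norm_mult norm_of_real using Av_bound m_bound[OF that] by (intro mult_mono) simp_all
qed measurable

lemma block_sum:
  assumes ik: "i \<in> S" "k \<in> S"
  shows "(\<Sum>j\<in>S. if j + l \<in> S \<and> qb j = qb (j + l) then xz N i j k (j + l) * w (qb j) \<phi> else 0)
     = real N * Av i k l (fl n N \<phi>)"
proof -
  let ?q = "fl n N \<phi>"
  let ?B = "{int n * ?q + 1..int n * ?q + int n}"
  let ?g = "\<lambda>j. if j + l \<in> ?B then xc N i j k (j + l) else 0"
  have "(\<Sum>j\<in>S. if j + l \<in> S \<and> qb j = qb (j + l) then xz N i j k (j + l) * w (qb j) \<phi> else 0)
      = (\<Sum>j\<in>S. if j \<in> ?B then ?g j * (real N / real n) else 0)"
  proof (intro sum.cong refl)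
    fix j assume j: "j \<in> S"
    show "(if j + l \<in> S \<and> qb j = qb (j + l) then xz N i j k (j + l) * w (qb j) \<phi> else 0)
        = (if j \<in> ?B then ?g j * (real N / real n) else 0)"
    proof (cases "qb j = ?q")
      case True
      have jB: "j \<in> ?B" using True by (rule qb_iff[THEN iffD1])
      have cond: "qb j = qb (j + l) \<longleftrightarrow> j + l \<in> ?B"
        unfolding True eq_commute[of ?q "qb (j + l)"] by (rule qb_iff)
      have wv: "w (qb j) \<phi> = real N / real n" using True by (simp add: w_def)
      have xv: "xc N i j k (j + l) = (if j + l \<in> S then xz N i j k (j + l) else 0)" using ik j by (simp add: xc_def)
      show ?thesis unfolding cond wv xv using jB
        by (cases "j + l \<in> S"; cases "j + l \<in> ?B") (simp_all only: if_True if_False simp_thms mult_zero_left)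
    next
      case False
      then have jB: "j \<notin> ?B" using qb_iff[of j ?q] by blast
      have wv: "w (qb j) \<phi> = 0" using False by (auto simp: w_def)
      show ?thesis unfolding wv using jB by (simp only: if_False mult_zero_right if_cancel)
    qed
  qed
  also have "\<dots> = (\<Sum>j\<in>{j\<in>S. j \<in> ?B}. ?g j * (real N / real n))"
    by (rule sum.inter_filter[symmetric]) simp
  also have "\<dots> = (\<Sum>j\<in>?B. ?g j * (real N / real n))"
  proof (rule sum.mono_neutral_left)
    show "\<forall>j\<in>?B - {j\<in>S. j \<in> ?B}. ?g j * (real N / real n) = 0"
    proof
      fix j assume "j \<in> ?B - {j\<in>S. j \<in> ?B}"
      then have "j \<notin> S" by blast
      then have "xc N i j k (j + l) = 0" unfolding xc_def by (simp del: atLeastAtMost_iff)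
      then show "?g j * (real N / real n) = 0" by (simp del: atLeastAtMost_iff)
    qed
  qed (simp, blast)
  also have "\<dots> = (\<Sum>b\<in>{1..int n}. (if b + l \<in> {1..int n} then xc N i (int n * ?q + b) k (int n * ?q + b + l) else 0) * (real N / real n))"
    by (rule sum.reindex_bij_witness[of _ "\<lambda>b. int n * ?q + b" "\<lambda>j. j - int n * ?q"]) (auto simp: algebra_simps)
  also have "\<dots> = real N * Av i k l ?q"
    unfolding Av_def sum_distrib_right[symmetric] by (simp only: times_divide_eq_right times_divide_eq_left mult.commute)
  finally show ?thesis .
qed

text \<open>Inside a block \<open>Mt j (j + l)\<close> does not depend on \<open>j\<close>, so the
  sum over \<open>j\<close> falls on the covariance alone and produces \<open>Av\<close>.\<close>

lemma Xm_formula: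
  assumes ik: "i \<in> S" "k \<in> S"
  shows "Xm i k = (\<integral>\<phi>. (\<Sum>l\<in>Kb. of_real (Av i k l (fl n N \<phi>)) * m \<phi> l) \<partial>U)"
proof -
  let ?f = "\<lambda>j l \<phi>. complex_of_real (if j + l \<in> S \<and> qb j = qb (j + l) then xz N i j k (j + l) * w (qb j) \<phi> else 0) * m \<phi> l"
  have fi: "integrable U (?f j l)" for j l
  proof (cases "j + l \<in> S \<and> qb j = qb (j + l)")
    case True
    have "integrable U (\<lambda>\<phi>. of_real (xz N i j k (j + l)) * (of_real (w (qb j) \<phi>) * m \<phi> l))"
      by (intro integrable_mult_right wm_integrable)
    then show ?thesis using True by (simp add: mult.assoc del: atLeastAtMost_iff)
  next
    case False
    then show ?thesis by (simp only: if_False of_real_0 mult_zero_left) simp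
  qed
  have "(\<Sum>l\<in>S. of_real (xz N i j k l) * Mt j l) = (\<Sum>l\<in>Kb. \<integral>\<phi>. ?f j l \<phi> \<partial>U)" if j: "j \<in> S" for j
  proof -
    have "(\<Sum>l\<in>S. of_real (xz N i j k l) * Mt j l) = (\<Sum>l\<in>Kb. if j + l \<in> S then of_real (xz N i j k (j + l)) * Mt j (j + l) else 0)"
    proof (rule sum_band)
      fix l assume l: "l \<in> S" "l - j \<notin> Kb"
      then have "int K < \<bar>l - j\<bar>" by (auto simp: Kb_def)
      then have "xz N i j k l = 0" using xz_band[OF ik(1) j ik(2) l(1)] by blast
      then show "of_real (xz N i j k l) * Mt j l = 0" by simp
    qed (simp_all add: card_Kb)
    also have "\<dots> = (\<Sum>l\<in>Kb. \<integral>\<phi>. ?f j l \<phi> \<partial>U)"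
    proof (intro sum.cong refl)
      fix l
      show "(if j + l \<in> S then of_real (xz N i j k (j + l)) * Mt j (j + l) else 0) = (\<integral>\<phi>. ?f j l \<phi> \<partial>U)"
      proof (cases "j + l \<in> S \<and> qb j = qb (j + l)")
        case True
        then have "(\<integral>\<phi>. ?f j l \<phi> \<partial>U) = (\<integral>\<phi>. of_real (xz N i j k (j + l)) * (of_real (w (qb j) \<phi>) * m \<phi> l) \<partial>U)"
          by (simp add: mult.assoc del: atLeastAtMost_iff)
        also have "\<dots> = of_real (xz N i j k (j + l)) * Mt j (j + l)" using True by (simp add: Mt_def)
        finally show ?thesis using True by (simp only: if_True simp_thms)
      next
        case False
        then have "(\<integral>\<phi>. ?f j l \<phi> \<partial>U) = 0" by (simp only: if_False of_real_0 mult_zero_left) simp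
        moreover have "(if j + l \<in> S then of_real (xz N i j k (j + l)) * Mt j (j + l) else 0) = 0"
          using False by (auto simp: Mt_def simp del: atLeastAtMost_iff)
        ultimately show ?thesis by simp
      qed
    qed
    finally show ?thesis .
  qed
  then have "(\<Sum>j\<in>S. \<Sum>l\<in>S. of_real (xz N i j k l) * Mt j l) = (\<Sum>j\<in>S. \<Sum>l\<in>Kb. \<integral>\<phi>. ?f j l \<phi> \<partial>U)" by (rule sum.cong[OF refl])
  also have "\<dots> = (\<Sum>l\<in>Kb. \<Sum>j\<in>S. \<integral>\<phi>. ?f j l \<phi> \<partial>U)" by (rule sum.swap)
  also have "\<dots> = (\<Sum>l\<in>Kb. \<integral>\<phi>. (\<Sum>j\<in>S. ?f j l \<phi>) \<partial>U)"
    by (intro sum.cong refl Bochner_Integration.integral_sum[symmetric] fi)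
  also have "\<dots> = (\<Sum>l\<in>Kb. \<integral>\<phi>. of_nat N * (of_real (Av i k l (fl n N \<phi>)) * m \<phi> l) \<partial>U)"
  proof (intro sum.cong refl Bochner_Integration.integral_cong)
    fix l \<phi>
    have "(\<Sum>j\<in>S. ?f j l \<phi>) = of_real (\<Sum>j\<in>S. if j + l \<in> S \<and> qb j = qb (j + l) then xz N i j k (j + l) * w (qb j) \<phi> else 0) * m \<phi> l"
      by (simp only: of_real_sum sum_distrib_right)
    also have "\<dots> = of_nat N * (of_real (Av i k l (fl n N \<phi>)) * m \<phi> l)"
      unfolding block_sum[OF ik] by simp
    finally show "(\<Sum>j\<in>S. ?f j l \<phi>) = of_nat N * (of_real (Av i k l (fl n N \<phi>)) * m \<phi> l)" .
  qed
  also have "\<dots> = of_nat N * (\<Sum>l\<in>Kb. \<integral>\<phi>. of_real (Av i k l (fl n N \<phi>)) * m \<phi> l \<partial>U)"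
    by (simp only: integral_mult_right_zero sum_distrib_left)
  also have "(\<Sum>l\<in>Kb. \<integral>\<phi>. of_real (Av i k l (fl n N \<phi>)) * m \<phi> l \<partial>U) = (\<integral>\<phi>. (\<Sum>l\<in>Kb. of_real (Av i k l (fl n N \<phi>)) * m \<phi> l) \<partial>U)"
    by (intro Bochner_Integration.integral_sum[symmetric] Av_integrable)
  finally show ?thesis unfolding Xm_def using N1 by simp
qed

lemma u_formula: "u \<theta> k = (\<integral>\<phi>. (\<Sum>l\<in>Kb. of_real (\<psi>t \<theta> \<phi> k l) * m \<phi> l) \<partial>U)"
  unfolding u_def by (intro Bochner_Integration.integral_sum[symmetric] \<psi>m_integrable)

lemma kernel_bound:
  assumes i: "integrable U (\<lambda>\<phi>. \<Sum>l\<in>Kb. of_real (c l \<phi>) * m \<phi> l)" and H: "integrable U H"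
    and b: "\<And>\<phi>. \<phi> \<in> Gd \<Longrightarrow> (\<Sum>l\<in>Kb. \<bar>c l \<phi>\<bar>) \<le> H \<phi>"
  shows "cmod (\<integral>\<phi>. (\<Sum>l\<in>Kb. of_real (c l \<phi>) * m \<phi> l) \<partial>U) \<le> \<Gamma> * integral\<^sup>L U H"
proof -
  have "cmod (\<integral>\<phi>. (\<Sum>l\<in>Kb. of_real (c l \<phi>) * m \<phi> l) \<partial>U) \<le> (\<integral>\<phi>. cmod (\<Sum>l\<in>Kb. of_real (c l \<phi>) * m \<phi> l) \<partial>U)"
    by (rule integral_norm_bound)
  also have "\<dots> \<le> (\<integral>\<phi>. \<Gamma> * H \<phi> \<partial>U)"
  proof (rule integral_mono_AE)
    show "integrable U (\<lambda>\<phi>. cmod (\<Sum>l\<in>Kb. of_real (c l \<phi>) * m \<phi> l))" by (rule integrable_norm[OF i])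
    show "integrable U (\<lambda>\<phi>. \<Gamma> * H \<phi>)" by (intro integrable_mult_right H)
    show "AE \<phi> in U. cmod (\<Sum>l\<in>Kb. of_real (c l \<phi>) * m \<phi> l) \<le> \<Gamma> * H \<phi>"
      using AE_Gd
    proof eventually_elim
      case (elim \<phi>)
      have "cmod (\<Sum>l\<in>Kb. of_real (c l \<phi>) * m \<phi> l) \<le> (\<Sum>l\<in>Kb. \<bar>c l \<phi>\<bar> * \<Gamma>)"
      proof (intro order_trans[OF norm_sum] sum_mono)
        fix l
        show "cmod (of_real (c l \<phi>) * m \<phi> l) \<le> \<bar>c l \<phi>\<bar> * \<Gamma>"
          unfolding norm_mult norm_of_real by (intro mult_left_mono m_strong[OF elim]) simp
      qed
      also have "\<dots> = (\<Sum>l\<in>Kb. \<bar>c l \<phi>\<bar>) * \<Gamma>" by (simp only: sum_distrib_right)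
      also have "\<dots> \<le> H \<phi> * \<Gamma>" using \<Gamma>_pos by (intro mult_right_mono b[OF elim]) simp
      finally show ?case by (simp only: mult.commute)
    qed
  qed
  also have "\<dots> = \<Gamma> * integral\<^sup>L U H" by simp
  finally show ?thesis .
qed

lemma Xm_le: "i \<in> S \<Longrightarrow> k \<in> S \<Longrightarrow> cmod (Xm i k) \<le> (2 * real K + 1) * \<Gamma>"
proof -
  assume ik: "i \<in> S" "k \<in> S"
  have "cmod (Xm i k) \<le> \<Gamma> * (\<integral>\<phi>. 2 * real K + 1 \<partial>U)"
    unfolding Xm_formula[OF ik]
  proof (rule kernel_bound)
    show "integrable U (\<lambda>\<phi>. \<Sum>l\<in>Kb. of_real (Av i k l (fl n N \<phi>)) * m \<phi> l)"
      by (intro Bochner_Integration.integrable_sum Av_integrable)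
    show "(\<Sum>l\<in>Kb. \<bar>Av i k l (fl n N \<phi>)\<bar>) \<le> 2 * real K + 1" for \<phi>
      using sum_bounded_above[of Kb "\<lambda>l. \<bar>Av i k l (fl n N \<phi>)\<bar>" 1] Av_bound by (simp add: card_Kb)
  qed simp
  then show ?thesis by (simp add: mult.commute)
qed

lemma u_strong: "cmod (u \<theta> k) \<le> (2 * real K + 1) * \<Gamma>"
proof -
  have "cmod (u \<theta> k) \<le> \<Gamma> * (\<integral>\<phi>. 2 * real K + 1 \<partial>U)"
    unfolding u_formula
  proof (rule kernel_bound)
    show "integrable U (\<lambda>\<phi>. \<Sum>l\<in>Kb. of_real (\<psi>t \<theta> \<phi> k l) * m \<phi> l)"
      by (intro Bochner_Integration.integrable_sum \<psi>m_integrable)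
    show "(\<Sum>l\<in>Kb. \<bar>\<psi>t \<theta> \<phi> k l\<bar>) \<le> 2 * real K + 1" for \<phi>
      using sum_bounded_above[of Kb "\<lambda>l. \<bar>\<psi>t \<theta> \<phi> k l\<bar>" 1] \<psi>t_bound by (simp add: card_Kb)
  qed simp
  then show ?thesis by (simp add: mult.commute)
qed

text \<open>Boundary loss of a block: for each of the \<open>2 * K + 1\<close> offsets at most
  \<open>K\<close> of the \<open>n\<close> positions are moved out of the block.\<close>

definition k1 :: real where "k1 = (2 * real K + 1) * (real K / real n)"

text \<open>Positions \<open>b\<close> with \<open>b + l\<close> inside the block contribute their
  deviation from \<open>\<psi>t\<close>; each of the others contributes at most 1, and
  \<open>k1\<close> counts them. The factor \<open>1 / n\<close> in front of the deviations is given
  up to arrive at \<open>DN\<close>.\<close>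

lemma Av_psi:
  assumes a: "a \<in> {1..int n}" and k: "k \<in> Kb"
  shows "(\<Sum>l\<in>Kb. \<bar>Av (int n * fl n N \<phi>' + a) (int n * fl n N \<phi>' + a + k) l (fl n N \<phi>) - \<psi>t \<phi>' \<phi> k l\<bar>) \<le> DN n N \<phi>' \<phi> + k1"
proof -
  define D where "D b l = \<bar>xc N (int n * fl n N \<phi>' + a) (int n * fl n N \<phi> + b) (int n * fl n N \<phi>' + a + k) (int n * fl n N \<phi> + b + l) - \<psi>t \<phi>' \<phi> k l\<bar>" for b l
  have one: "\<bar>Av (int n * fl n N \<phi>' + a) (int n * fl n N \<phi>' + a + k) l (fl n N \<phi>) - \<psi>t \<phi>' \<phi> k l\<bar> \<le> (\<Sum>b\<in>{1..int n}. D b l) + real K / real n"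
    if l: "l \<in> Kb" for l
  proof -
    let ?X = "\<lambda>b. xc N (int n * fl n N \<phi>' + a) (int n * fl n N \<phi> + b) (int n * fl n N \<phi>' + a + k) (int n * fl n N \<phi> + b + l)"
    have "Av (int n * fl n N \<phi>' + a) (int n * fl n N \<phi>' + a + k) l (fl n N \<phi>) - \<psi>t \<phi>' \<phi> k l
        = ((\<Sum>b\<in>{1..int n}. if b + l \<in> {1..int n} then ?X b else 0) - (\<Sum>b\<in>{1..int n}. \<psi>t \<phi>' \<phi> k l)) / real n"
      unfolding Av_def using n1 by (simp add: diff_divide_distrib)
    also have "\<dots> = (\<Sum>b\<in>{1..int n}. (if b + l \<in> {1..int n} then ?X b else 0) - \<psi>t \<phi>' \<phi> k l) / real n"
      by (simp only: sum_subtractf)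
    finally have "\<bar>Av (int n * fl n N \<phi>' + a) (int n * fl n N \<phi>' + a + k) l (fl n N \<phi>) - \<psi>t \<phi>' \<phi> k l\<bar>
        = \<bar>\<Sum>b\<in>{1..int n}. (if b + l \<in> {1..int n} then ?X b else 0) - \<psi>t \<phi>' \<phi> k l\<bar> / real n" by simp
    also have "\<dots> \<le> (\<Sum>b\<in>{1..int n}. D b l + (if b + l \<notin> {1..int n} then 1 else 0)) / real n"
    proof (intro divide_right_mono order_trans[OF sum_abs] sum_mono)
      fix b
      show "\<bar>(if b + l \<in> {1..int n} then ?X b else 0) - \<psi>t \<phi>' \<phi> k l\<bar> \<le> D b l + (if b + l \<notin> {1..int n} then 1 else 0)"
      proof (cases "b + l \<in> {1..int n}")
        case True
        then show ?thesis unfolding D_def by (simp del: atLeastAtMost_iff)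
      next
        case False
        have "0 \<le> D b l" unfolding D_def by simp
        then show ?thesis using False \<psi>t_bound[of \<phi>' \<phi> k l] by (simp del: atLeastAtMost_iff)
      qed
    qed simp
    also have "\<dots> = (\<Sum>b\<in>{1..int n}. D b l) / real n + real (card {b\<in>{1..int n}. b + l \<notin> {1..int n}}) / real n"
      unfolding sum.distrib add_divide_distrib by (subst sum.inter_filter[symmetric]) simp_all
    also have "\<dots> \<le> (\<Sum>b\<in>{1..int n}. D b l) + real K / real n"
    proof (intro add_mono divide_right_mono)
      have "0 \<le> (\<Sum>b\<in>{1..int n}. D b l)" unfolding D_def by (intro sum_nonneg) simp
      then show "(\<Sum>b\<in>{1..int n}. D b l) / real n \<le> (\<Sum>b\<in>{1..int n}. D b l)"
        using n1 by (simp add: divide_le_eq mult_le_cancel_left1)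
      have "card {b\<in>{1..int n}. b + l \<notin> {1..int n}} = card ({1..int n} - {b\<in>{1..int n}. b + l \<in> {1..int n}})"
        by (rule arg_cong[where f = card]) blast
      also have "\<dots> = card {1..int n} - card {b\<in>{1..int n}. b + l \<in> {1..int n}}"
        by (rule card_Diff_subset, rule finite_subset[of _ "{1..int n}"], blast, simp, blast)
      also have "card {1..int n} = n" by simp
      finally have e: "card {b\<in>{1..int n}. b + l \<notin> {1..int n}} = n - card {b\<in>{1..int n}. b + l \<in> {1..int n}}" .
      have "\<bar>l\<bar> \<le> int K" using l by (auto simp: Kb_def)
      then have "card {b\<in>{1..int n}. b + l \<in> {1..int n}} \<le> n"
        using card_shift_bounds(2)[of l K n] by (simp only: of_nat_le_iff)
      then have "real (card {b\<in>{1..int n}. b + l \<notin> {1..int n}}) = real n - real (card {b\<in>{1..int n}. b + l \<in> {1..int n}})"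
        unfolding e by (rule of_nat_diff)
      moreover have "real n - real K \<le> real (card {b\<in>{1..int n}. b + l \<in> {1..int n}})"
        using l by (intro card_shift_bounds(1)) (auto simp: Kb_def)
      ultimately show "real (card {b\<in>{1..int n}. b + l \<notin> {1..int n}}) \<le> real K" by linarith
    qed simp
    finally show ?thesis .
  qed
  have "(\<Sum>l\<in>Kb. \<bar>Av (int n * fl n N \<phi>' + a) (int n * fl n N \<phi>' + a + k) l (fl n N \<phi>) - \<psi>t \<phi>' \<phi> k l\<bar>)
      \<le> (\<Sum>l\<in>Kb. (\<Sum>b\<in>{1..int n}. D b l) + real K / real n)" by (intro sum_mono one)
  also have "\<dots> = (\<Sum>b\<in>{1..int n}. \<Sum>l\<in>Kb. D b l) + k1"
  proof -
    have "(\<Sum>l\<in>Kb. \<Sum>b\<in>{1..int n}. D b l) = (\<Sum>b\<in>{1..int n}. \<Sum>l\<in>Kb. D b l)" by (rule sum.swap)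
    then show ?thesis unfolding sum.distrib k1_def by (simp add: card_Kb algebra_simps)
  qed
  also have "(\<Sum>b\<in>{1..int n}. \<Sum>l\<in>Kb. D b l) \<le> DN n N \<phi>' \<phi>"
  proof -
    let ?t = "\<lambda>a b k. \<Sum>l\<in>Kb. \<bar>xc N (int n * fl n N \<phi>' + a) (int n * fl n N \<phi> + b) (int n * fl n N \<phi>' + a + k) (int n * fl n N \<phi> + b + l) - \<psi>t \<phi>' \<phi> k l\<bar>"
    have t0: "0 \<le> ?t a b k" for a b k by (intro sum_nonneg) simp
    have "(\<Sum>b\<in>{1..int n}. \<Sum>l\<in>Kb. D b l) = (\<Sum>b\<in>{1..int n}. ?t a b k)" unfolding D_def ..
    also have "\<dots> \<le> (\<Sum>b\<in>{1..int n}. \<Sum>k\<in>Kb. ?t a b k)"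
      using k t0 card_Kb(2) by (intro sum_mono member_le_sum) simp_all
    also have "\<dots> \<le> (\<Sum>a\<in>{1..int n}. \<Sum>b\<in>{1..int n}. \<Sum>k\<in>Kb. ?t a b k)"
      using a t0 by (intro member_le_sum[of a _ "\<lambda>a. \<Sum>b\<in>{1..int n}. \<Sum>k\<in>Kb. ?t a b k"] sum_nonneg) simp_all
    finally show ?thesis unfolding DN_def .
  qed
  finally show ?thesis by simp
qed

lemma Xm_u:
  assumes ik: "i \<in> S" "i + k \<in> S" and k: "k \<in> Kb" and \<phi>: "\<phi>' \<in> Gd" and q: "fl n N \<phi>' = qb i"
  shows "cmod (Xm i (i + k) - u \<phi>' k) \<le> \<Gamma> * (dN n N \<phi>' + k1)"
proof -
  define a where "a = i - int n * qb i"
  have a: "a \<in> {1..int n}" using qb_iff[of i "qb i"] by (simp add: a_def)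
  have ia: "i = int n * fl n N \<phi>' + a" by (simp add: a_def q)
  let ?c = "\<lambda>l \<phi>. Av i (i + k) l (fl n N \<phi>) - \<psi>t \<phi>' \<phi> k l"
  have i1: "integrable U (\<lambda>\<phi>. \<Sum>l\<in>Kb. of_real (Av i (i + k) l (fl n N \<phi>)) * m \<phi> l)"
    by (intro Bochner_Integration.integrable_sum Av_integrable)
  have i2: "integrable U (\<lambda>\<phi>. \<Sum>l\<in>Kb. of_real (\<psi>t \<phi>' \<phi> k l) * m \<phi> l)"
    by (intro Bochner_Integration.integrable_sum \<psi>m_integrable)
  have d: "(\<Sum>l\<in>Kb. of_real (Av i (i + k) l (fl n N \<phi>)) * m \<phi> l) - (\<Sum>l\<in>Kb. of_real (\<psi>t \<phi>' \<phi> k l) * m \<phi> l)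
      = (\<Sum>l\<in>Kb. of_real (?c l \<phi>) * m \<phi> l)" for \<phi>
    by (simp only: sum_subtractf[symmetric] of_real_diff left_diff_distrib)
  have "Xm i (i + k) - u \<phi>' k = (\<integral>\<phi>. (\<Sum>l\<in>Kb. of_real (?c l \<phi>) * m \<phi> l) \<partial>U)"
    unfolding Xm_formula[OF ik] u_formula Bochner_Integration.integral_diff[OF i1 i2, symmetric] d ..
  also have "cmod \<dots> \<le> \<Gamma> * (\<integral>\<phi>. DN n N \<phi>' \<phi> + k1 \<partial>U)"
  proof (rule kernel_bound)
    show "integrable U (\<lambda>\<phi>. \<Sum>l\<in>Kb. of_real (?c l \<phi>) * m \<phi> l)"
      using Bochner_Integration.integrable_diff[OF i1 i2] unfolding d .
    show "integrable U (\<lambda>\<phi>. DN n N \<phi>' \<phi> + k1)"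
      using DN_integrable[OF Gd_01[OF \<phi>]] by (intro Bochner_Integration.integrable_add) simp_all
    show "(\<Sum>l\<in>Kb. \<bar>?c l \<phi>\<bar>) \<le> DN n N \<phi>' \<phi> + k1" for \<phi>
      using Av_psi[OF a k, of \<phi>' \<phi>] unfolding ia[symmetric] .
  qed
  also have "(\<integral>\<phi>. DN n N \<phi>' \<phi> + k1 \<partial>U) = dN n N \<phi>' + k1"
    unfolding dN_def using DN_integrable[OF Gd_01[OF \<phi>]] by simp
  finally show ?thesis .
qed

end

section \<open>The residual of the discretised equation\<close>

context discretization
begin

text \<open>Residual of \<open>Mt\<close>: with \<open>Xm\<close> in the role of \<Xi>(Mt), it would
  vanish on \<open>S\<close> if \<open>Mt\<close> solved the matrix equation exactly.\<close>

definition Er :: "int \<Rightarrow> int \<Rightarrow> complex" where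
  "Er i l = (\<Sum>k\<in>S. ((if i = k then z else 0) + Xm i k) * Mt k l) + (if i = l then 1 else 0)"

definition qx :: "int \<Rightarrow> int \<Rightarrow> complex" where
  "qx i k = (if k = 0 then z else 0) + Xm i (i + k)"

lemma Xm_band: "i \<in> S \<Longrightarrow> k \<in> S \<Longrightarrow> k - i \<notin> Kb \<Longrightarrow> Xm i k = 0"
proof -
  assume ik: "i \<in> S" "k \<in> S" and "k - i \<notin> Kb"
  then have K: "int K < \<bar>k - i\<bar>" by (auto simp: Kb_def)
  have "of_real (xz N i j k l) * Mt j l = 0" if "j \<in> S" "l \<in> S" for j l
    using xz_band[OF ik(1) that(1) ik(2) that(2)] K by simp
  then have "(\<Sum>j\<in>S. \<Sum>l\<in>S. of_real (xz N i j k l) * Mt j l) = 0" by (intro sum.neutral ballI)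
  then show ?thesis unfolding Xm_def by simp
qed

lemma Er_expand:
  assumes i: "i \<in> S"
  shows "Er i l = (\<Sum>k\<in>Kb. if i + k \<in> S then qx i k * Mt (i + k) l else 0) + (if i = l then 1 else 0)"
proof -
  have "(\<Sum>k\<in>S. ((if i = k then z else 0) + Xm i k) * Mt k l)
      = (\<Sum>k\<in>Kb. if i + k \<in> S then ((if i = i + k then z else 0) + Xm i (i + k)) * Mt (i + k) l else 0)"
  proof (rule sum_band)
    fix k assume k: "k \<in> S" "k - i \<notin> Kb"
    then have "i \<noteq> k" using zero_Kb by auto
    then show "((if i = k then z else 0) + Xm i k) * Mt k l = 0" using Xm_band[OF i k] by simp
  qed (simp_all add: card_Kb)
  moreover have "(if i = i + k then z else 0) = (if k = 0 then z else 0)" for k by simp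
  ultimately show ?thesis unfolding Er_def qx_def by (simp only:)
qed

lemma qx_le: "i \<in> S \<Longrightarrow> i + k \<in> S \<Longrightarrow> cmod (qx i k) \<le> cmod z + (2 * real K + 1) * \<Gamma>"
  unfolding qx_def using Xm_le[of i "i + k"] norm_triangle_ineq[of z "Xm i (i + k)"]
  by (cases "k = 0") (simp_all, metis add_increasing norm_ge_zero)

definition Brow :: real where
  "Brow = 2 * ((2 * real K + 1) * ((2 * real K + 1) * ((cmod z + (2 * real K + 1) * \<Gamma>)\<^sup>2 * \<Gamma>\<^sup>2))) + 2"

text \<open>A crude bound for every row, from the band structure and \<open>Mt_row\<close>. It is
  spent on the few rows that are not \<open>good\<close>; its constant involves only
  \<open>K\<close>, \<open>cmod z\<close> and \<open>\<Gamma>\<close>.\<close>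

lemma Er_row:
  assumes i: "i \<in> S"
  shows "(\<Sum>l\<in>S. (cmod (Er i l))\<^sup>2) \<le> Brow"
proof -
  let ?a = "\<lambda>l k. if i + k \<in> S then qx i k * Mt (i + k) l else 0"
  let ?Z = "(cmod z + (2 * real K + 1) * \<Gamma>)\<^sup>2"
  have sq: "(cmod (a + b))\<^sup>2 \<le> 2 * (cmod a)\<^sup>2 + 2 * (cmod b)\<^sup>2" for a b
  proof -
    have "(cmod (a + b))\<^sup>2 \<le> (cmod a + cmod b)\<^sup>2" by (intro power_mono norm_triangle_ineq) simp
    also have "\<dots> \<le> 2 * (cmod a)\<^sup>2 + 2 * (cmod b)\<^sup>2"
      using sum_squares_bound[of "cmod a" "cmod b"] by (simp add: power2_sum)
    finally show ?thesis .
  qed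
  have "(\<Sum>l\<in>S. (cmod (Er i l))\<^sup>2) \<le> (\<Sum>l\<in>S. 2 * ((2 * real K + 1) * (\<Sum>k\<in>Kb. ?Z * (cmod (if i + k \<in> S then Mt (i + k) l else 0))\<^sup>2)) + 2 * (if i = l then 1 else 0))"
  proof (intro sum_mono)
    fix l
    have "(cmod (\<Sum>k\<in>Kb. ?a l k))\<^sup>2 \<le> (2 * real K + 1) * (\<Sum>k\<in>Kb. (cmod (?a l k))\<^sup>2)"
      using norm_sum_sq_le[of "?a l" Kb] by (simp add: card_Kb add.commute)
    also have "\<dots> \<le> (2 * real K + 1) * (\<Sum>k\<in>Kb. ?Z * (cmod (if i + k \<in> S then Mt (i + k) l else 0))\<^sup>2)"
    proof (intro mult_left_mono sum_mono)
      fix k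
      show "(cmod (?a l k))\<^sup>2 \<le> ?Z * (cmod (if i + k \<in> S then Mt (i + k) l else 0))\<^sup>2"
      proof (cases "i + k \<in> S")
        case True
        have "(cmod (qx i k))\<^sup>2 \<le> ?Z" by (intro power_mono qx_le i True) simp
        then have "(cmod (qx i k))\<^sup>2 * (cmod (Mt (i + k) l))\<^sup>2 \<le> ?Z * (cmod (Mt (i + k) l))\<^sup>2" by (rule mult_right_mono) simp
        then show ?thesis using True by (simp only: if_True norm_mult power_mult_distrib)
      next
        case False
        then show ?thesis by (simp only: if_False norm_zero) simp
      qed
    qed simp
    finally have 1: "(cmod (\<Sum>k\<in>Kb. ?a l k))\<^sup>2 \<le> (2 * real K + 1) * (\<Sum>k\<in>Kb. ?Z * (cmod (if i + k \<in> S then Mt (i + k) l else 0))\<^sup>2)" .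
    have 2: "(cmod (if i = l then 1 else 0))\<^sup>2 = (if i = l then 1 else (0::real))" by simp
    show "(cmod (Er i l))\<^sup>2 \<le> 2 * ((2 * real K + 1) * (\<Sum>k\<in>Kb. ?Z * (cmod (if i + k \<in> S then Mt (i + k) l else 0))\<^sup>2)) + 2 * (if i = l then 1 else 0)"
      unfolding Er_expand[OF i] using sq[of "\<Sum>k\<in>Kb. ?a l k" "if i = l then 1 else 0"] 1 unfolding 2 by linarith
  qed
  also have "\<dots> = 2 * ((2 * real K + 1) * (\<Sum>k\<in>Kb. ?Z * (\<Sum>l\<in>S. (cmod (if i + k \<in> S then Mt (i + k) l else 0))\<^sup>2))) + 2"
  proof -
    have "(\<Sum>l\<in>S. 2 * (if i = l then 1 else (0::real))) = 2" using i by (simp add: sum_distrib_left[symmetric])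
    moreover have "(\<Sum>l\<in>S. \<Sum>k\<in>Kb. ?Z * (cmod (if i + k \<in> S then Mt (i + k) l else 0))\<^sup>2)
       = (\<Sum>k\<in>Kb. \<Sum>l\<in>S. ?Z * (cmod (if i + k \<in> S then Mt (i + k) l else 0))\<^sup>2)" by (rule sum.swap)
    ultimately show ?thesis by (simp only: sum.distrib sum_distrib_left[symmetric])
  qed
  also have "\<dots> \<le> 2 * ((2 * real K + 1) * (\<Sum>k\<in>Kb. ?Z * \<Gamma>\<^sup>2)) + 2"
  proof (intro add_right_mono mult_left_mono sum_mono)
    fix k
    show "(\<Sum>l\<in>S. (cmod (if i + k \<in> S then Mt (i + k) l else 0))\<^sup>2) \<le> \<Gamma>\<^sup>2"
    proof (cases "i + k \<in> S")
      case True
      then show ?thesis using Mt_row[of S "i + k"] by (simp only: if_True finite_atLeastAtMost_int simp_thms)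
    next
      case False
      then show ?thesis by (simp only: if_False norm_zero) simp
    qed
  qed simp_all
  also have "\<dots> = Brow" unfolding Brow_def by (simp add: card_Kb add.commute)
  finally show ?thesis .
qed

text \<open>Rows of a complete block whose \<open>K\<close>-neighbourhood stays inside the block.
  There the banded matrix multiplies \<open>Mt\<close> as in an infinite Toeplitz system.\<close>

definition good :: "int \<Rightarrow> bool" where
  "good i \<longleftrightarrow> i \<in> S \<and> int K < i - int n * qb i \<and> i - int n * qb i \<le> int n - int K \<and> (qb i + 1) * int n \<le> int N"

lemma qb_nonneg: "i \<in> S \<Longrightarrow> 0 \<le> qb i"
  unfolding qb_def using n1 by (simp add: pos_imp_zdiv_nonneg_iff)

lemma good_block:
  assumes g: "good i" and k: "k \<in> Kb"
  shows "i + k \<in> S" "qb (i + k) = qb i"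
proof -
  have iS: "i \<in> S" using g by (simp only: good_def)
  have q0: "0 \<le> int n * qb i" using qb_nonneg[OF iS] by simp
  have qN: "int n * qb i + int n \<le> int N" using g by (simp add: good_def algebra_simps)
  have kk: "- int K \<le> k" "k \<le> int K" using k by (simp_all add: Kb_def)
  have gg: "int K < i - int n * qb i" "i - int n * qb i \<le> int n - int K" using g by (simp_all only: good_def)
  have r: "int n * qb i + 1 \<le> i + k" "i + k \<le> int n * qb i + int n" using gg kk by linarith+
  then show "qb (i + k) = qb i" unfolding qb_iff by simp
  have "1 \<le> i + k" "i + k \<le> int N" using r q0 qN by linarith+
  then show "i + k \<in> S" by simp
qed

lemma u_meas [measurable]: "(\<lambda>\<theta>. u \<theta> k) \<in> borel_measurable U"
proof -
  have mm: "(\<lambda>w. m (snd w) l) \<in> borel_measurable (U \<Otimes>\<^sub>M U)" for l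
    by (rule measurable_compose[OF measurable_snd m_meas])
  have pp: "(\<lambda>w. complex_of_real (\<psi>t (fst w) (snd w) k l)) \<in> borel_measurable (U \<Otimes>\<^sub>M U)" for l
  proof -
    have [measurable]: "(\<lambda>w. \<psi>t (fst w) (snd w) k l) \<in> borel_measurable (U \<Otimes>\<^sub>M U)"
      by (rule \<psi>t_meas2[OF fst_UU snd_UU])
    show ?thesis by measurable
  qed
  have "(\<lambda>\<theta>. \<integral>\<phi>. of_real (\<psi>t \<theta> \<phi> k l) * m \<phi> l \<partial>U) \<in> borel_measurable U" for l
  proof (rule U.borel_measurable_lebesgue_integral)
    show "(\<lambda>(\<theta>, \<phi>). complex_of_real (\<psi>t \<theta> \<phi> k l) * m \<phi> l) \<in> borel_measurable (U \<Otimes>\<^sub>M U)"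
      unfolding case_prod_beta by (intro borel_measurable_times mm pp)
  qed
  then show ?thesis unfolding u_def by (intro borel_measurable_sum)
qed

text \<open>The residual before averaging over the positions of the block: the difference between
  the coefficients of row \<open>i\<close> and the local coefficients \<open>u \<phi>\<close>,
  convolved with \<open>m \<phi>\<close>.\<close>

definition hh :: "int \<Rightarrow> int \<Rightarrow> real \<Rightarrow> complex" where
  "hh i l \<phi> = (\<Sum>k\<in>Kb. (Xm i (i + k) - u \<phi> k) * m \<phi> (l - i - k))"

lemma hh_meas [measurable]: "hh i l \<in> borel_measurable U"
  unfolding hh_def[abs_def] by (intro borel_measurable_sum borel_measurable_times borel_measurable_diff u_meas m_meas) simp_all

lemma cdiff_le: "good i \<Longrightarrow> k \<in> Kb \<Longrightarrow> cmod (Xm i (i + k) - u \<phi> k) \<le> 2 * (2 * real K + 1) * \<Gamma>"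
proof -
  assume g: "good i" and k: "k \<in> Kb"
  have "i \<in> S" using g by (simp only: good_def)
  from Xm_le[OF this good_block(1)[OF g k]] show ?thesis
    using u_strong[of \<phi> k] norm_triangle_ineq4[of "Xm i (i + k)" "u \<phi> k"] by linarith
qed

lemma hh_bound:
  assumes g: "good i" and \<phi>: "\<phi> \<in> {0..<1}"
  shows "cmod (hh i l \<phi>) \<le> (\<Sum>k\<in>Kb. (2 * (2 * real K + 1) * \<Gamma>) * (1 / Im z))"
  unfolding hh_def
proof (intro order_trans[OF norm_sum] sum_mono)
  fix k assume k: "k \<in> Kb"
  show "cmod ((Xm i (i + k) - u \<phi> k) * m \<phi> (l - i - k)) \<le> (2 * (2 * real K + 1) * \<Gamma>) * (1 / Im z)"
    unfolding norm_mult using cdiff_le[OF g k] m_bound[OF \<phi>] \<Gamma>_pos by (intro mult_mono) simp_all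
qed

text \<open>A complete block has mass 1, so the identity matrix can be written as the average of
  \<open>delta0\<close>, and \<open>conv_finite\<close> replaces \<open>delta0\<close> at each
  position by \<open>av\<close> convolved with \<open>m\<close>. What remains is the difference of
  coefficients in \<open>hh\<close>.\<close>

lemma Er_good:
  assumes g: "good i" and l: "l \<in> S" and q: "qb l = qb i"
  shows "Er i l = (\<integral>\<phi>. of_real (w (qb i) \<phi>) * hh i l \<phi> \<partial>U)"
proof -
  have iS: "i \<in> S" using g by (simp only: good_def)
  have w1: "integral\<^sup>L U (w (qb i)) = 1"
    using g qb_nonneg[OF iS] by (intro w_integral_full) (simp_all only: good_def)
  have "(\<Sum>k\<in>Kb. if i + k \<in> S then qx i k * Mt (i + k) l else 0) = (\<Sum>k\<in>Kb. \<integral>\<phi>. of_real (w (qb i) \<phi>) * m \<phi> (l - i - k) * qx i k \<partial>U)"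
  proof (intro sum.cong refl)
    fix k assume k: "k \<in> Kb"
    note b = good_block[OF g k]
    have "Mt (i + k) l = (\<integral>\<phi>. of_real (w (qb i) \<phi>) * m \<phi> (l - i - k) \<partial>U)"
      unfolding Mt_def b(2) using q by (simp add: diff_diff_eq)
    then have "qx i k * Mt (i + k) l = (\<integral>\<phi>. of_real (w (qb i) \<phi>) * m \<phi> (l - i - k) \<partial>U) * qx i k" by (simp only: mult.commute)
    also have "\<dots> = (\<integral>\<phi>. of_real (w (qb i) \<phi>) * m \<phi> (l - i - k) * qx i k \<partial>U)" by (rule integral_mult_left_zero[symmetric])
    finally show "(if i + k \<in> S then qx i k * Mt (i + k) l else 0) = (\<integral>\<phi>. of_real (w (qb i) \<phi>) * m \<phi> (l - i - k) * qx i k \<partial>U)"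
      using b(1) by (simp only: if_True)
  qed
  also have "\<dots> = (\<integral>\<phi>. (\<Sum>k\<in>Kb. of_real (w (qb i) \<phi>) * m \<phi> (l - i - k) * qx i k) \<partial>U)"
    by (intro Bochner_Integration.integral_sum[symmetric] integrable_mult_left wm_integrable)
  finally have A: "(\<Sum>k\<in>Kb. if i + k \<in> S then qx i k * Mt (i + k) l else 0) = (\<integral>\<phi>. (\<Sum>k\<in>Kb. of_real (w (qb i) \<phi>) * m \<phi> (l - i - k) * qx i k) \<partial>U)" .
  have wc: "integrable U (\<lambda>\<phi>. complex_of_real (w (qb i) \<phi>))" by (intro integrable_of_real w_integrable)
  have "(\<integral>\<phi>. complex_of_real (w (qb i) \<phi>) * delta0 (l - i) \<partial>U) = of_real (integral\<^sup>L U (w (qb i))) * delta0 (l - i)"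
    unfolding integral_mult_left_zero integral_complex_of_real ..
  then have B: "(if i = l then 1 else 0) = (\<integral>\<phi>. complex_of_real (w (qb i) \<phi>) * delta0 (l - i) \<partial>U)"
  proof -
    have "(if i = l then 1 else 0) = delta0 (l - i)" by (auto simp: delta0_def)
    also have "\<dots> = of_real (integral\<^sup>L U (w (qb i))) * delta0 (l - i)" unfolding w1 by (simp only: of_real_1 mult_1_left)
    finally show ?thesis unfolding integral_mult_left_zero integral_complex_of_real .
  qed
  have "Er i l = (\<integral>\<phi>. (\<Sum>k\<in>Kb. of_real (w (qb i) \<phi>) * m \<phi> (l - i - k) * qx i k) + of_real (w (qb i) \<phi>) * delta0 (l - i) \<partial>U)"
    unfolding Er_expand[OF iS] A B
    by (intro Bochner_Integration.integral_add[symmetric] Bochner_Integration.integrable_sum integrable_mult_left wm_integrable wc)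
  also have "\<dots> = (\<integral>\<phi>. of_real (w (qb i) \<phi>) * hh i l \<phi> \<partial>U)"
  proof (intro Bochner_Integration.integral_cong refl)
    fix \<phi> assume "\<phi> \<in> space U"
    then have \<phi>: "\<phi> \<in> {0..<1}" by simp
    have "hh i l \<phi> = (\<Sum>k\<in>Kb. m \<phi> (l - i - k) * qx i k + av \<phi> k * m \<phi> (l - i - k))"
      unfolding hh_def
    proof (intro sum.cong refl)
      fix k
      have e: "Xm i (i + k) - u \<phi> k = qx i k + av \<phi> k" by (simp add: qx_def av_def delta0_def)
      show "(Xm i (i + k) - u \<phi> k) * m \<phi> (l - i - k) = m \<phi> (l - i - k) * qx i k + av \<phi> k * m \<phi> (l - i - k)"
        unfolding e distrib_right by (simp only: mult.commute[of "qx i k"])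
    qed
    also have "\<dots> = (\<Sum>k\<in>Kb. m \<phi> (l - i - k) * qx i k) + delta0 (l - i)"
      by (simp only: sum.distrib conv_finite[OF \<phi>])
    finally show "(\<Sum>k\<in>Kb. of_real (w (qb i) \<phi>) * m \<phi> (l - i - k) * qx i k) + of_real (w (qb i) \<phi>) * delta0 (l - i) = of_real (w (qb i) \<phi>) * hh i l \<phi>"
      by (simp only: distrib_left sum_distrib_left mult.assoc)
  qed
  finally show ?thesis .
qed

lemma Er_good_other:
  assumes g: "good i" and q: "qb l \<noteq> qb i"
  shows "Er i l = 0"
proof -
  have iS: "i \<in> S" using g by (simp only: good_def)
  have "(if i + k \<in> S then qx i k * Mt (i + k) l else 0) = 0" if "k \<in> Kb" for k
  proof -
    have "Mt (i + k) l = 0" unfolding Mt_def good_block(2)[OF g that] using q by simp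
    then show ?thesis by simp
  qed
  then have "(\<Sum>k\<in>Kb. if i + k \<in> S then qx i k * Mt (i + k) l else 0) = 0" by (intro sum.neutral ballI)
  then show ?thesis unfolding Er_expand[OF iS] using q by auto
qed

definition C3 :: real where
  "C3 = (2 * real K + 1) * ((2 * real K + 1) * ((2 * (2 * real K + 1) * \<Gamma> * \<Gamma>) * \<Gamma>\<^sup>2))"

lemma C3_nonneg: "0 \<le> C3" unfolding C3_def using \<Gamma>_pos by simp

lemma k1_nonneg: "0 \<le> k1" unfolding k1_def by simp

lemma dN_integrable: "integrable U (dN n N)"
proof (rule integrable_U[where B = "Dc n"])
  show "dN n N \<in> borel_measurable U" by (rule dN_meas)
  show "norm (dN n N \<phi>) \<le> Dc n" if "\<phi> \<in> {0..<1}" for \<phi> using dN_nonneg dN_le[OF that] by simp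
qed

lemma H_integrable: "integrable U (\<lambda>\<phi>. C3 * (dN n N \<phi> + k1))"
  by (rule integrable_mult_right[OF Bochner_Integration.integrable_add[OF dN_integrable]]) simp

lemma wH_integrable: "integrable U (\<lambda>\<phi>. w q \<phi> * (C3 * (dN n N \<phi> + k1)))"
proof (rule integrable_U[where B = "real N / real n * (C3 * (Dc n + k1))"])
  show "(\<lambda>\<phi>. w q \<phi> * (C3 * (dN n N \<phi> + k1))) \<in> borel_measurable U"
    by (intro borel_measurable_times borel_measurable_add w_meas dN_meas) simp_all
  show "norm (w q \<phi> * (C3 * (dN n N \<phi> + k1))) \<le> real N / real n * (C3 * (Dc n + k1))" if "\<phi> \<in> {0..<1}" for \<phi>
  proof -
    have h1: "C3 * (dN n N \<phi> + k1) \<le> C3 * (Dc n + k1)" using dN_le[OF that] C3_nonneg by (intro mult_left_mono) simp_all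
    have h2: "0 \<le> C3 * (dN n N \<phi> + k1)" using C3_nonneg dN_nonneg k1_nonneg by simp
    have "w q \<phi> * (C3 * (dN n N \<phi> + k1)) \<le> real N / real n * (C3 * (Dc n + k1))"
      by (rule mult_mono[OF w_le h1 _ h2]) simp
    moreover have "0 \<le> w q \<phi> * (C3 * (dN n N \<phi> + k1))" using \<open>0 \<le> C3 * (dN n N \<phi> + k1)\<close> w_nonneg by simp
    ultimately show ?thesis by simp
  qed
qed

text \<open>Bessel sums the coefficients of \<open>m\<close> over the row. Of the squared
  coefficient difference one factor is bounded uniformly and the other by \<open>dN + k1\<close>;
  the result is linear in \<open>dN\<close>, whose mean tends to zero.\<close>

lemma hh_sum:
  assumes g: "good i" and \<phi>: "\<phi> \<in> Gd" and q: "fl n N \<phi> = qb i"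
  shows "(\<Sum>l\<in>S. (cmod (hh i l \<phi>))\<^sup>2) \<le> C3 * (dN n N \<phi> + k1)"
proof -
  let ?c = "\<lambda>k. (cmod (Xm i (i + k) - u \<phi> k))\<^sup>2"
  have iS: "i \<in> S" using g by (simp only: good_def)
  have c: "?c k \<le> (2 * (2 * real K + 1) * \<Gamma> * \<Gamma>) * (dN n N \<phi> + k1)" if k: "k \<in> Kb" for k
  proof -
    have "?c k \<le> (2 * (2 * real K + 1) * \<Gamma>) * (\<Gamma> * (dN n N \<phi> + k1))"
      unfolding power2_eq_square
      using cdiff_le[OF g k] Xm_u[OF iS good_block(1)[OF g k] k \<phi> q] \<Gamma>_pos by (intro mult_mono) simp_all
    then show ?thesis by (simp only: mult.assoc)
  qed
  have "(\<Sum>l\<in>S. (cmod (hh i l \<phi>))\<^sup>2) \<le> (\<Sum>l\<in>S. (2 * real K + 1) * (\<Sum>k\<in>Kb. ?c k * (cmod (m \<phi> (l - i - k)))\<^sup>2))"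
  proof (intro sum_mono)
    fix l
    have "(cmod (hh i l \<phi>))\<^sup>2 \<le> real (card Kb) * (\<Sum>k\<in>Kb. (cmod ((Xm i (i + k) - u \<phi> k) * m \<phi> (l - i - k)))\<^sup>2)"
      unfolding hh_def by (rule norm_sum_sq_le)
    also have "real (card Kb) = 2 * real K + 1" by (simp add: card_Kb)
    finally show "(cmod (hh i l \<phi>))\<^sup>2 \<le> (2 * real K + 1) * (\<Sum>k\<in>Kb. ?c k * (cmod (m \<phi> (l - i - k)))\<^sup>2)"
      by (simp only: norm_mult power_mult_distrib)
  qed
  also have "\<dots> = (2 * real K + 1) * (\<Sum>k\<in>Kb. ?c k * (\<Sum>l\<in>S. (cmod (m \<phi> (l - i - k)))\<^sup>2))"
  proof -
    have "(\<Sum>l\<in>S. \<Sum>k\<in>Kb. ?c k * (cmod (m \<phi> (l - i - k)))\<^sup>2) = (\<Sum>k\<in>Kb. \<Sum>l\<in>S. ?c k * (cmod (m \<phi> (l - i - k)))\<^sup>2)" by (rule sum.swap)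
    then show ?thesis by (simp only: sum_distrib_left[symmetric])
  qed
  also have "\<dots> \<le> (2 * real K + 1) * (\<Sum>k\<in>Kb. ((2 * (2 * real K + 1) * \<Gamma> * \<Gamma>) * (dN n N \<phi> + k1)) * \<Gamma>\<^sup>2)"
  proof (intro mult_left_mono sum_mono)
    fix k assume k: "k \<in> Kb"
    have "(\<Sum>l\<in>S. (cmod (m \<phi> (l - i - k)))\<^sup>2) = (\<Sum>r\<in>(\<lambda>l. l - i - k) ` S. (cmod (m \<phi> r))\<^sup>2)"
      by (subst sum.reindex) (simp_all add: inj_on_def)
    also have "\<dots> \<le> \<Gamma>\<^sup>2" by (intro m_bessel[OF \<phi>]) simp
    finally have "(\<Sum>l\<in>S. (cmod (m \<phi> (l - i - k)))\<^sup>2) \<le> \<Gamma>\<^sup>2" .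
    then show "?c k * (\<Sum>l\<in>S. (cmod (m \<phi> (l - i - k)))\<^sup>2) \<le> ((2 * (2 * real K + 1) * \<Gamma> * \<Gamma>) * (dN n N \<phi> + k1)) * \<Gamma>\<^sup>2"
      using c[OF k] \<Gamma>_pos dN_nonneg[of n N \<phi>] k1_nonneg by (intro mult_mono sum_nonneg) simp_all
  qed simp
  also have "\<dots> = C3 * (dN n N \<phi> + k1)"
    unfolding C3_def by (simp add: card_Kb)
  finally show ?thesis .
qed

lemma Er_good_row:
  assumes g: "good i"
  shows "(\<Sum>l\<in>S. (cmod (Er i l))\<^sup>2) \<le> (\<integral>\<phi>. w (qb i) \<phi> * (C3 * (dN n N \<phi> + k1)) \<partial>U)"
proof -
  define B where "B = (\<Sum>k\<in>Kb. (2 * (2 * real K + 1) * \<Gamma>) * (1 / Im z))"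
  have hB: "\<And>\<phi> l. \<phi> \<in> {0..<1} \<Longrightarrow> cmod (hh i l \<phi>) \<le> B" unfolding B_def by (rule hh_bound[OF g])
  have whi: "integrable U (\<lambda>\<phi>. w (qb i) \<phi> * (cmod (hh i l \<phi>))\<^sup>2)" for l
  proof (rule integrable_U[where B = "real N / real n * B\<^sup>2"])
    show "norm (w (qb i) \<phi> * (cmod (hh i l \<phi>))\<^sup>2) \<le> real N / real n * B\<^sup>2" if "\<phi> \<in> {0..<1}" for \<phi>
      unfolding norm_mult using w_nonneg[of "qb i" \<phi>] w_le[of "qb i" \<phi>] hB[OF that, of l]
      by (intro mult_mono) (simp_all add: power_mono)
  qed measurable
  have "(\<Sum>l\<in>S. (cmod (Er i l))\<^sup>2) \<le> (\<Sum>l\<in>S. \<integral>\<phi>. w (qb i) \<phi> * (cmod (hh i l \<phi>))\<^sup>2 \<partial>U)"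
  proof (intro sum_mono)
    fix l assume l: "l \<in> S"
    show "(cmod (Er i l))\<^sup>2 \<le> (\<integral>\<phi>. w (qb i) \<phi> * (cmod (hh i l \<phi>))\<^sup>2 \<partial>U)"
    proof (cases "qb l = qb i")
      case True
      show ?thesis unfolding Er_good[OF g l True]
        by (rule weighted_jensen[OF w_meas w_nonneg w_le w_integral_le hh_meas hB])
    next
      case False
      have "0 \<le> (\<integral>\<phi>. w (qb i) \<phi> * (cmod (hh i l \<phi>))\<^sup>2 \<partial>U)"
        by (intro integral_nonneg_AE AE_I2) (simp add: w_nonneg)
      then show ?thesis unfolding Er_good_other[OF g False] by simp
    qed
  qed
  also have "\<dots> = (\<integral>\<phi>. (\<Sum>l\<in>S. w (qb i) \<phi> * (cmod (hh i l \<phi>))\<^sup>2) \<partial>U)"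
    by (intro Bochner_Integration.integral_sum[symmetric] whi)
  also have "\<dots> \<le> (\<integral>\<phi>. w (qb i) \<phi> * (C3 * (dN n N \<phi> + k1)) \<partial>U)"
  proof (rule integral_mono_AE)
    show "integrable U (\<lambda>\<phi>. \<Sum>l\<in>S. w (qb i) \<phi> * (cmod (hh i l \<phi>))\<^sup>2)" by (intro Bochner_Integration.integrable_sum whi)
    show "integrable U (\<lambda>\<phi>. w (qb i) \<phi> * (C3 * (dN n N \<phi> + k1)))" by (rule wH_integrable)
    show "AE \<phi> in U. (\<Sum>l\<in>S. w (qb i) \<phi> * (cmod (hh i l \<phi>))\<^sup>2) \<le> w (qb i) \<phi> * (C3 * (dN n N \<phi> + k1))"
      using AE_Gd
    proof eventually_elim
      case (elim \<phi>)
      show ?case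
      proof (cases "fl n N \<phi> = qb i")
        case True
        show ?thesis unfolding sum_distrib_left[symmetric] by (intro mult_left_mono hh_sum[OF g elim True] w_nonneg)
      next
        case False
        then have "w (qb i) \<phi> = 0" by (simp add: w_def)
        then show ?thesis by simp
      qed
    qed
  qed
  finally show ?thesis .
qed

definition e1 :: real where "e1 = (\<integral>\<phi>. dN n N \<phi> \<partial>U)"

lemma good_total: "(\<Sum>i\<in>{i\<in>S. good i}. \<Sum>l\<in>S. (cmod (Er i l))\<^sup>2) \<le> real N * (C3 * (e1 + k1))"
proof -
  note dNi = dN_integrable
  have "(\<Sum>i\<in>{i\<in>S. good i}. \<Sum>l\<in>S. (cmod (Er i l))\<^sup>2) \<le> (\<Sum>i\<in>{i\<in>S. good i}. \<integral>\<phi>. w (qb i) \<phi> * (C3 * (dN n N \<phi> + k1)) \<partial>U)"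
    by (intro sum_mono Er_good_row) blast
  also have "\<dots> = (\<integral>\<phi>. (\<Sum>i\<in>{i\<in>S. good i}. w (qb i) \<phi> * (C3 * (dN n N \<phi> + k1))) \<partial>U)"
    by (intro Bochner_Integration.integral_sum[symmetric] wH_integrable)
  also have "\<dots> \<le> (\<integral>\<phi>. real N * (C3 * (dN n N \<phi> + k1)) \<partial>U)"
  proof (rule integral_mono)
    show "integrable U (\<lambda>\<phi>. \<Sum>i\<in>{i\<in>S. good i}. w (qb i) \<phi> * (C3 * (dN n N \<phi> + k1)))"
      by (intro Bochner_Integration.integrable_sum wH_integrable)
    show "integrable U (\<lambda>\<phi>. real N * (C3 * (dN n N \<phi> + k1)))" by (rule integrable_mult_right[OF H_integrable])
    fix \<phi>
    have "(\<Sum>i\<in>{i\<in>S. good i}. w (qb i) \<phi>) \<le> cs \<phi>"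
      unfolding cs_def by (rule sum_mono2) (simp, blast, simp add: w_nonneg)
    also have "\<dots> \<le> real N" by (rule cs_le)
    finally show "(\<Sum>i\<in>{i\<in>S. good i}. w (qb i) \<phi> * (C3 * (dN n N \<phi> + k1))) \<le> real N * (C3 * (dN n N \<phi> + k1))"
      unfolding sum_distrib_right[symmetric] using C3_nonneg dN_nonneg k1_nonneg by (intro mult_right_mono) simp_all
  qed
  also have "\<dots> = real N * (C3 * (e1 + k1))"
    unfolding e1_def using dNi by simp
  finally show ?thesis .
qed

text \<open>Each block loses at most \<open>K\<close> rows at either end, there are at most
  \<open>N / n + 1\<close> blocks, and the rows of an incomplete block are among the last
  \<open>n\<close> rows.\<close>

lemma bad_card: "real (card {i\<in>S. \<not> good i}) \<le> 2 * real K * (real N / real n + 1) + real n"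
proof -
  define Z where "Z = {1..int K} \<union> {int n - int K + 1..int n}"
  define Y where "Y = {0..int N div int n} \<times> Z"
  have sub: "{i\<in>S. \<not> good i} \<subseteq> (\<lambda>(q, a). int n * q + a) ` Y \<union> {int N - int n + 1..int N}"
  proof
    fix i assume "i \<in> {i\<in>S. \<not> good i}"
    then have iS: "i \<in> S" and ng: "\<not> good i" by blast+
    have ib: "i \<in> {int n * qb i + 1..int n * qb i + int n}" using qb_iff[of i "qb i"] by blast
    show "i \<in> (\<lambda>(q, a). int n * q + a) ` Y \<union> {int N - int n + 1..int N}"
    proof (cases "(qb i + 1) * int n \<le> int N")
      case False
      then have "int N < int n * qb i + int n" by (simp add: algebra_simps)
      then have "i \<in> {int N - int n + 1..int N}" using ib iS by simp
      then show ?thesis by blast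
    next
      case True
      define a where "a = i - int n * qb i"
      have "a \<in> Z" using ng True iS ib unfolding good_def Z_def a_def by auto
      moreover have "qb i \<in> {0..int N div int n}"
      proof -
        have "qb i \<le> int N div int n" unfolding qb_def using iS n1 by (intro zdiv_mono1) auto
        then show ?thesis using qb_nonneg[OF iS] by simp
      qed
      ultimately have "(qb i, a) \<in> Y" unfolding Y_def by blast
      moreover have "i = (\<lambda>(q, a). int n * q + a) (qb i, a)" by (simp add: a_def)
      ultimately show ?thesis by blast
    qed
  qed
  have finY: "finite Y" unfolding Y_def Z_def by simp
  have "card {i\<in>S. \<not> good i} \<le> card ((\<lambda>(q, a). int n * q + a) ` Y \<union> {int N - int n + 1..int N})"
    by (rule card_mono[OF _ sub]) (simp add: finY)
  also have "\<dots> \<le> card ((\<lambda>(q, a). int n * q + a) ` Y) + card {int N - int n + 1..int N}" by (rule card_Un_le)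
  also have "\<dots> \<le> card Y + n" using card_image_le[OF finY] by simp
  finally have 1: "real (card {i\<in>S. \<not> good i}) \<le> real (card Y) + real n" by linarith
  have "card Z \<le> card {1..int K} + card {int n - int K + 1..int n}" unfolding Z_def by (rule card_Un_le)
  then have "card Z \<le> 2 * K" by simp
  note cZ = this
  have "card Y = nat (int N div int n + 1) * card Z" unfolding Y_def card_cartesian_product by simp
  also have "nat (int N div int n + 1) = N div n + 1" by (simp add: nat_add_distrib zdiv_int[symmetric])
  also have "(N div n + 1) * card Z \<le> (N div n + 1) * (2 * K)" by (rule mult_le_mono2[OF cZ])
  finally have "card Y \<le> (N div n + 1) * (2 * K)" .
  then have "real (card Y) \<le> (real (N div n) + 1) * (2 * real K)"
    using of_nat_mono[of "card Y" "(N div n + 1) * (2 * K)", where 'a = real] by (simp add: algebra_simps)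
  also have "\<dots> \<le> (real N / real n + 1) * (2 * real K)"
  proof (intro mult_right_mono add_right_mono)
    have "real (N div n) * real n \<le> real N"
      using of_nat_mono[of "N div n * n" N, where 'a = real] by simp
    then show "real (N div n) \<le> real N / real n" using n1 by (simp add: le_divide_eq)
  qed simp
  finally show ?thesis using 1 mult.commute[of "real N / real n + 1" "2 * real K"] by linarith
qed

lemma Brow_nonneg: "0 \<le> Brow" unfolding Brow_def by simp

theorem Er_total:
  "(\<Sum>i\<in>S. \<Sum>l\<in>S. (cmod (Er i l))\<^sup>2) \<le> real N * (C3 * (e1 + k1)) + (2 * real K * (real N / real n + 1) + real n) * Brow"
proof -
  have "(\<Sum>i\<in>S. \<Sum>l\<in>S. (cmod (Er i l))\<^sup>2) = (\<Sum>i\<in>{i\<in>S. good i} \<union> {i\<in>S. \<not> good i}. \<Sum>l\<in>S. (cmod (Er i l))\<^sup>2)"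
    by (rule sum.cong) blast+
  also have "\<dots> = (\<Sum>i\<in>{i\<in>S. good i}. \<Sum>l\<in>S. (cmod (Er i l))\<^sup>2) + (\<Sum>i\<in>{i\<in>S. \<not> good i}. \<Sum>l\<in>S. (cmod (Er i l))\<^sup>2)"
    by (rule sum.union_disjoint) (rule finite_subset[of _ S], blast, simp, rule finite_subset[of _ S], blast, simp, blast)
  also have "(\<Sum>i\<in>{i\<in>S. \<not> good i}. \<Sum>l\<in>S. (cmod (Er i l))\<^sup>2) \<le> real (card {i\<in>S. \<not> good i}) * Brow"
    by (rule sum_bounded_above) (rule Er_row, blast)
  also have "real (card {i\<in>S. \<not> good i}) * Brow \<le> (2 * real K * (real N / real n + 1) + real n) * Brow"
    by (intro mult_right_mono bad_card Brow_nonneg)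
  finally show ?thesis using good_total by linarith
qed

end

section \<open>Lower bound for the trace and stability\<close>

context profile
begin

definition Ps :: "nat \<Rightarrow> (int \<times> int) set" where
  "Ps N = {p \<in> {1..int N} \<times> {1..int N}. snd p - fst p \<in> Kb}"

text \<open>The seminorm that the covariance operator sees. It controls the entries of
  \<open>Sig\<close> and the normalised trace, and it is bounded by the maximum norm as well as by
  the normalised Hilbert-Schmidt norm up to powers of \<open>2 * K + 1\<close>. Hence one comparison
  serves both the stability estimate and the block discretisation.\<close>

definition rho :: "nat \<Rightarrow> (int \<Rightarrow> int \<Rightarrow> complex) \<Rightarrow> real" where
  "rho N X = (\<Sum>p\<in>Ps N. cmod (X (fst p) (snd p))) / real N"

lemma finite_Ps: "finite (Ps N)"
  unfolding Ps_def by (rule finite_subset[of _ "{1..int N} \<times> {1..int N}"]) auto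

lemma card_row: "card {k\<in>{1..int N}. k - i \<in> Kb} \<le> 2 * K + 1"
proof -
  have "card {k\<in>{1..int N}. k - i \<in> Kb} \<le> card ((\<lambda>k. k + i) ` Kb)"
    by (rule card_mono) (auto simp: card_Kb intro!: image_eqI[of _ _ "_ - i"])
  also have "\<dots> \<le> card Kb" by (rule card_image_le) (simp add: card_Kb)
  finally show ?thesis by (simp add: card_Kb)
qed

lemma card_col: "card {i\<in>{1..int N}. k - i \<in> Kb} \<le> 2 * K + 1"
proof -
  have "{i\<in>{1..int N}. k - i \<in> Kb} \<subseteq> {i\<in>{1..int N}. i - k \<in> Kb}" by (auto simp: Kb_def)
  then have "card {i\<in>{1..int N}. k - i \<in> Kb} \<le> card {i\<in>{1..int N}. i - k \<in> Kb}"
    by (rule card_mono[rotated]) (rule finite_subset[of _ "{1..int N}"], blast, simp)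
  then show ?thesis using card_row[of N k] by simp
qed

lemma card_Ps: "card (Ps N) \<le> N * (2 * K + 1)"
proof -
  have eq: "Ps N = Sigma {1..int N} (\<lambda>i. {k\<in>{1..int N}. k - i \<in> Kb})" by (auto simp: Ps_def)
  have "card (Ps N) = (\<Sum>i\<in>{1..int N}. card {k\<in>{1..int N}. k - i \<in> Kb})"
    unfolding eq by (rule card_SigmaI) (simp, rule ballI, rule finite_subset[of _ "{1..int N}"], blast, simp)
  also have "\<dots> \<le> (\<Sum>i\<in>{1..int N}. 2 * K + 1)" by (intro sum_mono card_row)
  finally show ?thesis by simp
qed

lemma rho_nonneg: "0 \<le> rho N X" unfolding rho_def by (intro divide_nonneg_nonneg sum_nonneg) simp_all

lemma rho_max:
  assumes "N \<ge> 1" "\<And>i j. i \<in> {1..int N} \<Longrightarrow> j \<in> {1..int N} \<Longrightarrow> cmod (X i j) \<le> B" "0 \<le> B"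
  shows "rho N X \<le> (2 * real K + 1) * B"
proof -
  have "(\<Sum>p\<in>Ps N. cmod (X (fst p) (snd p))) \<le> real (card (Ps N)) * B"
    by (rule sum_bounded_above) (rule assms(2), auto simp: Ps_def)
  also have "\<dots> \<le> real (N * (2 * K + 1)) * B" using card_Ps assms(3) by (intro mult_right_mono) (simp_all only: of_nat_le_iff)
  finally have "rho N X \<le> real (N * (2 * K + 1)) * B / real N"
    unfolding rho_def by (rule divide_right_mono) simp
  moreover have "real (N * (2 * K + 1)) * B / real N = (2 * real K + 1) * B"
    unfolding of_nat_mult mult.assoc using assms(1) by simp
  ultimately show ?thesis by (simp only:)
qed

lemma rho_sq:
  assumes "N \<ge> 1"
  shows "(rho N X)\<^sup>2 \<le> (2 * real K + 1) * ((\<Sum>j\<in>{1..int N}. \<Sum>l\<in>{1..int N}. (cmod (X j l))\<^sup>2) / real N)"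
proof -
  define T where "T = (\<Sum>j\<in>{1..int N}. \<Sum>l\<in>{1..int N}. (cmod (X j l))\<^sup>2)"
  have "(\<Sum>p\<in>Ps N. (cmod (X (fst p) (snd p)))\<^sup>2) \<le> (\<Sum>p\<in>{1..int N} \<times> {1..int N}. (cmod (X (fst p) (snd p)))\<^sup>2)"
    by (rule sum_mono2) (auto simp: Ps_def)
  also have "\<dots> = T" unfolding T_def by (simp add: sum.cartesian_product case_prod_beta)
  finally have s: "(\<Sum>p\<in>Ps N. (cmod (X (fst p) (snd p)))\<^sup>2) \<le> T" .
  have T0: "0 \<le> T" unfolding T_def by (intro sum_nonneg) simp
  have "(\<Sum>p\<in>Ps N. cmod (X (fst p) (snd p)))\<^sup>2 \<le> (\<Sum>p\<in>Ps N. (cmod (X (fst p) (snd p)))\<^sup>2) * real (card (Ps N))"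
    by (rule sum_squared_le_sum_of_squares)
  also have "\<dots> \<le> T * real (N * (2 * K + 1))" using s card_Ps T0 by (intro mult_mono) (simp_all only: of_nat_le_iff of_nat_0_le_iff)
  finally have "(rho N X)\<^sup>2 \<le> T * real (N * (2 * K + 1)) / (real N)\<^sup>2"
    unfolding rho_def power_divide by (rule divide_right_mono) simp
  also have "\<dots> = (2 * real K + 1) * (T / real N)" using assms by (simp add: power2_eq_square field_simps)
  finally show ?thesis unfolding T_def .
qed

lemma ntr_le_rho: "cmod (ntr {1..int N} X) \<le> rho N X"
proof -
  have "cmod (\<Sum>i\<in>{1..int N}. X i i) \<le> (\<Sum>i\<in>{1..int N}. cmod (X i i))" by (rule norm_sum)
  also have "\<dots> = (\<Sum>p\<in>(\<lambda>i. (i, i)) ` {1..int N}. cmod (X (fst p) (snd p)))"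
    by (subst sum.reindex) (simp_all add: inj_on_def)
  also have "\<dots> \<le> (\<Sum>p\<in>Ps N. cmod (X (fst p) (snd p)))"
    by (rule sum_mono2[OF finite_Ps]) (auto simp: Ps_def Kb_def)
  finally have "cmod (\<Sum>i\<in>{1..int N}. X i i) / real N \<le> rho N X"
    unfolding rho_def by (rule divide_right_mono) simp
  then show ?thesis unfolding ntr_def by (simp add: norm_divide)
qed

text \<open>Schur test: every row and column has at most \<open>2 * K + 1\<close> nonzero entries,
  and each product is split by Young's inequality.\<close>

lemma band_dom:
  assumes b: "\<And>i k. i \<in> {1..int N} \<Longrightarrow> k \<in> {1..int N} \<Longrightarrow> cmod (B i k) \<le> r"
    and z: "\<And>i k. i \<in> {1..int N} \<Longrightarrow> k \<in> {1..int N} \<Longrightarrow> k - i \<notin> Kb \<Longrightarrow> B i k = 0" and r: "0 \<le> r"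
  shows "dom {1..int N} B (\<lambda>v. (2 * real K + 1) * r * sqn {1..int N} v) (\<lambda>v. (2 * real K + 1) * r * sqn {1..int N} v)"
  unfolding dom_def
proof (intro allI)
  fix v w :: "int \<Rightarrow> complex"
  let ?S = "{1..int N}"
  have fl: "(\<Sum>k\<in>?S. if P k then c else 0) = real (card {k\<in>?S. P k}) * c" for P and c :: real
  proof -
    have "(\<Sum>k\<in>?S. if P k then c else 0) = (\<Sum>k\<in>{k\<in>?S. P k}. c)" by (rule sum.inter_filter[symmetric]) simp
    then show ?thesis by simp
  qed
  have "2 * cmod (qf ?S v B w) \<le> 2 * (\<Sum>i\<in>?S. \<Sum>k\<in>?S. cmod (cnj (v i) * B i k * w k))"
    unfolding qf_expand by (intro mult_left_mono order_trans[OF norm_sum] sum_mono) simp_all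
  also have "\<dots> \<le> (\<Sum>i\<in>?S. \<Sum>k\<in>?S. (if k - i \<in> Kb then r * (cmod (v i))\<^sup>2 else 0) + (if k - i \<in> Kb then r * (cmod (w k))\<^sup>2 else 0))"
    unfolding sum_distrib_left
  proof (intro sum_mono)
    fix i k assume ik: "i \<in> ?S" "k \<in> ?S"
    show "2 * cmod (cnj (v i) * B i k * w k) \<le> (if k - i \<in> Kb then r * (cmod (v i))\<^sup>2 else 0) + (if k - i \<in> Kb then r * (cmod (w k))\<^sup>2 else 0)"
    proof (cases "k - i \<in> Kb")
      case True
      have "2 * cmod (cnj (v i) * B i k * w k) = cmod (B i k) * (2 * cmod (v i) * cmod (w k))" by (simp add: norm_mult)
      also have "\<dots> \<le> r * ((cmod (v i))\<^sup>2 + (cmod (w k))\<^sup>2)"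
        using b[OF ik] sum_squares_bound[of "cmod (v i)" "cmod (w k)"] r by (intro mult_mono) simp_all
      finally show ?thesis using True by (simp add: distrib_left)
    next
      case False
      then show ?thesis using z[OF ik False] by simp
    qed
  qed
  also have "\<dots> = (\<Sum>i\<in>?S. \<Sum>k\<in>?S. if k - i \<in> Kb then r * (cmod (v i))\<^sup>2 else 0) + (\<Sum>i\<in>?S. \<Sum>k\<in>?S. if k - i \<in> Kb then r * (cmod (w k))\<^sup>2 else 0)"
    by (simp only: sum.distrib)
  also have "(\<Sum>i\<in>?S. \<Sum>k\<in>?S. if k - i \<in> Kb then r * (cmod (w k))\<^sup>2 else 0) = (\<Sum>k\<in>?S. \<Sum>i\<in>?S. if k - i \<in> Kb then r * (cmod (w k))\<^sup>2 else 0)"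
    by (rule sum.swap)
  also have "(\<Sum>i\<in>?S. \<Sum>k\<in>?S. if k - i \<in> Kb then r * (cmod (v i))\<^sup>2 else 0) \<le> (\<Sum>i\<in>?S. (2 * real K + 1) * (r * (cmod (v i))\<^sup>2))"
    unfolding fl
  proof (intro sum_mono mult_right_mono)
    fix i
    show "real (card {k\<in>?S. k - i \<in> Kb}) \<le> 2 * real K + 1"
      using of_nat_mono[OF card_row[of N i], where 'a = real] by simp
  qed (use r in simp)
  also have "(\<Sum>k\<in>?S. \<Sum>i\<in>?S. if k - i \<in> Kb then r * (cmod (w k))\<^sup>2 else 0) \<le> (\<Sum>k\<in>?S. (2 * real K + 1) * (r * (cmod (w k))\<^sup>2))"
    unfolding fl
  proof (intro sum_mono mult_right_mono)
    fix k
    show "real (card {i\<in>?S. k - i \<in> Kb}) \<le> 2 * real K + 1"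
      using of_nat_mono[OF card_col[of N k], where 'a = real] by simp
  qed (use r in simp)
  finally show "2 * cmod (qf ?S v B w) \<le> (2 * real K + 1) * r * sqn ?S v + (2 * real K + 1) * r * sqn ?S w"
    unfolding sqn_def by (simp only: sum_distrib_left mult.assoc)
qed

end

section \<open>The covariance operator in Kraus form\<close>

locale kmodel = profile K P x c0 \<psi>
  for K :: nat and P :: "nat \<Rightarrow> 'a measure" and x :: "nat \<Rightarrow> nat \<Rightarrow> nat \<Rightarrow> 'a \<Rightarrow> real" and c0 :: real
    and \<psi> :: "real \<Rightarrow> real \<Rightarrow> int \<Rightarrow> int \<Rightarrow> real" +
  fixes N :: nat and Q :: "(bool \<times> nat) set" and kr :: "bool \<times> nat \<Rightarrow> int \<Rightarrow> int \<Rightarrow> real"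
  assumes N_ge1: "N \<ge> 1"
    and kr: "\<And>i j k l. i \<in> {1..int N} \<Longrightarrow> j \<in> {1..int N} \<Longrightarrow> k \<in> {1..int N} \<Longrightarrow> l \<in> {1..int N} \<Longrightarrow>
       xz N i j k l = (if i = k \<and> j = l then c0 else 0) + (\<Sum>a\<in>Q. kr a i j * kr a k l)"
begin

sublocale KM: kraus_map "{1..int N}" Q kr c0
  using N_ge1 c0pos by unfold_locales simp_all

lemma Sig_xz:
  assumes "i \<in> {1..int N}" "k \<in> {1..int N}"
  shows "KM.Sig X i k = (\<Sum>j\<in>{1..int N}. \<Sum>l\<in>{1..int N}. of_real (xz N i j k l) * X j l) / of_nat N"
  using KM.Sig_eq[of "xz N", OF kr assms, of X] by simp

lemma Sig_band: "i \<in> {1..int N} \<Longrightarrow> k \<in> {1..int N} \<Longrightarrow> k - i \<notin> Kb \<Longrightarrow> KM.Sig X i k = 0"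
proof -
  assume ik: "i \<in> {1..int N}" "k \<in> {1..int N}" and "k - i \<notin> Kb"
  then have K: "int K < \<bar>k - i\<bar>" by (auto simp: Kb_def)
  have "of_real (xz N i j k l) * X j l = 0" if "j \<in> {1..int N}" "l \<in> {1..int N}" for j l
    using xz_band[OF ik(1) that(1) ik(2) that(2)] K by simp
  then have "(\<Sum>j\<in>{1..int N}. \<Sum>l\<in>{1..int N}. of_real (xz N i j k l) * X j l) = 0" by (intro sum.neutral ballI)
  then show ?thesis unfolding Sig_xz[OF ik] by simp
qed

lemma Sig_le_rho: "i \<in> {1..int N} \<Longrightarrow> k \<in> {1..int N} \<Longrightarrow> cmod (KM.Sig X i k) \<le> rho N X"
proof -
  assume ik: "i \<in> {1..int N}" "k \<in> {1..int N}"
  let ?S = "{1..int N}"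
  have "cmod (\<Sum>j\<in>?S. \<Sum>l\<in>?S. of_real (xz N i j k l) * X j l) \<le> (\<Sum>j\<in>?S. \<Sum>l\<in>?S. cmod (of_real (xz N i j k l) * X j l))"
    by (intro order_trans[OF norm_sum] sum_mono order_refl)
  also have "\<dots> = (\<Sum>p\<in>?S \<times> ?S. cmod (of_real (xz N i (fst p) k (snd p)) * X (fst p) (snd p)))"
    by (simp add: sum.cartesian_product case_prod_beta)
  also have "\<dots> \<le> (\<Sum>p\<in>?S \<times> ?S. if snd p - fst p \<in> Kb then cmod (X (fst p) (snd p)) else 0)"
  proof (intro sum_mono)
    fix p assume p: "p \<in> ?S \<times> ?S"
    have pS: "fst p \<in> ?S" "snd p \<in> ?S" using mem_Times_iff[THEN iffD1, OF p] by blast+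
    show "cmod (of_real (xz N i (fst p) k (snd p)) * X (fst p) (snd p)) \<le> (if snd p - fst p \<in> Kb then cmod (X (fst p) (snd p)) else 0)"
    proof (cases "snd p - fst p \<in> Kb")
      case True
      have "\<bar>xz N i (fst p) k (snd p)\<bar> * cmod (X (fst p) (snd p)) \<le> 1 * cmod (X (fst p) (snd p))"
        by (intro mult_right_mono xz_bound ik pS) simp
      then show ?thesis using True by (simp add: norm_mult)
    next
      case False
      then have "int K < \<bar>snd p - fst p\<bar>" by (auto simp: Kb_def)
      then have "xz N i (fst p) k (snd p) = 0" using xz_band[OF ik(1) pS(1) ik(2) pS(2)] by blast
      then show ?thesis by simp
    qed
  qed
  also have "\<dots> = (\<Sum>p\<in>Ps N. cmod (X (fst p) (snd p)))"
    unfolding Ps_def by (rule sum.inter_filter[symmetric]) simp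
  finally show ?thesis unfolding Sig_xz[OF ik] rho_def by (simp add: norm_divide divide_right_mono)
qed

lemma dom_Sig:
  "dom {1..int N} (KM.Sig X) (\<lambda>v. (2 * real K + 1) * rho N X * sqn {1..int N} v) (\<lambda>v. (2 * real K + 1) * rho N X * sqn {1..int N} v)"
  by (rule band_dom) (rule Sig_le_rho Sig_band rho_nonneg; assumption)+

end

locale kdisc = discretization K P x c0 \<psi> z n N \<omega> + kmodel K P x c0 \<psi> N Q kr
  for K :: nat and P :: "nat \<Rightarrow> 'a measure" and x :: "nat \<Rightarrow> nat \<Rightarrow> nat \<Rightarrow> 'a \<Rightarrow> real" and c0 :: real
    and \<psi> :: "real \<Rightarrow> real \<Rightarrow> int \<Rightarrow> int \<Rightarrow> real" and z :: complex and n N :: nat and \<omega> :: real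
    and Q :: "(bool \<times> nat) set" and kr :: "bool \<times> nat \<Rightarrow> int \<Rightarrow> int \<Rightarrow> real"
begin

lemma Sig_Mt: "i \<in> S \<Longrightarrow> k \<in> S \<Longrightarrow> KM.Sig Mt i k = Xm i k"
  unfolding Xm_def by (rule Sig_xz)

text \<open>\<open>Mh - Mt\<close> equals \<open>Mh\<close> times the residual \<open>Er\<close>.
  The imaginary part of \<open>Qm z Mt\<close> is at least \<open>c0 * Im tr Mt\<close>, hence at
  least \<open>b\<close>, so \<open>Mh\<close> has operator norm at most \<open>1 / b\<close>. The
  Hilbert-Schmidt size of the residual thus passes to \<open>Mt - Mh\<close>, and from there to
  \<open>rho\<close>.\<close>

lemma Mh_exists:
  assumes b: "0 < b" "b \<le> c0 * Im (ntr S Mt)" and e: "(\<Sum>i\<in>S. \<Sum>l\<in>S. (cmod (Er i l))\<^sup>2) \<le> real N * e"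
  shows "\<exists>Mh. (\<forall>i\<in>S. \<forall>j\<in>S. mm S (KM.Qm z Mt) Mh i j = (if i = j then -1 else 0)) \<and>
     (rho N (\<lambda>i j. Mt i j - Mh i j))\<^sup>2 \<le> (2 * real K + 1) * (e / b\<^sup>2)"
proof -
  obtain Mh where Mh: "\<And>i j. i \<in> S \<Longrightarrow> j \<in> S \<Longrightarrow> mm S (KM.Qm z Mt) Mh i j = (if i = j then -1 else 0)"
    using KM.right_inverse_ex[OF eta Mt_pos] by blast
  have left: "\<And>i j. i \<in> S \<Longrightarrow> j \<in> S \<Longrightarrow> mm S Mh (KM.Qm z Mt) i j = (if i = j then -1 else 0)"
    by (rule KM.left_inverse[OF eta Mt_pos Mh])
  have norm: "b\<^sup>2 * sqn S (mv S Mh v) \<le> sqn S v" for v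
  proof -
    define h where "h = mv S Mh v"
    have Qh: "mv S (KM.Qm z Mt) h i = - v i" if "i \<in> S" for i
      using mm_eq_scalar_mv[OF KM.finS Mh that] unfolding h_def by simp
    have "b * sqn S h \<le> c0 * Im (ntr S Mt) * sqn S h" using b(2) by (intro mult_right_mono) simp_all
    also have "\<dots> \<le> Im (qf S h (KM.Sig Mt) h)" by (rule KM.Im_qf_Sig_ge[OF Mt_pos])
    also have "\<dots> \<le> Im (qf S h (KM.Qm z Mt) h)" unfolding KM.Im_qf_Qm using eta by simp
    also have "qf S h (KM.Qm z Mt) h = - ip S h v"
      unfolding qf_def ip_minus_right[symmetric] by (rule ip_cong) (simp_all only: Qh)
    also have "Im (- ip S h v) \<le> cmod (ip S h v)" using abs_Im_le_cmod[of "ip S h v"] by simp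
    finally have 1: "b * sqn S h \<le> cmod (ip S h v)" .
    have sq: "sqn S (\<lambda>i. of_real b * h i) = b\<^sup>2 * sqn S h"
      by (simp add: sqn_def norm_mult power_mult_distrib sum_distrib_left)
    have "ip S (\<lambda>i. of_real b * h i) v = of_real b * ip S h v"
      unfolding ip_def by (simp add: sum_distrib_left mult.assoc)
    then have "2 * (b * cmod (ip S h v)) \<le> b\<^sup>2 * sqn S h + sqn S v"
      using two_ip_le[of S "\<lambda>i. of_real b * h i" v] b(1) unfolding sq by (simp add: norm_mult)
    moreover have "b * (b * sqn S h) \<le> b * cmod (ip S h v)" using 1 b(1) by (intro mult_left_mono) simp_all
    moreover have "b * (b * sqn S h) = b\<^sup>2 * sqn S h" by (simp add: power2_eq_square)
    ultimately show ?thesis unfolding h_def by linarith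
  qed
  have R: "Mh j l - Mt j l = mv S Mh (\<lambda>i. Er i l) j" if jl: "j \<in> S" "l \<in> S" for j l
  proof -
    have Er: "Er i l = mv S (KM.Qm z Mt) (\<lambda>k. Mt k l) i + (if i = l then 1 else 0)" if i: "i \<in> S" for i
      unfolding Er_def mv_def KM.Qm_def
      by (intro arg_cong2[where f = "(+)"] sum.cong refl) (simp only: Sig_Mt[OF i])
    have "mv S Mh (\<lambda>i. Er i l) j = mv S Mh (\<lambda>i. mv S (KM.Qm z Mt) (\<lambda>k. Mt k l) i + (if i = l then 1 else 0)) j"
      by (rule fun_cong[OF mv_cong]) (rule Er)
    also have "\<dots> = mv S Mh (mv S (KM.Qm z Mt) (\<lambda>k. Mt k l)) j + (\<Sum>i\<in>S. Mh j i * (if i = l then 1 else 0))"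
      unfolding mv_def by (simp only: distrib_left sum.distrib)
    also have "mv S Mh (mv S (KM.Qm z Mt) (\<lambda>k. Mt k l)) j = - Mt j l"
      using mm_eq_scalar_mv[OF KM.finS left jl(1)] by simp
    also have "(\<Sum>i\<in>S. Mh j i * (if i = l then 1 else 0)) = Mh j l"
      using jl(2) by (simp add: if_distrib[of "\<lambda>x. _ * x"] cong: if_cong)
    finally show ?thesis by simp
  qed
  have "(\<Sum>j\<in>S. \<Sum>l\<in>S. (cmod (Mt j l - Mh j l))\<^sup>2) = (\<Sum>j\<in>S. \<Sum>l\<in>S. (cmod (mv S Mh (\<lambda>i. Er i l) j))\<^sup>2)"
    by (intro sum.cong refl) (simp only: norm_minus_commute R)
  also have "\<dots> = (\<Sum>l\<in>S. sqn S (mv S Mh (\<lambda>i. Er i l)))" unfolding sqn_def by (rule sum.swap)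
  finally have "b\<^sup>2 * (\<Sum>j\<in>S. \<Sum>l\<in>S. (cmod (Mt j l - Mh j l))\<^sup>2) = (\<Sum>l\<in>S. b\<^sup>2 * sqn S (mv S Mh (\<lambda>i. Er i l)))"
    by (simp only: sum_distrib_left)
  also have "\<dots> \<le> (\<Sum>l\<in>S. sqn S (\<lambda>i. Er i l))" by (intro sum_mono norm)
  also have "\<dots> = (\<Sum>i\<in>S. \<Sum>l\<in>S. (cmod (Er i l))\<^sup>2)" unfolding sqn_def by (rule sum.swap)
  also have "\<dots> \<le> real N * e" by (rule e)
  finally have "(\<Sum>j\<in>S. \<Sum>l\<in>S. (cmod (Mt j l - Mh j l))\<^sup>2) / real N \<le> e / b\<^sup>2"
    using b(1) N1 by (simp add: field_simps)
  then have "(2 * real K + 1) * ((\<Sum>j\<in>S. \<Sum>l\<in>S. (cmod (Mt j l - Mh j l))\<^sup>2) / real N) \<le> (2 * real K + 1) * (e / b\<^sup>2)"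
    by (intro mult_left_mono) simp_all
  with rho_sq[OF N1, of "\<lambda>i j. Mt i j - Mh i j"] have "(rho N (\<lambda>i j. Mt i j - Mh i j))\<^sup>2 \<le> (2 * real K + 1) * (e / b\<^sup>2)" by linarith
  then show ?thesis using Mh by blast
qed

text \<open>The imaginary part of the trace descends from \<open>\<omega>\<close> for
  \<open>m\<close> to \<open>7 * \<omega> / 8\<close> for \<open>Mt\<close>,
  \<open>3 * \<omega> / 4\<close> for \<open>Mh\<close> and \<open>\<omega> / 2\<close> for
  \<open>M\<close>. The last step rests on \<open>tau_bound\<close>, which presupposes no lower
  bound for the trace of \<open>M\<close>, so there is no circularity.\<close>

lemma ntr_lower:
  assumes M: "\<And>i j. i \<in> S \<Longrightarrow> j \<in> S \<Longrightarrow> mm S (KM.Qm z M) M i j = (if i = j then -1 else 0)"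
    and Mpos: "\<And>v. 0 \<le> Im (qf S v M v)"
    and nNs: "\<Gamma> * (real n / real N) \<le> \<omega> / 8"
    and r0: "0 < r0" "r0 \<le> \<omega> / 8" "(2 * real K + 1) * r0 \<le> c0 * (3 * \<omega> / 4) / 2"
      "(2 * real K + 1) * r0 \<le> c0\<^sup>2 * (3 * \<omega> / 4)^3 / 4"
      "6 * ((2 * real K + 1) * r0) / (c0\<^sup>2 * (3 * \<omega> / 4)\<^sup>2) \<le> \<omega> / 4"
    and e: "real N * (C3 * (e1 + k1)) + (2 * real K * (real N / real n + 1) + real n) * Brow \<le> real N * e"
    and er0: "(2 * real K + 1) * (e / (c0 * (7 * \<omega> / 8))\<^sup>2) \<le> r0\<^sup>2"
  shows "\<omega> / 2 \<le> Im (ntr S M)"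
proof -
  define b where "b = c0 * (7 * \<omega> / 8)"
  have "\<bar>Im (ntr S Mt - trT m)\<bar> \<le> \<omega> / 8" using abs_Im_le_cmod[of "ntr S Mt - trT m"] ntr_Mt nNs by linarith
  then have "\<bar>Im (ntr S Mt) - Im (trT m)\<bar> \<le> \<omega> / 8" by simp
  then have Imt: "7 * \<omega> / 8 \<le> Im (ntr S Mt)" using om_le by linarith
  have b0: "0 < b" unfolding b_def using c0pos om by simp
  have bI: "b \<le> c0 * Im (ntr S Mt)" unfolding b_def using c0pos Imt by (intro mult_left_mono) simp_all
  from Mh_exists[OF b0 bI order_trans[OF Er_total e]]
  obtain Mh where Mh: "\<And>i j. i \<in> S \<Longrightarrow> j \<in> S \<Longrightarrow> mm S (KM.Qm z Mt) Mh i j = (if i = j then -1 else 0)"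
    and rh: "(rho N (\<lambda>i j. Mt i j - Mh i j))\<^sup>2 \<le> (2 * real K + 1) * (e / b\<^sup>2)" by blast
  let ?R = "\<lambda>i j. Mt i j - Mh i j"
  have "(rho N ?R)\<^sup>2 \<le> r0\<^sup>2" using rh er0 unfolding b_def by linarith
  then have rr: "rho N ?R \<le> r0" using r0(1) by (rule power2_le_imp_le[OF _ less_imp_le])
  define \<epsilon> where "\<epsilon> = (2 * real K + 1) * rho N ?R"
  have \<epsilon>0: "0 \<le> \<epsilon>" unfolding \<epsilon>_def using rho_nonneg by simp
  have \<epsilon>r: "\<epsilon> \<le> (2 * real K + 1) * r0" unfolding \<epsilon>_def using rr by (intro mult_left_mono) simp_all
  have "ntr S ?R = ntr S Mt - ntr S Mh" by (rule KM.ntr_diff)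
  then have "\<bar>Im (ntr S Mt) - Im (ntr S Mh)\<bar> \<le> \<omega> / 8"
    using abs_Im_le_cmod[of "ntr S ?R"] ntr_le_rho[of N ?R] rr r0(2) by simp
  then have Imh: "3 * \<omega> / 4 \<le> Im (ntr S Mh)" using Imt by linarith
  have left: "\<And>i j. i \<in> S \<Longrightarrow> j \<in> S \<Longrightarrow> mm S M (KM.Qm z M) i j = (if i = j then -1 else 0)"
    by (rule KM.left_inverse[OF eta Mpos M])
  have "comparison S Q kr c0 z M Mt Mh \<epsilon> (3 * \<omega> / 4)"
  proof (intro comparison.intro KM.kraus_map_axioms comparison_axioms.intro)
    show "dom S (KM.Sig ?R) (\<lambda>v. \<epsilon> * sqn S v) (\<lambda>v. \<epsilon> * sqn S v)" unfolding \<epsilon>_def by (rule dom_Sig)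
    show "\<epsilon> \<le> c0 * (3 * \<omega> / 4) / 2" using \<epsilon>r r0(3) by linarith
    show "\<epsilon> \<le> c0\<^sup>2 * (3 * \<omega> / 4)^3 / 4" using \<epsilon>r r0(4) by linarith
    show "0 < 3 * \<omega> / 4" using om by simp
  qed (fact eta left Mh Mpos Mt_pos \<epsilon>0 Imh)+
  then interpret C: comparison S Q kr c0 z M Mt Mh \<epsilon> "3 * \<omega> / 4" .
  have "cmod C.\<tau> \<le> 6 * \<epsilon> / (c0\<^sup>2 * (3 * \<omega> / 4)\<^sup>2)" by (rule C.tau_bound)
  also have "\<dots> \<le> 6 * ((2 * real K + 1) * r0) / (c0\<^sup>2 * (3 * \<omega> / 4)\<^sup>2)"
    using \<epsilon>r by (intro divide_right_mono mult_left_mono) simp_all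
  finally have "cmod C.\<tau> \<le> \<omega> / 4" using r0(5) by linarith
  moreover have "C.\<tau> = ntr S M - ntr S Mh" unfolding C.\<tau>_def C.Dl_def by (rule KM.ntr_diff)
  ultimately have "\<bar>Im (ntr S M) - Im (ntr S Mh)\<bar> \<le> \<omega> / 4" using abs_Im_le_cmod[of C.\<tau>] by simp
  then show ?thesis using Imh by linarith
qed

end

section \<open>Transfer to the matrices and norms of the statement\<close>

lemma sum_int_nat: "sum f {1..int N} = (\<Sum>i\<in>{1..N}. f (int i))"
  by (rule sum.reindex_bij_witness[of _ int nat]) auto

lemma finite_entries:
  fixes N :: nat
  shows "finite (insert 0 {cmod (A i j) | i j. i \<in> {1..N} \<and> j \<in> {1..N}})"
proof -
  have "{cmod (A i j) | i j. i \<in> {1..N} \<and> j \<in> {1..N}} \<subseteq> (\<Union>i\<in>{1..N}. cmod ` A i ` {1..N})" by blast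
  then have "finite {cmod (A i j) | i j. i \<in> {1..N} \<and> j \<in> {1..N}}" by (rule finite_subset) simp
  then show ?thesis by (rule finite.insertI)
qed

lemma maxnorm_ge: "i \<in> {1..N} \<Longrightarrow> j \<in> {1..N} \<Longrightarrow> cmod (A i j) \<le> maxnorm N A"
  unfolding maxnorm_def by (rule Max_ge[OF finite_entries]) blast

lemma maxnorm_nonneg: "0 \<le> maxnorm N A"
  unfolding maxnorm_def by (rule Max_ge[OF finite_entries]) blast

lemma maxnorm_le:
  assumes "0 \<le> B" "\<And>i j. i \<in> {1..N} \<Longrightarrow> j \<in> {1..N} \<Longrightarrow> cmod (A i j) \<le> B"
  shows "maxnorm N A \<le> B"
  unfolding maxnorm_def using assms by (intro Max.boundedI finite_entries) auto

definition mat_int :: "(nat \<Rightarrow> nat \<Rightarrow> complex) \<Rightarrow> int \<Rightarrow> int \<Rightarrow> complex" where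
  "mat_int A i j = A (nat i) (nat j)"

lemma mat_int_le_maxnorm:
  assumes "i \<in> {1..int N}" "j \<in> {1..int N}"
  shows "cmod (mat_int A i j) \<le> maxnorm N A"
  unfolding mat_int_def using assms by (intro maxnorm_ge) auto

text \<open>The form in \<open>Mplus\<close> is the imaginary part of the form of \<open>M\<close>;
  the strict inequality is relaxed so as to include vectors that vanish on the index range.\<close>

lemma Mplus_Im_qf:
  assumes "Mplus N M"
  shows "0 \<le> Im (qf {1..int N} v (mat_int M) v)"
proof -
  define u where "u i = v (int i)" for i
  define A where "A = (\<Sum>i\<in>{1..N}. \<Sum>j\<in>{1..N}. cnj (u i) * M i j * u j)"
  have qf: "qf {1..int N} v (mat_int M) v = A"
    unfolding A_def u_def qf_expand sum_int_nat mat_int_def by simp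
  show ?thesis
  proof (cases "\<exists>i\<in>{1..N}. u i \<noteq> 0")
    case True
    have "(\<Sum>i\<in>{1..N}. \<Sum>j\<in>{1..N}. cnj (u i) * cnj (M j i) * u j) = (\<Sum>j\<in>{1..N}. \<Sum>i\<in>{1..N}. cnj (u i) * cnj (M j i) * u j)"
      by (rule sum.swap)
    also have "\<dots> = cnj A" unfolding A_def by (simp add: ac_simps)
    finally have c: "(\<Sum>i\<in>{1..N}. \<Sum>j\<in>{1..N}. cnj (u i) * cnj (M j i) * u j) = cnj A" .
    have "(\<Sum>i\<in>{1..N}. \<Sum>j\<in>{1..N}. cnj (u i) * ((M i j - cnj (M j i)) / (2 * \<i>)) * u j) =
        (\<Sum>i\<in>{1..N}. \<Sum>j\<in>{1..N}. (cnj (u i) * M i j * u j - cnj (u i) * cnj (M j i) * u j) / (2 * \<i>))"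
      by (intro sum.cong refl) (simp add: field_simps)
    also have "\<dots> = (A - cnj A) / (2 * \<i>)"
      unfolding sum_divide_distrib[symmetric] sum_subtractf c A_def by simp
    also have "\<dots> = of_real (Im A)" by (simp add: complex_eq_iff complex_diff_cnj)
    finally have eq: "(\<Sum>i\<in>{1..N}. \<Sum>j\<in>{1..N}. cnj (u i) * ((M i j - cnj (M j i)) / (2 * \<i>)) * u j) = of_real (Im A)" .
    have "0 < Re (\<Sum>i\<in>{1..N}. \<Sum>j\<in>{1..N}. cnj (u i) * ((M i j - cnj (M j i)) / (2 * \<i>)) * u j)"
      using assms True unfolding Mplus_def by blast
    then show ?thesis unfolding qf eq by simp
  next
    case False
    then have "A = 0" unfolding A_def by (intro sum.neutral ballI) auto
    then show ?thesis unfolding qf by simp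
  qed
qed

lemma small_ex:
  fixes a b c d :: real
  assumes "0 < A" "0 < B" "0 < C" "0 < D" "0 < a" "0 < b" "0 < c" "0 < d"
  shows "\<exists>r>0. A * r \<le> a \<and> B * r \<le> b \<and> C * r \<le> c \<and> D * r \<le> d"
proof (intro exI conjI)
  let ?r = "min (min (a / A) (b / B)) (min (c / C) (d / D))"
  show "0 < ?r" using assms by simp
  have *: "E * ?r \<le> e" if "?r \<le> e / E" "0 < E" for e E :: real
    using that by (simp only: pos_le_divide_eq mult.commute)
  show "A * ?r \<le> a" "B * ?r \<le> b" "C * ?r \<le> c" "D * ?r \<le> d" using assms by (auto intro!: *)
qed

context profile
begin

text \<open>Read off from \<open>entry_bound\<close>: \<open>c0\<close> times the constant of
  \<open>tau_bound\<close> plus 1, over the square of \<open>c0 * \<omega> / 2\<close>, a common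
  lower bound for \<open>bM\<close> and \<open>bH\<close>. One factor \<open>2 * K + 1\<close> leads
  from the maximum norm to \<open>rho\<close>, the other from \<open>rho\<close> to the domination
  constant.\<close>

definition Cs :: "real \<Rightarrow> real" where
  "Cs \<omega> = (2 * real K + 1)\<^sup>2 * (c0 * (6 / (c0\<^sup>2 * \<omega>\<^sup>2)) + 1) / (c0 * \<omega> / 2)\<^sup>2"

text \<open>The order of the choices matters: \<open>n\<close> comes first and makes the boundary
  terms of order \<open>K / n\<close> small, then \<open>N\<close>, because the mean deviation tends
  to zero only for fixed \<open>n\<close>.\<close>

lemma sizes_ex:
  assumes r: "0 < r" and s: "0 < s"
  shows "\<exists>n\<ge>1. \<exists>N0. \<forall>N\<ge>N0. n \<le> N \<and> G * (real n / real N) \<le> s \<and>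
    C * ((\<integral>\<phi>. dN n N \<phi> \<partial>U) + (2 * real K + 1) * (real K / real n)) + (2 * real K * (1 / real n + 1 / real N) + real n / real N) * B \<le> r"
proof -
  have "(\<lambda>n. C * (0 + (2 * real K + 1) * (real K / real n)) + (2 * real K * (1 / real n + 0) + 0) * B)
      \<longlonglongrightarrow> C * (0 + (2 * real K + 1) * 0) + (2 * real K * (0 + 0) + 0) * B"
    by (intro tendsto_add tendsto_mult tendsto_const lim_const_over_n)
  then have "\<forall>\<^sub>F n in sequentially. C * (0 + (2 * real K + 1) * (real K / real n)) + (2 * real K * (1 / real n + 0) + 0) * B < r"
    by (rule order_tendstoD(2)) (use r in simp)
  then have "\<forall>\<^sub>F n in sequentially. 1 \<le> n \<and> C * (0 + (2 * real K + 1) * (real K / real n)) + (2 * real K * (1 / real n + 0) + 0) * B < r"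
    by (rule eventually_conj[OF eventually_ge_at_top])
  then obtain n where n: "1 \<le> n" "C * (0 + (2 * real K + 1) * (real K / real n)) + (2 * real K * (1 / real n + 0) + 0) * B < r"
    using eventually_happens'[OF sequentially_bot] by blast
  have "(\<lambda>N. C * ((\<integral>\<phi>. dN n N \<phi> \<partial>U) + (2 * real K + 1) * (real K / real n)) + (2 * real K * (1 / real n + 1 / real N) + real n / real N) * B)
      \<longlonglongrightarrow> C * (0 + (2 * real K + 1) * (real K / real n)) + (2 * real K * (1 / real n + 0) + 0) * B"
    by (intro tendsto_add[OF tendsto_mult tendsto_mult] tendsto_add[OF tendsto_mult] tendsto_add tendsto_mult[OF tendsto_const] tendsto_const lim_const_over_n e1_limit n(1))
  then have 1: "\<forall>\<^sub>F N in sequentially. C * ((\<integral>\<phi>. dN n N \<phi> \<partial>U) + (2 * real K + 1) * (real K / real n)) + (2 * real K * (1 / real n + 1 / real N) + real n / real N) * B < r"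
    using n(2) by (rule order_tendstoD(2))
  have "(\<lambda>N. G * (real n / real N)) \<longlonglongrightarrow> G * 0" by (intro tendsto_mult[OF tendsto_const] lim_const_over_n)
  then have 2: "\<forall>\<^sub>F N in sequentially. G * (real n / real N) < s" by (rule order_tendstoD(2)) (use s in simp)
  have "\<forall>\<^sub>F N in sequentially. n \<le> N \<and> G * (real n / real N) \<le> s \<and>
    C * ((\<integral>\<phi>. dN n N \<phi> \<partial>U) + (2 * real K + 1) * (real K / real n)) + (2 * real K * (1 / real n + 1 / real N) + real n / real N) * B \<le> r"
    by (rule eventually_elim2[OF eventually_conj[OF eventually_ge_at_top[of n] 2] 1]) linarith
  then show ?thesis using n(1) unfolding eventually_sequentially by blast
qed

end

context kmodel
begin

lemma Sig_mat_int:
  assumes i: "i \<in> {1..int N}" and j: "j \<in> {1..N}"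
  shows "KM.Sig (mat_int M) i (int j) = Xi P x N M (nat i) j"
proof -
  have j': "int j \<in> {1..int N}" using j by simp
  show ?thesis unfolding Sig_xz[OF i j'] Xi_def sum_int_nat xz_def mat_int_def by simp
qed

lemma F_is_Qm:
  assumes F: "F_is P x N z M B" and i: "i \<in> {1..int N}" and k: "k \<in> {1..int N}"
  shows "mm {1..int N} (KM.Qm z (mat_int M)) (mat_int B) i k = (if i = k then -1 else 0)"
proof -
  have ik: "nat i \<in> {1..N}" "nat k \<in> {1..N}" "(nat i = nat k) = (i = k)" using i k by auto
  have e: "KM.Qm z (mat_int M) i (int j) * mat_int B (int j) k =
      - ((- (if nat i = j then z else 0) - Xi P x N M (nat i) j) * B j (nat k))" if "j \<in> {1..N}" for j
  proof -
    have "(i = int j) = (nat i = j)" using i by auto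
    then show ?thesis unfolding KM.Qm_def Sig_mat_int[OF i that] mat_int_def by (simp add: algebra_simps)
  qed
  have "mm {1..int N} (KM.Qm z (mat_int M)) (mat_int B) i k = - (\<Sum>j\<in>{1..N}. (- (if nat i = j then z else 0) - Xi P x N M (nat i) j) * B j (nat k))"
    unfolding mm_def sum_int_nat sum_negf[symmetric] by (rule sum.cong[OF refl]) (rule e)
  also have "\<dots> = - (if nat i = nat k then 1 else 0)"
    using F ik(1,2) unfolding F_is_def is_mat_inverse_def by simp
  finally show ?thesis unfolding ik(3) by simp
qed

text \<open>Comparison with \<open>M'\<close> as \<open>Mt\<close> and \<open>M' - R\<close> as
  \<open>Mh\<close>, which is exactly \<open>F\<close> of \<open>M'\<close>. Closeness of
  \<open>M'\<close> to \<open>M\<close> and smallness of \<open>R\<close> let \<open>Mh\<close>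
  retain half of the trace bound \<open>2 * \<omega>\<close>. The 1 added to \<open>Cs\<close>
  accounts for \<open>R\<close> itself, the difference of \<open>M'\<close> and
  \<open>Mh\<close>.\<close>

lemma stability:
  assumes eta: "Im z > 0" and om: "\<omega> > 0"
    and M: "Mplus N M" "F_is P x N z M M"
    and M': "Mplus N M'" "F_is P x N z M' (\<lambda>i j. M' i j - R i j)"
    and ntrM: "2 * \<omega> \<le> Im (ntr {1..int N} (mat_int M))"
    and small: "maxnorm N (\<lambda>i j. M' i j - M i j) \<le> \<epsilon>" "maxnorm N R \<le> \<epsilon>"
    and e1: "2 * (2 * real K + 1) * \<epsilon> \<le> \<omega>" and e2: "(2 * real K + 1)\<^sup>2 * \<epsilon> \<le> c0 * \<omega> / 2"
    and e3: "(2 * real K + 1)\<^sup>2 * \<epsilon> \<le> c0\<^sup>2 * \<omega>^3 / 4"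
  shows "maxnorm N (\<lambda>i j. M' i j - M i j) \<le> (Cs \<omega> + 1) * maxnorm N R"
proof -
  let ?S = "{1..int N}"
  define Mz M'z Rz Mh where "Mz = mat_int M" and "M'z = mat_int M'" and "Rz = mat_int R"
    and "Mh = mat_int (\<lambda>i j. M' i j - R i j)"
  define r where "r = maxnorm N R"
  define \<epsilon>' where "\<epsilon>' = (2 * real K + 1) * rho N Rz"
  have r0: "0 \<le> r" unfolding r_def by (rule maxnorm_nonneg)
  have rhoR: "rho N Rz \<le> (2 * real K + 1) * r"
    unfolding Rz_def r_def by (intro rho_max N_ge1 mat_int_le_maxnorm maxnorm_nonneg)
  have \<epsilon>'0: "0 \<le> \<epsilon>'" unfolding \<epsilon>'_def using rho_nonneg by simp
  have \<epsilon>'r: "\<epsilon>' \<le> (2 * real K + 1)\<^sup>2 * r"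
    unfolding \<epsilon>'_def power2_eq_square mult.assoc by (intro mult_left_mono rhoR) simp
  also have "\<dots> \<le> (2 * real K + 1)\<^sup>2 * \<epsilon>" unfolding r_def by (intro mult_left_mono small) simp
  finally have \<epsilon>'\<epsilon>: "\<epsilon>' \<le> (2 * real K + 1)\<^sup>2 * \<epsilon>" .
  have K\<epsilon>: "rho N (mat_int A) \<le> \<omega> / 2" if "maxnorm N A \<le> \<epsilon>" for A
  proof -
    have "rho N (mat_int A) \<le> (2 * real K + 1) * maxnorm N A"
      by (intro rho_max N_ge1 mat_int_le_maxnorm maxnorm_nonneg)
    also have "\<dots> \<le> (2 * real K + 1) * \<epsilon>" by (intro mult_left_mono that) simp
    finally show ?thesis using e1 by linarith
  qed
  have d1: "(\<lambda>i j. M'z i j - Mh i j) = Rz" unfolding M'z_def Mh_def Rz_def mat_int_def by simp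
  have d2: "(\<lambda>i j. M'z i j - Mz i j) = mat_int (\<lambda>i j. M' i j - M i j)" unfolding M'z_def Mz_def mat_int_def by simp
  have "\<bar>Im (ntr ?S M'z - ntr ?S Mh)\<bar> \<le> \<omega> / 2"
    unfolding KM.ntr_diff[symmetric] d1 Rz_def
    by (rule order_trans[OF abs_Im_le_cmod order_trans[OF ntr_le_rho K\<epsilon>[OF small(2)]]])
  moreover have "\<bar>Im (ntr ?S M'z - ntr ?S Mz)\<bar> \<le> \<omega> / 2"
    unfolding KM.ntr_diff[symmetric] d2
    by (rule order_trans[OF abs_Im_le_cmod order_trans[OF ntr_le_rho K\<epsilon>[OF small(1)]]])
  ultimately have ntrH: "\<omega> \<le> Im (ntr ?S Mh)" using ntrM unfolding Mz_def[symmetric] minus_complex.sel by linarith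
  have Mpos: "\<And>v. 0 \<le> Im (qf ?S v Mz v)" unfolding Mz_def by (rule Mplus_Im_qf[OF M(1)])
  have M'pos: "\<And>v. 0 \<le> Im (qf ?S v M'z v)" unfolding M'z_def by (rule Mplus_Im_qf[OF M'(1)])
  have QM: "\<And>i j. i \<in> ?S \<Longrightarrow> j \<in> ?S \<Longrightarrow> mm ?S (KM.Qm z Mz) Mz i j = (if i = j then -1 else 0)"
    unfolding Mz_def by (rule F_is_Qm[OF M(2)])
  have MQ: "\<And>i j. i \<in> ?S \<Longrightarrow> j \<in> ?S \<Longrightarrow> mm ?S Mz (KM.Qm z Mz) i j = (if i = j then -1 else 0)"
    by (rule KM.left_inverse[OF eta Mpos QM])
  have QH: "\<And>i j. i \<in> ?S \<Longrightarrow> j \<in> ?S \<Longrightarrow> mm ?S (KM.Qm z M'z) Mh i j = (if i = j then -1 else 0)"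
    unfolding M'z_def Mh_def by (rule F_is_Qm[OF M'(2)])
  have "comparison ?S Q kr c0 z Mz M'z Mh \<epsilon>' \<omega>"
  proof (intro comparison.intro KM.kraus_map_axioms comparison_axioms.intro)
    show "dom ?S (KM.Sig (\<lambda>i j. M'z i j - Mh i j)) (\<lambda>v. \<epsilon>' * sqn ?S v) (\<lambda>v. \<epsilon>' * sqn ?S v)"
      unfolding \<epsilon>'_def d1 by (rule dom_Sig)
    show "\<epsilon>' \<le> c0 * \<omega> / 2" using \<epsilon>'\<epsilon> e2 by linarith
    show "\<epsilon>' \<le> c0\<^sup>2 * \<omega>^3 / 4" using \<epsilon>'\<epsilon> e3 by linarith
  qed (fact eta MQ QH Mpos M'pos \<epsilon>'0 ntrH om)+
  then interpret C: comparison ?S Q kr c0 z Mz M'z Mh \<epsilon>' \<omega> .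
  define b where "b = c0 * \<omega> / 2"
  have b0: "0 < b" unfolding b_def using c0pos om by simp
  have inv: "1 / t\<^sup>2 \<le> 1 / b\<^sup>2" if "b \<le> t" for t
    using that b0 by (intro divide_left_mono power_mono) (simp_all add: zero_less_mult_iff)
  have "c0 * \<omega> / 2 \<le> c0 * (2 * \<omega>)" using c0pos om by simp
  also have "\<dots> \<le> c0 * Im (ntr ?S Mz)" unfolding Mz_def using c0pos ntrM by (intro mult_left_mono) simp_all
  finally have bM: "b \<le> C.bM" unfolding C.bM_def b_def using eta by linarith
  have bH: "b \<le> C.bH" unfolding b_def by (rule C.bH_ge(2))
  define c where "c = c0 * (6 / (c0\<^sup>2 * \<omega>\<^sup>2)) + 1"
  have c0': "0 \<le> c" unfolding c_def using c0pos by simp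
  have "c0 * cmod C.\<tau> \<le> c0 * (6 * \<epsilon>' / (c0\<^sup>2 * \<omega>\<^sup>2))" using C.tau_bound c0pos by (intro mult_left_mono) simp_all
  then have t: "c0 * cmod C.\<tau> + \<epsilon>' \<le> c * \<epsilon>'" unfolding c_def by (simp add: distrib_right)
  have ent: "cmod (Mz i j - Mh i j) \<le> Cs \<omega> * r" if "i \<in> ?S" "j \<in> ?S" for i j
  proof -
    have "2 * cmod (Mz i j - Mh i j) \<le> (c0 * cmod C.\<tau> + \<epsilon>') * (1 / C.bM\<^sup>2 + 1 / C.bH\<^sup>2)"
      by (rule C.entry_bound[OF that])
    also have "\<dots> \<le> (c * \<epsilon>') * (1 / b\<^sup>2 + 1 / b\<^sup>2)"
      using t inv[OF bM] inv[OF bH] c0' \<epsilon>'0 by (intro mult_mono add_mono) simp_all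
    also have "\<dots> = 2 * ((c / b\<^sup>2) * \<epsilon>')" by simp
    finally have "cmod (Mz i j - Mh i j) \<le> (c / b\<^sup>2) * \<epsilon>'" by linarith
    also have "\<dots> \<le> (c / b\<^sup>2) * ((2 * real K + 1)\<^sup>2 * r)" using c0' by (intro mult_left_mono \<epsilon>'r) simp
    also have "\<dots> = Cs \<omega> * r" unfolding Cs_def c_def[symmetric] b_def[symmetric] by simp
    finally show ?thesis .
  qed
  have Cs0: "0 \<le> Cs \<omega>" unfolding Cs_def c_def[symmetric] using c0' by simp
  show ?thesis
  proof (rule maxnorm_le)
    show "0 \<le> (Cs \<omega> + 1) * maxnorm N R" using Cs0 maxnorm_nonneg[of N R] by simp
    fix i j assume ij: "i \<in> {1..N}" "j \<in> {1..N}"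
    then have ij': "int i \<in> ?S" "int j \<in> ?S" by simp_all
    have "M' i j - M i j = - (Mz (int i) (int j) - Mh (int i) (int j)) + R i j"
      unfolding Mz_def Mh_def mat_int_def by simp
    then have "cmod (M' i j - M i j) \<le> cmod (Mz (int i) (int j) - Mh (int i) (int j)) + cmod (R i j)"
      using norm_triangle_ineq[of "- (Mz (int i) (int j) - Mh (int i) (int j))" "R i j"] unfolding norm_minus_cancel by simp
    also have "\<dots> \<le> Cs \<omega> * r + r" unfolding r_def
      by (rule add_mono[OF ent[OF ij', unfolded r_def] maxnorm_ge[OF ij]])
    finally show "cmod (M' i j - M i j) \<le> (Cs \<omega> + 1) * maxnorm N R" unfolding r_def by (simp add: distrib_right)
  qed
qed

end

context profile
begin

text \<open>All thresholds are built from \<open>c0\<close>, \<open>\<omega>\<close>,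
  \<open>K\<close> and the bound \<open>Zb\<close> on the domain before \<open>z\<close> is fixed.
  The deviation \<open>dN\<close> involves only the covariance and the profile, so its convergence
  is automatically uniform in \<open>z\<close>, although \<open>m\<close> and its regularity depend
  on \<open>z\<close>.\<close>

lemma ntr_lower_uniform:
  assumes om: "0 < \<omega>" and Zb: "\<And>z. z \<in> D \<Longrightarrow> cmod z \<le> Zb" and D: "\<And>z. z \<in> D \<Longrightarrow> 0 < Im z"
    and lim: "\<And>z m. z \<in> D \<Longrightarrow> m \<in> Tplus \<Longrightarrow> solves_limit_eq \<psi> z m \<Longrightarrow> \<omega> \<le> Im (trT m)"
  shows "\<exists>N0. \<forall>N\<ge>N0. \<forall>z\<in>D. \<forall>M. Mplus N M \<and> F_is P x N z M M \<longrightarrow> \<omega> / 2 \<le> Im (ntr {1..int N} (mat_int M))"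
proof -
  define \<kappa> where "\<kappa> = 2 * real K + 1"
  define b where "b = c0 * (7 * \<omega> / 8)"
  define \<Gamma> where "\<Gamma> = 1 / (c0 * \<omega>)"
  define C where "C = \<kappa> * (\<kappa> * ((2 * \<kappa> * \<Gamma> * \<Gamma>) * \<Gamma>\<^sup>2))"
  define Br where "Br = 2 * (\<kappa> * (\<kappa> * ((Zb + \<kappa> * \<Gamma>)\<^sup>2 * \<Gamma>\<^sup>2))) + 2"
  have \<kappa>0: "0 < \<kappa>" unfolding \<kappa>_def by simp
  have b0: "0 < b" unfolding b_def using c0pos om by simp
  have \<Gamma>0: "0 < \<Gamma>" unfolding \<Gamma>_def using c0pos om by simp
  have d0: "0 < c0\<^sup>2 * (3 * \<omega> / 4)\<^sup>2" using c0pos om by simp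
  have "\<exists>r>0. 1 * r \<le> \<omega> / 8 \<and> \<kappa> * r \<le> c0 * (3 * \<omega> / 4) / 2 \<and> \<kappa> * r \<le> c0\<^sup>2 * (3 * \<omega> / 4)^3 / 4 \<and>
      6 * \<kappa> / (c0\<^sup>2 * (3 * \<omega> / 4)\<^sup>2) * r \<le> \<omega> / 4"
    by (rule small_ex) (use c0pos om \<kappa>0 d0 in simp_all)
  then obtain r0 where r0: "0 < r0" "1 * r0 \<le> \<omega> / 8" "\<kappa> * r0 \<le> c0 * (3 * \<omega> / 4) / 2"
      "\<kappa> * r0 \<le> c0\<^sup>2 * (3 * \<omega> / 4)^3 / 4" "6 * \<kappa> / (c0\<^sup>2 * (3 * \<omega> / 4)\<^sup>2) * r0 \<le> \<omega> / 4" by blast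
  \<comment> \<open>Threshold for the residual per row: by \<open>Mh_exists\<close> it makes
    \<open>rho\<close> of \<open>Mt - Mh\<close> at most \<open>r0\<close>.\<close>
  have rp: "0 < r0\<^sup>2 * b\<^sup>2 / \<kappa>" using r0(1) b0 \<kappa>0 by simp
  obtain n N0 where n: "1 \<le> n" and N0: "\<And>N. N0 \<le> N \<Longrightarrow> n \<le> N \<and> \<Gamma> * (real n / real N) \<le> \<omega> / 8 \<and>
    C * ((\<integral>\<phi>. dN n N \<phi> \<partial>U) + (2 * real K + 1) * (real K / real n)) + (2 * real K * (1 / real n + 1 / real N) + real n / real N) * Br \<le> r0\<^sup>2 * b\<^sup>2 / \<kappa>"
    using sizes_ex[OF rp, of "\<omega> / 8" \<Gamma> C Br] om by auto
  show ?thesis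
  proof (rule exI[of _ N0], intro allI ballI impI)
    fix N z M assume N: "N0 \<le> N" and z: "z \<in> D" and M: "Mplus N M \<and> F_is P x N z M M"
    have nN: "n \<le> N" and nN8: "\<Gamma> * (real n / real N) \<le> \<omega> / 8" using N0[OF N] by blast+
    have N1: "1 \<le> N" using n nN by simp
    obtain Q :: "(bool \<times> nat) set" and kr where kr: "\<And>i j k l. i \<in> {1..int N} \<Longrightarrow> j \<in> {1..int N} \<Longrightarrow> k \<in> {1..int N} \<Longrightarrow> l \<in> {1..int N} \<Longrightarrow>
       xz N i j k l = (if i = k \<and> j = l then c0 else 0) + (\<Sum>a\<in>Q. kr a i j * kr a k l)"
      using kraus_ex[of N] by blast
    interpret L: limit_problem K P x c0 \<psi> z using D[OF z] by unfold_locales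
    have om_le: "\<omega> \<le> Im (trT L.m)" by (rule lim[OF z L.m_Tplus L.solves])
    have ax1: "discretization_axioms K \<psi> z n N \<omega>"
      by (intro discretization_axioms.intro n nN om om_le)
    have ax2: "kmodel_axioms P x c0 N Q kr"
      by (intro kmodel_axioms.intro N1) (fact kr)
    interpret KD: kdisc K P x c0 \<psi> z n N \<omega> Q kr
      by (intro kdisc.intro discretization.intro kmodel.intro L.limit_problem_axioms profile_axioms ax1 ax2)
    define e where "e = C * ((\<integral>\<phi>. dN n N \<phi> \<partial>U) + (2 * real K + 1) * (real K / real n)) + (2 * real K * (1 / real n + 1 / real N) + real n / real N) * Br"
    have C3: "KD.C3 = C" unfolding KD.C3_def C_def KD.\<Gamma>_def \<Gamma>_def \<kappa>_def by (rule refl)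
    have Brow: "KD.Brow \<le> Br"
      unfolding KD.Brow_def Br_def KD.\<Gamma>_def \<Gamma>_def[symmetric] \<kappa>_def[symmetric]
      using \<kappa>0 \<Gamma>0 Zb[OF z] by (intro add_mono mult_left_mono mult_right_mono power_mono order_refl) simp_all
    have eb: "(2 * real K * (real N / real n + 1) + real n) * Br = real N * ((2 * real K * (1 / real n + 1 / real N) + real n / real N) * Br)"
      using N1 by (simp add: field_simps)
    have "real N * (KD.C3 * (KD.e1 + KD.k1)) + (2 * real K * (real N / real n + 1) + real n) * KD.Brow
        \<le> real N * (KD.C3 * (KD.e1 + KD.k1)) + (2 * real K * (real N / real n + 1) + real n) * Br"
      using Brow by (intro add_left_mono mult_left_mono) simp_all
    also have "\<dots> = real N * e"
      unfolding eb e_def C3 KD.e1_def KD.k1_def by (simp only: distrib_left)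
    finally have e: "real N * (KD.C3 * (KD.e1 + KD.k1)) + (2 * real K * (real N / real n + 1) + real n) * KD.Brow \<le> real N * e" .
    have "e \<le> r0\<^sup>2 * b\<^sup>2 / \<kappa>" unfolding e_def using N0[OF N] by blast
    then have "e * \<kappa> \<le> r0\<^sup>2 * b\<^sup>2" using \<kappa>0 by (simp only: pos_le_divide_eq)
    then have "e * \<kappa> / b\<^sup>2 \<le> r0\<^sup>2" using b0 by (simp only: pos_divide_le_eq zero_less_power)
    then have er: "(2 * real K + 1) * (e / (c0 * (7 * \<omega> / 8))\<^sup>2) \<le> r0\<^sup>2"
      unfolding \<kappa>_def[symmetric] b_def[symmetric] by (simp add: mult.commute)
    show "\<omega> / 2 \<le> Im (ntr {1..int N} (mat_int M))"
    proof (rule KD.ntr_lower)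
      show "KD.\<Gamma> * (real n / real N) \<le> \<omega> / 8" unfolding KD.\<Gamma>_def \<Gamma>_def[symmetric] by (rule nN8)
      show "0 < r0" "r0 \<le> \<omega> / 8" using r0(1,2) by simp_all
      show "(2 * real K + 1) * r0 \<le> c0 * (3 * \<omega> / 4) / 2" "(2 * real K + 1) * r0 \<le> c0\<^sup>2 * (3 * \<omega> / 4)^3 / 4"
        unfolding \<kappa>_def[symmetric] by (fact r0)+
      show "6 * ((2 * real K + 1) * r0) / (c0\<^sup>2 * (3 * \<omega> / 4)\<^sup>2) \<le> \<omega> / 4"
        unfolding \<kappa>_def[symmetric] using r0(5) by (simp only: mult.assoc times_divide_eq_left)
      show "mm {1..int N} (KD.KM.Qm z (mat_int M)) (mat_int M) i j = (if i = j then -1 else 0)"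
        if "i \<in> {1..int N}" "j \<in> {1..int N}" for i j
        by (rule KD.F_is_Qm[OF conjunct2[OF M] that])
      show "0 \<le> Im (qf {1..int N} v (mat_int M) v)" for v by (rule Mplus_Im_qf[OF conjunct1[OF M]])
    qed (fact e er)+
  qed
qed

end

theorem theorem4p21:
  fixes K :: nat
    and P :: "nat \<Rightarrow> 'a measure"
    and x :: "nat \<Rightarrow> nat \<Rightarrow> nat \<Rightarrow> 'a \<Rightarrow> real"
    and \<psi> :: "real \<Rightarrow> real \<Rightarrow> int \<Rightarrow> int \<Rightarrow> real"
    and c0 \<omega> :: real
    and D :: "complex set"
  assumes "K \<ge> 1"
    and "K_dependent_model K P x"
    and "psi_profile K P x \<psi>"
    and "c0 > 0"
    and "xi_pos_def P x c0"
    and "open D" and "connected D" and "bounded D" and "D \<subseteq> {z. Im z > 0}"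
    and "\<omega> > 0"
    and "\<forall>z\<in>D. \<forall>m. m \<in> Tplus \<and> solves_limit_eq \<psi> z m \<longrightarrow> Im (trT m) \<ge> \<omega>"
  shows "\<exists>\<epsilon>>0. \<exists>c ND. \<forall>N \<ge> ND. \<forall>z\<in>D. \<forall>M M' R.
           Mplus N M \<and> F_is P x N z M M \<and>
           Mplus N M' \<and> F_is P x N z M' (\<lambda>i j. M' i j - R i j) \<and>
           max (maxnorm N (\<lambda>i j. M' i j - M i j)) (maxnorm N R) \<le> \<epsilon> \<longrightarrow>
           maxnorm N (\<lambda>i j. M' i j - M i j) \<le> c * (maxnorm N R + 1 / real N)"
proof -
  interpret profile K P x c0 \<psi>
    using assms(2-5) by (intro profile.intro model.intro profile_axioms.intro)
  obtain Zb where Zb: "\<And>z. z \<in> D \<Longrightarrow> cmod z \<le> Zb" using assms(8) unfolding bounded_iff by blast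
  have D: "\<And>z. z \<in> D \<Longrightarrow> 0 < Im z" using assms(9) by blast
  have lim: "\<And>z m. z \<in> D \<Longrightarrow> m \<in> Tplus \<Longrightarrow> solves_limit_eq \<psi> z m \<Longrightarrow> \<omega> \<le> Im (trT m)"
    using assms(11) by blast
  from ntr_lower_uniform[OF assms(10) Zb D lim] obtain N0 where
    N0: "\<forall>N\<ge>N0. \<forall>z\<in>D. \<forall>M. Mplus N M \<and> F_is P x N z M M \<longrightarrow> \<omega> / 2 \<le> Im (ntr {1..int N} (mat_int M))" ..
  \<comment> \<open>The trace bound \<open>\<omega> / 2\<close> for \<open>M\<close> is then
    \<open>2 * w\<close>, the form in which \<open>stability\<close> asks for it.\<close>
  define w where "w = \<omega> / 4"
  have w: "0 < w" unfolding w_def using assms(10) by simp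
  have "\<exists>\<epsilon>>0. 1 * \<epsilon> \<le> 1 \<and> 2 * (2 * real K + 1) * \<epsilon> \<le> w \<and> (2 * real K + 1)\<^sup>2 * \<epsilon> \<le> c0 * w / 2 \<and> (2 * real K + 1)\<^sup>2 * \<epsilon> \<le> c0\<^sup>2 * w^3 / 4"
    by (rule small_ex) (use c0pos w in \<open>simp_all add: zero_less_power add_pos_nonneg\<close>)
  then obtain \<epsilon> where \<epsilon>: "0 < \<epsilon>" "2 * (2 * real K + 1) * \<epsilon> \<le> w" "(2 * real K + 1)\<^sup>2 * \<epsilon> \<le> c0 * w / 2" "(2 * real K + 1)\<^sup>2 * \<epsilon> \<le> c0\<^sup>2 * w^3 / 4" by blast
  have Cs0: "0 \<le> Cs w" unfolding Cs_def using c0pos by simp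
  show ?thesis
  proof (rule exI[of _ \<epsilon>], rule conjI[OF \<epsilon>(1)], rule exI[of _ "Cs w + 1"], rule exI[of _ "max 1 N0"], intro allI ballI impI)
    fix N z M M' R
    assume N: "max 1 N0 \<le> N" and z: "z \<in> D"
      and H: "Mplus N M \<and> F_is P x N z M M \<and> Mplus N M' \<and> F_is P x N z M' (\<lambda>i j. M' i j - R i j) \<and>
           max (maxnorm N (\<lambda>i j. M' i j - M i j)) (maxnorm N R) \<le> \<epsilon>"
    obtain Q :: "(bool \<times> nat) set" and kr where kr: "\<And>i j k l. i \<in> {1..int N} \<Longrightarrow> j \<in> {1..int N} \<Longrightarrow> k \<in> {1..int N} \<Longrightarrow> l \<in> {1..int N} \<Longrightarrow>
       xz N i j k l = (if i = k \<and> j = l then c0 else 0) + (\<Sum>a\<in>Q. kr a i j * kr a k l)"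
      using kraus_ex[of N] by blast
    have N1: "1 \<le> N" using N by simp
    have "kmodel_axioms P x c0 N Q kr" by (intro kmodel_axioms.intro N1) (fact kr)
    then interpret KM: kmodel K P x c0 \<psi> N Q kr by (intro kmodel.intro profile_axioms)
    have "maxnorm N (\<lambda>i j. M' i j - M i j) \<le> (Cs w + 1) * maxnorm N R"
    proof (rule KM.stability[OF D[OF z] w _ _ _ _ _ _ _ \<epsilon>(2-4)])
      show "2 * w \<le> Im (ntr {1..int N} (mat_int M))"
        using N0[rule_format, of N z M] N z H unfolding w_def by simp
    qed (use H in simp_all)
    also have "\<dots> \<le> (Cs w + 1) * (maxnorm N R + 1 / real N)" using Cs0 by (intro mult_left_mono) simp_all
    finally show "maxnorm N (\<lambda>i j. M' i j - M i j) \<le> (Cs w + 1) * (maxnorm N R + 1 / real N)" .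
  qed
qed

end
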